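(* Let $(\Omega,\mathcal{F},(\mathcal{F}_t)_{t\ge0},\mathbb{P})$ be a filtered probability space satisfying the usual conditions, $B$ an $\ell$-dimensional $(\mathcal{F}_t)$-Brownian motion, and $A\colon\mathbb{R}^d\rightrightarrows\mathbb{R}^d$ a maximal monotone operator with $\mathcal{S}:=\{x:0\in A(x)\}\neq\emptyset$. Let $\sigma\colon\Omega\times\mathbb{R}_+\times\mathbb{R}^d\to\mathbb{R}^{d\times\ell}$ satisfy: (i) $\sigma(\cdot,\cdot,x)$ is progressively measurable for each $x$; (ii) there is $\kappa\in L^2_{\mathrm{loc}}(\mathbb{R}_+;\mathbb{R})$ with $\|\sigma(t,x)-\sigma(t,y)\|\le\kappa(t)\|x-y\|$; (iii) $\mathbb{E}\int_0^\infty\sigma_\infty(t)^2dt<\infty$ where $\sigma_\infty(t):=\sup_x\|\sigma(t,x)\|$. Let $X_0$ be an $\mathcal{F}_0$-measurable square-integrable random variable with values in $\operatorname{cl}\operatorname{dom}A$ and let $X$ be the unique solution of $dX_t\in -A(X_t)dt+\sigma(t,X_t)dB_t$ with initial value $X_0$. Suppose moreover that for every $x_0\in\operatorname{cl}\operatorname{dom}A$, every trajectory of the deterministic inclusion $\dot x(t)\in -A(x(t))$, $x(0)=x_0$, converges to an element of $\mathcal{S}$. Then there exists a random variable $X^\star\colon\Omega\to\mathcal{S}$ such that $\mathbb{P}$-a.s. $\lim_{t\to\infty}X_t=X^\star$ and $\lim_{t\to\infty}\mathbb{E}\|X_t-X^\star\|^2=0$.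
   Context: Solution concept: a triplet $(X,Y,M)$ of $\mathbb{R}^d$-valued processes solves $dX_t\in -A(X_t)dt+\sigma(t,X_t)dB_t$, $X_0\in\operatorname{cl}\operatorname{dom}A$, if: $X,Y,M$ are continuous progressively measurable with $Y_0=M_0=0$; $X_t\in\operatorname{cl}\operatorname{dom}A$ for all $t$ a.s., $(\omega,t)\mapsto\sigma(\omega,t,X_t(\omega))$ is progressively measurable with $\int_0^T\|\sigma(t,X_t)\|^2dt<\infty$ a.s. for all $T$; $Y$ has paths of bounded variation on compacts and for every pair of continuous adapted processes $(\alpha,\beta)$ with $(\alpha_t,\beta_t)\in\operatorname{gph}A$ for all $t$, a.s. $\int_a^b\langle X_t-\alpha_t,dY_t\rangle\ge\int_a^b\langle X_t-\alpha_t,\beta_t\rangle dt$ for all $0\le a\le b$; $M$ is a continuous local martingale with $\langle M_t,x-y\rangle=0$ for all $x,y\in\operatorname{dom}A$, all $t$, a.s.; and a.s. $X_t=X_0-Y_t+M_t+\int_0^t\sigma(s,X_s)dB_s$ for all $t\ge0$. Such a solution exists and is unique. Trajectories of the deterministic inclusion are absolutely continuous solutions. *)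

theory Defs
  imports "HOL-Probability.Probability"
begin

definition usual_conditions :: "'a measure \<Rightarrow> (real \<Rightarrow> 'a measure) \<Rightarrow> bool" where
  "usual_conditions M F \<longleftrightarrow>
     prob_space M \<and>
     (\<forall>t\<ge>0. space (F t) = space M \<and> sets (F t) \<subseteq> sets M) \<and>
     (\<forall>s t. 0 \<le> s \<longrightarrow> s \<le> t \<longrightarrow> sets (F s) \<subseteq> sets (F t)) \<and>
     (\<forall>N A. N \<in> null_sets M \<longrightarrow> A \<subseteq> N \<longrightarrow> A \<in> sets M) \<and>
     null_sets M \<subseteq> sets (F 0) \<and>
     (\<forall>t\<ge>0. sets (F t) = (\<Inter>s\<in>{t<..}. sets (F s)))"

definition adapted :: "(real \<Rightarrow> 'a measure) \<Rightarrow> ('a \<Rightarrow> real \<Rightarrow> 'b::topological_space) \<Rightarrow> bool" where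
  "adapted F Z \<longleftrightarrow> (\<forall>t\<ge>0. (\<lambda>\<omega>. Z \<omega> t) \<in> borel_measurable (F t))"

definition progressive :: "(real \<Rightarrow> 'a measure) \<Rightarrow> ('a \<Rightarrow> real \<Rightarrow> 'b::topological_space) \<Rightarrow> bool" where
  "progressive F Z \<longleftrightarrow>
     (\<forall>t\<ge>0. (\<lambda>(\<omega>, s). Z \<omega> s) \<in> borel_measurable (F t \<Otimes>\<^sub>M restrict_space borel {0..t}))"

definition stop_time :: "(real \<Rightarrow> 'a measure) \<Rightarrow> ('a \<Rightarrow> real) \<Rightarrow> bool" where
  "stop_time F \<tau> \<longleftrightarrow> (\<forall>t\<ge>0. {\<omega> \<in> space (F t). \<tau> \<omega> \<le> t} \<in> sets (F t))"

definition gauss_dens :: "real \<Rightarrow> real ^ 'l \<Rightarrow> ennreal" where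
  "gauss_dens h x = ennreal ((2 * pi * h) powr (- real CARD('l) / 2) * exp (- (norm x)\<^sup>2 / (2 * h)))"

definition brownian :: "'a measure \<Rightarrow> (real \<Rightarrow> 'a measure) \<Rightarrow> ('a \<Rightarrow> real \<Rightarrow> real ^ 'l) \<Rightarrow> bool" where
  "brownian M F B \<longleftrightarrow>
     adapted F B \<and>
     (AE \<omega> in M. B \<omega> 0 = 0 \<and> continuous_on {0..} (B \<omega>)) \<and>
     (\<forall>s t. 0 \<le> s \<longrightarrow> s < t \<longrightarrow>
        distr M borel (\<lambda>\<omega>. B \<omega> t - B \<omega> s) = density lborel (gauss_dens (t - s)) \<and>
        (\<forall>A \<in> sets (F s). \<forall>C \<in> sets borel.
            measure M (A \<inter> {\<omega> \<in> space M. B \<omega> t - B \<omega> s \<in> C})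
              = measure M A * measure M {\<omega> \<in> space M. B \<omega> t - B \<omega> s \<in> C}))"

definition cont_local_martingale ::
  "'a measure \<Rightarrow> (real \<Rightarrow> 'a measure) \<Rightarrow> ('a \<Rightarrow> real \<Rightarrow> 'b::{banach, second_countable_topology}) \<Rightarrow> bool" where
  "cont_local_martingale M F Z \<longleftrightarrow>
     adapted F Z \<and> (\<forall>\<omega> \<in> space M. continuous_on {0..} (Z \<omega>)) \<and>
     (\<exists>\<tau> :: nat \<Rightarrow> 'a \<Rightarrow> real.
        (\<forall>k. stop_time F (\<tau> k)) \<and>
        (\<forall>k. \<forall>\<omega> \<in> space M. 0 \<le> \<tau> k \<omega> \<and> \<tau> k \<omega> \<le> \<tau> (Suc k) \<omega>) \<and>
        (AE \<omega> in M. filterlim (\<lambda>k. \<tau> k \<omega>) at_top sequentially) \<and>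
        (\<forall>k s t. 0 \<le> s \<longrightarrow> s \<le> t \<longrightarrow>
           integrable M (\<lambda>\<omega>. Z \<omega> (min t (\<tau> k \<omega>))) \<and>
           (\<forall>A \<in> sets (F s).
              set_lebesgue_integral M A (\<lambda>\<omega>. Z \<omega> (min t (\<tau> k \<omega>)))
              = set_lebesgue_integral M A (\<lambda>\<omega>. Z \<omega> (min s (\<tau> k \<omega>))))))"

definition simple_pred :: "'a measure \<Rightarrow> (real \<Rightarrow> 'a measure) \<Rightarrow> (nat \<Rightarrow> real) \<Rightarrow> nat
    \<Rightarrow> (nat \<Rightarrow> 'a \<Rightarrow> real ^ 'l ^ 'd) \<Rightarrow> bool" where
  "simple_pred M F ts n \<xi> \<longleftrightarrow> ts 0 = 0 \<and> (\<forall>i<n. ts i < ts (Suc i)) \<and>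
     (\<forall>i<n. \<xi> i \<in> borel_measurable (F (ts i)) \<and> (\<exists>C. \<forall>\<omega> \<in> space M. norm (\<xi> i \<omega>) \<le> C))"

definition simple_integrand :: "(nat \<Rightarrow> real) \<Rightarrow> nat \<Rightarrow> (nat \<Rightarrow> 'a \<Rightarrow> real ^ 'l ^ 'd)
    \<Rightarrow> 'a \<Rightarrow> real \<Rightarrow> real ^ 'l ^ 'd" where
  "simple_integrand ts n \<xi> \<omega> s = (\<Sum>i<n. if ts i < s \<and> s \<le> ts (Suc i) then \<xi> i \<omega> else 0)"

definition simple_stoch_int :: "(nat \<Rightarrow> real) \<Rightarrow> nat \<Rightarrow> (nat \<Rightarrow> 'a \<Rightarrow> real ^ 'l ^ 'd)
    \<Rightarrow> ('a \<Rightarrow> real \<Rightarrow> real ^ 'l) \<Rightarrow> 'a \<Rightarrow> real \<Rightarrow> real ^ 'd" where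
  "simple_stoch_int ts n \<xi> B \<omega> t =
     (\<Sum>i<n. \<xi> i \<omega> *v (B \<omega> (min t (ts (Suc i))) - B \<omega> (min t (ts i))))"

definition conv_prob_zero :: "'a measure \<Rightarrow> (nat \<Rightarrow> 'a \<Rightarrow> ennreal) \<Rightarrow> bool" where
  "conv_prob_zero M Z \<longleftrightarrow>
     (\<forall>e>0. ((\<lambda>k. measure M {\<omega> \<in> space M. Z k \<omega> > ennreal e}) \<longlongrightarrow> 0) sequentially)"

definition is_stoch_integral :: "'a measure \<Rightarrow> (real \<Rightarrow> 'a measure) \<Rightarrow> ('a \<Rightarrow> real \<Rightarrow> real ^ 'l)
    \<Rightarrow> ('a \<Rightarrow> real \<Rightarrow> real ^ 'l ^ 'd) \<Rightarrow> ('a \<Rightarrow> real \<Rightarrow> real ^ 'd) \<Rightarrow> bool" where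
  "is_stoch_integral M F B H I \<longleftrightarrow>
     adapted F I \<and> (AE \<omega> in M. I \<omega> 0 = 0 \<and> continuous_on {0..} (I \<omega>)) \<and>
     (\<forall>ts n \<xi>. (\<forall>k. simple_pred M F (ts k) (n k) (\<xi> k)) \<and>
        (\<forall>T\<ge>0. conv_prob_zero M (\<lambda>k \<omega>. \<integral>\<^sup>+ s. ennreal ((norm (simple_integrand (ts k) (n k) (\<xi> k) \<omega> s - H \<omega> s))\<^sup>2)
                                             * indicator {0..T} s \<partial>lborel))
        \<longrightarrow> (\<forall>T\<ge>0. conv_prob_zero M (\<lambda>k \<omega>. SUP t\<in>{0..T}.
                ennreal (norm (simple_stoch_int (ts k) (n k) (\<xi> k) B \<omega> t - I \<omega> t)))))"

definition is_partition :: "real \<Rightarrow> real \<Rightarrow> nat \<Rightarrow> (nat \<Rightarrow> real) \<Rightarrow> bool" where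
  "is_partition a b n p \<longleftrightarrow> p 0 = a \<and> p n = b \<and> (\<forall>i<n. p i \<le> p (Suc i))"

definition bounded_variation_on :: "real \<Rightarrow> real \<Rightarrow> (real \<Rightarrow> 'b::real_normed_vector) \<Rightarrow> bool" where
  "bounded_variation_on a b g \<longleftrightarrow>
     (\<exists>C. \<forall>n p. is_partition a b n p \<longrightarrow> (\<Sum>i<n. norm (g (p (Suc i)) - g (p i))) \<le> C)"

definition RS_has_integral :: "(real \<Rightarrow> 'b::real_inner) \<Rightarrow> (real \<Rightarrow> 'b) \<Rightarrow> real \<Rightarrow> real \<Rightarrow> real \<Rightarrow> bool" where
  "RS_has_integral f g a b J \<longleftrightarrow>
     (\<forall>e>0. \<exists>\<delta>>0. \<forall>n p q. is_partition a b n p \<and> (\<forall>i<n. p (Suc i) - p i < \<delta>)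
        \<and> (\<forall>i<n. p i \<le> q i \<and> q i \<le> p (Suc i))
        \<longrightarrow> \<bar>(\<Sum>i<n. inner (f (q i)) (g (p (Suc i)) - g (p i))) - J\<bar> < e)"

definition abs_continuous_on :: "real \<Rightarrow> real \<Rightarrow> (real \<Rightarrow> 'b::real_normed_vector) \<Rightarrow> bool" where
  "abs_continuous_on a b x \<longleftrightarrow>
     (\<forall>e>0. \<exists>\<delta>>0. \<forall>n (u::nat \<Rightarrow> real) v.
        (\<forall>i<n. a \<le> u i \<and> u i \<le> v i \<and> v i \<le> b) \<and>
        (\<forall>i<n. \<forall>j<n. i \<noteq> j \<longrightarrow> v i \<le> u j \<or> v j \<le> u i) \<and>
        (\<Sum>i<n. v i - u i) < \<delta>
        \<longrightarrow> (\<Sum>i<n. norm (x (v i) - x (u i))) < e)"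

definition gph :: "('b \<Rightarrow> 'b set) \<Rightarrow> ('b \<times> 'b) set" where
  "gph A = {(x, y). y \<in> A x}"

definition dom_op :: "('b \<Rightarrow> 'b set) \<Rightarrow> 'b set" where
  "dom_op A = {x. A x \<noteq> {}}"

definition monotone_op :: "('b::real_inner \<Rightarrow> 'b set) \<Rightarrow> bool" where
  "monotone_op A \<longleftrightarrow> (\<forall>x y u v. u \<in> A x \<longrightarrow> v \<in> A y \<longrightarrow> inner (x - y) (u - v) \<ge> 0)"

definition maximal_monotone :: "('b::real_inner \<Rightarrow> 'b set) \<Rightarrow> bool" where
  "maximal_monotone A \<longleftrightarrow> monotone_op A \<and>
     (\<forall>A'. monotone_op A' \<and> gph A \<subseteq> gph A' \<longrightarrow> A' = A)"

definition ode_traj :: "('b::euclidean_space \<Rightarrow> 'b set) \<Rightarrow> 'b \<Rightarrow> (real \<Rightarrow> 'b) \<Rightarrow> bool" where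
  "ode_traj A x0 x \<longleftrightarrow> x 0 = x0 \<and> (\<forall>T\<ge>0. abs_continuous_on 0 T x) \<and>
     (AE t in lborel. t > 0 \<longrightarrow> (\<exists>v. (x has_vector_derivative v) (at t) \<and> - v \<in> A (x t)))"

definition sde_solution :: "'a measure \<Rightarrow> (real \<Rightarrow> 'a measure) \<Rightarrow> ('a \<Rightarrow> real \<Rightarrow> real ^ 'l)
    \<Rightarrow> (real ^ 'd \<Rightarrow> (real ^ 'd) set) \<Rightarrow> ('a \<Rightarrow> real \<Rightarrow> real ^ 'd \<Rightarrow> real ^ 'l ^ 'd)
    \<Rightarrow> ('a \<Rightarrow> real ^ 'd) \<Rightarrow> ('a \<Rightarrow> real \<Rightarrow> real ^ 'd) \<Rightarrow> ('a \<Rightarrow> real \<Rightarrow> real ^ 'd)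
    \<Rightarrow> ('a \<Rightarrow> real \<Rightarrow> real ^ 'd) \<Rightarrow> bool" where
  "sde_solution M F B A \<sigma> X0 X Y Mt \<longleftrightarrow>
     progressive F X \<and> progressive F Y \<and> progressive F Mt \<and>
     (\<forall>\<omega> \<in> space M. continuous_on {0..} (X \<omega>) \<and> continuous_on {0..} (Y \<omega>)
        \<and> continuous_on {0..} (Mt \<omega>) \<and> Y \<omega> 0 = 0 \<and> Mt \<omega> 0 = 0) \<and>
     (AE \<omega> in M. \<forall>t\<ge>0. X \<omega> t \<in> closure (dom_op A)) \<and>
     progressive F (\<lambda>\<omega> t. \<sigma> \<omega> t (X \<omega> t)) \<and>
     (AE \<omega> in M. \<forall>T. (\<integral>\<^sup>+ t. ennreal ((norm (\<sigma> \<omega> t (X \<omega> t)))\<^sup>2) * indicator {0..T} t \<partial>lborel) < \<infinity>) \<and>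
     (\<forall>\<omega> \<in> space M. \<forall>T\<ge>0. bounded_variation_on 0 T (Y \<omega>)) \<and>
     (\<forall>\<alpha> \<beta>. adapted F \<alpha> \<and> adapted F \<beta> \<and>
        (\<forall>\<omega> \<in> space M. continuous_on {0..} (\<alpha> \<omega>) \<and> continuous_on {0..} (\<beta> \<omega>)) \<and>
        (\<forall>\<omega> \<in> space M. \<forall>t\<ge>0. (\<alpha> \<omega> t, \<beta> \<omega> t) \<in> gph A)
        \<longrightarrow> (AE \<omega> in M. \<forall>a b. 0 \<le> a \<longrightarrow> a \<le> b \<longrightarrow>
              (\<exists>J. RS_has_integral (\<lambda>t. X \<omega> t - \<alpha> \<omega> t) (Y \<omega>) a b J \<and>
                   J \<ge> integral {a..b} (\<lambda>t. inner (X \<omega> t - \<alpha> \<omega> t) (\<beta> \<omega> t))))) \<and>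
     cont_local_martingale M F Mt \<and>
     (AE \<omega> in M. \<forall>t\<ge>0. \<forall>x \<in> dom_op A. \<forall>y \<in> dom_op A. inner (Mt \<omega> t) (x - y) = 0) \<and>
     (\<exists>I. is_stoch_integral M F B (\<lambda>\<omega> t. \<sigma> \<omega> t (X \<omega> t)) I \<and>
        (AE \<omega> in M. \<forall>t\<ge>0. X \<omega> t = X0 \<omega> - Y \<omega> t + Mt \<omega> t + I \<omega> t))"

end

(*
Compare X after a time s with a deterministic trajectory x started at a point of dom A. Inserting the
constant pairs (point, slope) of the implicit Euler scheme of x into the variational inequality for Y and
letting the step size tend to zero gives an energy estimate
  E |X(s+r) - x(r)|^2 <= E |X(s) - x(0)|^2 + c E int_s^oo |sigma|^2,
also on F_s-events, together with a maximal version of it; for this an upper bound on the second moments of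
the stochastic integral, with some constant c, replaces the Ito isometry. Partitioning Omega into countably
many F_s-events on which X(s) is close to a single point of dom A, and taking s so large that the tail of the
integral of |sigma|^2 is small, X stays close to a trajectory on each of them, and this trajectory
converges to a zero of A. Hence X(t) converges almost surely and in mean square.
*)
theory Submission
  imports Defs
begin

subsection \<open>Maximal monotone operators and resolvents\<close>

text \<open>The inequality characterising \<open>Y\<close> admits only continuous selections of the
  graph of \<open>A\<close>, whereas a trajectory in general has a discontinuous velocity and cannot
  be inserted itself. The implicit Euler scheme supplies a constant graph pair on each cell, and the
  trajectory is recovered in the limit. The scheme also proves that trajectories exist, without
  which the assumption about them could not be applied. It starts in \<open>dom_op A\<close>, where
  the initial slope bounds all later ones; the values of X(s) lie only in the closure, hence the
  countable dense family of starting points. There is no Ito formula: squared distances are expanded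
  over the grid. The noise then contributes a sum of mean zero, removed by stopping and Fatou's
  lemma, and squared increments, for which an upper bound suffices. The integral is specified only
  through limits in probability of simple integrals, so this bound requires an approximating
  sequence of simple processes. Its constant comes from comparing two Gaussian densities and is
  harmless, since it only multiplies a tail that tends to zero.\<close>

lemma maximal_monotoneD:
  assumes "maximal_monotone A" and "u \<in> A x" and "v \<in> A y"
  shows "inner (x - y) (u - v) \<ge> 0"
  using assms unfolding maximal_monotone_def monotone_op_def by blast

text \<open>Adding the pair (x, u) to the graph keeps it monotone, so maximality forces the pair to
  be there already.\<close>

lemma maximal_monotoneI_mem:
  assumes max: "maximal_monotone A"
    and *: "\<And>a b. b \<in> A a \<Longrightarrow> inner (x - a) (u - b) \<ge> 0"
  shows "u \<in> A x"
proof -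
  define A' where "A' = A(x := insert u (A x))"
  have sym: "inner (a - x) (b - u) \<ge> 0" if "b \<in> A a" for a b
    using *[OF that] by (metis inner_minus_left inner_minus_right minus_diff_eq minus_minus)
  have "monotone_op A'"
    unfolding monotone_op_def A'_def
    using * sym maximal_monotoneD[OF max] by (auto split: if_splits)
  moreover have "gph A \<subseteq> gph A'"
    by (auto simp: gph_def A'_def)
  ultimately have "A' = A"
    using max unfolding maximal_monotone_def by blast
  then show ?thesis
    by (metis A'_def fun_upd_same insertI1)
qed

text \<open>The expression d + d' - <a', b> - <a, b'> is affine in each of its two triples and
  nonnegative on pairs of generators by monotonicity. Nonnegativity passes to the hull in one
  triple, then in the other, and on the diagonal it reads 2 (d - <a, b>) \<ge> 0.\<close>

lemma convex_hull_inner_graph: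
  fixes G :: "('b::euclidean_space \<times> 'b) set"
  assumes mono: "\<And>a b a' b'. (a, b) \<in> G \<Longrightarrow> (a', b') \<in> G \<Longrightarrow> inner (a - a') (b - b') \<ge> 0"
    and p: "(a, b, d) \<in> convex hull ((\<lambda>(a, b). (a, b, inner a b)) ` G)"
  shows "inner a b \<le> d"
proof -
  let ?K = "convex hull ((\<lambda>(a, b). (a, b, inner a b)) ` G)"
  define H where "H = (\<lambda>(a', b', d'::real). {(a::'b, b::'b, d::real). d + d' - inner a' b - inner a b' \<ge> 0})"
  have H: "convex (H q)" for q
  proof -
    obtain a' b' d' where q: "q = (a', b', d')" by (cases q)
    have "H q = {p. inner (- b', - a', 1::real) p \<ge> - d'}"
      unfolding H_def q by (auto simp: inner_prod_def inner_commute algebra_simps)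
    then show ?thesis by (simp only: convex_halfspace_ge)
  qed
  have sym: "p \<in> H q \<longleftrightarrow> q \<in> H p" for p q
    by (cases p; cases q) (auto simp: H_def inner_commute algebra_simps)
  have gen: "(a', b', inner a' b') \<in> H (a, b, inner a b)" if "(a, b) \<in> G" "(a', b') \<in> G" for a b a' b'
    using mono[OF that] by (auto simp: H_def inner_diff_left inner_diff_right inner_commute algebra_simps)
  have 1: "?K \<subseteq> H q" if "q \<in> (\<lambda>(a, b). (a, b, inner a b)) ` G" for q
    by (rule hull_minimal) (use that gen H in auto)
  have "?K \<subseteq> H (a, b, d)"
    by (rule hull_minimal) (use 1 p sym H in blast)+
  then have "(a, b, d) \<in> H (a, b, d)" using p by blast
  then show ?thesis by (simp add: H_def)
qed

text \<open>The point is \<open>c / 2\<close>, where \<open>(c, d)\<close> maximises the concave function \<open>- |c|\<^sup>2 / 4 - d\<close> over the convex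
  hull of the points \<open>(a - b, inner a b)\<close>; the first-order conditions are the claimed inequalities.\<close>

lemma finite_monotone_extension:
  fixes G :: "('b::euclidean_space \<times> 'b) set"
  assumes fin: "finite G"
    and mono: "\<And>a b a' b'. (a, b) \<in> G \<Longrightarrow> (a', b') \<in> G \<Longrightarrow> inner (a - a') (b - b') \<ge> 0"
  shows "\<exists>x. \<forall>(a, b)\<in>G. inner (x - a) (x + b) \<le> 0"
proof (cases "G = {}")
  case False
  let ?g = "\<lambda>(a::'b, b::'b). (a, b, inner a b)"
  let ?K = "convex hull (?g ` G)"
  define f where "f = (\<lambda>(a::'b, b::'b, d::real). - (inner (a - b) (a - b)) / 4 - d)"
  have "compact ?K" "?K \<noteq> {}"
    using fin False by (auto intro: finite_imp_compact_convex_hull)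
  moreover have "continuous_on ?K f"
    unfolding f_def case_prod_beta by (intro continuous_intros) auto
  ultimately obtain p where p: "p \<in> ?K" and max: "\<And>q. q \<in> ?K \<Longrightarrow> f q \<le> f p"
    using continuous_attains_sup[of ?K f] by blast
  obtain a b d where pe: "p = (a, b, d)" by (cases p)
  have dab: "inner a b \<le> d"
  proof (rule convex_hull_inner_graph)
    show "(a, b, d) \<in> ?K" using p by (simp only: pe)
  qed (fact mono)
  define c where "c = a - b"
  have key: "inner ((1/2) *\<^sub>R c - a') ((1/2) *\<^sub>R c + b') \<le> 0" if G: "(a', b') \<in> G" for a' b'
  proof -
    define q where "q = (a', b', inner a' b')"
    define c' where "c' = a' - b'"
    define e where "e = c' - c"
    define \<delta> where "\<delta> = inner a' b' - d"
    have qK: "q \<in> ?K" unfolding q_def by (rule hull_inc) (use G in force)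
    \<comment> \<open>First-order condition at the maximiser \<open>p\<close>: move from
      \<open>p\<close> towards the generator \<open>q\<close> and expand the quadratic
      function.\<close>
    have pert: "- (inner c e) * t / 2 - t\<^sup>2 * inner e e / 4 - \<delta> * t \<le> 0" if t: "0 < t" "t \<le> 1" for t
    proof -
      have "(1 - t) *\<^sub>R p + t *\<^sub>R q \<in> ?K"
        using p qK t by (intro convexD[OF convex_convex_hull]) auto
      from max[OF this] have "f ((1 - t) *\<^sub>R p + t *\<^sub>R q) - f p \<le> 0" by simp
      moreover have "f ((1 - t) *\<^sub>R p + t *\<^sub>R q) = - inner (c + t *\<^sub>R e) (c + t *\<^sub>R e) / 4 - (d + t * \<delta>)"
      proof -
        have "((1 - t) *\<^sub>R a + t *\<^sub>R a') - ((1 - t) *\<^sub>R b + t *\<^sub>R b') = c + t *\<^sub>R e"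
          by (simp add: c_def e_def c'_def algebra_simps)
        moreover have "(1 - t) * d + t * inner a' b' = d + t * \<delta>"
          by (simp add: \<delta>_def algebra_simps)
        ultimately show ?thesis
          unfolding f_def pe q_def by simp
      qed
      moreover have "f p = - inner c c / 4 - d" by (simp add: f_def pe c_def)
      ultimately show ?thesis
        by (simp add: inner_add_left inner_add_right inner_commute power2_eq_square algebra_simps)
    qed
    \<comment> \<open>Division by \<open>t\<close> leaves a remainder of order \<open>t\<close>; the
      chosen \<open>t\<close> makes it at most \<epsilon>.\<close>
    have "- (inner c e) / 2 - \<delta> \<le> 0"
    proof (rule field_le_epsilon)
      fix \<epsilon> :: real assume "\<epsilon> > 0"
      define t where "t = min 1 (\<epsilon> / (inner e e + 1))"
      have pos: "inner e e + 1 > 0" by (simp add: add_nonneg_pos)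
      have t: "0 < t" "t \<le> 1" using \<open>\<epsilon> > 0\<close> pos by (auto simp: t_def)
      have te: "t * inner e e \<le> \<epsilon>"
      proof -
        have "t * inner e e \<le> t * (inner e e + 1)" using t by simp
        also have "\<dots> \<le> \<epsilon> / (inner e e + 1) * (inner e e + 1)"
          unfolding t_def by (rule mult_right_mono) (use pos in auto)
        also have "\<dots> = \<epsilon>" using pos by simp
        finally show ?thesis .
      qed
      have "t * (- (inner c e) / 2 - t * inner e e / 4 - \<delta>) \<le> 0"
        using pert[OF t] by (simp add: power2_eq_square algebra_simps)
      then have "- (inner c e) / 2 - t * inner e e / 4 - \<delta> \<le> 0"
        using t by (simp add: mult_le_0_iff)
      then show "- (inner c e) / 2 - \<delta> \<le> 0 + \<epsilon>" using te \<open>\<epsilon> > 0\<close> by linarith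
    qed
    then have k: "- (inner c c') / 2 + inner c c / 2 - inner a' b' + d \<le> 0"
      by (simp add: e_def \<delta>_def inner_diff_right field_simps)
    have "inner c c = inner a a - 2 * inner a b + inner b b"
      by (simp add: c_def inner_diff_left inner_diff_right inner_commute)
    \<comment> \<open>The identity - |c|^2 / 4 - <a, b> = - |a + b|^2 / 4 is what makes the optimal
      value have the right sign.\<close>
    moreover have "inner (a + b) (a + b) \<ge> 0" by simp
    ultimately have "- inner c c / 4 - inner a b \<le> 0"
      by (simp add: inner_add_left inner_add_right inner_commute)
    moreover have "inner ((1/2) *\<^sub>R c - a') ((1/2) *\<^sub>R c + b') = inner c c / 4 - inner c c' / 2 - inner a' b'"
      by (simp add: c'_def inner_diff_left inner_diff_right inner_add_right inner_add_left inner_commute field_simps)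
    ultimately show ?thesis using k dab by linarith
  qed
  show ?thesis by (rule exI[of _ "(1/2) *\<^sub>R c"]) (use key in auto)
qed auto

text \<open>Each graph point (a, b) restricts x to the closed ball with a and w - h b as opposite
  ends of a diameter. Finitely many of these balls meet by \<open>finite_monotone_extension\<close>,
  all of them by compactness, and maximality puts a common point into the graph.\<close>

theorem minty:
  fixes A :: "'b::euclidean_space \<Rightarrow> 'b set"
  assumes max: "maximal_monotone A" and h: "h > 0"
  shows "\<exists>x. (1 / h) *\<^sub>R (w - x) \<in> A x"
proof -
  define C where "C = (\<lambda>(a, b). {x. inner (x - a) (x - w + h *\<^sub>R b) \<le> 0})"
  have cl: "closed (C p)" for p
    unfolding C_def case_prod_beta by (intro closed_Collect_le continuous_intros)
  have bd: "bounded (C (a, b))" for a b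
  proof -
    have "norm x \<le> norm a + norm (a - w + h *\<^sub>R b)" if "x \<in> C (a, b)" for x
    proof -
      have "inner (x - a) (x - a) \<le> - inner (x - a) (a - w + h *\<^sub>R b)"
        using that by (simp add: C_def inner_diff_left inner_diff_right inner_add_right algebra_simps)
      also have "\<dots> \<le> norm (x - a) * norm (a - w + h *\<^sub>R b)"
        using Cauchy_Schwarz_ineq2[of "x - a" "a - w + h *\<^sub>R b"] by linarith
      finally have "norm (x - a) * norm (x - a) \<le> norm (x - a) * norm (a - w + h *\<^sub>R b)"
        by (simp add: power2_norm_eq_inner[symmetric] power2_eq_square)
      then have "norm (x - a) \<le> norm (a - w + h *\<^sub>R b)"
        by (metis mult_le_cancel_left_pos norm_ge_zero order_le_less)
      then show ?thesis using norm_triangle_sub[of x a] by linarith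
    qed
    then show ?thesis unfolding bounded_iff by blast
  qed
  have "\<Inter> (C ` gph A) \<noteq> {}"
  proof (rule compact_fip_Heine_Borel)
    fix T assume "T \<in> C ` gph A"
    then show "compact T" using cl bd by (force simp: compact_eq_bounded_closed)
  next
    fix \<F> assume "finite \<F>" "\<F> \<subseteq> C ` gph A"
    then obtain G where G: "G \<subseteq> gph A" "finite G" "\<F> = C ` G"
      by (meson finite_subset_image)
    \<comment> \<open>With slopes shifted to h b - w, the inequality of the finite extension lemma
      is exactly membership in \<open>C (a, b)\<close>; scaling by h > 0 and a common shift preserve
      monotonicity.\<close>
    define G' where "G' = (\<lambda>(a, b). (a, h *\<^sub>R b - w)) ` G"
    have "\<exists>x. \<forall>(a, b)\<in>G'. inner (x - a) (x + b) \<le> 0"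
    proof (rule finite_monotone_extension)
      show "finite G'" using G by (simp add: G'_def)
      fix a b a' b' assume "(a, b) \<in> G'" "(a', b') \<in> G'"
      then obtain u u' where "u \<in> A a" "b = h *\<^sub>R u - w" "u' \<in> A a'" "b' = h *\<^sub>R u' - w"
      proof -
        from \<open>(a, b) \<in> G'\<close> obtain u where "(a, u) \<in> G" "b = h *\<^sub>R u - w" by (auto simp: G'_def)
        moreover from \<open>(a', b') \<in> G'\<close> obtain u' where "(a', u') \<in> G" "b' = h *\<^sub>R u' - w"
          by (auto simp: G'_def)
        ultimately show ?thesis using G that unfolding gph_def by blast
      qed
      then have "inner (a - a') (b - b') = h * inner (a - a') (u - u')" "inner (a - a') (u - u') \<ge> 0"
        using maximal_monotoneD[OF max] by (simp_all add: inner_diff_right right_diff_distrib)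
      then show "inner (a - a') (b - b') \<ge> 0" using h by simp
    qed
    then obtain x where "\<forall>(a, b)\<in>G'. inner (x - a) (x + b) \<le> 0" by blast
    then have "x \<in> \<Inter> \<F>"
      unfolding G G'_def by (auto simp: C_def algebra_simps)
    then show "\<Inter> \<F> \<noteq> {}" by blast
  qed
  then obtain x where x: "\<And>a b. b \<in> A a \<Longrightarrow> x \<in> C (a, b)"
    by (auto simp: gph_def)
  have "(1 / h) *\<^sub>R (w - x) \<in> A x"
  proof (rule maximal_monotoneI_mem[OF max])
    fix a b assume "b \<in> A a"
    from x[OF this] have "0 \<le> - inner (x - a) (x - w + h *\<^sub>R b)" by (simp add: C_def)
    also have "\<dots> = h * inner (x - a) ((1 / h) *\<^sub>R (w - x) - b)"
      using h by (simp add: inner_diff_right inner_add_right field_simps)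
    finally show "0 \<le> inner (x - a) ((1 / h) *\<^sub>R (w - x) - b)"
      using h by (simp add: zero_le_mult_iff)
  qed
  then show ?thesis by blast
qed

definition resolvent :: "('b::real_inner \<Rightarrow> 'b set) \<Rightarrow> real \<Rightarrow> 'b \<Rightarrow> 'b" where
  "resolvent A h w = (SOME x. (1 / h) *\<^sub>R (w - x) \<in> A x)"

lemma resolvent:
  fixes A :: "'b::euclidean_space \<Rightarrow> 'b set"
  assumes "maximal_monotone A" and "h > 0"
  shows "(1 / h) *\<^sub>R (w - resolvent A h w) \<in> A (resolvent A h w)"
  unfolding resolvent_def by (rule someI_ex[OF minty[OF assms]])

lemma resolvent_nonexpansive:
  fixes A :: "'b::euclidean_space \<Rightarrow> 'b set"
  assumes max: "maximal_monotone A" and h: "h > 0"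
  shows "norm (resolvent A h w - resolvent A h w') \<le> norm (w - w')"
proof -
  define x x' where "x = resolvent A h w" and "x' = resolvent A h w'"
  have "0 \<le> inner (x - x') ((1 / h) *\<^sub>R (w - x) - (1 / h) *\<^sub>R (w' - x'))"
    unfolding x_def x'_def by (intro maximal_monotoneD[OF max] resolvent assms)
  also have "\<dots> = (1 / h) * (inner (x - x') (w - w') - inner (x - x') (x - x'))"
    by (simp add: inner_diff_right algebra_simps)
  finally have "inner (x - x') (x - x') \<le> inner (x - x') (w - w')"
    using h by (simp add: zero_le_divide_iff)
  also have "\<dots> \<le> norm (x - x') * norm (w - w')" by (rule norm_cauchy_schwarz)
  finally have "norm (x - x') * norm (x - x') \<le> norm (x - x') * norm (w - w')"
    by (simp add: power2_norm_eq_inner[symmetric] power2_eq_square)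
  then show ?thesis
    unfolding x_def x'_def by (metis mult_le_cancel_left_pos norm_ge_zero order_le_less)
qed

subsection \<open>The implicit Euler scheme\<close>

lemma norm_square_diff_eq:
  fixes u v :: "'b::real_inner"
  shows "(norm v)\<^sup>2 - (norm u)\<^sup>2 = 2 * inner v (v - u) - (norm (v - u))\<^sup>2"
  by (simp add: power2_norm_eq_inner inner_diff_left inner_diff_right inner_commute)

text \<open>The parameter \<open>n\<close> is a refinement level: steps have length 1 / 2^n, so that
  every grid is contained in all finer ones.\<close>

primrec euler :: "('b::real_inner \<Rightarrow> 'b set) \<Rightarrow> 'b \<Rightarrow> nat \<Rightarrow> nat \<Rightarrow> 'b" where
  "euler A x0 n 0 = x0"
| "euler A x0 n (Suc i) = resolvent A (1 / 2 ^ n) (euler A x0 n i)"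

declare euler.simps(2) [simp del]

text \<open>The step is implicit: this vector belongs to \<open>A\<close> at the new point with
  index \<open>Suc i\<close>, not at the old one.\<close>

definition euler_slope :: "('b::real_inner \<Rightarrow> 'b set) \<Rightarrow> 'b \<Rightarrow> nat \<Rightarrow> nat \<Rightarrow> 'b" where
  "euler_slope A x0 n i = (2 ^ n) *\<^sub>R (euler A x0 n i - euler A x0 n (Suc i))"

text \<open>Truncation by \<open>nat\<close> gives index 0 at negative times, which later extends
  the flow constantly to the left of 0.\<close>

definition grid_index :: "real \<Rightarrow> nat \<Rightarrow> nat" where
  "grid_index t n = nat \<lfloor>t * 2 ^ n\<rfloor>"

lemma grid_index_le: "t \<ge> 0 \<Longrightarrow> real (grid_index t n) / 2 ^ n \<le> t"
  by (simp add: grid_index_def divide_le_eq)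

lemma grid_index_gt: "t < real (grid_index t n) / 2 ^ n + 1 / 2 ^ n"
proof -
  have "t * 2 ^ n < real (grid_index t n) + 1"
    unfolding grid_index_def by linarith
  then have "t < (real (grid_index t n) + 1) / 2 ^ n" by (simp add: less_divide_eq)
  then show ?thesis by (simp add: add_divide_distrib)
qed

lemma grid_index_mono: "s \<le> t \<Longrightarrow> grid_index s n \<le> grid_index t n"
  unfolding grid_index_def by (intro nat_mono floor_mono mult_right_mono) auto

lemma half_power_LIMSEQ: "(\<lambda>n. c / 2 ^ n) \<longlonglongrightarrow> (0::real)"
  by (rule LIMSEQ_divide_realpow_zero) simp

lemma grid_index_LIMSEQ:
  assumes "t \<ge> 0" shows "(\<lambda>n. real (grid_index t n) / 2 ^ n) \<longlonglongrightarrow> t"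
proof (rule tendsto_sandwich)
  show "\<forall>\<^sub>F n in sequentially. t - 1 / 2 ^ n \<le> real (grid_index t n) / 2 ^ n"
    using grid_index_gt by (intro always_eventually allI) (smt (verit))
  show "\<forall>\<^sub>F n in sequentially. real (grid_index t n) / 2 ^ n \<le> t"
    using grid_index_le[OF assms] by simp
  have "(\<lambda>n. t - 1 / 2 ^ n) \<longlonglongrightarrow> t - 0"
    by (intro tendsto_intros half_power_LIMSEQ)
  then show "(\<lambda>n. t - 1 / 2 ^ n) \<longlonglongrightarrow> t" by simp
qed simp

text \<open>The witness \<open>y0\<close> does more than place \<open>x0\<close> in the domain: its
  norm \<open>L\<close> bounds all slopes of the scheme and becomes the Lipschitz constant of the
  limit.\<close>

locale monotone_flow =
  fixes A :: "'b::euclidean_space \<Rightarrow> 'b set" and x0 y0 :: 'b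
  assumes max: "maximal_monotone A" and y0: "y0 \<in> A x0"
begin

abbreviation "e \<equiv> euler A x0"
abbreviation "s \<equiv> euler_slope A x0"
abbreviation "L \<equiv> norm y0"

lemma slope_mem: "s n i \<in> A (e n (Suc i))"
  using resolvent[OF max, of "1 / 2 ^ n" "e n i"] by (simp add: euler_slope_def euler.simps)

lemma euler_Suc: "e n (Suc i) = e n i - (1 / 2 ^ n) *\<^sub>R s n i"
  by (simp add: euler_slope_def)

text \<open>The step is a negative multiple of the slope s, so monotonicity between the old and the
  new point becomes <s, s - y> \<le> 0, and Cauchy-Schwarz finishes.\<close>

lemma slope_decreasing:
  assumes "y \<in> A (e n i)" shows "norm (s n i) \<le> norm y"
proof -
  have "0 \<le> inner (e n (Suc i) - e n i) (s n i - y)"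
    by (rule maximal_monotoneD[OF max slope_mem assms])
  also have "\<dots> = - (1 / 2 ^ n) * inner (s n i) (s n i - y)"
    by (subst euler_Suc) simp
  finally have "(1 / 2 ^ n) * inner (s n i) (s n i - y) \<le> 0" by simp
  then have "inner (s n i) (s n i - y) \<le> 0"
    by (simp add: field_simps)
  then have "inner (s n i) (s n i) \<le> inner (s n i) y" by (simp add: inner_diff_right)
  also have "\<dots> \<le> norm (s n i) * norm y" by (rule norm_cauchy_schwarz)
  finally have "norm (s n i) * norm (s n i) \<le> norm (s n i) * norm y"
    by (simp add: power2_norm_eq_inner[symmetric] power2_eq_square)
  then show ?thesis by (metis mult_le_cancel_left_pos norm_ge_zero order_le_less)
qed

lemma slope_bound: "norm (s n i) \<le> L"
proof (induction i)
  case 0 show ?case by (rule slope_decreasing) (use y0 in simp)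
next
  case (Suc i)
  have "norm (s n (Suc i)) \<le> norm (s n i)" by (rule slope_decreasing[OF slope_mem])
  then show ?case using Suc by simp
qed

section \<open>Cauchy property of the dyadic Euler schemes\<close>

lemma euler_diff_le: "norm (e n (i + p) - e n i) \<le> L * (real p / 2 ^ n)"
proof (induction p)
  case (Suc p)
  have "norm (e n (i + Suc p) - e n i) \<le> norm (e n (i + p) - e n i) + norm ((1 / 2 ^ n) *\<^sub>R s n (i + p))"
  proof -
    have "e n (i + Suc p) - e n i = (e n (i + p) - e n i) - (1 / 2 ^ n) *\<^sub>R s n (i + p)"
      unfolding add_Suc_right by (subst euler_Suc) simp
    then show ?thesis by (metis norm_triangle_ineq4)
  qed
  also have "norm ((1 / 2 ^ n) *\<^sub>R s n (i + p)) \<le> L * (1 / 2 ^ n)"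
    using slope_bound[of n "i + p"] by (simp add: divide_right_mono)
  also have "norm (e n (i + p) - e n i) \<le> L * (real p / 2 ^ n)" by (rule Suc.IH)
  finally show ?case by (simp add: field_simps)
qed simp

lemma euler_diff_le': "norm (e n i - e n j) \<le> L * \<bar>real i / 2 ^ n - real j / 2 ^ n\<bar>"
proof (cases "j \<le> i")
  case True
  with euler_diff_le[of n j "i - j"] show ?thesis
    by (simp add: diff_divide_distrib[symmetric] of_nat_diff)
next
  case False
  then have "i \<le> j" by simp
  have "norm (e n j - e n i) \<le> L * (real (j - i) / 2 ^ n)"
    using euler_diff_le[of n i "j - i"] \<open>i \<le> j\<close> by simp
  also have "real (j - i) / 2 ^ n = \<bar>real i / 2 ^ n - real j / 2 ^ n\<bar>"
    using \<open>i \<le> j\<close> by (simp add: diff_divide_distrib[symmetric] of_nat_diff)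
  finally show ?thesis by (simp add: norm_minus_commute)
qed

text \<open>One coarse step, interpolated linearly, is compared with the fine steps inside it.
  Monotonicity is available only at the coarse implicit endpoint, from which the interpolated point
  differs by \<open>r\<close> times the slope. This mismatch costs at most (h L) (2 L) in the inner
  product, hence 4 L^2 h times the elapsed time in the squared distance.\<close>

lemma euler_refine_step:
  assumes "j \<le> 2 ^ p"
  shows "(norm (e n i - (real j / 2 ^ (n + p)) *\<^sub>R s n i - e (n + p) (k + j)))\<^sup>2
    \<le> (norm (e n i - e (n + p) k))\<^sup>2 + 4 * L\<^sup>2 * (1 / 2 ^ n) * (real j / 2 ^ (n + p))"
  using assms
proof (induction j)
  case (Suc j)
  let ?m = "n + p"
  let ?h = "1 / 2 ^ n :: real" and ?k = "1 / 2 ^ (n + p) :: real"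
  define y y' where "y = s n i" and "y' = s ?m (k + j)"
  define d d' where "d = e n i - (real j * ?k) *\<^sub>R y - e ?m (k + j)"
    and "d' = e n i - (real (Suc j) * ?k) *\<^sub>R y - e ?m (k + Suc j)"
  have dd: "d' - d = - ?k *\<^sub>R (y - y')"
  proof -
    have "e ?m (k + Suc j) = e ?m (k + j) - ?k *\<^sub>R y'"
      unfolding y'_def add_Suc_right by (rule euler_Suc)
    then show ?thesis unfolding d_def d'_def by (simp add: algebra_simps add_divide_distrib)
  qed
  \<comment> \<open>The time that remains until the coarse endpoint; it is nonnegative because at
    most 2^p fine steps fit into a coarse one.\<close>
  define r where "r = ?h - real (Suc j) * ?k"
  have r: "0 \<le> r" "r \<le> ?h"
  proof -
    have "real (Suc j) \<le> 2 ^ p" using Suc.prems by (metis of_nat_le_iff of_nat_numeral of_nat_power)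
    then have "real (Suc j) * ?k \<le> 2 ^ p * ?k" by (intro mult_right_mono) auto
    also have "\<dots> = ?h" by (simp add: power_add)
    finally show "0 \<le> r" by (simp add: r_def)
    show "r \<le> ?h" by (simp add: r_def)
  qed
  have d'e: "d' = (e n (Suc i) - e ?m (k + Suc j)) + r *\<^sub>R y"
  proof -
    have "e n (Suc i) = e n i - ?h *\<^sub>R y" unfolding y_def by (rule euler_Suc)
    then show ?thesis unfolding d'_def r_def by (simp add: algebra_simps)
  qed
  have mon: "0 \<le> inner (e n (Suc i) - e ?m (k + Suc j)) (y - y')"
    unfolding y_def y'_def add_Suc_right by (rule maximal_monotoneD[OF max slope_mem slope_mem])
  have "- inner (r *\<^sub>R y) (y - y') \<le> norm (r *\<^sub>R y) * norm (y - y')"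
    using Cauchy_Schwarz_ineq2[of "r *\<^sub>R y" "y - y'"] by linarith
  also have "\<dots> \<le> (?h * L) * (2 * L)"
  proof (rule mult_mono)
    show "norm (r *\<^sub>R y) \<le> ?h * L"
      unfolding norm_scaleR using r slope_bound[of n i] by (intro mult_mono) (auto simp: y_def)
    show "norm (y - y') \<le> 2 * L"
      using norm_triangle_ineq4[of y y'] slope_bound unfolding y_def y'_def by (smt (verit))
  qed auto
  also have "\<dots> = 2 * L\<^sup>2 * ?h" by (simp add: power2_eq_square)
  finally have "- inner d' (y - y') \<le> 2 * L\<^sup>2 * ?h"
    using mon unfolding d'e inner_add_left by linarith
  then have "2 * ?k * (- inner d' (y - y')) \<le> 2 * ?k * (2 * L\<^sup>2 * ?h)"
    by (intro mult_left_mono) auto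
  then have *: "2 * inner d' (d' - d) \<le> 4 * L\<^sup>2 * ?h * ?k"
    unfolding dd inner_scaleR_right by (simp add: mult_ac)
  have "(norm d')\<^sup>2 \<le> (norm d)\<^sup>2 + 4 * L\<^sup>2 * ?h * ?k"
    using norm_square_diff_eq[of d' d] * zero_le_power2[of "norm (d' - d)"] by linarith
  also have "(norm d)\<^sup>2 \<le> (norm (e n i - e ?m k))\<^sup>2 + 4 * L\<^sup>2 * ?h * (real j * ?k)"
    using Suc unfolding d_def y_def by simp
  finally show ?case unfolding d'_def y_def by (simp add: field_simps)
qed simp

lemma euler_refine: "(norm (e n i - e (n + p) (i * 2 ^ p)))\<^sup>2 \<le> 4 * L\<^sup>2 * (1 / 2 ^ n) * (real i / 2 ^ n)"
proof (induction i)
  case (Suc i)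
  have 1: "(2::real) ^ p / 2 ^ (n + p) = 1 / 2 ^ n" by (simp add: power_add)
  have "(norm (e n (Suc i) - e (n + p) (i * 2 ^ p + 2 ^ p)))\<^sup>2
      \<le> (norm (e n i - e (n + p) (i * 2 ^ p)))\<^sup>2 + 4 * L\<^sup>2 * (1 / 2 ^ n) * (1 / 2 ^ n)"
    using euler_refine_step[of "2 ^ p" p n i "i * 2 ^ p"] unfolding euler_Suc by (simp add: 1)
  also have "\<dots> \<le> 4 * L\<^sup>2 * (1 / 2 ^ n) * (real i / 2 ^ n) + 4 * L\<^sup>2 * (1 / 2 ^ n) * (1 / 2 ^ n)"
    using Suc by simp
  also have "\<dots> = 4 * L\<^sup>2 * (1 / 2 ^ n) * (real (Suc i) / 2 ^ n)" by (simp add: field_simps)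
  finally show ?case by (simp add: add.commute)
qed simp

text \<open>The exponential formula for the semigroup generated by -\<open>A\<close>, along dyadic
  steps. The limit involves \<open>A\<close> and \<open>x0\<close> but not the witness
  \<open>y0\<close>, so it can be named later without choosing a slope.\<close>

definition flow :: "real \<Rightarrow> 'b" where
  "flow t = lim (\<lambda>n. e n (grid_index t n))"

text \<open>The first term is the refinement error at the coarse grid point before \<open>t\<close>;
  the second accounts for the two grid points before \<open>t\<close> differing by at most one
  coarse step.\<close>

lemma euler_Cauchy_bound:
  assumes t: "t \<ge> 0"
  shows "norm (e n (grid_index t n) - e (n + p) (grid_index t (n + p))) \<le> 2 * L * sqrt (t / 2 ^ n) + L / 2 ^ n"
proof -
  let ?i = "grid_index t n" and ?j = "grid_index t (n + p)"
  have "(norm (e n ?i - e (n + p) (?i * 2 ^ p)))\<^sup>2 \<le> 4 * L\<^sup>2 * (1 / 2 ^ n) * (real ?i / 2 ^ n)"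
    by (rule euler_refine)
  also have "\<dots> \<le> 4 * L\<^sup>2 * (1 / 2 ^ n) * t"
    using grid_index_le[OF t] by (intro mult_left_mono) auto
  also have "\<dots> = (2 * L * sqrt (t / 2 ^ n))\<^sup>2"
    using t by (simp add: power_mult_distrib)
  finally have 1: "norm (e n ?i - e (n + p) (?i * 2 ^ p)) \<le> 2 * L * sqrt (t / 2 ^ n)"
    by (rule power2_le_imp_le) (use t in auto)
  have "\<bar>real (?i * 2 ^ p) / 2 ^ (n + p) - real ?j / 2 ^ (n + p)\<bar> \<le> 1 / 2 ^ n"
  proof -
    have a: "real (?i * 2 ^ p) / 2 ^ (n + p) = real ?i / 2 ^ n" by (simp add: power_add)
    have "(1::real) / 2 ^ (n + p) \<le> 1 / 2 ^ n"
      by (intro divide_left_mono) (auto intro: power_increasing)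
    moreover note grid_index_le[OF t, of n] grid_index_le[OF t, of "n + p"]
      grid_index_gt[of t n] grid_index_gt[of t "n + p"]
    ultimately show ?thesis unfolding a by linarith
  qed
  then have "L * \<bar>real (?i * 2 ^ p) / 2 ^ (n + p) - real ?j / 2 ^ (n + p)\<bar> \<le> L * (1 / 2 ^ n)"
    by (intro mult_left_mono) auto
  then have 2: "norm (e (n + p) (?i * 2 ^ p) - e (n + p) ?j) \<le> L / 2 ^ n"
    using euler_diff_le'[of "n + p" "?i * 2 ^ p" ?j] by simp
  show ?thesis
    using norm_triangle_ineq[of "e n ?i - e (n + p) (?i * 2 ^ p)" "e (n + p) (?i * 2 ^ p) - e (n + p) ?j"] 1 2
    by simp
qed

lemma euler_grid_LIMSEQ:
  assumes t: "t \<ge> 0" shows "(\<lambda>n. e n (grid_index t n)) \<longlonglongrightarrow> flow t"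
proof -
  define b where "b n = 2 * L * sqrt (t / 2 ^ n) + L / 2 ^ n" for n :: nat
  have "b \<longlonglongrightarrow> 2 * L * sqrt 0 + 0"
    unfolding b_def by (intro tendsto_intros half_power_LIMSEQ)
  then have b: "b \<longlonglongrightarrow> 0" by simp
  have "Cauchy (\<lambda>n. e n (grid_index t n))"
  proof (rule CauchyI)
    fix r :: real assume "r > 0"
    then have "\<forall>\<^sub>F n in sequentially. b n < r / 2" using order_tendstoD(2)[OF b, of "r / 2"] by simp
    then obtain N where N: "b N < r / 2" by (auto simp: eventually_sequentially)
    have *: "norm (e N (grid_index t N) - e n (grid_index t n)) < r / 2" if "n \<ge> N" for n
      using order_le_less_trans[OF euler_Cauchy_bound[OF t, of N "n - N"] N[unfolded b_def]] that by simp
    show "\<exists>M. \<forall>m\<ge>M. \<forall>n\<ge>M. norm (e m (grid_index t m) - e n (grid_index t n)) < r"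
    proof (intro exI allI impI)
      fix m n assume mn: "N \<le> m" "N \<le> n"
      show "norm (e m (grid_index t m) - e n (grid_index t n)) < r"
        using norm_triangle_ineq4[of "e N (grid_index t N) - e n (grid_index t n)" "e N (grid_index t N) - e m (grid_index t m)"]
          *[OF mn(1)] *[OF mn(2)] by (simp add: norm_minus_commute)
    qed
  qed
  then show ?thesis
    unfolding flow_def by (simp add: Cauchy_convergent convergent_LIMSEQ_iff[symmetric])
qed

text \<open>Indices other than \<open>grid_index t n\<close> are needed for shifted times, since the
  grid index of a sum need not be the sum of the grid indices.\<close>

lemma euler_LIMSEQ:
  assumes t: "t \<ge> 0" and i: "(\<lambda>n. real (i n) / 2 ^ n) \<longlonglongrightarrow> t"
  shows "(\<lambda>n. e n (i n)) \<longlonglongrightarrow> flow t"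
proof -
  have "(\<lambda>n. L * \<bar>real (i n) / 2 ^ n - real (grid_index t n) / 2 ^ n\<bar>) \<longlonglongrightarrow> L * \<bar>t - t\<bar>"
    by (intro tendsto_intros i grid_index_LIMSEQ[OF t])
  then have "(\<lambda>n. L * \<bar>real (i n) / 2 ^ n - real (grid_index t n) / 2 ^ n\<bar>) \<longlonglongrightarrow> 0" by simp
  then have "(\<lambda>n. e n (i n) - e n (grid_index t n)) \<longlonglongrightarrow> 0"
    by (rule Lim_null_comparison[rotated]) (use euler_diff_le' in simp)
  then have "(\<lambda>n. (e n (i n) - e n (grid_index t n)) + e n (grid_index t n)) \<longlonglongrightarrow> 0 + flow t"
    by (intro tendsto_add euler_grid_LIMSEQ[OF t])
  then show ?thesis by simp
qed

lemma flow_0 [simp]: "flow 0 = x0"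
  using euler_LIMSEQ[of 0 "\<lambda>_. 0"] by (simp add: LIMSEQ_const_iff)

lemma flow_Lipschitz:
  assumes "r \<ge> 0" "t \<ge> 0" shows "norm (flow t - flow r) \<le> L * \<bar>t - r\<bar>"
proof (rule LIMSEQ_le)
  show "(\<lambda>n. norm (e n (grid_index t n) - e n (grid_index r n))) \<longlonglongrightarrow> norm (flow t - flow r)"
    by (intro tendsto_intros euler_grid_LIMSEQ assms)
  show "(\<lambda>n. L * \<bar>real (grid_index t n) / 2 ^ n - real (grid_index r n) / 2 ^ n\<bar>) \<longlonglongrightarrow> L * \<bar>t - r\<bar>"
    by (intro tendsto_intros grid_index_LIMSEQ assms)
qed (use euler_diff_le' in blast)

section \<open>Dissipation and speed bounds for the limit flow\<close>

lemma euler_dissip_step: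
  assumes b: "b \<in> A a"
  shows "(norm (e n (Suc i) - a))\<^sup>2 - (norm (e n i - a))\<^sup>2 \<le> 2 / 2 ^ n * inner b (a - e n (Suc i))"
proof -
  have "0 \<le> (1 / 2 ^ n) * inner (e n (Suc i) - a) (s n i - b)"
    using maximal_monotoneD[OF max slope_mem[of n i] b] by simp
  moreover have "e n (Suc i) - e n i = - (1 / 2 ^ n) *\<^sub>R s n i" by (subst euler_Suc) simp
  then have "inner (e n (Suc i) - a) (e n (Suc i) - e n i) = - (1 / 2 ^ n) * inner (e n (Suc i) - a) (s n i)"
    by (metis inner_scaleR_right)
  ultimately have "inner (e n (Suc i) - a) (e n (Suc i) - e n i) \<le> - (1 / 2 ^ n) * inner (e n (Suc i) - a) b"
    by (simp add: inner_diff_right right_diff_distrib del: euler.simps)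
  moreover have "inner b (a - e n (Suc i)) = - inner (e n (Suc i) - a) b"
    by (metis inner_commute inner_minus_left minus_diff_eq)
  ultimately have "inner (e n (Suc i) - a) (e n (Suc i) - e n i) \<le> 1 / 2 ^ n * inner b (a - e n (Suc i))"
    by simp
  then have "2 * inner (e n (Suc i) - a) (e n (Suc i) - e n i) \<le> 2 / 2 ^ n * inner b (a - e n (Suc i))"
    by simp
  moreover have "(norm (e n (Suc i) - a))\<^sup>2 - (norm (e n i - a))\<^sup>2 \<le> 2 * inner (e n (Suc i) - a) (e n (Suc i) - e n i)"
    using norm_square_diff_eq[of "e n (Suc i) - a" "e n i - a"] by simp
  ultimately show ?thesis by (rule order_trans[rotated])
qed

text \<open>Summation of the one-step inequality, with the moving point frozen at index
  \<open>i\<close>; each frozen term costs |b| L times the elapsed time.\<close>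

lemma euler_dissip:
  assumes b: "b \<in> A a"
  shows "(norm (e n (i + p) - a))\<^sup>2 - (norm (e n i - a))\<^sup>2
    \<le> 2 * (real p / 2 ^ n) * (inner b (a - e n i) + norm b * L * (real p / 2 ^ n))"
proof (induction p)
  case (Suc p)
  let ?h = "1 / 2 ^ n :: real"
  define c where "c = inner b (a - e n i)"
  define K where "K = norm b * L"
  have K: "K \<ge> 0" by (simp add: K_def)
  have "inner b (a - e n (i + Suc p)) \<le> c + K * (real (Suc p) * ?h)"
  proof -
    have "inner b (a - e n (i + Suc p)) = c + inner b (e n i - e n (i + Suc p))"
      by (simp add: c_def inner_diff_right)
    also have "inner b (e n i - e n (i + Suc p)) \<le> norm b * norm (e n i - e n (i + Suc p))"
      by (rule norm_cauchy_schwarz)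
    also have "\<dots> \<le> norm b * (L * (real (Suc p) * ?h))"
      using euler_diff_le[of n i "Suc p"] by (intro mult_left_mono) (auto simp: norm_minus_commute)
    finally show ?thesis by (simp add: K_def mult.assoc)
  qed
  then have "2 * ?h * inner b (a - e n (i + Suc p)) \<le> 2 * ?h * (c + K * (real (Suc p) * ?h))"
    by (intro mult_left_mono) auto
  then have "(norm (e n (i + Suc p) - a))\<^sup>2 - (norm (e n i - a))\<^sup>2
      \<le> 2 * (real p * ?h) * (c + K * (real p * ?h)) + 2 * ?h * (c + K * (real (Suc p) * ?h))"
    using euler_dissip_step[OF b, of n "i + p"] Suc unfolding c_def K_def
    by simp
  also have "\<dots> = 2 * (real (Suc p) * ?h) * c + 2 * K * ?h * ?h * (real p * real p + real (Suc p))"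
    by (simp add: algebra_simps add_divide_distrib)
  also have "\<dots> \<le> 2 * (real (Suc p) * ?h) * c + 2 * K * ?h * ?h * (real (Suc p) * real (Suc p))"
    using K by (intro add_left_mono mult_left_mono) (auto simp: algebra_simps)
  also have "\<dots> = 2 * (real (Suc p) * ?h) * (c + K * (real (Suc p) * ?h))"
    by (simp add: algebra_simps add_divide_distrib)
  finally show ?case unfolding c_def K_def by simp
qed simp

text \<open>The inclusion in integrated form, tested against a graph point. It mentions no
  derivative, survives the limit of the schemes, and after division by t - r its quadratic error
  disappears.\<close>

lemma flow_dissip:
  assumes b: "b \<in> A a" and rt: "0 \<le> r" "r \<le> t"
  shows "(norm (flow t - a))\<^sup>2 - (norm (flow r - a))\<^sup>2
    \<le> 2 * (t - r) * (inner b (a - flow r) + norm b * L * (t - r))"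
proof (rule LIMSEQ_le)
  have t: "t \<ge> 0" using rt by simp
  define i p where "i n = grid_index r n" and "p n = grid_index t n - grid_index r n" for n
  have ip: "i n + p n = grid_index t n" for n
    using grid_index_mono[OF rt(2), of n] by (simp add: i_def p_def)
  have pl: "(\<lambda>n. real (p n) / 2 ^ n) \<longlonglongrightarrow> t - r"
  proof -
    have "real (p n) / 2 ^ n = real (grid_index t n) / 2 ^ n - real (grid_index r n) / 2 ^ n" for n
      using grid_index_mono[OF rt(2), of n] by (simp add: p_def of_nat_diff diff_divide_distrib)
    then show ?thesis using grid_index_LIMSEQ[OF t] grid_index_LIMSEQ[OF rt(1)] by (simp add: tendsto_diff)
  qed
  show "(\<lambda>n. (norm (e n (i n + p n) - a))\<^sup>2 - (norm (e n (i n) - a))\<^sup>2) \<longlonglongrightarrow> (norm (flow t - a))\<^sup>2 - (norm (flow r - a))\<^sup>2"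
    unfolding ip unfolding i_def by (intro tendsto_intros euler_grid_LIMSEQ t rt)
  show "(\<lambda>n. 2 * (real (p n) / 2 ^ n) * (inner b (a - e n (i n)) + norm b * L * (real (p n) / 2 ^ n)))
      \<longlonglongrightarrow> 2 * (t - r) * (inner b (a - flow r) + norm b * L * (t - r))"
    unfolding i_def by (intro tendsto_intros euler_grid_LIMSEQ pl rt)
qed (use euler_dissip[OF b] in blast)

lemma euler_speed:
  assumes b: "b \<in> A a"
  shows "norm (e n (i + p) - a) \<le> norm (e n i - a) + real p / 2 ^ n * norm b"
proof (induction p)
  case (Suc p)
  let ?h = "1 / 2 ^ n :: real"
  define u v where "u = e n (i + p) - a" and "v = e n (i + Suc p) - a"
  have "0 \<le> ?h * inner v (s n (i + p) - b)"
    using maximal_monotoneD[OF max slope_mem[of n "i + p"] b] unfolding v_def by simp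
  moreover have "v = u - ?h *\<^sub>R s n (i + p)"
    unfolding u_def v_def add_Suc_right euler_Suc by simp
  then have "inner v v = inner v u - ?h * inner v (s n (i + p))"
    by (metis inner_diff_right inner_scaleR_right)
  ultimately have "inner v v \<le> inner v u + ?h * (- inner v b)"
    by (simp add: inner_diff_right right_diff_distrib)
  also have "\<dots> \<le> norm v * norm u + ?h * (norm v * norm b)"
    using norm_cauchy_schwarz[of v u] Cauchy_Schwarz_ineq2[of v b] by (intro add_mono mult_left_mono) auto
  finally have "norm v * norm v \<le> norm v * (norm u + ?h * norm b)"
    by (simp add: power2_norm_eq_inner[symmetric] power2_eq_square algebra_simps)
  then have "norm v \<le> norm u + ?h * norm b \<or> norm v = 0"
    by (metis mult_le_cancel_left_pos norm_ge_zero order_le_less)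
  then have "norm v \<le> norm u + ?h * norm b" by auto
  then show ?case using Suc unfolding u_def v_def by (simp add: field_simps)
qed simp

text \<open>Two choices of the graph point matter later: a point of the flow itself bounds the
  difference quotients that start there, and a zero of \<open>A\<close> shows that distances to
  zeros never increase.\<close>

lemma flow_speed:
  assumes b: "b \<in> A a" and rt: "0 \<le> r" "r \<le> t"
  shows "norm (flow t - a) \<le> norm (flow r - a) + (t - r) * norm b"
proof (rule LIMSEQ_le)
  have t: "t \<ge> 0" using rt by simp
  show "(\<lambda>n. norm (e n (grid_index t n) - a)) \<longlonglongrightarrow> norm (flow t - a)"
    by (intro tendsto_intros euler_grid_LIMSEQ t)
  show "(\<lambda>n. norm (e n (grid_index r n) - a) + (real (grid_index t n) / 2 ^ n - real (grid_index r n) / 2 ^ n) * norm b)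
     \<longlonglongrightarrow> norm (flow r - a) + (t - r) * norm b"
    by (intro tendsto_intros euler_grid_LIMSEQ grid_index_LIMSEQ t rt)
  have "norm (e n (grid_index t n) - a) \<le> norm (e n (grid_index r n) - a) + (real (grid_index t n) / 2 ^ n - real (grid_index r n) / 2 ^ n) * norm b" for n
    using euler_speed[OF b, of n "grid_index r n" "grid_index t n - grid_index r n"] grid_index_mono[OF rt(2), of n]
    by (simp add: of_nat_diff diff_divide_distrib)
  then show "\<exists>N. \<forall>n\<ge>N. norm (e n (grid_index t n) - a) \<le> norm (e n (grid_index r n) - a) + (real (grid_index t n) / 2 ^ n - real (grid_index r n) / 2 ^ n) * norm b"
    by blast
qed

text \<open>A time shift of the scheme is produced by the same resolvents, so their nonexpansiveness
  makes increments over a fixed span shrink. This is the source of the monotonicity of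
  \<open>speed\<close>.\<close>

lemma euler_increment_decreasing: "norm (e n (i + j + p) - e n (i + j)) \<le> norm (e n (i + p) - e n i)"
proof (induction j)
  case (Suc j)
  have "norm (e n (i + Suc j + p) - e n (i + Suc j)) \<le> norm (e n (i + j + p) - e n (i + j))"
    by (simp add: euler.simps resolvent_nonexpansive[OF max])
  then show ?case using Suc by linarith
qed simp

lemma flow_increment_decreasing:
  assumes rt: "0 \<le> r" "r \<le> t" and h: "h \<ge> 0"
  shows "norm (flow (t + h) - flow t) \<le> norm (flow (r + h) - flow r)"
proof (rule LIMSEQ_le)
  have t: "t \<ge> 0" using rt by simp
  have sum: "(\<lambda>n. real (grid_index u n + grid_index h n) / 2 ^ n) \<longlonglongrightarrow> u + h" if "u \<ge> 0" for u
    using tendsto_add[OF grid_index_LIMSEQ[OF that] grid_index_LIMSEQ[OF h]] by (simp add: add_divide_distrib)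
  show "(\<lambda>n. norm (e n (grid_index t n + grid_index h n) - e n (grid_index t n))) \<longlonglongrightarrow> norm (flow (t + h) - flow t)"
    by (intro tendsto_intros euler_LIMSEQ sum) (use t h in \<open>auto intro: grid_index_LIMSEQ\<close>)
  show "(\<lambda>n. norm (e n (grid_index r n + grid_index h n) - e n (grid_index r n))) \<longlonglongrightarrow> norm (flow (r + h) - flow r)"
    by (intro tendsto_intros euler_LIMSEQ sum) (use rt h in \<open>auto intro: grid_index_LIMSEQ\<close>)
  have "norm (e n (grid_index t n + grid_index h n) - e n (grid_index t n)) \<le> norm (e n (grid_index r n + grid_index h n) - e n (grid_index r n))" for n
    using euler_increment_decreasing[of n "grid_index r n" "grid_index t n - grid_index r n" "grid_index h n"]
      grid_index_mono[OF rt(2), of n] by simp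
  then show "\<exists>N. \<forall>n\<ge>N. norm (e n (grid_index t n + grid_index h n) - e n (grid_index t n)) \<le> norm (e n (grid_index r n + grid_index h n) - e n (grid_index r n))"
    by blast
qed

end

subsection \<open>Trajectories of the deterministic inclusion\<close>

lemma subseq_LIMSEQ_principle:
  fixes f :: "nat \<Rightarrow> 'b::metric_space"
  assumes "\<And>r. strict_mono (r::nat \<Rightarrow> nat) \<Longrightarrow> \<exists>r'. strict_mono (r'::nat \<Rightarrow> nat) \<and> (f \<circ> r \<circ> r') \<longlonglongrightarrow> l"
  shows "f \<longlonglongrightarrow> l"
proof (rule ccontr)
  assume "\<not> f \<longlonglongrightarrow> l"
  then obtain e where e: "e > 0" "\<exists>\<^sub>F n in sequentially. \<not> dist (f n) l < e"
    unfolding tendsto_iff not_eventually[symmetric] by (auto simp: not_eventually)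
  then have "infinite {n. \<not> dist (f n) l < e}"
    by (simp add: frequently_cofinite cofinite_eq_sequentially[symmetric])
  then obtain r :: "nat \<Rightarrow> nat" where r: "strict_mono r" "\<And>n. \<not> dist (f (r n)) l < e"
    using infinite_enumerate[of "{n. \<not> dist (f n) l < e}"] by auto
  obtain r' :: "nat \<Rightarrow> nat" where "(f \<circ> r \<circ> r') \<longlonglongrightarrow> l" using assms[OF r(1)] by blast
  then have "\<forall>\<^sub>F n in sequentially. dist ((f \<circ> r \<circ> r') n) l < e"
    using e(1) unfolding tendsto_iff by blast
  then show False using r(2) by (auto simp: eventually_sequentially)
qed

text \<open>By maximality membership of u in \<open>A x\<close> is tested by inequalities affine in
  u, so the value is an intersection of closed half-spaces.\<close>

lemma maximal_monotone_values:
  fixes A :: "'b::real_inner \<Rightarrow> 'b set"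
  assumes max: "maximal_monotone A"
  shows "closed (A x)" "convex (A x)"
proof -
  have "A x = (\<Inter>(a, b)\<in>gph A. {u. inner (x - a) u \<ge> inner (x - a) b})"
  proof (intro equalityI subsetI)
    fix u assume "u \<in> A x"
    from maximal_monotoneD[OF max this] show "u \<in> (\<Inter>(a, b)\<in>gph A. {u. inner (x - a) u \<ge> inner (x - a) b})"
      by (auto simp: gph_def inner_diff_right)
  next
    fix u assume "u \<in> (\<Inter>(a, b)\<in>gph A. {u. inner (x - a) u \<ge> inner (x - a) b})"
    then show "u \<in> A x"
      by (intro maximal_monotoneI_mem[OF max]) (auto simp: gph_def inner_diff_right)
  qed
  then show "closed (A x)" "convex (A x)"
    by (auto intro!: closed_INT convex_INT closed_halfspace_ge convex_halfspace_ge simp only: case_prod_beta)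
qed

text \<open>For the fixed value 0 the same tests are affine in the point x.\<close>

lemma maximal_monotone_zeros_closed:
  fixes A :: "'b::real_inner \<Rightarrow> 'b set"
  assumes max: "maximal_monotone A"
  shows "closed {x. 0 \<in> A x}"
proof -
  have "{x. 0 \<in> A x} = (\<Inter>(a, b)\<in>gph A. {x. inner (- b) x \<ge> inner (- b) a})"
  proof (intro equalityI subsetI)
    fix x assume "x \<in> {x. 0 \<in> A x}"
    then have "0 \<in> A x" by simp
    from maximal_monotoneD[OF max this] show "x \<in> (\<Inter>(a, b)\<in>gph A. {x. inner (- b) x \<ge> inner (- b) a})"
      by (fastforce simp: gph_def inner_diff_left inner_diff_right inner_commute)
  next
    fix x assume "x \<in> (\<Inter>(a, b)\<in>gph A. {x. inner (- b) x \<ge> inner (- b) a})"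
    then have "0 \<in> A x"
      by (intro maximal_monotoneI_mem[OF max]) (fastforce simp: gph_def inner_diff_left inner_diff_right inner_commute)
    then show "x \<in> {x. 0 \<in> A x}" by simp
  qed
  then show ?thesis
    by (auto intro!: closed_INT closed_halfspace_ge simp only: case_prod_beta)
qed

definition minimal_section :: "('b::euclidean_space \<Rightarrow> 'b set) \<Rightarrow> 'b \<Rightarrow> 'b" where
  "minimal_section A x = closest_point (A x) 0"

text \<open>The third claim, uniqueness of the element of least norm in a closed convex set, is what
  later identifies the derivative of the flow.\<close>

lemma minimal_section:
  fixes A :: "'b::euclidean_space \<Rightarrow> 'b set"
  assumes max: "maximal_monotone A" and u: "u \<in> A x"
  shows "minimal_section A x \<in> A x" "norm (minimal_section A x) \<le> norm u"
    and "norm u \<le> norm (minimal_section A x) \<Longrightarrow> u = minimal_section A x"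
proof -
  note cc = maximal_monotone_values[OF max, of x]
  have ne: "A x \<noteq> {}" using u by blast
  show 1: "minimal_section A x \<in> A x"
    unfolding minimal_section_def by (rule closest_point_in_set[OF cc(1) ne])
  have le: "norm (minimal_section A x) \<le> norm v" if "v \<in> A x" for v
    using closest_point_le[OF cc(1) that, of 0] by (simp add: minimal_section_def)
  show "norm (minimal_section A x) \<le> norm u" by (rule le[OF u])
  assume "norm u \<le> norm (minimal_section A x)"
  then show "u = minimal_section A x"
    unfolding minimal_section_def using le u
    by (intro closest_point_unique cc) (auto simp: minimal_section_def[symmetric] dest: order_trans)
qed

section \<open>Difference quotients and derivatives of the flow\<close>

context monotone_flow
begin

text \<open>The constant extension makes \<open>speed\<close> monotone on the whole line, so that a
  monotone real function has only countably many discontinuities can be applied to it.\<close>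

lemma flow_neg: "t \<le> 0 \<Longrightarrow> flow t = x0"
proof -
  assume "t \<le> 0"
  then have "grid_index t n = 0" for n
    using mult_nonpos_nonneg[of t "2 ^ n"] by (simp add: grid_index_def floor_le_iff)
  then show ?thesis by (simp add: flow_def)
qed

abbreviation "quot t h \<equiv> (flow (t + h) - flow t) /\<^sub>R h"

lemma norm_quot: "norm (quot t h) = norm (flow (t + h) - flow t) / \<bar>h\<bar>"
  by (simp add: divide_inverse mult.commute)

text \<open>Membership is tested by maximality. The quotient of |flow - a|^2 tends to twice <flow t
  - a, v>, its second-order part vanishing with \<open>h n\<close>, while \<open>flow_dissip\<close>
  bounds it for either sign of the increment.\<close>

lemma quot_limit_mem:
  assumes t: "t \<ge> 0" and h: "\<And>n::nat. h n \<noteq> 0" "\<And>n. t + h n \<ge> 0" "h \<longlonglongrightarrow> 0"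
    and v: "(\<lambda>n. quot t (h n)) \<longlonglongrightarrow> v"
  shows "- v \<in> A (flow t)"
proof (rule maximal_monotoneI_mem[OF max])
  fix a b assume b: "b \<in> A a"
  define q where "q n = quot t (h n)" for n
  define Q where "Q n = ((norm (flow (t + h n) - a))\<^sup>2 - (norm (flow t - a))\<^sup>2) / h n" for n
  have hq: "flow (t + h n) = flow t + h n *\<^sub>R q n" for n
    using h(1)[of n] by (simp add: q_def)
  have Qe: "Q n = 2 * inner (flow t - a) (q n) + h n * inner (q n) (q n)" for n
  proof -
    have "(norm (flow (t + h n) - a))\<^sup>2 - (norm (flow t - a))\<^sup>2 = 2 * h n * inner (flow t - a) (q n) + h n * h n * inner (q n) (q n)"
      unfolding hq power2_norm_eq_inner
      by (simp add: inner_add_left inner_add_right inner_diff_left inner_diff_right inner_commute algebra_simps)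
    then show ?thesis using h(1)[of n] by (simp add: Q_def field_simps)
  qed
  have qv: "q \<longlonglongrightarrow> v" using v by (simp add: q_def[abs_def])
  have "(\<lambda>n. 2 * inner (flow t - a) (q n) + h n * inner (q n) (q n)) \<longlonglongrightarrow> 2 * inner (flow t - a) v + 0 * inner v v"
    by (intro tendsto_intros qv h(3))
  then have Ql: "Q \<longlonglongrightarrow> 2 * inner (flow t - a) v" by (simp add: Qe[abs_def])
  \<comment> \<open>The factor 2 in front of the error covers negative increments: there the
    dissipation inequality is anchored at the earlier time, and moving the anchor to
    \<open>t\<close> costs a second |b| L |h|.\<close>
  define R where "R n = 2 * (inner b (a - flow t) + 2 * norm b * L * \<bar>h n\<bar>)" for n
  have Rl: "R \<longlonglongrightarrow> 2 * (inner b (a - flow t) + 2 * norm b * L * \<bar>0\<bar>)"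
    unfolding R_def by (intro tendsto_intros h(3))
  have "Q n \<le> R n" for n
  proof (cases "h n > 0")
    case True
    have "(norm (flow (t + h n) - a))\<^sup>2 - (norm (flow t - a))\<^sup>2 \<le> 2 * h n * (inner b (a - flow t) + norm b * L * h n)"
      using flow_dissip[OF b t, of "t + h n"] True by simp
    then have "Q n \<le> 2 * (inner b (a - flow t) + norm b * L * h n)"
      using True by (simp add: Q_def divide_le_eq mult_ac)
    also have "norm b * L * h n \<le> 2 * norm b * L * \<bar>h n\<bar>"
      using True by (simp add: mult_right_mono)
    finally show ?thesis by (simp add: R_def)
  next
    case False
    define k where "k = - h n"
    have k: "k > 0" using False h(1)[of n] by (simp add: k_def)
    have tk: "t + h n = t - k" "t - k \<ge> 0" using h(2)[of n] by (auto simp: k_def)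
    have "(norm (flow t - a))\<^sup>2 - (norm (flow (t - k) - a))\<^sup>2 \<le> 2 * k * (inner b (a - flow (t - k)) + norm b * L * k)"
      using flow_dissip[OF b tk(2), of t] k by simp
    moreover have "Q n = ((norm (flow t - a))\<^sup>2 - (norm (flow (t - k) - a))\<^sup>2) / k"
      unfolding Q_def tk(1) using k by (simp add: k_def field_simps)
    ultimately have "Q n \<le> 2 * (inner b (a - flow (t - k)) + norm b * L * k)"
      using k by (simp add: divide_le_eq mult_ac)
    also have "inner b (a - flow (t - k)) = inner b (a - flow t) + inner b (flow t - flow (t - k))"
      by (simp add: inner_diff_right)
    also have "inner b (flow t - flow (t - k)) \<le> norm b * (L * k)"
      using norm_cauchy_schwarz[of b "flow t - flow (t - k)"] flow_Lipschitz[OF tk(2) t] k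
      by (smt (verit) mult_left_mono norm_ge_zero)
    finally show ?thesis using k by (simp add: R_def k_def)
  qed
  then have "2 * inner (flow t - a) v \<le> 2 * (inner b (a - flow t) + 2 * norm b * L * \<bar>0\<bar>)"
    by (intro LIMSEQ_le[OF Ql Rl]) auto
  then show "0 \<le> inner (flow t - a) (- v - b)"
    by (simp add: inner_diff_right inner_diff_left inner_commute)
qed

lemma quot_subseq:
  assumes t: "t \<ge> 0" and h: "\<And>n::nat. h n \<noteq> 0" "\<And>n. t + h n \<ge> 0" "h \<longlonglongrightarrow> 0"
    and c: "\<And>n. norm (quot t (h n)) \<le> c n" "c \<longlonglongrightarrow> C"
  shows "\<exists>r v. strict_mono (r::nat \<Rightarrow> nat) \<and> (\<lambda>n. quot t (h (r n))) \<longlonglongrightarrow> v \<and> - v \<in> A (flow t) \<and> norm v \<le> C"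
proof -
  have "Bseq c" using c(2) by (rule convergent_imp_Bseq[OF convergentI])
  then obtain K where K: "\<And>n. \<bar>c n\<bar> \<le> K" by (auto simp: Bseq_def)
  have "bounded (range (\<lambda>n. quot t (h n)))"
    unfolding bounded_iff using c(1) K by (auto intro!: exI[of _ K]) (smt (verit))
  then obtain v r where r: "strict_mono (r::nat \<Rightarrow> nat)" "((\<lambda>n. quot t (h n)) \<circ> r) \<longlonglongrightarrow> v"
    using bounded_imp_convergent_subsequence by blast
  have v: "(\<lambda>n. quot t (h (r n))) \<longlonglongrightarrow> v" using r(2) by (simp add: o_def)
  have "(\<lambda>n. h (r n)) \<longlonglongrightarrow> 0" using LIMSEQ_subseq_LIMSEQ[OF h(3) r(1)] by (simp add: o_def)
  then have "- v \<in> A (flow t)"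
    by (intro quot_limit_mem[OF t _ _ _ v]) (use h in auto)
  moreover have "norm v \<le> C"
  proof (rule LIMSEQ_le)
    show "(\<lambda>n. norm (quot t (h (r n)))) \<longlonglongrightarrow> norm v" by (intro tendsto_intros v)
    show "(\<lambda>n. c (r n)) \<longlonglongrightarrow> C" using LIMSEQ_subseq_LIMSEQ[OF c(2) r(1)] by (simp add: o_def)
  qed (use c(1) in auto)
  ultimately show ?thesis using r v by blast
qed

text \<open>The slope is taken at the earlier of the two times, because \<open>flow_speed\<close>
  only runs forward.\<close>

lemma quot_bound:
  assumes "t \<ge> 0" "h \<noteq> 0" "t + h \<ge> 0" and b: "b \<in> A (flow (min t (t + h)))"
  shows "norm (quot t h) \<le> norm b"
proof -
  let ?r = "min t (t + h)"
  have "norm (flow (?r + \<bar>h\<bar>) - flow ?r) \<le> \<bar>h\<bar> * norm b"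
    using flow_speed[OF b, of ?r "?r + \<bar>h\<bar>"] assms(1,3) by auto
  moreover have "norm (flow (?r + \<bar>h\<bar>) - flow ?r) = norm (flow (t + h) - flow t)"
    by (cases "h > 0") (auto simp: norm_minus_commute)
  ultimately show ?thesis unfolding norm_quot using assms(2) by (simp add: divide_le_eq mult.commute)
qed

lemma flow_in_domain: "t \<ge> 0 \<Longrightarrow> A (flow t) \<noteq> {}"
proof -
  assume t: "t \<ge> 0"
  have "norm (quot t (1 / real (Suc n))) \<le> L" for n
  proof -
    define h where "h = 1 / real (Suc n)"
    have "h > 0" by (simp add: h_def)
    then have "norm (quot t h) \<le> L"
      unfolding norm_quot using flow_Lipschitz[of t "t + h"] t by (simp add: divide_le_eq)
    then show ?thesis by (simp only: h_def)
  qed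
  then have "\<exists>r v. strict_mono (r::nat \<Rightarrow> nat) \<and> (\<lambda>n. quot t (1 / real (Suc (r n)))) \<longlonglongrightarrow> v \<and> - v \<in> A (flow t) \<and> norm v \<le> L"
    by (intro quot_subseq[OF t, of _ "\<lambda>_. L"]) (use t LIMSEQ_inverse_real_of_nat in \<open>auto simp: inverse_eq_divide\<close>)
  then show ?thesis by blast
qed

definition speed :: "real \<Rightarrow> real" where
  "speed t = norm (minimal_section A (flow t))"

lemma minimal_flow: "t \<ge> 0 \<Longrightarrow> minimal_section A (flow t) \<in> A (flow t)"
  using flow_in_domain[of t] minimal_section(1)[OF max] by blast

lemma quot_speed:
  assumes "t \<ge> 0" "h \<noteq> 0" "t + h \<ge> 0" shows "norm (quot t h) \<le> speed (min t (t + h))"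
  unfolding speed_def by (intro quot_bound minimal_flow assms) (use assms in auto)

text \<open>Quotients at \<open>t\<close> are no longer than those at \<open>r\<close>, which
  \<open>speed r\<close> bounds. A limit point of them gives an element of \<open>A (flow t)\<close>
  of norm at most \<open>speed r\<close>, and the minimal section is no longer than that.\<close>

lemma speed_decreasing:
  assumes rt: "0 \<le> r" "r \<le> t" shows "speed t \<le> speed r"
proof -
  have t: "t \<ge> 0" using rt by simp
  have "norm (quot t (1 / real (Suc n))) \<le> speed r" for n
  proof -
    have "norm (quot t (1 / real (Suc n))) \<le> norm (quot r (1 / real (Suc n)))"
      using flow_increment_decreasing[OF rt, of "1 / real (Suc n)"] by (simp add: norm_quot divide_right_mono)
    also have "\<dots> \<le> speed (min r (r + 1 / real (Suc n)))" by (rule quot_speed) (use rt in auto)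
    also have "min r (r + 1 / real (Suc n)) = r" by simp
    finally show ?thesis .
  qed
  then have "\<exists>q v. strict_mono (q::nat \<Rightarrow> nat) \<and> (\<lambda>n. quot t (1 / real (Suc (q n)))) \<longlonglongrightarrow> v \<and> - v \<in> A (flow t) \<and> norm v \<le> speed r"
    by (intro quot_subseq[OF t, of _ "\<lambda>_. speed r"]) (use t LIMSEQ_inverse_real_of_nat in \<open>auto simp: inverse_eq_divide\<close>)
  then obtain v where "- v \<in> A (flow t)" "norm v \<le> speed r" by blast
  then show ?thesis using minimal_section(2)[OF max] unfolding speed_def by fastforce
qed

lemma speed_antimono: "antimono speed"
proof (rule antimonoI)
  fix r t :: real assume "r \<le> t"
  have *: "speed r = speed (max r 0)" for r
    by (cases "r \<ge> 0") (auto simp: speed_def flow_neg max_def)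
  show "speed t \<le> speed r"
    using speed_decreasing[of "max r 0" "max t 0"] \<open>r \<le> t\<close> * [of r] *[of t] by auto
qed

text \<open>Where the speed is continuous, every limit of difference quotients is minus an element of \<open>A (flow t)\<close>
  whose norm is at most the minimal one, and this determines it.\<close>

lemma flow_derivative:
  assumes t: "t > 0" and cont: "isCont speed t"
  shows "(flow has_vector_derivative - minimal_section A (flow t)) (at t)"
proof -
  define v where "v = - minimal_section A (flow t)"
  have "(quot t \<longlongrightarrow> v) (at 0 within {- t<..})"
    unfolding tendsto_at_iff_sequentially
  proof (intro allI impI)
    fix h :: "nat \<Rightarrow> real" assume hs: "\<forall>i. h i \<in> {- t<..} - {0}" and h0: "h \<longlonglongrightarrow> 0"
    have h: "h n \<noteq> 0" "t + h n \<ge> 0" for n using hs[rule_format, of n] by auto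
    show "(quot t \<circ> h) \<longlonglongrightarrow> v"
    proof (rule subseq_LIMSEQ_principle)
      fix r :: "nat \<Rightarrow> nat" assume r: "strict_mono r"
      have hr: "(\<lambda>n. h (r n)) \<longlonglongrightarrow> 0" using LIMSEQ_subseq_LIMSEQ[OF h0 r] by (simp add: o_def)
      have "(\<lambda>n. min t (t + h (r n))) \<longlonglongrightarrow> min t (t + 0)" by (intro tendsto_intros hr)
      then have "(\<lambda>n. speed (min t (t + h (r n)))) \<longlonglongrightarrow> speed t"
        by (intro isCont_tendsto_compose[OF cont]) simp
      then have "\<exists>q w. strict_mono (q::nat \<Rightarrow> nat) \<and> (\<lambda>n. quot t (h (r (q n)))) \<longlonglongrightarrow> w \<and> - w \<in> A (flow t) \<and> norm w \<le> speed t"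
        using t h by (intro quot_subseq[of t "\<lambda>n. h (r n)", OF _ _ _ hr]) (auto intro: quot_speed simp del: norm_scaleR)
      then obtain q w where q: "strict_mono (q::nat \<Rightarrow> nat)" "(\<lambda>n. quot t (h (r (q n)))) \<longlonglongrightarrow> w"
        and w: "- w \<in> A (flow t)" "norm w \<le> speed t" by blast
      have "- w = minimal_section A (flow t)"
        by (rule minimal_section(3)[OF max w(1)]) (use w(2) in \<open>simp add: speed_def\<close>)
      then have "w = v" unfolding v_def by (metis minus_minus)
      then show "\<exists>q. strict_mono (q::nat \<Rightarrow> nat) \<and> (quot t \<circ> h \<circ> r \<circ> q) \<longlonglongrightarrow> v"
        using q by (auto simp: o_def)
    qed
  qed
  then have lim: "(quot t \<longlongrightarrow> v) (at 0)"
    using t by (simp add: at_within_open[of 0 "{- t<..}"])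
  have "((\<lambda>h. norm (quot t h - v)) \<longlongrightarrow> norm (v - v)) (at 0)" by (intro tendsto_intros lim)
  then have "((\<lambda>h. norm (quot t h - v)) \<longlongrightarrow> 0) (at 0)" by simp
  moreover have "\<forall>\<^sub>F h in at (0::real). norm (quot t h - v) = norm (flow (t + h) - flow t - h *\<^sub>R v) / norm h"
  proof (rule eventually_at_filter[THEN iffD2], rule always_eventually, intro allI impI)
    fix h :: real assume "h \<noteq> 0"
    then have "quot t h - v = (flow (t + h) - flow t - h *\<^sub>R v) /\<^sub>R h"
      by (simp add: scaleR_diff_right)
    then show "norm (quot t h - v) = norm (flow (t + h) - flow t - h *\<^sub>R v) / norm h"
      by (simp only: norm_scaleR) (simp add: divide_inverse mult.commute)
  qed
  ultimately have "((\<lambda>h. norm (flow (t + h) - flow t - h *\<^sub>R v) / norm h) \<longlongrightarrow> 0) (at 0)"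
    by (simp cong: tendsto_cong)
  then show ?thesis
    unfolding v_def[symmetric] has_vector_derivative_def has_derivative_at by (simp add: bounded_linear_scaleR_left)
qed

lemma flow_abs_continuous: "abs_continuous_on 0 T flow"
  unfolding abs_continuous_on_def
proof (intro allI impI)
  fix \<epsilon> :: real assume \<epsilon>: "\<epsilon> > 0"
  show "\<exists>\<delta>>0. \<forall>n (u :: nat \<Rightarrow> real) v. (\<forall>i<n. 0 \<le> u i \<and> u i \<le> v i \<and> v i \<le> T) \<and>
      (\<forall>i<n. \<forall>j<n. i \<noteq> j \<longrightarrow> v i \<le> u j \<or> v j \<le> u i) \<and> (\<Sum>i<n. v i - u i) < \<delta>
      \<longrightarrow> (\<Sum>i<n. norm (flow (v i) - flow (u i))) < \<epsilon>"
  \<comment> \<open>\<open>L + 1\<close> instead of \<open>L\<close> keeps the witness meaningful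
    when the slope bound is 0.\<close>
  proof (rule exI[of _ "\<epsilon> / (L + 1)"], intro conjI allI impI)
    have L1: "L + 1 > 0" by (simp add: add_nonneg_pos)
    show "\<epsilon> / (L + 1) > 0" using \<epsilon> L1 by simp
    fix n and u v :: "nat \<Rightarrow> real"
    assume *: "(\<forall>i<n. 0 \<le> u i \<and> u i \<le> v i \<and> v i \<le> T) \<and>
      (\<forall>i<n. \<forall>j<n. i \<noteq> j \<longrightarrow> v i \<le> u j \<or> v j \<le> u i) \<and> (\<Sum>i<n. v i - u i) < \<epsilon> / (L + 1)"
    have "(\<Sum>i<n. norm (flow (v i) - flow (u i))) \<le> (\<Sum>i<n. (L + 1) * (v i - u i))"
    proof (rule sum_mono)
      fix i assume "i \<in> {..<n}"
      then have "0 \<le> u i" "u i \<le> v i" using * by auto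
      then show "norm (flow (v i) - flow (u i)) \<le> (L + 1) * (v i - u i)"
        using flow_Lipschitz[of "u i" "v i"] by (simp add: algebra_simps)
    qed
    also have "\<dots> = (L + 1) * (\<Sum>i<n. v i - u i)" by (simp add: sum_distrib_left)
    also have "\<dots> < (L + 1) * (\<epsilon> / (L + 1))" using * L1 by (intro mult_strict_left_mono) auto
    also have "\<dots> = \<epsilon>" using L1 by simp
    finally show "(\<Sum>i<n. norm (flow (v i) - flow (u i))) < \<epsilon>" .
  qed
qed

text \<open>\<open>speed\<close> is monotone, hence continuous outside a countable and therefore
  null set; at all other positive times \<open>flow_derivative\<close> applies. This is what lets
  the hypothesis on deterministic trajectories act on \<open>flow\<close>.\<close>

theorem flow_ode_traj: "ode_traj A x0 flow"
  unfolding ode_traj_def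
proof (intro conjI allI impI)
  have "mono (\<lambda>t. - speed t)" using speed_antimono by (auto simp: mono_def antimono_def)
  then have "countable {t. \<not> isCont (\<lambda>t. - speed t) t}" by (rule mono_ctble_discont)
  then have "{t. \<not> isCont (\<lambda>t. - speed t) t} \<in> null_sets lborel" by (rule countable_imp_null_set_lborel)
  then have "AE t in lborel. isCont (\<lambda>t. - speed t) t"
    by (rule AE_I') auto
  then show "AE t in lborel. t > 0 \<longrightarrow> (\<exists>v. (flow has_vector_derivative v) (at t) \<and> - v \<in> A (flow t))"
  proof (rule AE_mp, intro AE_I2 impI)
    fix t :: real assume c: "isCont (\<lambda>t. - speed t) t" and t: "t > 0"
    have "isCont speed t" using isCont_minus[OF c] by simp
    from flow_derivative[OF t this] minimal_flow[of t] t
    show "\<exists>v. (flow has_vector_derivative v) (at t) \<and> - v \<in> A (flow t)"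
      by (intro exI[of _ "- minimal_section A (flow t)"]) simp
  qed
qed (auto intro: flow_abs_continuous)

end

subsection \<open>Square-integrable orthogonal increments\<close>

lemma norm_matrix_vector_le:
  fixes \<xi> :: "real ^ 'l ^ 'd"
  shows "norm (\<xi> *v x) \<le> norm \<xi> * norm x"
proof -
  have "norm (\<xi> *v x) = L2_set (\<lambda>i. norm ((\<xi> *v x) $ i)) UNIV" by (simp add: norm_vec_def)
  also have "\<dots> \<le> L2_set (\<lambda>i. norm (\<xi> $ i) * norm x) UNIV"
    by (rule L2_set_mono) (auto simp: matrix_vector_mul_component intro: Cauchy_Schwarz_ineq2)
  also have "\<dots> = norm \<xi> * norm x"
    by (simp add: norm_vec_def L2_set_left_distrib)
  finally show ?thesis .
qed

lemma norm_vector_matrix_le: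
  fixes \<xi> :: "real ^ 'l ^ 'd"
  shows "norm (w v* \<xi>) \<le> norm \<xi> * norm w"
proof -
  have "norm (w v* \<xi>) * norm (w v* \<xi>) = inner w (\<xi> *v (w v* \<xi>))"
    by (simp add: dot_lmul_matrix[symmetric] power2_norm_eq_inner[symmetric] power2_eq_square)
  also have "\<dots> \<le> norm w * norm (\<xi> *v (w v* \<xi>))" by (rule norm_cauchy_schwarz)
  also have "\<dots> \<le> norm w * (norm \<xi> * norm (w v* \<xi>))"
    by (intro mult_left_mono norm_matrix_vector_le) auto
  finally have "norm (w v* \<xi>) * norm (w v* \<xi>) \<le> (norm \<xi> * norm w) * norm (w v* \<xi>)" by (simp add: mult_ac)
  then show ?thesis
    by (metis mult_le_cancel_right_pos mult_nonneg_nonneg norm_ge_zero order_le_less)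
qed

lemma borel_measurable_matrix_vector [measurable]:
  fixes \<xi> :: "'a \<Rightarrow> real ^ 'l ^ 'd"
  assumes "\<xi> \<in> borel_measurable N" "x \<in> borel_measurable N"
  shows "(\<lambda>\<omega>. \<xi> \<omega> *v x \<omega>) \<in> borel_measurable N"
  by (rule borel_measurable_continuous_Pair[OF assms])
    (unfold matrix_vector_mult_def, intro continuous_intros)

lemma borel_measurable_vector_matrix [measurable]:
  fixes \<xi> :: "'a \<Rightarrow> real ^ 'l ^ 'd"
  assumes "w \<in> borel_measurable N" "\<xi> \<in> borel_measurable N"
  shows "(\<lambda>\<omega>. w \<omega> v* \<xi> \<omega>) \<in> borel_measurable N"
  by (rule borel_measurable_continuous_Pair[OF assms])
    (unfold vector_matrix_mult_def, intro continuous_intros)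

definition L2 :: "'a measure \<Rightarrow> ('a \<Rightarrow> 'b::euclidean_space) \<Rightarrow> bool" where
  "L2 M Z \<longleftrightarrow> Z \<in> borel_measurable M \<and> (\<integral>\<^sup>+ \<omega>. ennreal ((norm (Z \<omega>))\<^sup>2) \<partial>M) < \<infinity>"

lemma L2_measurable [measurable_dest]: "L2 M Z \<Longrightarrow> Z \<in> borel_measurable M"
  by (simp add: L2_def)

lemma L2_integrable_square: "L2 M Z \<longleftrightarrow> Z \<in> borel_measurable M \<and> integrable M (\<lambda>\<omega>. (norm (Z \<omega>))\<^sup>2)"
  unfolding L2_def integrable_iff_bounded by (auto simp: top.not_eq_extremum)

lemma L2_nn_integral_eq: "L2 M Z \<Longrightarrow> (\<integral>\<^sup>+ \<omega>. ennreal ((norm (Z \<omega>))\<^sup>2) \<partial>M) = ennreal (\<integral>\<omega>. (norm (Z \<omega>))\<^sup>2 \<partial>M)"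
  by (intro nn_integral_eq_integral) (auto simp: L2_integrable_square)

lemma L2_bound:
  assumes "L2 M Z" "W \<in> borel_measurable M" "\<And>\<omega>. \<omega> \<in> space M \<Longrightarrow> norm (W \<omega>) \<le> C * norm (Z \<omega>)"
  shows "L2 M W"
  unfolding L2_integrable_square
proof (rule conjI[OF assms(2)], rule Bochner_Integration.integrable_bound)
  show "integrable M (\<lambda>\<omega>. C\<^sup>2 * (norm (Z \<omega>))\<^sup>2)" using assms(1) unfolding L2_integrable_square by (intro integrable_mult_right) simp
  show "AE \<omega> in M. norm ((norm (W \<omega>))\<^sup>2) \<le> norm (C\<^sup>2 * (norm (Z \<omega>))\<^sup>2)"
  proof (rule AE_I2)
    fix \<omega> assume "\<omega> \<in> space M"
    from power_mono[OF assms(3)[OF this], of 2]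
    show "norm ((norm (W \<omega>))\<^sup>2) \<le> norm (C\<^sup>2 * (norm (Z \<omega>))\<^sup>2)"
      by (simp add: power_mult_distrib)
  qed
  show "(\<lambda>\<omega>. (norm (W \<omega>))\<^sup>2) \<in> borel_measurable M" using assms(2) by measurable
qed

lemma L2_inner_integrable:
  assumes "L2 M Z" "L2 M W" shows "integrable M (\<lambda>\<omega>. inner (Z \<omega>) (W \<omega>))"
proof (rule Bochner_Integration.integrable_bound)
  show "integrable M (\<lambda>\<omega>. (norm (Z \<omega>))\<^sup>2 + (norm (W \<omega>))\<^sup>2)" using assms by (simp add: L2_integrable_square)
  have "\<bar>inner z w\<bar> \<le> (norm z)\<^sup>2 + (norm w)\<^sup>2" for z w :: 'b
    using Cauchy_Schwarz_ineq2[of z w] sum_squares_bound[of "norm z" "norm w"]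
      mult_nonneg_nonneg[OF norm_ge_zero norm_ge_zero, of z w] by linarith
  then show "AE \<omega> in M. norm (inner (Z \<omega>) (W \<omega>)) \<le> norm ((norm (Z \<omega>))\<^sup>2 + (norm (W \<omega>))\<^sup>2)"
    by auto
  show "(\<lambda>\<omega>. inner (Z \<omega>) (W \<omega>)) \<in> borel_measurable M"
    using assms by (intro borel_measurable_inner) (auto simp: L2_def)
qed

lemma L2_add:
  assumes "L2 M Z" "L2 M W" shows "L2 M (\<lambda>\<omega>. Z \<omega> + W \<omega>)"
proof -
  have "(norm (Z \<omega> + W \<omega>))\<^sup>2 = (norm (Z \<omega>))\<^sup>2 + 2 * inner (Z \<omega>) (W \<omega>) + (norm (W \<omega>))\<^sup>2" for \<omega>
    by (simp add: power2_norm_eq_inner inner_add_left inner_add_right inner_commute)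
  moreover have "(\<lambda>\<omega>. Z \<omega> + W \<omega>) \<in> borel_measurable M"
    using assms by (intro borel_measurable_add) (auto simp: L2_def)
  ultimately show ?thesis
    unfolding L2_integrable_square using assms L2_inner_integrable[OF assms]
    by (intro conjI) (auto simp: L2_integrable_square)
qed

lemma L2_0: "L2 M (\<lambda>_. 0)" by (simp add: L2_def)

lemma (in finite_measure) L2_integrable:
  fixes Z :: "'a \<Rightarrow> 'b::euclidean_space"
  assumes "L2 M Z" shows "integrable M Z"
proof (rule Bochner_Integration.integrable_bound)
  show "integrable M (\<lambda>\<omega>. 1 + (norm (Z \<omega>))\<^sup>2)" using assms by (simp add: L2_integrable_square)
  have "norm z \<le> 1 + (norm z)\<^sup>2" for z :: 'b
    using sum_squares_bound[of "norm z" 1] norm_ge_zero[of z] by (simp only: power_one mult_1_right)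
  then show "AE \<omega> in M. norm (Z \<omega>) \<le> norm (1 + (norm (Z \<omega>))\<^sup>2)" by auto
qed (use assms in \<open>simp add: L2_def\<close>)

text \<open>The condition E(Z | G) = 0 in weak form, for vector-valued square-integrable Z.
  Orthogonality to all square-integrable \<open>G\<close>-measurable vectors is exactly what the
  expansion of squares consumes.\<close>

definition orth_increment :: "'a measure \<Rightarrow> 'a measure \<Rightarrow> ('a \<Rightarrow> 'b::euclidean_space) \<Rightarrow> bool" where
  "orth_increment M G Z \<longleftrightarrow> L2 M Z \<and>
     (\<forall>w. w \<in> borel_measurable G \<longrightarrow> L2 M w \<longrightarrow> (\<integral>\<omega>. inner (w \<omega>) (Z \<omega>) \<partial>M) = 0)"

lemma orth_increment_0: "orth_increment M G (\<lambda>_. 0)"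
  by (simp add: orth_increment_def L2_0)

text \<open>The tests on events say that the conditional expectation is 0, and a
  \<open>G\<close>-measurable factor can be pulled out of it.\<close>

lemma (in prob_space) orth_increment_real:
  fixes Z :: "'a \<Rightarrow> real"
  assumes sub: "subalgebra M G" and Z: "integrable M Z"
    and zero: "\<And>A. A \<in> sets G \<Longrightarrow> (\<integral>\<omega>. indicator A \<omega> * Z \<omega> \<partial>M) = 0"
    and w: "w \<in> borel_measurable G" "integrable M (\<lambda>\<omega>. w \<omega> * Z \<omega>)"
  shows "(\<integral>\<omega>. w \<omega> * Z \<omega> \<partial>M) = 0"
proof -
  interpret sigma_finite_subalgebra M G
    by (rule finite_measure_subalgebra_is_sigma_finite, rule finite_measure_subalgebra.intro)
      (rule finite_measure_axioms, rule finite_measure_subalgebra_axioms.intro, rule sub)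
  have "AE \<omega> in M. real_cond_exp M G Z \<omega> = 0"
    by (rule real_cond_exp_charact) (use zero Z in \<open>auto simp: set_lebesgue_integral_def\<close>)
  then have "(\<integral>\<omega>. w \<omega> * real_cond_exp M G Z \<omega> \<partial>M) = (\<integral>\<omega>. 0 \<partial>M)"
    using measurable_from_subalg[OF sub w(1)] by (intro integral_cong_AE) auto
  then show ?thesis using real_cond_exp_intg(2)[OF w(2) w(1)] Z by auto
qed

lemma (in prob_space) orth_incrementI:
  fixes Z :: "'a \<Rightarrow> 'b::euclidean_space"
  assumes sub: "subalgebra M G" and Z: "L2 M Z"
    and zero: "\<And>A b. A \<in> sets G \<Longrightarrow> b \<in> Basis \<Longrightarrow> (\<integral>\<omega>. indicator A \<omega> * inner (Z \<omega>) b \<partial>M) = 0"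
  shows "orth_increment M G Z"
  unfolding orth_increment_def
proof (intro conjI allI impI Z)
  fix w :: "'a \<Rightarrow> 'b" assume w: "w \<in> borel_measurable G" "L2 M w"
  have comp: "L2 M (\<lambda>\<omega>. inner (V \<omega>) b)" if "L2 M V" "b \<in> Basis" for V :: "'a \<Rightarrow> 'b" and b
    by (rule L2_bound[OF that(1), of _ 1]) (use that Basis_le_norm L2_measurable[OF that(1)] in auto)
  have int: "integrable M (\<lambda>\<omega>. inner (w \<omega>) b * inner (Z \<omega>) b)" if b: "b \<in> Basis" for b
    using L2_inner_integrable[OF comp[OF w(2) b] comp[OF Z b]] by simp
  have z: "(\<integral>\<omega>. inner (w \<omega>) b * inner (Z \<omega>) b \<partial>M) = 0" if b: "b \<in> Basis" for b
    by (rule orth_increment_real[OF sub L2_integrable[OF comp[OF Z b]] zero[OF _ b] _ int[OF b]]) (use w in auto)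
  have "(\<integral>\<omega>. inner (w \<omega>) (Z \<omega>) \<partial>M) = (\<integral>\<omega>. (\<Sum>b\<in>Basis. inner (w \<omega>) b * inner (Z \<omega>) b) \<partial>M)"
    by (simp add: euclidean_inner[symmetric])
  also have "\<dots> = (\<Sum>b\<in>Basis. \<integral>\<omega>. inner (w \<omega>) b * inner (Z \<omega>) b \<partial>M)"
    by (rule Bochner_Integration.integral_sum) (rule int)
  also have "\<dots> = 0" by (simp add: z)
  finally show "(\<integral>\<omega>. inner (w \<omega>) (Z \<omega>) \<partial>M) = 0" .
qed

text \<open>Transposition moves the matrix to the test vector: <w, \<xi> Z> = <w \<xi>, Z>, and
  boundedness of \<xi> keeps the new test vector square-integrable.\<close>

lemma orth_increment_matrix:
  fixes \<xi> :: "'a \<Rightarrow> real ^ 'l ^ 'd"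
  assumes sub: "subalgebra M G" and Z: "orth_increment M G Z"
    and \<xi>: "\<xi> \<in> borel_measurable G" "\<And>\<omega>. \<omega> \<in> space M \<Longrightarrow> norm (\<xi> \<omega>) \<le> C"
  shows "orth_increment M G (\<lambda>\<omega>. \<xi> \<omega> *v Z \<omega>)"
  unfolding orth_increment_def
proof (intro conjI allI impI)
  have \<xi>M: "\<xi> \<in> borel_measurable M" by (rule measurable_from_subalg[OF sub \<xi>(1)])
  have LZ: "L2 M Z" using Z by (simp add: orth_increment_def)
  show "L2 M (\<lambda>\<omega>. \<xi> \<omega> *v Z \<omega>)"
    by (rule L2_bound[OF LZ, of _ C])
      (use \<xi>M L2_measurable[OF LZ] \<xi>(2) in \<open>auto intro!: order_trans[OF norm_matrix_vector_le] mult_right_mono\<close>)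
  fix w :: "'a \<Rightarrow> real ^ 'd" assume w: "w \<in> borel_measurable G" "L2 M w"
  have "L2 M (\<lambda>\<omega>. w \<omega> v* \<xi> \<omega>)"
    by (rule L2_bound[OF w(2), of _ C])
      (use \<xi>M L2_measurable[OF w(2)] \<xi>(2) in \<open>auto intro!: order_trans[OF norm_vector_matrix_le] mult_right_mono\<close>)
  moreover have "(\<lambda>\<omega>. w \<omega> v* \<xi> \<omega>) \<in> borel_measurable G" using w \<xi> by measurable
  ultimately have "(\<integral>\<omega>. inner (w \<omega> v* \<xi> \<omega>) (Z \<omega>) \<partial>M) = 0" using Z by (simp add: orth_increment_def)
  then show "(\<integral>\<omega>. inner (w \<omega>) (\<xi> \<omega> *v Z \<omega>) \<partial>M) = 0" by (simp add: dot_lmul_matrix)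
qed

lemma orth_increment_inner:
  fixes u :: "'a \<Rightarrow> 'b::euclidean_space"
  assumes sub: "subalgebra M G" and Z: "orth_increment M G Z"
    and u: "u \<in> borel_measurable G" "\<And>\<omega>. \<omega> \<in> space M \<Longrightarrow> norm (u \<omega>) \<le> C"
  shows "orth_increment M G (\<lambda>\<omega>. inner (u \<omega>) (Z \<omega>))"
  unfolding orth_increment_def
proof (intro conjI allI impI)
  have uM: "u \<in> borel_measurable M" by (rule measurable_from_subalg[OF sub u(1)])
  have LZ: "L2 M Z" using Z by (simp add: orth_increment_def)
  show "L2 M (\<lambda>\<omega>. inner (u \<omega>) (Z \<omega>))"
  proof (rule L2_bound[OF LZ, of _ C])
    show "(\<lambda>\<omega>. inner (u \<omega>) (Z \<omega>)) \<in> borel_measurable M" using uM L2_measurable[OF LZ] by measurable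
    fix \<omega> assume "\<omega> \<in> space M"
    then show "norm (inner (u \<omega>) (Z \<omega>)) \<le> C * norm (Z \<omega>)"
      using Cauchy_Schwarz_ineq2[of "u \<omega>" "Z \<omega>"] u(2) by (fastforce intro: order_trans mult_right_mono)
  qed
  fix w :: "'a \<Rightarrow> real" assume w: "w \<in> borel_measurable G" "L2 M w"
  have wM: "w \<in> borel_measurable M" by (rule L2_measurable[OF w(2)])
  have "L2 M (\<lambda>\<omega>. w \<omega> *\<^sub>R u \<omega>)"
    by (rule L2_bound[OF w(2), of _ C])
      (use uM wM u(2) in \<open>auto simp: mult.commute[of C] intro!: mult_left_mono\<close>)
  moreover have "(\<lambda>\<omega>. w \<omega> *\<^sub>R u \<omega>) \<in> borel_measurable G" using w u by measurable
  ultimately have "(\<integral>\<omega>. inner (w \<omega> *\<^sub>R u \<omega>) (Z \<omega>) \<partial>M) = 0"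
    using Z unfolding orth_increment_def by blast
  then show "(\<integral>\<omega>. inner (w \<omega>) (inner (u \<omega>) (Z \<omega>)) \<partial>M) = 0" by simp
qed

lemma orth_increment_mono:
  assumes "orth_increment M G Z" "\<And>w :: 'a \<Rightarrow> 'b. w \<in> borel_measurable H \<Longrightarrow> w \<in> borel_measurable G"
  shows "orth_increment M H (Z :: 'a \<Rightarrow> 'b::euclidean_space)"
  using assms unfolding orth_increment_def by blast

text \<open>Pythagoras: the sum of the first terms is measurable with respect to the
  \<sigma>-algebra at which the next term has conditional mean zero, so the cross term
  vanishes.\<close>

lemma orth_increment_sum:
  fixes T :: "nat \<Rightarrow> 'a \<Rightarrow> 'b::euclidean_space"
  assumes orth: "\<And>i. i < n \<Longrightarrow> orth_increment M (G i) (T i)"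
    and meas: "\<And>i j. i < j \<Longrightarrow> j < n \<Longrightarrow> T i \<in> borel_measurable (G j)"
  shows "L2 M (\<lambda>\<omega>. \<Sum>i<n. T i \<omega>) \<and> (\<integral>\<^sup>+\<omega>. ennreal ((norm (\<Sum>i<n. T i \<omega>))\<^sup>2) \<partial>M) = (\<Sum>i<n. \<integral>\<^sup>+\<omega>. ennreal ((norm (T i \<omega>))\<^sup>2) \<partial>M)"
  using assms
proof (induction n)
  case 0 then show ?case by (simp add: L2_0)
next
  case (Suc n)
  let ?S = "\<lambda>\<omega>. \<Sum>i<n. T i \<omega>"
  have IH: "L2 M ?S" "(\<integral>\<^sup>+\<omega>. ennreal ((norm (?S \<omega>))\<^sup>2) \<partial>M) = (\<Sum>i<n. \<integral>\<^sup>+\<omega>. ennreal ((norm (T i \<omega>))\<^sup>2) \<partial>M)"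
    using Suc by auto
  have T: "L2 M (T n)" using Suc.prems(1)[of n] by (simp add: orth_increment_def)
  have SG: "?S \<in> borel_measurable (G n)"
    using Suc.prems(2) by (intro borel_measurable_sum) auto
  have zero: "(\<integral>\<omega>. inner (?S \<omega>) (T n \<omega>) \<partial>M) = 0"
    using Suc.prems(1)[of n] SG IH(1) unfolding orth_increment_def by blast
  have ST: "L2 M (\<lambda>\<omega>. ?S \<omega> + T n \<omega>)" by (rule L2_add[OF IH(1) T])
  have "(\<integral>\<omega>. (norm (?S \<omega> + T n \<omega>))\<^sup>2 \<partial>M) = (\<integral>\<omega>. (norm (?S \<omega>))\<^sup>2 + 2 * inner (?S \<omega>) (T n \<omega>) + (norm (T n \<omega>))\<^sup>2 \<partial>M)"
    by (rule Bochner_Integration.integral_cong) (auto simp: power2_norm_eq_inner inner_add_left inner_add_right inner_commute)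
  also have "\<dots> = (\<integral>\<omega>. (norm (?S \<omega>))\<^sup>2 \<partial>M) + (\<integral>\<omega>. (norm (T n \<omega>))\<^sup>2 \<partial>M)"
    using IH(1) T L2_inner_integrable[OF IH(1) T] zero by (simp add: L2_integrable_square)
  finally have "(\<integral>\<^sup>+\<omega>. ennreal ((norm (?S \<omega> + T n \<omega>))\<^sup>2) \<partial>M) = (\<integral>\<^sup>+\<omega>. ennreal ((norm (?S \<omega>))\<^sup>2) \<partial>M) + (\<integral>\<^sup>+\<omega>. ennreal ((norm (T n \<omega>))\<^sup>2) \<partial>M)"
    unfolding L2_nn_integral_eq[OF ST] L2_nn_integral_eq[OF IH(1)] L2_nn_integral_eq[OF T] by (simp add: ennreal_plus)
  then show ?case using ST IH(2) by simp
qed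

subsection \<open>Brownian increments\<close>

text \<open>This plays the role of an inequality between conditional expectations given
  \<open>G\<close>: a comparison known on events extends to arbitrary nonnegative
  \<open>G\<close>-measurable weights.\<close>

lemma nn_integral_mult_mono_subalg:
  assumes sub: "subalgebra M G" and f: "f \<in> borel_measurable M" and g: "g \<in> borel_measurable M"
    and le: "\<And>A. A \<in> sets G \<Longrightarrow> (\<integral>\<^sup>+\<omega>. indicator A \<omega> * f \<omega> \<partial>M) \<le> (\<integral>\<^sup>+\<omega>. indicator A \<omega> * g \<omega> \<partial>M)"
    and w: "w \<in> borel_measurable G"
  shows "(\<integral>\<^sup>+\<omega>. w \<omega> * f \<omega> \<partial>M) \<le> (\<integral>\<^sup>+\<omega>. w \<omega> * g \<omega> \<partial>M)"
  using w
proof (induction rule: borel_measurable_induct)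
  case (cong v w)
  have "space M = space G" using sub by (simp add: subalgebra_def)
  then have "(\<integral>\<^sup>+\<omega>. v \<omega> * f \<omega> \<partial>M) = (\<integral>\<^sup>+\<omega>. w \<omega> * f \<omega> \<partial>M)" "(\<integral>\<^sup>+\<omega>. v \<omega> * g \<omega> \<partial>M) = (\<integral>\<^sup>+\<omega>. w \<omega> * g \<omega> \<partial>M)"
    using cong by (auto intro!: nn_integral_cong)
  then show ?case using cong by simp
next
  case (set A) then show ?case by (rule le)
next
  case (mult u c)
  have [measurable]: "u \<in> borel_measurable M" by (rule measurable_from_subalg[OF sub]) fact
  show ?case using mult f g by (simp add: mult.assoc nn_integral_cmult mult_left_mono)
next
  case (add u v)
  have [measurable]: "u \<in> borel_measurable M" "v \<in> borel_measurable M"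
    by (rule measurable_from_subalg[OF sub], fact)+
  show ?case using add f g by (simp add: distrib_right nn_integral_add add_mono)
next
  case (seq U)
  have [measurable]: "U i \<in> borel_measurable M" for i
    by (rule measurable_from_subalg[OF sub]) (use seq in auto)
  have *: "(\<integral>\<^sup>+\<omega>. (SUP i. U i) \<omega> * k \<omega> \<partial>M) = (SUP i. \<integral>\<^sup>+\<omega>. U i \<omega> * k \<omega> \<partial>M)" if [measurable]: "k \<in> borel_measurable M" for k
  proof -
    have "(\<integral>\<^sup>+\<omega>. (SUP i. U i) \<omega> * k \<omega> \<partial>M) = (\<integral>\<^sup>+\<omega>. (SUP i. U i \<omega> * k \<omega>) \<partial>M)"
      by (simp add: SUP_mult_right_ennreal image_comp)
    also have "\<dots> = (SUP i. \<integral>\<^sup>+\<omega>. U i \<omega> * k \<omega> \<partial>M)"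
      using seq(3) by (intro nn_integral_monotone_convergence_SUP) (auto simp: incseq_def le_fun_def intro!: mult_right_mono)
    finally show ?thesis .
  qed
  show ?case unfolding *[OF f] *[OF g] using seq(5) by (intro SUP_mono) blast
qed

lemma lborel_distr_uminus_euclidean: "distr lborel borel uminus = (lborel :: 'b::euclidean_space measure)"
proof -
  have "(lborel :: 'b measure) = density (distr lborel borel (\<lambda>x. 0 + (- 1) *\<^sub>R x)) (\<lambda>_. ennreal (\<bar>- 1\<bar> ^ DIM('b)))"
    by (rule lborel_affine) simp
  also have "\<dots> = distr lborel borel uminus"
    by (simp add: density_1)
  finally show ?thesis by simp
qed

locale brownian_basis =
  fixes M :: "'a measure" and F :: "real \<Rightarrow> 'a measure" and B :: "'a \<Rightarrow> real \<Rightarrow> real ^ 'l"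
  assumes usual: "usual_conditions M F" and BM: "brownian M F B"
begin

sublocale prob_space M
  using usual unfolding usual_conditions_def by (elim conjE)

lemma filtration_space: "t \<ge> 0 \<Longrightarrow> space (F t) = space M"
  and filtration_sets: "t \<ge> 0 \<Longrightarrow> A \<in> sets (F t) \<Longrightarrow> A \<in> sets M"
proof -
  have *: "\<forall>t\<ge>0. space (F t) = space M \<and> sets (F t) \<subseteq> sets M"
    using usual unfolding usual_conditions_def by (elim conjE)
  then show "t \<ge> 0 \<Longrightarrow> space (F t) = space M" "t \<ge> 0 \<Longrightarrow> A \<in> sets (F t) \<Longrightarrow> A \<in> sets M" by blast+
qed

lemma filtration_subalgebra: "t \<ge> 0 \<Longrightarrow> subalgebra M (F t)"
  unfolding subalgebra_def using filtration_space filtration_sets by auto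

lemma filtration_sets_mono: "0 \<le> s \<Longrightarrow> s \<le> t \<Longrightarrow> A \<in> sets (F s) \<Longrightarrow> A \<in> sets (F t)"
proof -
  have "\<forall>s t. 0 \<le> s \<longrightarrow> s \<le> t \<longrightarrow> sets (F s) \<subseteq> sets (F t)"
    using usual unfolding usual_conditions_def by (elim conjE)
  then show "0 \<le> s \<Longrightarrow> s \<le> t \<Longrightarrow> A \<in> sets (F s) \<Longrightarrow> A \<in> sets (F t)" by blast
qed

lemma filtration_mono: "0 \<le> s \<Longrightarrow> s \<le> t \<Longrightarrow> f \<in> measurable (F s) N \<Longrightarrow> f \<in> measurable (F t) N"
  by (rule measurable_from_subalg[of "F t" "F s"])
    (auto simp: subalgebra_def filtration_space intro: filtration_sets_mono)

lemma brownian_adapted: "t \<ge> 0 \<Longrightarrow> (\<lambda>\<omega>. B \<omega> t) \<in> borel_measurable (F t)"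
  using BM by (simp add: brownian_def adapted_def)

lemma brownian_measurable [measurable]: "t \<ge> 0 \<Longrightarrow> (\<lambda>\<omega>. B \<omega> t) \<in> borel_measurable M"
  by (rule measurable_from_subalg[OF filtration_subalgebra brownian_adapted])

lemma brownian_diff_measurable: "0 \<le> s \<Longrightarrow> 0 \<le> t \<Longrightarrow> (\<lambda>\<omega>. B \<omega> t - B \<omega> s) \<in> borel_measurable M"
  by (intro borel_measurable_diff brownian_measurable)

lemma brownian_increment_distr: "0 \<le> s \<Longrightarrow> s < t \<Longrightarrow> distr M borel (\<lambda>\<omega>. B \<omega> t - B \<omega> s) = density lborel (gauss_dens (t - s))"
  and brownian_increment_indep: "0 \<le> s \<Longrightarrow> s < t \<Longrightarrow> A \<in> sets (F s) \<Longrightarrow> C \<in> sets borel \<Longrightarrow>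
    measure M (A \<inter> {\<omega> \<in> space M. B \<omega> t - B \<omega> s \<in> C}) = measure M A * measure M {\<omega> \<in> space M. B \<omega> t - B \<omega> s \<in> C}"
proof -
  have *: "\<forall>s t. 0 \<le> s \<longrightarrow> s < t \<longrightarrow>
        distr M borel (\<lambda>\<omega>. B \<omega> t - B \<omega> s) = density lborel (gauss_dens (t - s)) \<and>
        (\<forall>A \<in> sets (F s). \<forall>C \<in> sets borel.
            measure M (A \<inter> {\<omega> \<in> space M. B \<omega> t - B \<omega> s \<in> C})
              = measure M A * measure M {\<omega> \<in> space M. B \<omega> t - B \<omega> s \<in> C})"
    using BM unfolding brownian_def by (elim conjE)
  show "0 \<le> s \<Longrightarrow> s < t \<Longrightarrow> distr M borel (\<lambda>\<omega>. B \<omega> t - B \<omega> s) = density lborel (gauss_dens (t - s))"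
    using *[rule_format, of s t] by simp
  show "0 \<le> s \<Longrightarrow> s < t \<Longrightarrow> A \<in> sets (F s) \<Longrightarrow> C \<in> sets borel \<Longrightarrow>
    measure M (A \<inter> {\<omega> \<in> space M. B \<omega> t - B \<omega> s \<in> C}) = measure M A * measure M {\<omega> \<in> space M. B \<omega> t - B \<omega> s \<in> C}"
    using conjunct2[OF *[rule_format, of s t]] by blast
qed

section \<open>Law and second moment of Brownian increments\<close>

lemma gauss_dens_measurable [measurable]: "gauss_dens h \<in> borel_measurable borel"
  unfolding gauss_dens_def by measurable

lemma brownian_increment_nn_integral:
  assumes st: "0 \<le> s" "s < t" and A: "A \<in> sets (F s)" and g[measurable]: "g \<in> borel_measurable borel"
  shows "(\<integral>\<^sup>+\<omega>. indicator A \<omega> * g (B \<omega> t - B \<omega> s) \<partial>M) = emeasure M A * (\<integral>\<^sup>+x. gauss_dens (t - s) x * g x \<partial>lborel)"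
proof -
  let ?D = "\<lambda>\<omega>. B \<omega> t - B \<omega> s"
  have [measurable]: "A \<in> sets M" by (rule filtration_sets[OF st(1) A])
  have [measurable]: "?D \<in> borel_measurable M" by (rule brownian_diff_measurable) (use st in auto)
  have dist: "distr M borel ?D = density lborel (gauss_dens (t - s))"
    and ind: "\<And>C. C \<in> sets borel \<Longrightarrow> measure M (A \<inter> {\<omega> \<in> space M. ?D \<omega> \<in> C}) = measure M A * measure M {\<omega> \<in> space M. ?D \<omega> \<in> C}"
  proof -
    show "distr M borel ?D = density lborel (gauss_dens (t - s))" by (rule brownian_increment_distr[OF st])
    show "\<And>C. C \<in> sets borel \<Longrightarrow> measure M (A \<inter> {\<omega> \<in> space M. ?D \<omega> \<in> C}) = measure M A * measure M {\<omega> \<in> space M. ?D \<omega> \<in> C}"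
      by (rule brownian_increment_indep[OF st A])
  qed
  \<comment> \<open>Independence as an identity of measures: restricting the probability to
    \<open>A\<close> and pushing forward gives the law of the increment scaled by the probability of
    \<open>A\<close>.\<close>
  have eq: "distr (density M (indicator A)) borel ?D = scale_measure (emeasure M A) (distr M borel ?D)"
  proof (rule measure_eqI)
    fix C assume "C \<in> sets (distr (density M (indicator A)) borel ?D)"
    then have C[measurable]: "C \<in> sets borel" by simp
    have pre: "?D -` C \<inter> space M = {\<omega> \<in> space M. ?D \<omega> \<in> C}" by auto
    have "emeasure (distr (density M (indicator A)) borel ?D) C = emeasure (density M (indicator A)) {\<omega> \<in> space M. ?D \<omega> \<in> C}"
      by (subst emeasure_distr) (auto simp: pre)
    also have "\<dots> = emeasure M (A \<inter> {\<omega> \<in> space M. ?D \<omega> \<in> C})"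
      by (subst emeasure_density) (auto simp: indicator_inter_arith[symmetric])
    also have "\<dots> = emeasure M A * emeasure M {\<omega> \<in> space M. ?D \<omega> \<in> C}"
      unfolding emeasure_eq_measure ind[OF C] by (simp add: ennreal_mult)
    also have "\<dots> = emeasure (scale_measure (emeasure M A) (distr M borel ?D)) C"
      by (simp add: emeasure_distr pre)
    finally show "emeasure (distr (density M (indicator A)) borel ?D) C = emeasure (scale_measure (emeasure M A) (distr M borel ?D)) C" .
  qed simp
  have "(\<integral>\<^sup>+\<omega>. indicator A \<omega> * g (?D \<omega>) \<partial>M) = (\<integral>\<^sup>+\<omega>. g (?D \<omega>) \<partial>density M (indicator A))"
    by (subst nn_integral_density) auto
  also have "\<dots> = (\<integral>\<^sup>+x. g x \<partial>distr (density M (indicator A)) borel ?D)"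
    by (subst nn_integral_distr) auto
  also have "\<dots> = emeasure M A * (\<integral>\<^sup>+x. g x \<partial>distr M borel ?D)"
    unfolding eq by (simp add: nn_integral_scale_measure)
  also have "(\<integral>\<^sup>+x. g x \<partial>distr M borel ?D) = (\<integral>\<^sup>+x. gauss_dens (t - s) x * g x \<partial>lborel)"
    unfolding dist by (subst nn_integral_density) auto
  finally show ?thesis .
qed

text \<open>With u = |x|^2 / (4 h) the factor 4 comes from |x|^2 = 4 h u, and the power of 2 is the
  ratio of the normalising constants of the Gaussian densities of variances h and 2 h.\<close>

definition brownian_const :: real where "brownian_const = 4 * 2 powr (real CARD('l) / 2)"

text \<open>Since \<open>u * exp (- u) \<le> 1\<close>, the function \<open>|x|\<^sup>2\<close> times the Gaussian density of variance \<open>h\<close>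
  is at most \<open>h\<close> times a constant times the density of variance \<open>2 h\<close>, which has total mass one.\<close>

lemma gauss_second_moment:
  assumes h: "h > 0"
  shows "(\<integral>\<^sup>+x. gauss_dens h x * ennreal ((norm (x :: real ^ 'l))\<^sup>2) \<partial>lborel) \<le> ennreal (brownian_const * h)"
proof -
  \<comment> \<open>That the density of variance 2 h has mass one is read off from the Brownian
    motion itself: it is the law of the increment over [0, 2 h].\<close>
  have "prob_space (distr M borel (\<lambda>\<omega>. B \<omega> (2 * h) - B \<omega> 0))"
    by (rule prob_space_distr, rule brownian_diff_measurable) (use h in auto)
  moreover have "distr M borel (\<lambda>\<omega>. B \<omega> (2 * h) - B \<omega> 0) = density lborel (gauss_dens (2 * h))"
    using brownian_increment_distr[of 0 "2 * h"] h by simp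
  ultimately have "emeasure (density lborel (gauss_dens (2 * h) :: real ^ 'l \<Rightarrow> ennreal)) UNIV = 1"
    using prob_space.emeasure_space_1 by fastforce
  then have one: "(\<integral>\<^sup>+x. gauss_dens (2 * h) (x :: real ^ 'l) \<partial>lborel) = 1"
    by (subst (asm) emeasure_density) auto
  have pw: "gauss_dens h x * ennreal ((norm x)\<^sup>2) \<le> ennreal (brownian_const * h) * gauss_dens (2 * h) x" for x :: "real ^ 'l"
  proof -
    define u where "u = (norm x)\<^sup>2 / (4 * h)"
    define p where "p = (2 * pi * h) powr (- real CARD('l) / 2)"
    have u: "u \<ge> 0" "(norm x)\<^sup>2 = 4 * h * u" using h by (auto simp: u_def)
    have p2: "(2 * pi * (2 * h)) powr (- real CARD('l) / 2) = p * 2 powr (- (real CARD('l) / 2))"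
    proof -
      have "2 * pi * (2 * h) = (2 * pi * h) * 2" by simp
      then show ?thesis using h unfolding p_def by (simp only: powr_mult) simp
    qed
    have "exp u \<ge> u" using exp_ge_add_one_self[of u] by linarith
    then have "u * exp (- u) \<le> 1" by (simp add: exp_minus field_simps)
    then have "(u * exp (- u)) * exp (- u) \<le> 1 * exp (- u)" by (intro mult_right_mono) auto
    then have ue: "u * exp (- (2 * u)) \<le> exp (- u)" by (simp add: mult_exp_exp mult.assoc)
    have "p * exp (- (norm x)\<^sup>2 / (2 * h)) * (norm x)\<^sup>2 = 4 * h * p * (u * exp (- (2 * u)))"
      using h by (simp add: u(2))
    also have "\<dots> \<le> 4 * h * p * exp (- u)" using ue h by (intro mult_left_mono) (auto simp: p_def)
    also have "\<dots> = (brownian_const * h) * ((2 * pi * (2 * h)) powr (- real CARD('l) / 2) * exp (- (norm x)\<^sup>2 / (2 * (2 * h))))"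
      unfolding p2 using h by (simp add: brownian_const_def u(2) powr_minus field_simps)
    finally have "p * exp (- (norm x)\<^sup>2 / (2 * h)) * (norm x)\<^sup>2 \<le> \<dots>" .
    then show ?thesis
      unfolding gauss_dens_def p_def using h by (simp add: ennreal_mult[symmetric] brownian_const_def)
  qed
  have "(\<integral>\<^sup>+x. gauss_dens h x * ennreal ((norm (x :: real ^ 'l))\<^sup>2) \<partial>lborel) \<le> (\<integral>\<^sup>+x. ennreal (brownian_const * h) * gauss_dens (2 * h) (x :: real ^ 'l) \<partial>lborel)"
    by (intro nn_integral_mono pw)
  also have "\<dots> = ennreal (brownian_const * h)"
    by (subst nn_integral_cmult) (auto simp: one)
  finally show ?thesis .
qed

lemma brownian_increment_square:
  assumes st: "0 \<le> s" "s < t" and A: "A \<in> sets (F s)"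
  shows "(\<integral>\<^sup>+\<omega>. indicator A \<omega> * ennreal ((norm (B \<omega> t - B \<omega> s))\<^sup>2) \<partial>M) \<le> ennreal (brownian_const * (t - s)) * emeasure M A"
proof -
  have "(\<integral>\<^sup>+\<omega>. indicator A \<omega> * ennreal ((norm (B \<omega> t - B \<omega> s))\<^sup>2) \<partial>M)
      = emeasure M A * (\<integral>\<^sup>+x. gauss_dens (t - s) x * ennreal ((norm (x :: real ^ 'l))\<^sup>2) \<partial>lborel)"
    by (rule brownian_increment_nn_integral[OF st A]) measurable
  also have "\<dots> \<le> emeasure M A * ennreal (brownian_const * (t - s))"
    using st by (intro mult_left_mono gauss_second_moment) auto
  finally show ?thesis by (simp add: mult.commute)
qed

lemma brownian_increment_orth:
  assumes st: "0 \<le> s" "s < t"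
  shows "orth_increment M (F s) (\<lambda>\<omega>. B \<omega> t - B \<omega> s)"
proof -
  let ?D = "\<lambda>\<omega>. B \<omega> t - B \<omega> s"
  have D[measurable]: "?D \<in> borel_measurable M" by (rule brownian_diff_measurable) (use st in auto)
  have sp: "space M \<in> sets (F s)" using filtration_subalgebra[OF st(1)] sets.top[of "F s"] by (simp add: subalgebra_def)
  have "(\<integral>\<^sup>+\<omega>. ennreal ((norm (?D \<omega>))\<^sup>2) \<partial>M) = (\<integral>\<^sup>+\<omega>. indicator (space M) \<omega> * ennreal ((norm (?D \<omega>))\<^sup>2) \<partial>M)"
    by (rule nn_integral_cong) auto
  also have "\<dots> \<le> ennreal (brownian_const * (t - s)) * emeasure M (space M)"
    by (rule brownian_increment_square[OF st sp])
  also have "\<dots> < \<infinity>" by (simp add: emeasure_space_1)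
  finally have L2: "L2 M ?D" by (simp add: L2_def)
  show ?thesis
  proof (rule orth_incrementI[OF filtration_subalgebra[OF st(1)] L2])
    fix A and b :: "real ^ 'l" assume A: "A \<in> sets (F s)" and b: "b \<in> Basis"
    have [measurable]: "A \<in> sets M" by (rule filtration_sets[OF st(1) A])
    \<comment> \<open>The density is even, so reflection exchanges the positive and the negative
      part of a component. Both parts have the same integral over \<open>A\<close>, and the mean
      vanishes.\<close>
    have refl: "(\<integral>\<^sup>+x. gauss_dens (t - s) x * ennreal (inner x b) \<partial>lborel) = (\<integral>\<^sup>+x. gauss_dens (t - s) x * ennreal (- inner x b) \<partial>lborel)"
    proof -
      have "(\<integral>\<^sup>+x. gauss_dens (t - s) x * ennreal (inner x b) \<partial>lborel) = (\<integral>\<^sup>+x. gauss_dens (t - s) x * ennreal (inner x b) \<partial>distr lborel borel uminus)"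
        by (simp add: lborel_distr_uminus_euclidean)
      also have "\<dots> = (\<integral>\<^sup>+x. gauss_dens (t - s) (- x) * ennreal (inner (- x) b) \<partial>lborel)"
        by (subst nn_integral_distr) auto
      finally show ?thesis by (simp add: gauss_dens_def)
    qed
    have pos: "(\<integral>\<^sup>+\<omega>. ennreal (indicator A \<omega> * inner (?D \<omega>) b) \<partial>M) = emeasure M A * (\<integral>\<^sup>+x. gauss_dens (t - s) x * ennreal (inner x b) \<partial>lborel)"
      by (subst brownian_increment_nn_integral[OF st A, symmetric]) (auto intro!: nn_integral_cong split: split_indicator)
    have neg: "(\<integral>\<^sup>+\<omega>. ennreal (- (indicator A \<omega> * inner (?D \<omega>) b)) \<partial>M) = emeasure M A * (\<integral>\<^sup>+x. gauss_dens (t - s) x * ennreal (- inner x b) \<partial>lborel)"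
      by (subst brownian_increment_nn_integral[OF st A, of "\<lambda>x. ennreal (- inner x b)", symmetric]) (auto intro!: nn_integral_cong split: split_indicator)
    have "integrable M (\<lambda>\<omega>. indicator A \<omega> * inner (?D \<omega>) b)"
      using integrable_mult_indicator[OF \<open>A \<in> sets M\<close> integrable_inner_left[OF L2_integrable[OF L2]], of b] by simp
    then show "(\<integral>\<omega>. indicator A \<omega> * inner (?D \<omega>) b \<partial>M) = 0"
      by (subst real_lebesgue_integral_def) (auto simp: pos neg refl)
  qed
qed

end

subsection \<open>Stochastic integrals of simple processes\<close>

lemma orth_increment_add:
  assumes "orth_increment M G Z" "orth_increment M G W"
  shows "orth_increment M G (\<lambda>\<omega>. Z \<omega> + W \<omega>)"
  unfolding orth_increment_def
proof (intro conjI allI impI)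
  have L: "L2 M Z" "L2 M W" using assms by (auto simp: orth_increment_def)
  show "L2 M (\<lambda>\<omega>. Z \<omega> + W \<omega>)" by (rule L2_add[OF L])
  fix w :: "'a \<Rightarrow> 'b" assume w: "w \<in> borel_measurable G" "L2 M w"
  have "(\<integral>\<omega>. inner (w \<omega>) (Z \<omega> + W \<omega>) \<partial>M) = (\<integral>\<omega>. inner (w \<omega>) (Z \<omega>) \<partial>M) + (\<integral>\<omega>. inner (w \<omega>) (W \<omega>) \<partial>M)"
    unfolding inner_add_right using L w by (intro Bochner_Integration.integral_add L2_inner_integrable)
  also have "\<dots> = 0" using assms w by (simp add: orth_increment_def)
  finally show "(\<integral>\<omega>. inner (w \<omega>) (Z \<omega> + W \<omega>) \<partial>M) = 0" .
qed

lemma orth_increment_sum_orth: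
  assumes "\<And>i. i < (n::nat) \<Longrightarrow> orth_increment M G (T i)"
  shows "orth_increment M G (\<lambda>\<omega>. \<Sum>i<n. T i \<omega>)"
  using assms by (induction n) (auto intro: orth_increment_0 orth_increment_add)

lemma grid_mono:
  fixes p :: "nat \<Rightarrow> real"
  assumes "\<And>i. i < n \<Longrightarrow> p i \<le> p (Suc i)" "i \<le> j" "j \<le> n"
  shows "p i \<le> p j"
  using assms(2,3)
proof (induction j)
  case (Suc j)
  then show ?case using assms(1)[of j] by (cases "i = Suc j") (auto simp: le_Suc_eq)
qed simp

text \<open>Projection of a time onto [u, v]. An increment of a simple integral over [u, v] becomes
  a sum over the projected partition, in which cells outside [u, v] collapse to points.\<close>

definition clamp_time :: "real \<Rightarrow> real \<Rightarrow> real \<Rightarrow> real" where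
  "clamp_time u v r = max u (min v r)"

lemma simple_stoch_int_diff:
  assumes "u \<le> v"
  shows "simple_stoch_int ts n \<xi> B \<omega> v - simple_stoch_int ts n \<xi> B \<omega> u =
    (\<Sum>i<n. \<xi> i \<omega> *v (B \<omega> (clamp_time u v (ts (Suc i))) - B \<omega> (clamp_time u v (ts i))))"
proof -
  have *: "B \<omega> (min v r) - B \<omega> (min u r) = B \<omega> (clamp_time u v r) - B \<omega> u" for r
    using assms by (cases "r \<le> u") (auto simp: clamp_time_def min_def max_def)
  have "(B \<omega> (min v r') - B \<omega> (min v r)) - (B \<omega> (min u r') - B \<omega> (min u r)) = B \<omega> (clamp_time u v r') - B \<omega> (clamp_time u v r)" for r r'
  proof -
    have "(B \<omega> (min v r') - B \<omega> (min v r)) - (B \<omega> (min u r') - B \<omega> (min u r))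
      = (B \<omega> (min v r') - B \<omega> (min u r')) - (B \<omega> (min v r) - B \<omega> (min u r))" by simp
    then show ?thesis unfolding * by simp
  qed
  then show ?thesis
    unfolding simple_stoch_int_def
    by (simp add: sum_subtractf[symmetric] matrix_vector_mult_diff_distrib[symmetric])
qed

context brownian_basis
begin

lemma grid_stoch_sum:
  fixes \<eta> :: "nat \<Rightarrow> 'a \<Rightarrow> real ^ 'l ^ 'd"
  assumes p0: "0 \<le> p 0" and p: "\<And>i. i < n \<Longrightarrow> p i \<le> p (Suc i)"
    and \<eta>: "\<And>i. i < n \<Longrightarrow> \<eta> i \<in> borel_measurable (F (p i))"
    and bd: "\<And>i. i < n \<Longrightarrow> \<exists>C. \<forall>\<omega>\<in>space M. norm (\<eta> i \<omega>) \<le> C"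
  shows "orth_increment M (F (p 0)) (\<lambda>\<omega>. \<Sum>i<n. \<eta> i \<omega> *v (B \<omega> (p (Suc i)) - B \<omega> (p i)))"
    and "(\<integral>\<^sup>+\<omega>. ennreal ((norm (\<Sum>i<n. \<eta> i \<omega> *v (B \<omega> (p (Suc i)) - B \<omega> (p i))))\<^sup>2) \<partial>M)
      \<le> ennreal brownian_const * (\<integral>\<^sup>+\<omega>. ennreal (\<Sum>i<n. (norm (\<eta> i \<omega>))\<^sup>2 * (p (Suc i) - p i)) \<partial>M)"
proof -
  define T where "T i \<omega> = \<eta> i \<omega> *v (B \<omega> (p (Suc i)) - B \<omega> (p i))" for i \<omega>
  have pm: "i \<le> j \<Longrightarrow> j \<le> n \<Longrightarrow> p i \<le> p j" for i j
    using grid_mono[of n p, OF p] by blast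
  have p_nonneg: "0 \<le> p i" if "i \<le> n" for i using pm[of 0 i] that p0 by simp
  have orth: "orth_increment M (F (p i)) (T i)" if i: "i < n" for i
  proof (cases "p i < p (Suc i)")
    case True
    obtain C where C: "\<And>\<omega>. \<omega> \<in> space M \<Longrightarrow> norm (\<eta> i \<omega>) \<le> C" using bd[OF i] by blast
    show ?thesis
      unfolding T_def using i p_nonneg[of i] True
      by (intro orth_increment_matrix[OF filtration_subalgebra brownian_increment_orth \<eta> C]) auto
  next
    case False
    then have "p (Suc i) = p i" using p[OF i] by simp
    then have "T i = (\<lambda>_. 0)" by (intro ext) (simp add: T_def)
    then show ?thesis by (simp add: orth_increment_0)
  qed
  have meas: "T i \<in> borel_measurable (F (p j))" if "i < j" "j < n" for i j
  proof -
    have le: "p i \<le> p (Suc i)" "p (Suc i) \<le> p j" "0 \<le> p i" "0 \<le> p (Suc i)"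
      using pm[of i "Suc i"] pm[of "Suc i" j] p_nonneg[of i] p_nonneg[of "Suc i"] that by simp_all
    have "\<eta> i \<in> borel_measurable (F (p (Suc i)))"
      using le that by (intro filtration_mono[OF _ _ \<eta>]) auto
    moreover have "(\<lambda>\<omega>. B \<omega> (p (Suc i))) \<in> borel_measurable (F (p (Suc i)))"
      by (rule brownian_adapted[OF le(4)])
    moreover have "(\<lambda>\<omega>. B \<omega> (p i)) \<in> borel_measurable (F (p (Suc i)))"
      by (rule filtration_mono[OF le(3,1) brownian_adapted[OF le(3)]])
    ultimately have "T i \<in> borel_measurable (F (p (Suc i)))"
      unfolding T_def by (intro borel_measurable_matrix_vector borel_measurable_diff)
    then show ?thesis by (rule filtration_mono[OF le(4,2)])
  qed
  show "orth_increment M (F (p 0)) (\<lambda>\<omega>. \<Sum>i<n. \<eta> i \<omega> *v (B \<omega> (p (Suc i)) - B \<omega> (p i)))"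
    unfolding T_def[symmetric]
  proof (rule orth_increment_sum_orth)
    fix i assume i: "i < n"
    show "orth_increment M (F (p 0)) (T i)"
      by (rule orth_increment_mono[OF orth[OF i]], rule filtration_mono[OF p0]) (use pm i in auto)
  qed
  \<comment> \<open>The squared coefficient is a weight known at the left end of the cell, so the
    bound for the squared Brownian increment on events extends to it.\<close>
  have T2: "(\<integral>\<^sup>+\<omega>. ennreal ((norm (T i \<omega>))\<^sup>2) \<partial>M) \<le> (\<integral>\<^sup>+\<omega>. ennreal brownian_const * ennreal ((norm (\<eta> i \<omega>))\<^sup>2 * (p (Suc i) - p i)) \<partial>M)" if i: "i < n" for i
  proof (cases "p i < p (Suc i)")
    case True
    have \<eta>i: "(\<lambda>\<omega>. ennreal ((norm (\<eta> i \<omega>))\<^sup>2)) \<in> borel_measurable (F (p i))"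
      using \<eta>[OF i] by measurable
    have pi: "0 \<le> p i" "0 \<le> p (Suc i)" using p_nonneg i by auto
    have "(\<integral>\<^sup>+\<omega>. ennreal ((norm (T i \<omega>))\<^sup>2) \<partial>M) \<le> (\<integral>\<^sup>+\<omega>. ennreal ((norm (\<eta> i \<omega>))\<^sup>2) * ennreal ((norm (B \<omega> (p (Suc i)) - B \<omega> (p i)))\<^sup>2) \<partial>M)"
      unfolding T_def ennreal_mult[OF zero_le_power2 zero_le_power2, symmetric] power_mult_distrib[symmetric]
      by (intro nn_integral_mono ennreal_leI power_mono norm_matrix_vector_le) auto
    also have "\<dots> \<le> (\<integral>\<^sup>+\<omega>. ennreal ((norm (\<eta> i \<omega>))\<^sup>2) * ennreal (brownian_const * (p (Suc i) - p i)) \<partial>M)"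
    proof (rule nn_integral_mult_mono_subalg[OF filtration_subalgebra[OF pi(1)] _ _ _ \<eta>i])
      have "(\<lambda>\<omega>. B \<omega> (p (Suc i)) - B \<omega> (p i)) \<in> borel_measurable M" by (rule brownian_diff_measurable[OF pi])
      then show "(\<lambda>\<omega>. ennreal ((norm (B \<omega> (p (Suc i)) - B \<omega> (p i)))\<^sup>2)) \<in> borel_measurable M" by measurable
      fix A assume A: "A \<in> sets (F (p i))"
      have AM: "A \<in> sets M" by (rule filtration_sets[OF pi(1) A])
      show "(\<integral>\<^sup>+\<omega>. indicator A \<omega> * ennreal ((norm (B \<omega> (p (Suc i)) - B \<omega> (p i)))\<^sup>2) \<partial>M) \<le> (\<integral>\<^sup>+\<omega>. indicator A \<omega> * ennreal (brownian_const * (p (Suc i) - p i)) \<partial>M)"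
        using brownian_increment_square[OF pi(1) True A] AM by (simp add: nn_integral_multc mult.commute)
    qed simp
    also have "\<dots> = (\<integral>\<^sup>+\<omega>. ennreal brownian_const * ennreal ((norm (\<eta> i \<omega>))\<^sup>2 * (p (Suc i) - p i)) \<partial>M)"
      using True by (intro nn_integral_cong) (simp add: ennreal_mult[symmetric] brownian_const_def mult_ac)
    finally show ?thesis .
  next
    case False
    then have "p (Suc i) = p i" using p[OF i] by simp
    then show ?thesis by (simp add: T_def)
  qed
  have \<eta>M: "\<eta> i \<in> borel_measurable M" if "i < n" for i
    by (rule measurable_from_subalg[OF filtration_subalgebra \<eta>]) (use that p_nonneg in auto)
  have "(\<integral>\<^sup>+\<omega>. ennreal ((norm (\<Sum>i<n. T i \<omega>))\<^sup>2) \<partial>M) = (\<Sum>i<n. \<integral>\<^sup>+\<omega>. ennreal ((norm (T i \<omega>))\<^sup>2) \<partial>M)"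
    by (rule conjunct2[OF orth_increment_sum[of n M "\<lambda>i. F (p i)" T]]) (use orth meas in auto)
  also have "\<dots> \<le> (\<Sum>i<n. \<integral>\<^sup>+\<omega>. ennreal brownian_const * ennreal ((norm (\<eta> i \<omega>))\<^sup>2 * (p (Suc i) - p i)) \<partial>M)"
    by (rule sum_mono) (use T2 in auto)
  also have "\<dots> = (\<integral>\<^sup>+\<omega>. (\<Sum>i<n. ennreal brownian_const * ennreal ((norm (\<eta> i \<omega>))\<^sup>2 * (p (Suc i) - p i))) \<partial>M)"
    by (rule nn_integral_sum[symmetric]) (use \<eta>M in measurable)
  also have "\<dots> = (\<integral>\<^sup>+\<omega>. ennreal brownian_const * ennreal (\<Sum>i<n. (norm (\<eta> i \<omega>))\<^sup>2 * (p (Suc i) - p i)) \<partial>M)"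
  proof (rule nn_integral_cong)
    fix \<omega>
    have "(\<Sum>i<n. ennreal ((norm (\<eta> i \<omega>))\<^sup>2 * (p (Suc i) - p i))) = ennreal (\<Sum>i<n. (norm (\<eta> i \<omega>))\<^sup>2 * (p (Suc i) - p i))"
      by (rule sum_ennreal) (use p in simp)
    then show "(\<Sum>i<n. ennreal brownian_const * ennreal ((norm (\<eta> i \<omega>))\<^sup>2 * (p (Suc i) - p i)))
        = ennreal brownian_const * ennreal (\<Sum>i<n. (norm (\<eta> i \<omega>))\<^sup>2 * (p (Suc i) - p i))"
      by (simp only: sum_distrib_left[symmetric])
  qed
  also have "\<dots> = ennreal brownian_const * (\<integral>\<^sup>+\<omega>. ennreal (\<Sum>i<n. (norm (\<eta> i \<omega>))\<^sup>2 * (p (Suc i) - p i)) \<partial>M)"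
  proof (rule nn_integral_cmult)
    have "(\<lambda>\<omega>. \<Sum>i<n. (norm (\<eta> i \<omega>))\<^sup>2 * (p (Suc i) - p i)) \<in> borel_measurable M"
    proof (rule borel_measurable_sum)
      fix i assume "i \<in> {..<n}"
      then have "\<eta> i \<in> borel_measurable M" using \<eta>M by simp
      then show "(\<lambda>\<omega>. (norm (\<eta> i \<omega>))\<^sup>2 * (p (Suc i) - p i)) \<in> borel_measurable M" by measurable
    qed
    then show "(\<lambda>\<omega>. ennreal (\<Sum>i<n. (norm (\<eta> i \<omega>))\<^sup>2 * (p (Suc i) - p i))) \<in> borel_measurable M" by measurable
  qed
  finally show "(\<integral>\<^sup>+\<omega>. ennreal ((norm (\<Sum>i<n. \<eta> i \<omega> *v (B \<omega> (p (Suc i)) - B \<omega> (p i))))\<^sup>2) \<partial>M)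
      \<le> ennreal brownian_const * (\<integral>\<^sup>+\<omega>. ennreal (\<Sum>i<n. (norm (\<eta> i \<omega>))\<^sup>2 * (p (Suc i) - p i)) \<partial>M)"
    by (simp only: T_def)
qed

text \<open>An event \<open>A\<close> known at time \<open>u\<close> is absorbed into the
  coefficients, so the localised estimate is the plain one for a modified simple process.\<close>

lemma simple_stoch_int_increment:
  fixes \<xi> :: "nat \<Rightarrow> 'a \<Rightarrow> real ^ 'l ^ 'd"
  assumes simple: "simple_pred M F ts n \<xi>" and uv: "0 \<le> u" "u \<le> v"
  shows "orth_increment M (F u) (\<lambda>\<omega>. simple_stoch_int ts n \<xi> B \<omega> v - simple_stoch_int ts n \<xi> B \<omega> u)"
    and "A \<in> sets (F u) \<Longrightarrow>
      (\<integral>\<^sup>+\<omega>. indicator A \<omega> * ennreal ((norm (simple_stoch_int ts n \<xi> B \<omega> v - simple_stoch_int ts n \<xi> B \<omega> u))\<^sup>2) \<partial>M)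
      \<le> ennreal brownian_const * (\<integral>\<^sup>+\<omega>. indicator A \<omega> * (\<integral>\<^sup>+s. ennreal ((norm (simple_integrand ts n \<xi> \<omega> s))\<^sup>2) * indicator {u<..v} s \<partial>lborel) \<partial>M)"
proof -
  define p where "p i = clamp_time u v (ts i)" for i
  have ts: "ts 0 = 0" "\<And>i. i < n \<Longrightarrow> ts i < ts (Suc i)"
    and \<xi>: "\<And>i. i < n \<Longrightarrow> \<xi> i \<in> borel_measurable (F (ts i))" "\<And>i. i < n \<Longrightarrow> \<exists>C. \<forall>\<omega>\<in>space M. norm (\<xi> i \<omega>) \<le> C"
    using simple by (auto simp: simple_pred_def)
  have tsm: "ts i \<le> ts j" if "i \<le> j" "j \<le> n" for i j
    by (rule grid_mono[of n]) (use ts that in \<open>auto intro: less_imp_le\<close>)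
  have ts0: "0 \<le> ts i" if "i \<le> n" for i using tsm[of 0 i] ts(1) that by simp
  have p0: "p 0 = u" using uv ts(1) by (simp add: p_def clamp_time_def)
  have pS: "p i \<le> p (Suc i)" if "i < n" for i
    using ts(2)[OF that] by (auto simp: p_def clamp_time_def)
  have pts: "ts i \<le> p i" if "p i < p (Suc i)" for i
    using that by (auto simp: p_def clamp_time_def min_def max_def split: if_splits)
  \<comment> \<open>The coefficient is set to 0 on collapsed cells: if \<open>ts i\<close> lies
    beyond \<open>v\<close>, then \<open>\<xi> i\<close> need not be measurable at the projected
    time \<open>p i\<close>. On the remaining cells \<open>ts i\<close> is at most
    \<open>p i\<close>.\<close>
  define \<eta> where "\<eta> A i \<omega> = (if p i < p (Suc i) then indicator A \<omega> *\<^sub>R \<xi> i \<omega> else 0)" for A i \<omega>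
  have \<eta>m: "\<eta> A i \<in> borel_measurable (F (p i))" if A: "A \<in> sets (F u)" and i: "i < n" for A i
  proof (cases "p i < p (Suc i)")
    case True
    have "\<xi> i \<in> borel_measurable (F (p i))"
      by (rule filtration_mono[OF ts0 pts[OF True] \<xi>(1)[OF i]]) (use i in auto)
    moreover have "A \<in> sets (F (p i))"
      by (rule filtration_sets_mono[OF uv(1) _ A]) (simp add: p_def clamp_time_def)
    ultimately show ?thesis unfolding \<eta>_def using True by simp
  next
    case False then show ?thesis by (simp add: \<eta>_def[abs_def])
  qed
  have \<eta>b: "\<exists>C. \<forall>\<omega>\<in>space M. norm (\<eta> A i \<omega>) \<le> C" if i: "i < n" for A i
  proof -
    obtain C where "\<forall>\<omega>\<in>space M. norm (\<xi> i \<omega>) \<le> C" using \<xi>(2)[OF i] by blast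
    then have "\<forall>\<omega>\<in>space M. norm (\<eta> A i \<omega>) \<le> max C 0"
      by (auto simp: \<eta>_def indicator_def le_max_iff_disj)
    then show ?thesis by blast
  qed
  let ?D = "\<lambda>\<omega>. simple_stoch_int ts n \<xi> B \<omega> v - simple_stoch_int ts n \<xi> B \<omega> u"
  have eq: "(\<Sum>i<n. \<eta> A i \<omega> *v (B \<omega> (p (Suc i)) - B \<omega> (p i))) = indicator A \<omega> *\<^sub>R ?D \<omega>" for A \<omega>
    unfolding simple_stoch_int_diff[OF uv(2)] p_def[symmetric] scaleR_sum_right
    using pS by (intro sum.cong) (fastforce simp: \<eta>_def scaleR_matrix_vector_assoc)+
  have g: "orth_increment M (F u) (\<lambda>\<omega>. indicator A \<omega> *\<^sub>R ?D \<omega>)"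
    "(\<integral>\<^sup>+\<omega>. ennreal ((norm (indicator A \<omega> *\<^sub>R ?D \<omega>))\<^sup>2) \<partial>M)
      \<le> ennreal brownian_const * (\<integral>\<^sup>+\<omega>. ennreal (\<Sum>i<n. (norm (\<eta> A i \<omega>))\<^sup>2 * (p (Suc i) - p i)) \<partial>M)"
    if A: "A \<in> sets (F u)" for A
    using grid_stoch_sum[of p n "\<eta> A", OF _ pS \<eta>m[OF A] \<eta>b] p0 uv(1) unfolding eq by auto
  have sp: "space M \<in> sets (F u)" using filtration_space[OF uv(1)] sets.top[of "F u"] by simp
  have "orth_increment M (F u) ?D \<longleftrightarrow> orth_increment M (F u) (\<lambda>\<omega>. indicator (space M) \<omega> *\<^sub>R ?D \<omega>)"
    unfolding orth_increment_def L2_def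
    by (intro arg_cong2[where f="(\<and>)"] measurable_cong arg_cong2[where f="(<)"] nn_integral_cong refl all_cong imp_cong
        arg_cong2[where f="(=)"] Bochner_Integration.integral_cong) auto
  then show "orth_increment M (F u) ?D" using g(1)[OF sp] by blast
  assume A: "A \<in> sets (F u)"
  have "(\<integral>\<^sup>+\<omega>. indicator A \<omega> * ennreal ((norm (?D \<omega>))\<^sup>2) \<partial>M) = (\<integral>\<^sup>+\<omega>. ennreal ((norm (indicator A \<omega> *\<^sub>R ?D \<omega>))\<^sup>2) \<partial>M)"
    by (intro nn_integral_cong) (auto split: split_indicator)
  also note g(2)[OF A]
  also have "(\<integral>\<^sup>+\<omega>. ennreal (\<Sum>i<n. (norm (\<eta> A i \<omega>))\<^sup>2 * (p (Suc i) - p i)) \<partial>M)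
     \<le> (\<integral>\<^sup>+\<omega>. indicator A \<omega> * (\<integral>\<^sup>+s. ennreal ((norm (simple_integrand ts n \<xi> \<omega> s))\<^sup>2) * indicator {u<..v} s \<partial>lborel) \<partial>M)"
  proof (rule nn_integral_mono)
    fix \<omega>
    have "ennreal (\<Sum>i<n. (norm (\<eta> A i \<omega>))\<^sup>2 * (p (Suc i) - p i)) = (\<Sum>i<n. ennreal ((norm (\<eta> A i \<omega>))\<^sup>2) * emeasure lborel {p i<..p (Suc i)})"
      using pS by (subst sum_ennreal[symmetric]) (auto simp: ennreal_mult intro!: sum.cong)
    also have "\<dots> = (\<integral>\<^sup>+s. (\<Sum>i<n. ennreal ((norm (\<eta> A i \<omega>))\<^sup>2) * indicator {p i<..p (Suc i)} s) \<partial>lborel)"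
      by (subst nn_integral_sum) (auto simp: nn_integral_cmult_indicator)
    also have "\<dots> \<le> (\<integral>\<^sup>+s. indicator A \<omega> * (ennreal ((norm (simple_integrand ts n \<xi> \<omega> s))\<^sup>2) * indicator {u<..v} s) \<partial>lborel)"
    proof (rule nn_integral_mono)
      fix s
      show "(\<Sum>i<n. ennreal ((norm (\<eta> A i \<omega>))\<^sup>2) * indicator {p i<..p (Suc i)} s) \<le> indicator A \<omega> * (ennreal ((norm (simple_integrand ts n \<xi> \<omega> s))\<^sup>2) * indicator {u<..v} s)"
      proof (cases "\<exists>k<n. s \<in> {p k<..p (Suc k)}")
        case True
        then obtain k where k: "k < n" "p k < s" "s \<le> p (Suc k)" by auto
        then have s: "u < s" "s \<le> v" "ts k < s" "s \<le> ts (Suc k)"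
          using uv by (auto simp: p_def clamp_time_def max_def min_def split: if_splits)
        \<comment> \<open>The cells are half-open and disjoint, so at any time the integrand has a
          single nonzero summand and its square is not affected by cross terms.\<close>
        have unique: "ts i < s \<and> s \<le> ts (Suc i) \<longleftrightarrow> i = k" if i: "i < n" for i
        proof (cases i k rule: linorder_cases)
          case less
          then have "ts (Suc i) \<le> ts k" using k by (intro tsm) auto
          then show ?thesis using less s by auto
        next
          case greater
          then have "ts (Suc k) \<le> ts i" using i by (intro tsm) auto
          then show ?thesis using greater s by auto
        qed (use s in auto)
        have "simple_integrand ts n \<xi> \<omega> s = (\<Sum>i<n. if i = k then \<xi> i \<omega> else 0)"
          unfolding simple_integrand_def using unique by (intro sum.cong) auto
        then have si: "simple_integrand ts n \<xi> \<omega> s = \<xi> k \<omega>" using k by simp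
        have "(\<Sum>i<n. ennreal ((norm (\<eta> A i \<omega>))\<^sup>2) * indicator {p i<..p (Suc i)} s) \<le> (\<Sum>i<n. if i = k then indicator A \<omega> * ennreal ((norm (\<xi> k \<omega>))\<^sup>2) else 0)"
        proof (rule sum_mono)
          fix i assume i: "i \<in> {..<n}"
          have "s \<in> {p i<..p (Suc i)} \<Longrightarrow> i = k"
            using unique[of i] i uv by (auto simp: p_def clamp_time_def max_def min_def split: if_splits)
          then have "i \<noteq> k \<Longrightarrow> indicator {p i<..p (Suc i)} s = (0::ennreal)" by (auto simp: indicator_def)
          moreover have "ennreal ((norm (\<eta> A k \<omega>))\<^sup>2) * indicator {p k<..p (Suc k)} s \<le> indicator A \<omega> * ennreal ((norm (\<xi> k \<omega>))\<^sup>2)"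
            by (cases "\<omega> \<in> A") (auto simp: \<eta>_def indicator_def)
          ultimately show "ennreal ((norm (\<eta> A i \<omega>))\<^sup>2) * indicator {p i<..p (Suc i)} s \<le> (if i = k then indicator A \<omega> * ennreal ((norm (\<xi> k \<omega>))\<^sup>2) else 0)"
            by (cases "i = k") simp_all
        qed
        also have "\<dots> = indicator A \<omega> * ennreal ((norm (\<xi> k \<omega>))\<^sup>2)" using k by simp
        finally show ?thesis using s by (simp add: si)
      next
        case False
        then have "(\<Sum>i<n. ennreal ((norm (\<eta> A i \<omega>))\<^sup>2) * indicator {p i<..p (Suc i)} s) = 0"
          by (intro sum.neutral) auto
        then show ?thesis by simp
      qed
    qed
    also have "\<dots> = indicator A \<omega> * (\<integral>\<^sup>+s. ennreal ((norm (simple_integrand ts n \<xi> \<omega> s))\<^sup>2) * indicator {u<..v} s \<partial>lborel)"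
      by (rule nn_integral_cmult) (simp add: simple_integrand_def)
    finally show "ennreal (\<Sum>i<n. (norm (\<eta> A i \<omega>))\<^sup>2 * (p (Suc i) - p i)) \<le> \<dots>" .
  qed
  finally show "(\<integral>\<^sup>+\<omega>. indicator A \<omega> * ennreal ((norm (?D \<omega>))\<^sup>2) \<partial>M)
    \<le> ennreal brownian_const * (\<integral>\<^sup>+\<omega>. indicator A \<omega> * (\<integral>\<^sup>+s. ennreal ((norm (simple_integrand ts n \<xi> \<omega> s))\<^sup>2) * indicator {u<..v} s \<partial>lborel) \<partial>M)"
    by (simp add: mult_left_mono)
qed

end

subsection \<open>Approximation by simple processes\<close>

lemma ennreal_tendsto_0I:
  fixes f :: "'c \<Rightarrow> ennreal"
  assumes "\<And>e::real. e > 0 \<Longrightarrow> \<forall>\<^sub>F x in F. f x \<le> ennreal e"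
  shows "(f \<longlongrightarrow> 0) F"
proof (rule order_tendstoI)
  fix a :: ennreal assume a: "0 < a"
  obtain e :: real where e: "e > 0" "ennreal e < a"
  proof (cases a)
    case (real r)
    then have "r > 0" using a by simp
    then show ?thesis using that[of "r / 2"] real by (simp add: ennreal_less_iff)
  next
    case top then show ?thesis using that[of 1] by simp
  qed
  from assms[OF e(1)] show "\<forall>\<^sub>F x in F. f x < a" by eventually_elim (use e(2) in auto)
qed simp

lemma ennreal_tendsto_0D:
  fixes f :: "'c \<Rightarrow> ennreal"
  assumes "(f \<longlongrightarrow> 0) F" "(e::real) > 0"
  shows "\<forall>\<^sub>F x in F. f x < ennreal e"
  using order_tendstoD(2)[OF assms(1), of "ennreal e"] assms(2) by simp

text \<open>A continuous retraction onto the ball of radius R. Applied to approximants of a function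
  with values in that ball, it supplies a bound for dominated convergence without spoiling the
  limit.\<close>

definition radial_clip :: "real \<Rightarrow> 'b::real_normed_vector \<Rightarrow> 'b" where
  "radial_clip R x = (R / max R (norm x)) *\<^sub>R x"

lemma radial_clip:
  assumes "R > 0"
  shows "norm (radial_clip R x) \<le> R" "norm x \<le> R \<Longrightarrow> radial_clip R x = x"
proof -
  have "max R (norm x) > 0" using assms by simp
  then have "norm (radial_clip R x) = R * norm x / max R (norm x)"
    using assms by (simp add: radial_clip_def)
  also have "\<dots> \<le> R * max R (norm x) / max R (norm x)"
    using assms by (intro divide_right_mono mult_left_mono) auto
  also have "\<dots> = R" using \<open>max R (norm x) > 0\<close> by simp
  finally show "norm (radial_clip R x) \<le> R" .
  show "norm x \<le> R \<Longrightarrow> radial_clip R x = x"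
    using assms by (simp add: radial_clip_def max_absorb1)
qed

lemma continuous_on_radial_clip:
  assumes "R > 0" "continuous_on S g" shows "continuous_on S (\<lambda>x. radial_clip R (g x))"
  unfolding radial_clip_def by (intro continuous_intros assms) (use assms(1) in auto)

text \<open>A measurable function is almost everywhere a limit of continuous ones; after clipping,
  dominated convergence turns this into approximation in L1 on a bounded interval.\<close>

lemma L1_approx_continuous:
  fixes f :: "real \<Rightarrow> 'b::euclidean_space"
  assumes f[measurable]: "f \<in> borel_measurable borel" and R: "R > 0" "\<And>s. norm (f s) \<le> R" and e: "e > 0"
  shows "\<exists>g. continuous_on UNIV g \<and> (\<integral>\<^sup>+s. ennreal (norm (f s - g s)) * indicator {a..b} s \<partial>lborel) < ennreal e"
proof -
  have "f \<in> borel_measurable lebesgue" using f by (simp add: measurable_completion)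
  then have "f measurable_on {a..b}" by (rule lebesgue_measurable_imp_measurable_on) simp
  then obtain N g where N: "negligible N" and gc: "\<And>n. continuous_on UNIV (g n)"
    and gl: "\<And>x. x \<notin> N \<Longrightarrow> (\<lambda>n. g n x) \<longlonglongrightarrow> (if x \<in> {a..b} then f x else 0)"
    unfolding measurable_on_def by blast
  define h where "h n s = norm (f s - radial_clip R (g n s)) * indicator {a..b} s" for n s
  have cc: "continuous_on UNIV (\<lambda>s. radial_clip R (g n s))" for n
    by (rule continuous_on_radial_clip[OF R(1) gc])
  have cm[measurable]: "(\<lambda>s. radial_clip R (g n s)) \<in> borel_measurable borel" for n
    by (rule borel_measurable_continuous_onI[OF cc])
  have hm[measurable]: "h n \<in> borel_measurable lborel" for n unfolding h_def by measurable
  have "AE s in lebesgue. s \<notin> N" using N by (simp add: negligible_iff_null_sets AE_not_in)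
  then have "AE s in lebesgue. (\<lambda>n. h n s) \<longlonglongrightarrow> 0"
  proof (rule AE_mp, intro AE_I2 impI)
    fix s assume s: "s \<notin> N"
    show "(\<lambda>n. h n s) \<longlonglongrightarrow> 0"
    proof (cases "s \<in> {a..b}")
      case True
      have cl: "isCont (radial_clip R) (f s)"
        using continuous_on_radial_clip[OF R(1) continuous_on_id[of "UNIV :: 'b set"]]
          continuous_on_eq_continuous_at[of UNIV "radial_clip R :: 'b \<Rightarrow> 'b"] by simp
      have "(\<lambda>n. radial_clip R (g n s)) \<longlonglongrightarrow> radial_clip R (f s)"
        by (rule isCont_tendsto_compose[OF cl]) (use gl[OF s] True in simp)
      then have "(\<lambda>n. norm (f s - radial_clip R (g n s)) * indicator {a..b} s) \<longlonglongrightarrow> norm (f s - radial_clip R (f s)) * indicator {a..b} s"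
        by (intro tendsto_intros)
      then show ?thesis using radial_clip(2)[OF R(1) R(2)] by (simp add: h_def)
    qed (simp add: h_def)
  qed
  then have ae': "AE s in lborel. (\<lambda>n. h n s) \<longlonglongrightarrow> 0"
    by (simp add: AE_completion_iff)
  have bd: "norm (h n s) \<le> 2 * R * indicator {a..b} s" for n s
    using norm_triangle_ineq4[of "f s" "radial_clip R (g n s)"] R(2)[of s] radial_clip(1)[OF R(1), of "g n s"]
    by (auto simp: h_def indicator_def)
  have ib: "integrable lborel (\<lambda>s. 2 * R * indicator {a..b} s)" using emeasure_compact_finite[of "{a..b}"]
    by (intro integrable_mult_right integrable_real_indicator) auto
  have "(\<lambda>n. integral\<^sup>L lborel (h n)) \<longlonglongrightarrow> integral\<^sup>L lborel (\<lambda>_ :: real. 0)"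
    by (rule integral_dominated_convergence[where w="\<lambda>s. 2 * R * indicator {a..b} s"]) (use ae' bd ib in auto)
  then have "\<forall>\<^sub>F n in sequentially. integral\<^sup>L lborel (h n) < e"
    by (rule order_tendstoD) (use e in simp)
  then obtain n where n: "integral\<^sup>L lborel (h n) < e" by (auto simp: eventually_sequentially)
  have hi: "integrable lborel (h n)" by (rule Bochner_Integration.integrable_bound[OF ib]) (use order_trans[OF bd abs_ge_self] in auto)
  have "(\<integral>\<^sup>+s. ennreal (norm (f s - radial_clip R (g n s))) * indicator {a..b} s \<partial>lborel) = (\<integral>\<^sup>+s. ennreal (h n s) \<partial>lborel)"
    by (intro nn_integral_cong) (auto simp: h_def indicator_def)
  also have "\<dots> = ennreal (integral\<^sup>L lborel (h n))"
    by (rule nn_integral_eq_integral[OF hi]) (simp add: h_def)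
  also have "\<dots> < ennreal e" using n e by (simp add: ennreal_lessI)
  finally show ?thesis using cc by blast
qed

text \<open>The average runs over the cell that ends at i / 2^n, while \<open>avg_step\<close> uses
  it on the cell that begins there. The delay makes the value known at the left end of the cell of
  use, as a simple predictable process requires. For i = 0 the window lies to the left of time
  0.\<close>

definition delayed_avg :: "nat \<Rightarrow> nat \<Rightarrow> (real \<Rightarrow> 'b::euclidean_space) \<Rightarrow> 'b" where
  "delayed_avg n i f = 2 ^ n *\<^sub>R (\<integral>s. indicator {(real i - 1) / 2 ^ n<..real i / 2 ^ n} s *\<^sub>R f s \<partial>lborel)"

definition avg_step :: "nat \<Rightarrow> nat \<Rightarrow> (real \<Rightarrow> 'b::euclidean_space) \<Rightarrow> real \<Rightarrow> 'b" where
  "avg_step n T f s = (\<Sum>i<T * 2 ^ n. if real i / 2 ^ n < s \<and> s \<le> real (Suc i) / 2 ^ n then delayed_avg n i f else 0)"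

section \<open>L1 convergence of delayed dyadic averages\<close>

lemma dyadic_cell_unique:
  assumes "real i / 2 ^ n < s" "s \<le> real (Suc i) / 2 ^ n" "real j / 2 ^ n < s" "s \<le> real (Suc j) / 2 ^ n"
  shows "i = j"
proof -
  have "real i / 2 ^ n < real (Suc j) / 2 ^ n" "real j / 2 ^ n < real (Suc i) / 2 ^ n" using assms by linarith+
  then have "real i < real (Suc j)" "real j < real (Suc i)" by (simp_all only: divide_less_cancel) auto
  then show ?thesis by linarith
qed

lemma dyadic_cell_exists:
  assumes "0 < s" "s \<le> real T"
  shows "\<exists>i<T * 2 ^ n. real i / 2 ^ n < s \<and> s \<le> real (Suc i) / 2 ^ n"
proof -
  define k where "k = nat \<lceil>s * 2 ^ n\<rceil>"
  have "s * 2 ^ n > 0" using assms by simp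
  then have k: "k > 0" "real k - 1 < s * 2 ^ n" "s * 2 ^ n \<le> real k"
    unfolding k_def by linarith+
  have "s * 2 ^ n \<le> real (T * 2 ^ n)" using assms by simp
  then have "\<lceil>s * 2 ^ n\<rceil> \<le> int (T * 2 ^ n)" by (simp add: ceiling_le_iff)
  then have "k \<le> T * 2 ^ n" unfolding k_def by linarith
  then show ?thesis
    using k by (intro exI[of _ "k - 1"]) (auto simp: of_nat_diff divide_less_eq le_divide_eq Suc_diff_Suc)
qed

lemma avg_step_eq:
  assumes "i < T * 2 ^ n" "real i / 2 ^ n < s" "s \<le> real (Suc i) / 2 ^ n"
  shows "avg_step n T f s = delayed_avg n i f"
proof -
  have "avg_step n T f s = (\<Sum>j<T * 2 ^ n. if j = i then delayed_avg n i f else 0)"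
    unfolding avg_step_def
  proof (rule sum.cong[OF refl])
    fix j
    show "(if real j / 2 ^ n < s \<and> s \<le> real (Suc j) / 2 ^ n then delayed_avg n j f else 0) = (if j = i then delayed_avg n i f else 0)"
      using dyadic_cell_unique[OF assms(2,3), of j] assms(2,3) by (cases "j = i") auto
  qed
  then show ?thesis using assms(1) by simp
qed

lemma sum_dyadic_indicator:
  "(\<Sum>i<m. indicator {(real i - 1) / 2 ^ n<..real i / 2 ^ n} s) = (indicator {- 1 / 2 ^ n<..(real m - 1) / 2 ^ n} s :: ennreal)"
proof (induction m)
  case (Suc m)
  have "- 1 / 2 ^ n \<le> (real m - 1) / 2 ^ n" "(real m - 1) / 2 ^ n \<le> real m / 2 ^ n"
    by (intro divide_right_mono; simp)+
  then show ?case using Suc by (auto simp: indicator_def)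
qed simp

lemma emeasure_Ioc_finite: "emeasure lborel {a<..b :: real} < \<infinity>"
proof -
  have "emeasure lborel {a<..b} \<le> emeasure lborel {a..b}" by (rule emeasure_mono) auto
  also have "\<dots> < \<infinity>" by (rule emeasure_compact_finite) simp
  finally show ?thesis .
qed

lemma integrable_indicator_bounded:
  fixes f :: "real \<Rightarrow> 'b::euclidean_space"
  assumes [measurable]: "f \<in> borel_measurable borel" and "\<And>s. norm (f s) \<le> R"
  shows "integrable lborel (\<lambda>s. indicator {a<..b} s *\<^sub>R f s)"
proof (rule Bochner_Integration.integrable_bound)
  show "integrable lborel (\<lambda>s. R * indicator {a<..b} s)"
    by (intro integrable_mult_right integrable_real_indicator) (auto intro: emeasure_Ioc_finite[simplified])
  have "\<bar>R\<bar> = R" using order_trans[OF norm_ge_zero assms(2)] by simp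
  then show "AE s in lborel. norm (indicator {a<..b} s *\<^sub>R f s) \<le> norm (R * indicator {a<..b} s)"
    using assms(2) by (auto simp: indicator_def)
qed measurable

lemma integrable_indicator_continuous:
  fixes g :: "real \<Rightarrow> 'b::euclidean_space"
  assumes g: "continuous_on UNIV g"
  shows "integrable lborel (\<lambda>s. indicator {a<..b} s *\<^sub>R g s)"
proof -
  have "set_integrable lborel {a..b} g"
    by (rule borel_integrable_atLeastAtMost') (rule continuous_on_subset[OF g], simp)
  then have "set_integrable lborel {a<..b} g" by (rule set_integrable_subset) auto
  then show ?thesis by (simp add: set_integrable_def)
qed

text \<open>Averaging over a cell does not increase the L1 norm. The domain on the right begins at
  -1 because the first window precedes time 0 and has length at most 1.\<close>

lemma avg_step_contraction:
  fixes f g :: "real \<Rightarrow> 'b::euclidean_space"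
  assumes [measurable]: "f \<in> borel_measurable borel" "g \<in> borel_measurable borel"
    and int: "\<And>a b. integrable lborel (\<lambda>s. indicator {a<..b} s *\<^sub>R f s)" "\<And>a b. integrable lborel (\<lambda>s. indicator {a<..b} s *\<^sub>R g s)"
  shows "(\<integral>\<^sup>+s. ennreal (norm (avg_step n T f s - avg_step n T g s)) * indicator {0<..real T} s \<partial>lborel)
    \<le> (\<integral>\<^sup>+s. ennreal (norm (f s - g s)) * indicator {-1..real T} s \<partial>lborel)"
proof -
  let ?J = "\<lambda>i. {(real i - 1) / 2 ^ n<..real i / 2 ^ n}" and ?I = "\<lambda>i. {real i / 2 ^ n<..real (Suc i) / 2 ^ n}"
  define e where "e i = (\<integral>\<^sup>+s. ennreal (norm (f s - g s)) * indicator (?J i) s \<partial>lborel)" for i :: nat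
  have avg: "ennreal (norm (delayed_avg n i f - delayed_avg n i g)) \<le> ennreal (2 ^ n) * e i" for i
  proof -
    have "delayed_avg n i f - delayed_avg n i g = 2 ^ n *\<^sub>R (\<integral>s. indicator (?J i) s *\<^sub>R (f s - g s) \<partial>lborel)"
      unfolding delayed_avg_def using int by (simp add: scaleR_diff_right[symmetric] Bochner_Integration.integral_diff[symmetric])
    then have "ennreal (norm (delayed_avg n i f - delayed_avg n i g)) = ennreal (2 ^ n) * ennreal (norm (\<integral>s. indicator (?J i) s *\<^sub>R (f s - g s) \<partial>lborel))"
      by (simp add: ennreal_mult)
    also have "\<dots> \<le> ennreal (2 ^ n) * (\<integral>\<^sup>+s. ennreal (norm (indicator (?J i) s *\<^sub>R (f s - g s))) \<partial>lborel)"
      using Bochner_Integration.integrable_diff[OF int(1) int(2)]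
      by (intro mult_left_mono integral_norm_bound_ennreal) (auto simp: scaleR_diff_right)
    also have "(\<integral>\<^sup>+s. ennreal (norm (indicator (?J i) s *\<^sub>R (f s - g s))) \<partial>lborel) = e i"
      unfolding e_def by (intro nn_integral_cong) (auto simp: indicator_def)
    finally show ?thesis .
  qed
  have "(\<integral>\<^sup>+s. ennreal (norm (avg_step n T f s - avg_step n T g s)) * indicator {0<..real T} s \<partial>lborel)
    \<le> (\<integral>\<^sup>+s. (\<Sum>i<T * 2 ^ n. ennreal (2 ^ n) * e i * indicator (?I i) s) \<partial>lborel)"
  proof (rule nn_integral_mono)
    fix s
    show "ennreal (norm (avg_step n T f s - avg_step n T g s)) * indicator {0<..real T} s \<le> (\<Sum>i<T * 2 ^ n. ennreal (2 ^ n) * e i * indicator (?I i) s)"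
    proof (cases "s \<in> {0<..real T}")
      case True
      then obtain i where i: "i < T * 2 ^ n" "real i / 2 ^ n < s" "s \<le> real (Suc i) / 2 ^ n"
        using dyadic_cell_exists by (metis greaterThanAtMost_iff)
      have "ennreal (norm (avg_step n T f s - avg_step n T g s)) \<le> ennreal (2 ^ n) * e i * indicator (?I i) s"
        using avg[of i] i by (simp add: avg_step_eq[OF i])
      also have "\<dots> \<le> (\<Sum>i<T * 2 ^ n. ennreal (2 ^ n) * e i * indicator (?I i) s)"
        by (rule member_le_sum) (use i in auto)
      finally show ?thesis using True by simp
    qed simp
  qed
  also have "\<dots> = (\<Sum>i<T * 2 ^ n. ennreal (2 ^ n) * e i * emeasure lborel (?I i))"
    by (subst nn_integral_sum) (auto simp: nn_integral_cmult_indicator)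
  also have "\<dots> = (\<Sum>i<T * 2 ^ n. e i)"
  proof (rule sum.cong[OF refl])
    fix i
    have "emeasure lborel (?I i) = ennreal (1 / 2 ^ n)"
      by (subst emeasure_lborel_Ioc) (auto simp: divide_right_mono diff_divide_distrib[symmetric])
    moreover have "ennreal (2 ^ n) * ennreal (1 / 2 ^ n) = 1" by (simp add: ennreal_mult[symmetric])
    ultimately show "ennreal (2 ^ n) * e i * emeasure lborel (?I i) = e i"
      by (metis mult.assoc mult.commute mult_1)
  qed
  also have "\<dots> = (\<integral>\<^sup>+s. (\<Sum>i<T * 2 ^ n. ennreal (norm (f s - g s)) * indicator (?J i) s) \<partial>lborel)"
    unfolding e_def by (subst nn_integral_sum) auto
  also have "\<dots> \<le> (\<integral>\<^sup>+s. ennreal (norm (f s - g s)) * indicator {-1..real T} s \<partial>lborel)"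
  proof (rule nn_integral_mono)
    fix s
    have "{- 1 / 2 ^ n<..(real (T * 2 ^ n) - 1) / 2 ^ n} \<subseteq> {-1..real T}"
    proof
      fix s :: real assume s: "s \<in> {- 1 / 2 ^ n<..(real (T * 2 ^ n) - 1) / 2 ^ n}"
      define q :: real where "q = 1 / 2 ^ n"
      have "q \<le> 1" "q \<ge> 0" by (simp_all add: q_def)
      moreover have "(real (T * 2 ^ n) - 1) / 2 ^ n = real T - q" by (simp add: q_def diff_divide_distrib)
      moreover have "- 1 / 2 ^ n = - q" by (simp add: q_def)
      ultimately have "- q < s" "s \<le> real T - q" using s by (auto simp only: greaterThanAtMost_iff)
      then show "s \<in> {-1..real T}" using \<open>q \<le> 1\<close> \<open>q \<ge> 0\<close> by auto
    qed
    then have "indicator {- 1 / 2 ^ n<..(real (T * 2 ^ n) - 1) / 2 ^ n} s \<le> (indicator {-1..real T} s :: ennreal)"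
      by (auto simp: indicator_def)
    then show "(\<Sum>i<T * 2 ^ n. ennreal (norm (f s - g s)) * indicator (?J i) s) \<le> ennreal (norm (f s - g s)) * indicator {-1..real T} s"
      by (simp only: sum_distrib_left[symmetric] sum_dyadic_indicator mult_left_mono zero_le)
  qed
  finally show ?thesis .
qed

text \<open>The averaging window and the point of use lie within 2 / 2^n of each other, so uniform
  continuity on [-1, T] suffices; -1 again leaves room for the delay.\<close>

lemma avg_step_continuous:
  fixes g :: "real \<Rightarrow> 'b::euclidean_space"
  assumes g: "continuous_on UNIV g" and e: "e > 0"
  shows "\<forall>\<^sub>F n in sequentially. \<forall>s\<in>{0<..real T}. norm (avg_step n T g s - g s) \<le> e"
proof -
  have "uniformly_continuous_on {-1..real T} g"
    by (intro compact_uniformly_continuous continuous_on_subset[OF g]) auto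
  then obtain d where d: "d > 0" and dd: "\<And>r s. r \<in> {-1..real T} \<Longrightarrow> s \<in> {-1..real T} \<Longrightarrow> \<bar>r - s\<bar> < d \<Longrightarrow> norm (g r - g s) < e"
    unfolding uniformly_continuous_on_def using e by (metis dist_norm real_norm_def)
  have "(\<lambda>n. 2 / 2 ^ n :: real) \<longlonglongrightarrow> 0" by (rule LIMSEQ_divide_realpow_zero) simp
  then have "\<forall>\<^sub>F n in sequentially. 2 / 2 ^ n < d" by (rule order_tendstoD) (rule d)
  then show ?thesis
  proof eventually_elim
    case (elim n)
    show ?case
    proof
      fix s assume "s \<in> {0<..real T}"
      then have s: "0 < s" "s \<le> real T" by auto
      then obtain i where i: "i < T * 2 ^ n" "real i / 2 ^ n < s" "s \<le> real (Suc i) / 2 ^ n"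
        using dyadic_cell_exists by metis
      let ?J = "{(real i - 1) / 2 ^ n<..real i / 2 ^ n}"
      have mJ: "measure lborel ?J = 1 / 2 ^ n"
        by (subst measure_lborel_Ioc) (auto simp: divide_right_mono diff_divide_distrib[symmetric])
      have fin: "emeasure lborel ?J < \<infinity>" by (rule emeasure_Ioc_finite)
      have ic: "integrable lborel (\<lambda>r. indicator ?J r *\<^sub>R g s)"
        by (intro integrable_scaleR_left integrable_real_indicator fin) simp
      have "(\<integral>r. indicator ?J r *\<^sub>R g s \<partial>lborel) = (1 / 2 ^ n) *\<^sub>R g s"
        using fin by (simp add: mJ)
      then have "delayed_avg n i g - g s = 2 ^ n *\<^sub>R ((\<integral>r. indicator ?J r *\<^sub>R g r \<partial>lborel) - (\<integral>r. indicator ?J r *\<^sub>R g s \<partial>lborel))"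
        by (simp add: delayed_avg_def scaleR_diff_right)
      also have "\<dots> = 2 ^ n *\<^sub>R (\<integral>r. indicator ?J r *\<^sub>R g r - indicator ?J r *\<^sub>R g s \<partial>lborel)"
        by (subst Bochner_Integration.integral_diff[OF integrable_indicator_continuous[OF g] ic]) simp
      finally have "norm (delayed_avg n i g - g s) = 2 ^ n * norm (\<integral>r. indicator ?J r *\<^sub>R g r - indicator ?J r *\<^sub>R g s \<partial>lborel)"
        by simp
      also have "\<dots> \<le> 2 ^ n * (\<integral>r. e * indicator ?J r \<partial>lborel)"
      proof (rule mult_left_mono, rule order_trans[OF Bochner_Integration.integral_norm_bound], rule integral_mono)
        show "integrable lborel (\<lambda>r. norm (indicator ?J r *\<^sub>R g r - indicator ?J r *\<^sub>R g s))"
          by (rule integrable_norm, rule Bochner_Integration.integrable_diff[OF integrable_indicator_continuous[OF g] ic])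
        show "integrable lborel (\<lambda>r. e * indicator ?J r)" using fin by (intro integrable_mult_right integrable_real_indicator) auto
        fix r :: real
        show "norm (indicator ?J r *\<^sub>R g r - indicator ?J r *\<^sub>R g s) \<le> e * indicator ?J r"
        proof (cases "r \<in> ?J")
          case True
          define q x :: real where "q = 1 / 2 ^ n" and "x = real i / 2 ^ n"
          have a: "(real i - 1) / 2 ^ n = x - q" "real (Suc i) / 2 ^ n = x + q" "2 / 2 ^ n = 2 * q"
            by (simp_all add: q_def x_def diff_divide_distrib add_divide_distrib)
          have b: "q \<le> 1" "0 \<le> x" by (simp_all add: q_def x_def)
          have "x - q < r" "r \<le> x" using True unfolding a x_def[symmetric] by auto
          moreover have "x < s" "s \<le> x + q" "2 * q < d"
            using i(2,3) elim unfolding a x_def[symmetric] by auto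
          ultimately have "r \<in> {-1..real T}" "\<bar>r - s\<bar> < d" using s b by auto
          then have "norm (g r - g s) < e" using s by (intro dd) auto
          then show ?thesis using True by simp
        qed simp
      qed simp
      also have "\<dots> = e" using fin by (simp add: mJ)
      finally show "norm (avg_step n T g s - g s) \<le> e" by (simp add: avg_step_eq[OF i])
    qed
  qed
qed

lemma avg_step_measurable [measurable]: "avg_step n T f \<in> borel_measurable borel"
  unfolding avg_step_def by measurable

theorem avg_step_L1:
  fixes f :: "real \<Rightarrow> 'b::euclidean_space"
  assumes f[measurable]: "f \<in> borel_measurable borel" and R: "\<And>s. norm (f s) \<le> R"
  shows "(\<lambda>n. \<integral>\<^sup>+s. ennreal (norm (avg_step n T f s - f s)) * indicator {0<..real T} s \<partial>lborel) \<longlonglongrightarrow> 0"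
proof (rule ennreal_tendsto_0I)
  fix e :: real assume e: "e > 0"
  \<comment> \<open>The budget: two L1 errors of size \<open>e'\<close>, one for the function and
    one for its average, plus a uniform error \<open>e'\<close> over an interval of length
    \<open>T\<close>.\<close>
  define e' where "e' = e / (2 + real T)"
  have e': "e' > 0" using e by (simp add: e'_def)
  have R': "max R 1 > 0" "\<And>s. norm (f s) \<le> max R 1" using R by (auto simp: le_max_iff_disj)
  obtain g where gc: "continuous_on UNIV g"
    and g: "(\<integral>\<^sup>+s. ennreal (norm (f s - g s)) * indicator {-1..real T} s \<partial>lborel) < ennreal e'"
    using L1_approx_continuous[OF f R' e'] by blast
  have gm[measurable]: "g \<in> borel_measurable borel" by (rule borel_measurable_continuous_onI[OF gc])
  from avg_step_continuous[OF gc e', of T]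
  show "\<forall>\<^sub>F n in sequentially. (\<integral>\<^sup>+s. ennreal (norm (avg_step n T f s - f s)) * indicator {0<..real T} s \<partial>lborel) \<le> ennreal e"
  proof eventually_elim
    case (elim n)
    let ?i = "\<lambda>s. indicator {0<..real T} s :: ennreal"
    have "(\<integral>\<^sup>+s. ennreal (norm (avg_step n T f s - f s)) * ?i s \<partial>lborel)
      \<le> (\<integral>\<^sup>+s. (ennreal (norm (avg_step n T f s - avg_step n T g s)) * ?i s + ennreal e' * ?i s) + ennreal (norm (f s - g s)) * indicator {-1..real T} s \<partial>lborel)"
    proof (rule nn_integral_mono)
      fix s
      show "ennreal (norm (avg_step n T f s - f s)) * ?i s \<le> (ennreal (norm (avg_step n T f s - avg_step n T g s)) * ?i s + ennreal e' * ?i s) + ennreal (norm (f s - g s)) * indicator {-1..real T} s"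
      proof (cases "s \<in> {0<..real T}")
        case True
        have "norm (avg_step n T f s - f s) \<le> norm (avg_step n T f s - avg_step n T g s) + e' + norm (f s - g s)"
          using elim[rule_format, OF True] norm_triangle_ineq[of "avg_step n T f s - avg_step n T g s" "avg_step n T g s - g s"]
            norm_triangle_ineq4[of "avg_step n T f s - g s" "f s - g s"] by (simp add: algebra_simps)
        then have "ennreal (norm (avg_step n T f s - f s)) \<le> ennreal (norm (avg_step n T f s - avg_step n T g s)) + ennreal e' + ennreal (norm (f s - g s))"
          using e' by (simp add: ennreal_plus[symmetric] ennreal_leI del: ennreal_plus)
        then show ?thesis using True by simp
      qed simp
    qed
    also have "\<dots> = (\<integral>\<^sup>+s. ennreal (norm (avg_step n T f s - avg_step n T g s)) * ?i s \<partial>lborel) + ennreal e' * emeasure lborel {0<..real T}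
        + (\<integral>\<^sup>+s. ennreal (norm (f s - g s)) * indicator {-1..real T} s \<partial>lborel)"
      by (simp add: nn_integral_add nn_integral_cmult_indicator)
    also have "\<dots> \<le> ennreal e' + ennreal e' * ennreal (real T) + ennreal e'"
    proof (intro add_mono)
      have "(\<integral>\<^sup>+s. ennreal (norm (avg_step n T f s - avg_step n T g s)) * ?i s \<partial>lborel) \<le> (\<integral>\<^sup>+s. ennreal (norm (f s - g s)) * indicator {-1..real T} s \<partial>lborel)"
        by (rule avg_step_contraction[OF f gm integrable_indicator_bounded[OF f R] integrable_indicator_continuous[OF gc]])
      then show "(\<integral>\<^sup>+s. ennreal (norm (avg_step n T f s - avg_step n T g s)) * ?i s \<partial>lborel) \<le> ennreal e'" using g by simp
    qed (use g in auto)
    also have "\<dots> = ennreal (e' + e' * real T + e')"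
      using e' by (simp add: ennreal_mult[symmetric] ennreal_plus[symmetric] del: ennreal_plus)
    also have "e' + e' * real T + e' = e' * (2 + real T)" by (simp add: algebra_simps)
    also have "\<dots> = e" by (simp add: e'_def add_pos_nonneg)
    finally show ?case .
  qed
qed

lemma delayed_avg_bound:
  fixes f :: "real \<Rightarrow> 'b::euclidean_space"
  assumes [measurable]: "f \<in> borel_measurable borel" and R: "\<And>s. norm (f s) \<le> R"
  shows "norm (delayed_avg n i f) \<le> R"
proof -
  let ?J = "{(real i - 1) / 2 ^ n<..real i / 2 ^ n}"
  have mJ: "measure lborel ?J = 1 / 2 ^ n"
    by (subst measure_lborel_Ioc) (auto simp: divide_right_mono diff_divide_distrib[symmetric])
  have "norm (\<integral>s. indicator ?J s *\<^sub>R f s \<partial>lborel) \<le> (\<integral>s. R * indicator ?J s \<partial>lborel)"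
  proof (rule order_trans[OF Bochner_Integration.integral_norm_bound], rule integral_mono)
    show "integrable lborel (\<lambda>s. norm (indicator ?J s *\<^sub>R f s))"
      by (rule integrable_norm, rule integrable_indicator_bounded[OF _ R]) simp
    show "integrable lborel (\<lambda>s. R * indicator ?J s)"
      by (intro integrable_mult_right integrable_real_indicator emeasure_Ioc_finite) simp
    show "norm (indicator ?J s *\<^sub>R f s) \<le> R * indicator ?J s" for s
      using R[of s] by (simp add: indicator_def)
  qed
  also have "\<dots> = R * (1 / 2 ^ n)" using emeasure_Ioc_finite by (simp add: mJ)
  finally show ?thesis by (simp add: delayed_avg_def field_simps)
qed

section \<open>Simple approximation of a progressive integrand\<close>

locale stoch_integrand = brownian_basis M F B
  for M :: "'a measure" and F and B :: "'a \<Rightarrow> real \<Rightarrow> real ^ 'l" +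
  fixes H :: "'a \<Rightarrow> real \<Rightarrow> real ^ 'l ^ 'd"
  assumes prog: "progressive F H"
    and square_fin: "(\<integral>\<^sup>+ \<omega>. (\<integral>\<^sup>+ t. ennreal ((norm (H \<omega> t))\<^sup>2) * indicator {0..} t \<partial>lborel) \<partial>M) < \<infinity>"
begin

text \<open>Progressive measurability says nothing about negative times, yet the first averaging
  window lies there, so the integrand is extended by 0. At nonnegative times it can differ from
  \<open>H\<close> only at time 0, which has measure zero.\<close>

definition H_pos :: "'a \<Rightarrow> real \<Rightarrow> real ^ 'l ^ 'd" where
  "H_pos \<omega> s = (if 0 < s then H \<omega> s else 0)"

text \<open>Truncation in time and size gives bounded paths with support in a bounded interval, to
  which the L1 theorem for averages applies.\<close>

definition H_trunc :: "nat \<Rightarrow> 'a \<Rightarrow> real \<Rightarrow> real ^ 'l ^ 'd" where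
  "H_trunc k \<omega> s = (if 0 < s \<and> s \<le> real k \<and> norm (H \<omega> s) \<le> real k then H \<omega> s else 0)"

lemma H_cut_measurable_F:
  assumes T: "T \<ge> 0"
  shows "(\<lambda>(\<omega>, s). if 0 < s \<and> s \<le> T then H \<omega> s else 0) \<in> borel_measurable (F T \<Otimes>\<^sub>M borel)"
proof -
  \<comment> \<open>Clamping the time to [0, T] maps the whole line into the restricted space on
    which progressive measurability is stated; the cutoff afterwards removes the clamped
    values.\<close>
  have c: "(\<lambda>p. (fst p, max 0 (min T (snd p)))) \<in> measurable (F T \<Otimes>\<^sub>M borel) (F T \<Otimes>\<^sub>M restrict_space borel {0..T})"
    by (intro measurable_Pair measurable_restrict_space2) (use T in auto)
  have "(\<lambda>(\<omega>, s). H \<omega> s) \<in> borel_measurable (F T \<Otimes>\<^sub>M restrict_space borel {0..T})"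
    using prog T unfolding progressive_def by blast
  from measurable_compose[OF c this]
  have [measurable]: "(\<lambda>p. H (fst p) (max 0 (min T (snd p)))) \<in> borel_measurable (F T \<Otimes>\<^sub>M borel)" by simp
  have "(\<lambda>(\<omega>, s). if 0 < s \<and> s \<le> T then H \<omega> s else 0) = (\<lambda>p. if 0 < snd p \<and> snd p \<le> T then H (fst p) (max 0 (min T (snd p))) else 0)"
    by (auto simp: fun_eq_iff)
  also have "\<dots> \<in> borel_measurable (F T \<Otimes>\<^sub>M borel)" by measurable
  finally show ?thesis .
qed

lemma measurable_FM:
  assumes T: "T \<ge> 0" and f: "f \<in> measurable (F T \<Otimes>\<^sub>M borel) N"
  shows "f \<in> measurable (M \<Otimes>\<^sub>M borel) N"
proof -
  have id: "(\<lambda>\<omega>. \<omega>) \<in> measurable M (F T)"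
    using filtration_subalgebra[OF T] by (intro measurableI) (auto simp: subalgebra_def dest: sets.sets_into_space)
  have "(\<lambda>p. (fst p, snd p)) \<in> measurable (M \<Otimes>\<^sub>M borel) (F T \<Otimes>\<^sub>M borel)"
    by (intro measurable_Pair measurable_compose[OF measurable_fst id] measurable_snd)
  from measurable_compose[OF this f] show ?thesis by simp
qed

lemma H_pos_measurable [measurable]: "(\<lambda>(\<omega>, s). H_pos \<omega> s) \<in> borel_measurable (M \<Otimes>\<^sub>M borel)"
proof (rule borel_measurable_LIMSEQ_metric)
  show "(\<lambda>(\<omega>, s). if 0 < s \<and> s \<le> real n then H \<omega> s else 0) \<in> borel_measurable (M \<Otimes>\<^sub>M borel)" for n :: nat
    by (rule measurable_FM[OF _ H_cut_measurable_F]) auto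
  fix p :: "'a \<times> real"
  obtain \<omega> s where p: "p = (\<omega>, s)" by (cases p)
  have "\<forall>\<^sub>F n in sequentially. s \<le> real n"
    using filterlim_real_sequentially filterlim_at_top by blast
  then have "\<forall>\<^sub>F n in sequentially. (case p of (\<omega>, s) \<Rightarrow> if 0 < s \<and> s \<le> real n then H \<omega> s else 0) = (case p of (\<omega>, s) \<Rightarrow> H_pos \<omega> s)"
    by eventually_elim (auto simp: p H_pos_def)
  then show "(\<lambda>n. case p of (\<omega>, s) \<Rightarrow> if 0 < s \<and> s \<le> real n then H \<omega> s else 0) \<longlonglongrightarrow> (case p of (\<omega>, s) \<Rightarrow> H_pos \<omega> s)"
    by (rule tendsto_eventually)
qed

lemma H_trunc_cut_measurable:
  assumes T: "T \<ge> 0"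
  shows "(\<lambda>(\<omega>, s). if s \<le> T then H_trunc k \<omega> s else 0) \<in> borel_measurable (F T \<Otimes>\<^sub>M borel)"
proof -
  define G where "G = (\<lambda>(\<omega>, s). if 0 < s \<and> s \<le> T then H \<omega> s else 0)"
  have [measurable]: "G \<in> borel_measurable (F T \<Otimes>\<^sub>M borel)" unfolding G_def by (rule H_cut_measurable_F[OF T])
  have "(\<lambda>(\<omega>, s). if s \<le> T then H_trunc k \<omega> s else 0) = (\<lambda>p. if snd p \<le> real k \<and> norm (G p) \<le> real k then G p else 0)"
    by (auto simp: fun_eq_iff G_def H_trunc_def)
  also have "\<dots> \<in> borel_measurable (F T \<Otimes>\<^sub>M borel)" by measurable
  finally show ?thesis .
qed

lemma H_trunc_measurable [measurable]: "(\<lambda>(\<omega>, s). H_trunc k \<omega> s) \<in> borel_measurable (M \<Otimes>\<^sub>M borel)"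
proof -
  have "(\<lambda>(\<omega>, s). H_trunc k \<omega> s) = (\<lambda>p. if snd p \<le> real k \<and> norm (case p of (\<omega>, s) \<Rightarrow> H_pos \<omega> s) \<le> real k then (case p of (\<omega>, s) \<Rightarrow> H_pos \<omega> s) else 0)"
    by (auto simp: fun_eq_iff H_pos_def H_trunc_def)
  also have "\<dots> \<in> borel_measurable (M \<Otimes>\<^sub>M borel)" by measurable
  finally show ?thesis .
qed

lemma section_measurable:
  assumes "(\<lambda>(\<omega>, s). f \<omega> s) \<in> borel_measurable (M \<Otimes>\<^sub>M borel)" "\<omega> \<in> space M"
  shows "f \<omega> \<in> borel_measurable borel"
  using measurable_compose[OF measurable_Pair1'[OF assms(2)] assms(1)] by simp

lemma H_trunc_bound: "norm (H_trunc k \<omega> s) \<le> real k" by (simp add: H_trunc_def)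

text \<open>The window ends at i / 2^n, so only values of the integrand up to that time enter.
  Cutting the integrand off there leaves the integral unchanged and makes it jointly measurable for
  the \<sigma>-algebra of that time.\<close>

lemma delayed_avg_H_measurable: "(\<lambda>\<omega>. delayed_avg n i (H_trunc k \<omega>)) \<in> borel_measurable (F (real i / 2 ^ n))"
proof -
  let ?J = "{(real i - 1) / 2 ^ n<..real i / 2 ^ n}"
  have T: "real i / 2 ^ n \<ge> 0" by simp
  note [measurable] = H_trunc_cut_measurable[OF T, of k]
  have "(\<lambda>(\<omega>, s). indicator ?J s *\<^sub>R (if s \<le> real i / 2 ^ n then H_trunc k \<omega> s else 0)) =
    (\<lambda>p. indicator ?J (snd p) *\<^sub>R (case p of (\<omega>, s) \<Rightarrow> (if s \<le> real i / 2 ^ n then H_trunc k \<omega> s else 0)))"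
    by (auto simp: fun_eq_iff)
  also have "\<dots> \<in> borel_measurable (F (real i / 2 ^ n) \<Otimes>\<^sub>M borel)" by measurable
  finally have "(\<lambda>(\<omega>, s). indicator ?J s *\<^sub>R (if s \<le> real i / 2 ^ n then H_trunc k \<omega> s else 0)) \<in> borel_measurable (F (real i / 2 ^ n) \<Otimes>\<^sub>M lborel)"
    by (simp cong: measurable_cong_sets sets_pair_measure_cong)
  then have "(\<lambda>\<omega>. \<integral>s. indicator ?J s *\<^sub>R (if s \<le> real i / 2 ^ n then H_trunc k \<omega> s else 0) \<partial>lborel) \<in> borel_measurable (F (real i / 2 ^ n))"
    by (rule lborel.borel_measurable_lebesgue_integral)
  moreover have "(\<integral>s. indicator ?J s *\<^sub>R (if s \<le> real i / 2 ^ n then H_trunc k \<omega> s else 0) \<partial>lborel) = (\<integral>s. indicator ?J s *\<^sub>R H_trunc k \<omega> s \<partial>lborel)" for \<omega>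
    by (rule Bochner_Integration.integral_cong) (auto simp: indicator_def)
  ultimately show ?thesis unfolding delayed_avg_def by simp
qed

lemma delayed_avg_simple: "simple_pred M F (\<lambda>i. real i / 2 ^ n) m (\<lambda>i \<omega>. delayed_avg n i (H_trunc k \<omega>))"
  unfolding simple_pred_def
proof (intro conjI allI impI)
  fix i :: nat
  show "real i / 2 ^ n < real (Suc i) / 2 ^ n" by (simp add: divide_strict_right_mono)
  show "(\<lambda>\<omega>. delayed_avg n i (H_trunc k \<omega>)) \<in> borel_measurable (F (real i / 2 ^ n))"
    by (rule delayed_avg_H_measurable)
  show "\<exists>C. \<forall>\<omega>\<in>space M. norm (delayed_avg n i (H_trunc k \<omega>)) \<le> C"
    using delayed_avg_bound[OF section_measurable[OF H_trunc_measurable] H_trunc_bound] by blast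
qed simp

lemma simple_integrand_avg:
  "simple_integrand (\<lambda>i. real i / 2 ^ n) (T * 2 ^ n) (\<lambda>i \<omega>. delayed_avg n i (H_trunc k \<omega>)) \<omega> s = avg_step n T (H_trunc k \<omega>) s"
  by (simp add: simple_integrand_def avg_step_def)

lemma avg_step_H_measurable [measurable]: "(\<lambda>(\<omega>, s). avg_step n T (H_trunc k \<omega>) s) \<in> borel_measurable (M \<Otimes>\<^sub>M borel)"
proof -
  have [measurable]: "(\<lambda>\<omega>. delayed_avg n i (H_trunc k \<omega>)) \<in> borel_measurable M" for i
    by (rule measurable_from_subalg[OF filtration_subalgebra delayed_avg_H_measurable]) simp
  show ?thesis unfolding avg_step_def by measurable
qed

lemma avg_step_H_bound: "\<omega> \<in> space M \<Longrightarrow> norm (avg_step n T (H_trunc k \<omega>) s) \<le> real k"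
proof -
  assume \<omega>: "\<omega> \<in> space M"
  show ?thesis
  proof (cases "\<exists>i<T * 2 ^ n. real i / 2 ^ n < s \<and> s \<le> real (Suc i) / 2 ^ n")
    case True
    then obtain i where i: "i < T * 2 ^ n" "real i / 2 ^ n < s" "s \<le> real (Suc i) / 2 ^ n" by blast
    show ?thesis unfolding avg_step_eq[OF i]
      by (rule delayed_avg_bound[OF section_measurable[OF H_trunc_measurable \<omega>] H_trunc_bound])
  next
    case False
    then have "avg_step n T (H_trunc k \<omega>) s = 0" unfolding avg_step_def by (intro sum.neutral) auto
    then show ?thesis by simp
  qed
qed

text \<open>Both functions are bounded by \<open>k\<close>, so the squared error is at most 2 k
  times the L1 error and tends to 0 on every path; the same bound dominates the integral over the
  probability space.\<close>

lemma avg_step_H_L2: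
  "(\<lambda>n. \<integral>\<^sup>+\<omega>. (\<integral>\<^sup>+s. ennreal ((norm (avg_step n k (H_trunc k \<omega>) s - H_trunc k \<omega> s))\<^sup>2) * indicator {0<..real k} s \<partial>lborel) \<partial>M) \<longlonglongrightarrow> 0"
proof -
  define D where "D n \<omega> = (\<integral>\<^sup>+s. ennreal ((norm (avg_step n k (H_trunc k \<omega>) s - H_trunc k \<omega> s))\<^sup>2) * indicator {0<..real k} s \<partial>lborel)" for n \<omega>
  have meas: "D n \<in> borel_measurable M" for n
  proof -
    have "(\<lambda>p. ennreal ((norm ((case p of (\<omega>, s) \<Rightarrow> avg_step n k (H_trunc k \<omega>) s) - (case p of (\<omega>, s) \<Rightarrow> H_trunc k \<omega> s)))\<^sup>2) * indicator {0<..real k} (snd p)) \<in> borel_measurable (M \<Otimes>\<^sub>M borel)"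
      by measurable
    then have "(\<lambda>(\<omega>, s). ennreal ((norm (avg_step n k (H_trunc k \<omega>) s - H_trunc k \<omega> s))\<^sup>2) * indicator {0<..real k} s) \<in> borel_measurable (M \<Otimes>\<^sub>M lborel)"
      by (simp add: case_prod_beta' cong: measurable_cong_sets sets_pair_measure_cong)
    then show ?thesis unfolding D_def by (rule lborel.borel_measurable_nn_integral)
  qed
  have two: "norm (avg_step n k (H_trunc k \<omega>) s - H_trunc k \<omega> s) \<le> 2 * real k" if "\<omega> \<in> space M" for n \<omega> s
    using norm_triangle_ineq4[of "avg_step n k (H_trunc k \<omega>) s" "H_trunc k \<omega> s"] avg_step_H_bound[OF that, of n k k s] H_trunc_bound[of k \<omega> s] by linarith
  have bound: "D n \<omega> \<le> ennreal ((2 * real k)\<^sup>2 * real k)" if "\<omega> \<in> space M" for n \<omega>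
  proof -
    have "D n \<omega> \<le> (\<integral>\<^sup>+s. ennreal ((2 * real k)\<^sup>2) * indicator {0<..real k} s \<partial>lborel)"
      unfolding D_def by (intro nn_integral_mono mult_right_mono ennreal_leI power_mono two that) auto
    also have "\<dots> = ennreal ((2 * real k)\<^sup>2 * real k)" by (simp add: nn_integral_cmult_indicator ennreal_mult)
    finally show ?thesis .
  qed
  have lim: "(\<lambda>n. D n \<omega>) \<longlonglongrightarrow> 0" if \<omega>: "\<omega> \<in> space M" for \<omega>
  proof -
    define L where "L n = (\<integral>\<^sup>+s. ennreal (norm (avg_step n k (H_trunc k \<omega>) s - H_trunc k \<omega> s)) * indicator {0<..real k} s \<partial>lborel)" for n
    have sm[measurable]: "H_trunc k \<omega> \<in> borel_measurable borel" by (rule section_measurable[OF H_trunc_measurable \<omega>])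
    have L0: "L \<longlonglongrightarrow> 0" unfolding L_def[abs_def] by (rule avg_step_L1[OF sm H_trunc_bound])
    have le: "D n \<omega> \<le> ennreal (2 * real k) * L n" for n
    proof -
      have "D n \<omega> \<le> (\<integral>\<^sup>+s. ennreal (2 * real k) * (ennreal (norm (avg_step n k (H_trunc k \<omega>) s - H_trunc k \<omega> s)) * indicator {0<..real k} s) \<partial>lborel)"
        unfolding D_def mult.assoc[symmetric]
      proof (intro nn_integral_mono mult_right_mono)
        fix s
        have "(norm (avg_step n k (H_trunc k \<omega>) s - H_trunc k \<omega> s))\<^sup>2 \<le> (2 * real k) * norm (avg_step n k (H_trunc k \<omega>) s - H_trunc k \<omega> s)"
          unfolding power2_eq_square by (intro mult_right_mono two \<omega>) simp
        then show "ennreal ((norm (avg_step n k (H_trunc k \<omega>) s - H_trunc k \<omega> s))\<^sup>2) \<le> ennreal (2 * real k) * ennreal (norm (avg_step n k (H_trunc k \<omega>) s - H_trunc k \<omega> s))"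
          by (simp add: ennreal_mult[symmetric] ennreal_leI)
      qed simp
      also have "\<dots> = ennreal (2 * real k) * L n" unfolding L_def by (rule nn_integral_cmult) measurable
      finally show ?thesis .
    qed
    have "(\<lambda>n. ennreal (2 * real k) * L n) \<longlonglongrightarrow> ennreal (2 * real k) * 0"
      by (intro tendsto_mult_ennreal L0 tendsto_const) auto
    then have "(\<lambda>n. ennreal (2 * real k) * L n) \<longlonglongrightarrow> 0" by simp
    then show ?thesis by (rule tendsto_sandwich[OF _ _ tendsto_const, rotated 2]) (use le in auto)
  qed
  have "(\<lambda>n. \<integral>\<^sup>+\<omega>. D n \<omega> \<partial>M) \<longlonglongrightarrow> (\<integral>\<^sup>+\<omega>. 0 \<partial>M)"
    by (rule nn_integral_dominated_convergence[where w="\<lambda>_. ennreal ((2 * real k)\<^sup>2 * real k)"])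
      (use meas bound lim emeasure_space_1 in \<open>auto simp: ennreal_mult_less_top\<close>)
  then show ?thesis by (simp add: D_def)
qed

lemma H_pos_square_fin: "(\<integral>\<^sup>+p. ennreal ((norm (case p of (\<omega>, s) \<Rightarrow> H_pos \<omega> s))\<^sup>2) \<partial>(M \<Otimes>\<^sub>M lborel)) < \<infinity>"
proof -
  have [measurable]: "(\<lambda>(\<omega>, s). H_pos \<omega> s) \<in> borel_measurable (M \<Otimes>\<^sub>M lborel)"
    using H_pos_measurable by (simp cong: measurable_cong_sets sets_pair_measure_cong)
  have "(\<integral>\<^sup>+p. ennreal ((norm (case p of (\<omega>, s) \<Rightarrow> H_pos \<omega> s))\<^sup>2) \<partial>(M \<Otimes>\<^sub>M lborel)) = (\<integral>\<^sup>+\<omega>. \<integral>\<^sup>+s. ennreal ((norm (H_pos \<omega> s))\<^sup>2) \<partial>lborel \<partial>M)"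
    by (subst lborel.nn_integral_fst[symmetric]) auto
  also have "\<dots> \<le> (\<integral>\<^sup>+ \<omega>. (\<integral>\<^sup>+ t. ennreal ((norm (H \<omega> t))\<^sup>2) * indicator {0..} t \<partial>lborel) \<partial>M)"
    by (intro nn_integral_mono) (auto simp: H_pos_def)
  also note square_fin
  finally show ?thesis .
qed

text \<open>The difference is either 0 or \<open>H_pos\<close> itself, so on the product space the
  square of \<open>H_pos\<close> is a dominating function.\<close>

lemma H_trunc_L2:
  "(\<lambda>k. \<integral>\<^sup>+\<omega>. (\<integral>\<^sup>+s. ennreal ((norm (H_trunc k \<omega> s - H_pos \<omega> s))\<^sup>2) \<partial>lborel) \<partial>M) \<longlonglongrightarrow> 0"
proof -
  have m1[measurable]: "(\<lambda>(\<omega>, s). H_pos \<omega> s) \<in> borel_measurable (M \<Otimes>\<^sub>M lborel)"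
    using H_pos_measurable by (simp cong: measurable_cong_sets sets_pair_measure_cong)
  have m2[measurable]: "(\<lambda>(\<omega>, s). H_trunc k \<omega> s) \<in> borel_measurable (M \<Otimes>\<^sub>M lborel)" for k
    using H_trunc_measurable by (simp cong: measurable_cong_sets sets_pair_measure_cong)
  define d where "d k p = ennreal ((norm ((case p of (\<omega>, s) \<Rightarrow> H_trunc k \<omega> s) - (case p of (\<omega>, s) \<Rightarrow> H_pos \<omega> s)))\<^sup>2)" for k p
  have [measurable]: "d k \<in> borel_measurable (M \<Otimes>\<^sub>M lborel)" for k unfolding d_def[abs_def] by measurable
  have "(\<lambda>k. \<integral>\<^sup>+p. d k p \<partial>(M \<Otimes>\<^sub>M lborel)) \<longlonglongrightarrow> (\<integral>\<^sup>+p. 0 \<partial>(M \<Otimes>\<^sub>M (lborel :: real measure)))"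
  proof (rule nn_integral_dominated_convergence[where w="\<lambda>p. ennreal ((norm (case p of (\<omega>, s) \<Rightarrow> H_pos \<omega> s))\<^sup>2)"])
    show "AE p in M \<Otimes>\<^sub>M lborel. d k p \<le> ennreal ((norm (case p of (\<omega>, s) \<Rightarrow> H_pos \<omega> s))\<^sup>2)" for k
      by (rule AE_I2) (auto simp: d_def H_trunc_def H_pos_def)
    show "AE p in M \<Otimes>\<^sub>M lborel. (\<lambda>k. d k p) \<longlonglongrightarrow> 0"
    proof (rule AE_I2)
      fix p :: "'a \<times> real"
      obtain \<omega> s where p: "p = (\<omega>, s)" by (cases p)
      have "\<forall>\<^sub>F k in sequentially. max s (norm (H \<omega> s)) \<le> real k"
        using filterlim_real_sequentially filterlim_at_top by blast
      then have "\<forall>\<^sub>F k in sequentially. d k p = 0"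
        by eventually_elim (auto simp: d_def p H_trunc_def H_pos_def)
      then show "(\<lambda>k. d k p) \<longlonglongrightarrow> 0" by (rule tendsto_eventually)
    qed
  qed (use H_pos_square_fin in auto)
  moreover have "(\<integral>\<^sup>+p. d k p \<partial>(M \<Otimes>\<^sub>M lborel)) = (\<integral>\<^sup>+\<omega>. (\<integral>\<^sup>+s. ennreal ((norm (H_trunc k \<omega> s - H_pos \<omega> s))\<^sup>2) \<partial>lborel) \<partial>M)" for k
    by (subst lborel.nn_integral_fst[symmetric]) (auto simp: d_def)
  ultimately show ?thesis by simp
qed

theorem simple_approximation:
  "\<exists>ts n \<xi>. (\<forall>k. simple_pred M F (ts k) (n k) (\<xi> k)) \<and>
    (\<forall>k. (\<lambda>(\<omega>, s). simple_integrand (ts k) (n k) (\<xi> k) \<omega> s) \<in> borel_measurable (M \<Otimes>\<^sub>M borel)) \<and>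
    (\<forall>T. (\<lambda>k. \<integral>\<^sup>+\<omega>. (\<integral>\<^sup>+s. ennreal ((norm (simple_integrand (ts k) (n k) (\<xi> k) \<omega> s - H_pos \<omega> s))\<^sup>2) * indicator {0<..T} s \<partial>lborel) \<partial>M) \<longlonglongrightarrow> 0)"
proof -
  define E where "E n k = (\<integral>\<^sup>+\<omega>. (\<integral>\<^sup>+s. ennreal ((norm (avg_step n k (H_trunc k \<omega>) s - H_trunc k \<omega> s))\<^sup>2) * indicator {0<..real k} s \<partial>lborel) \<partial>M)" for n k
  define E' where "E' k = (\<integral>\<^sup>+\<omega>. (\<integral>\<^sup>+s. ennreal ((norm (H_trunc k \<omega> s - H_pos \<omega> s))\<^sup>2) \<partial>lborel) \<partial>M)" for k
  \<comment> \<open>Diagonal choice: for truncation level \<open>k\<close> the dyadic level is taken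
    so fine that averaging adds an error below 1 / (k + 1).\<close>
  have "\<exists>n. E n k < ennreal (1 / real (Suc k))" for k
  proof -
    have "(\<lambda>n. E n k) \<longlonglongrightarrow> 0" unfolding E_def by (rule avg_step_H_L2)
    from ennreal_tendsto_0D[OF this, of "1 / real (Suc k)"] show ?thesis by (auto simp: eventually_sequentially)
  qed
  then obtain m where m: "\<And>k. E (m k) k < ennreal (1 / real (Suc k))" by metis
  define ts where "ts k i = real i / 2 ^ m k" for k i :: nat
  define n where "n k = k * 2 ^ m k" for k
  define \<xi> where "\<xi> k i \<omega> = delayed_avg (m k) i (H_trunc k \<omega>)" for k i \<omega>
  have si: "simple_integrand (ts k) (n k) (\<xi> k) \<omega> s = avg_step (m k) k (H_trunc k \<omega>) s" for k \<omega> s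
    using simple_integrand_avg[of "m k" k k \<omega> s] unfolding ts_def n_def \<xi>_def by simp
  have lim: "(\<lambda>k. \<integral>\<^sup>+\<omega>. (\<integral>\<^sup>+s. ennreal ((norm (avg_step (m k) k (H_trunc k \<omega>) s - H_pos \<omega> s))\<^sup>2) * indicator {0<..T} s \<partial>lborel) \<partial>M) \<longlonglongrightarrow> 0" for T
  proof -
    define Q where "Q k = (\<integral>\<^sup>+\<omega>. (\<integral>\<^sup>+s. ennreal ((norm (avg_step (m k) k (H_trunc k \<omega>) s - H_pos \<omega> s))\<^sup>2) * indicator {0<..T} s \<partial>lborel) \<partial>M)" for k
    have bound: "Q k \<le> 2 * E (m k) k + 2 * E' k" if k: "T \<le> real k" for k
    proof -
      have m1: "(\<lambda>p. ennreal ((norm ((case p of (\<omega>, s) \<Rightarrow> avg_step (m k) k (H_trunc k \<omega>) s) - (case p of (\<omega>, s) \<Rightarrow> H_trunc k \<omega> s)))\<^sup>2) * indicator {0<..real k} (snd p)) \<in> borel_measurable (M \<Otimes>\<^sub>M borel)"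
        by measurable
      have m2: "(\<lambda>p. ennreal ((norm ((case p of (\<omega>, s) \<Rightarrow> H_trunc k \<omega> s) - (case p of (\<omega>, s) \<Rightarrow> H_pos \<omega> s)))\<^sup>2)) \<in> borel_measurable (M \<Otimes>\<^sub>M borel)"
        by measurable
      have M1: "(\<lambda>\<omega>. \<integral>\<^sup>+s. ennreal ((norm (avg_step (m k) k (H_trunc k \<omega>) s - H_trunc k \<omega> s))\<^sup>2) * indicator {0<..real k} s \<partial>lborel) \<in> borel_measurable M"
        by (rule lborel.borel_measurable_nn_integral) (use m1 in \<open>simp add: case_prod_beta' cong: measurable_cong_sets sets_pair_measure_cong\<close>)
      have M2: "(\<lambda>\<omega>. \<integral>\<^sup>+s. ennreal ((norm (H_trunc k \<omega> s - H_pos \<omega> s))\<^sup>2) \<partial>lborel) \<in> borel_measurable M"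
        by (rule lborel.borel_measurable_nn_integral) (use m2 in \<open>simp add: case_prod_beta' cong: measurable_cong_sets sets_pair_measure_cong\<close>)
      have "Q k \<le> (\<integral>\<^sup>+\<omega>. 2 * (\<integral>\<^sup>+s. ennreal ((norm (avg_step (m k) k (H_trunc k \<omega>) s - H_trunc k \<omega> s))\<^sup>2) * indicator {0<..real k} s \<partial>lborel)
          + 2 * (\<integral>\<^sup>+s. ennreal ((norm (H_trunc k \<omega> s - H_pos \<omega> s))\<^sup>2) \<partial>lborel) \<partial>M)"
        unfolding Q_def
      proof (rule nn_integral_mono)
        fix \<omega> assume \<omega>: "\<omega> \<in> space M"
        note [measurable] = section_measurable[OF H_trunc_measurable[of k] \<omega>] section_measurable[OF H_pos_measurable \<omega>]
        have "(\<integral>\<^sup>+s. ennreal ((norm (avg_step (m k) k (H_trunc k \<omega>) s - H_pos \<omega> s))\<^sup>2) * indicator {0<..T} s \<partial>lborel)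
          \<le> (\<integral>\<^sup>+s. 2 * (ennreal ((norm (avg_step (m k) k (H_trunc k \<omega>) s - H_trunc k \<omega> s))\<^sup>2) * indicator {0<..real k} s)
            + 2 * ennreal ((norm (H_trunc k \<omega> s - H_pos \<omega> s))\<^sup>2) \<partial>lborel)"
        proof (rule nn_integral_mono)
          fix s
          let ?a = "avg_step (m k) k (H_trunc k \<omega>) s - H_trunc k \<omega> s" and ?b = "H_trunc k \<omega> s - H_pos \<omega> s"
          have "(norm (?a + ?b))\<^sup>2 \<le> (norm ?a + norm ?b)\<^sup>2" by (intro power_mono norm_triangle_ineq) simp
          also have "\<dots> \<le> 2 * (norm ?a)\<^sup>2 + 2 * (norm ?b)\<^sup>2"
            using sum_squares_bound[of "norm ?a" "norm ?b"] by (simp add: power2_sum)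
          finally have "(norm (avg_step (m k) k (H_trunc k \<omega>) s - H_pos \<omega> s))\<^sup>2 \<le> 2 * (norm ?a)\<^sup>2 + 2 * (norm ?b)\<^sup>2" by simp
          then have "ennreal ((norm (avg_step (m k) k (H_trunc k \<omega>) s - H_pos \<omega> s))\<^sup>2) \<le> ennreal (2 * (norm ?a)\<^sup>2 + 2 * (norm ?b)\<^sup>2)"
            by (rule ennreal_leI)
          also have "\<dots> = 2 * ennreal ((norm ?a)\<^sup>2) + 2 * ennreal ((norm ?b)\<^sup>2)"
            by (simp add: ennreal_mult)
          finally show "ennreal ((norm (avg_step (m k) k (H_trunc k \<omega>) s - H_pos \<omega> s))\<^sup>2) * indicator {0<..T} s
             \<le> 2 * (ennreal ((norm ?a)\<^sup>2) * indicator {0<..real k} s) + 2 * ennreal ((norm ?b)\<^sup>2)"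
            using k by (auto simp: indicator_def)
        qed
        also have "\<dots> = 2 * (\<integral>\<^sup>+s. ennreal ((norm (avg_step (m k) k (H_trunc k \<omega>) s - H_trunc k \<omega> s))\<^sup>2) * indicator {0<..real k} s \<partial>lborel)
          + 2 * (\<integral>\<^sup>+s. ennreal ((norm (H_trunc k \<omega> s - H_pos \<omega> s))\<^sup>2) \<partial>lborel)"
          by (simp add: nn_integral_add nn_integral_cmult)
        finally show "(\<integral>\<^sup>+s. ennreal ((norm (avg_step (m k) k (H_trunc k \<omega>) s - H_pos \<omega> s))\<^sup>2) * indicator {0<..T} s \<partial>lborel) \<le> \<dots>" .
      qed
      also have "\<dots> = 2 * E (m k) k + 2 * E' k"
        unfolding E_def E'_def using M1 M2 by (simp add: nn_integral_add nn_integral_cmult)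
      finally show ?thesis .
    qed
    have E1: "(\<lambda>k. E (m k) k) \<longlonglongrightarrow> 0"
    proof (rule tendsto_sandwich[OF _ _ tendsto_const])
      have "(\<lambda>k. 1 / real (Suc k)) \<longlonglongrightarrow> 0" using LIMSEQ_inverse_real_of_nat by (simp add: inverse_eq_divide)
      then show "(\<lambda>k. ennreal (1 / real (Suc k))) \<longlonglongrightarrow> 0" using tendsto_ennrealI by fastforce
      show "\<forall>\<^sub>F k in sequentially. E (m k) k \<le> ennreal (1 / real (Suc k))"
        using m by (intro always_eventually allI) (simp add: less_imp_le)
    qed simp
    have "(\<lambda>k. 2 * E (m k) k + 2 * E' k) \<longlonglongrightarrow> 2 * 0 + 2 * 0"
      unfolding E'_def by (intro tendsto_add tendsto_mult_ennreal E1 H_trunc_L2 tendsto_const) auto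
    then have lim0: "(\<lambda>k. 2 * E (m k) k + 2 * E' k) \<longlonglongrightarrow> 0" by simp
    have "\<forall>\<^sub>F k in sequentially. T \<le> real k"
      using filterlim_real_sequentially filterlim_at_top by blast
    then have "\<forall>\<^sub>F k in sequentially. Q k \<le> 2 * E (m k) k + 2 * E' k"
      by eventually_elim (rule bound)
    then have "Q \<longlonglongrightarrow> 0" by (rule tendsto_sandwich[OF _ _ tendsto_const lim0, rotated]) simp
    then show ?thesis by (simp add: Q_def[abs_def])
  qed
  show ?thesis
  proof (intro exI[of _ ts] exI[of _ n] exI[of _ \<xi>] conjI allI)
    show "simple_pred M F (ts k) (n k) (\<xi> k)" for k
      using delayed_avg_simple[of "m k" "n k" k] unfolding ts_def \<xi>_def by simp
    show "(\<lambda>(\<omega>, s). simple_integrand (ts k) (n k) (\<xi> k) \<omega> s) \<in> borel_measurable (M \<Otimes>\<^sub>M borel)" for k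
      unfolding si by (rule avg_step_H_measurable)
    show "(\<lambda>k. \<integral>\<^sup>+\<omega>. (\<integral>\<^sup>+s. ennreal ((norm (simple_integrand (ts k) (n k) (\<xi> k) \<omega> s - H_pos \<omega> s))\<^sup>2) * indicator {0<..T} s \<partial>lborel) \<partial>M) \<longlonglongrightarrow> 0" for T
      unfolding si by (rule lim)
  qed
qed

end

subsection \<open>Increments of the stochastic integral\<close>

text \<open>Turns an exceedance over uncountably many times into a countable union of
  events.\<close>

lemma continuous_exceeds_rational:
  fixes f :: "real \<Rightarrow> real"
  assumes f: "continuous_on {0..T} f" and T: "T > 0" and t: "t \<in> {0..T}" "f t > e"
  shows "\<exists>q\<in>\<rat>. q \<in> {0..T} \<and> f q > e"
proof -
  obtain d where d: "d > 0" "\<And>x. x \<in> {0..T} \<Longrightarrow> dist x t < d \<Longrightarrow> dist (f x) (f t) < f t - e"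
    using f t unfolding continuous_on_iff by (metis diff_gt_0_iff_gt)
  have "max 0 (t - d) < min T (t + d)" using t T d by auto
  then obtain q where "q \<in> \<rat>" "max 0 (t - d) < q" "q < min T (t + d)"
    using Rats_dense_in_real by blast
  then have q: "q \<in> \<rat>" "q \<in> {0..T}" "dist q t < d" by (auto simp: dist_real_def)
  from d(2)[OF q(2,3)] have "f q > e" by (simp add: dist_real_def)
  with q show ?thesis by blast
qed

text \<open>The function \<open>x + \<delta> x\<^sup>2 + 1 / (4 \<delta>)\<close> is nonnegative, so Fatou's lemma applies to sequences that are
  merely bounded in \<open>L\<^sup>2\<close>.\<close>

lemma square_completion_nonneg: "(\<delta>::real) > 0 \<Longrightarrow> x + \<delta> * x\<^sup>2 + 1 / (4 * \<delta>) \<ge> 0"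
proof -
  assume d: "\<delta> > 0"
  have "x + \<delta> * x\<^sup>2 + 1 / (4 * \<delta>) = \<delta> * (x + 1 / (2 * \<delta>))\<^sup>2"
    using d by (simp add: power2_eq_square field_simps)
  then show ?thesis using d by simp
qed

text \<open>Instead of uniform integrability, Fatou's lemma is applied to \<open>h (f k)\<close>.
  This costs \<delta> K, and \<delta> is chosen so that the cost is at most \<open>e\<close>; the
  constant 1 / (4 \<delta>) cancels and the nonnegative term with the square of \<open>g\<close> is
  dropped.\<close>

lemma (in prob_space) mean_zero_limit_le:
  fixes f :: "nat \<Rightarrow> 'a \<Rightarrow> real"
  assumes fk: "\<And>k. L2 M (f k)" "\<And>k. (\<integral>\<omega>. f k \<omega> \<partial>M) = 0" "\<And>k. (\<integral>\<^sup>+\<omega>. ennreal ((f k \<omega>)\<^sup>2) \<partial>M) \<le> ennreal K"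
    and g: "L2 M g" and lim: "AE \<omega> in M. (\<lambda>k. f k \<omega>) \<longlonglongrightarrow> g \<omega>" and K: "K \<ge> 0"
  shows "(\<integral>\<omega>. g \<omega> \<partial>M) \<le> 0"
proof (rule field_le_epsilon)
  fix e :: real assume e: "e > 0"
  define \<delta> where "\<delta> = e / (K + 1)"
  have d: "\<delta> > 0" using e K by (simp add: \<delta>_def)
  define h where "h x = x + \<delta> * x\<^sup>2 + 1 / (4 * \<delta>)" for x :: real
  have h0: "h x \<ge> 0" for x unfolding h_def by (rule square_completion_nonneg[OF d])
  have hm[measurable]: "h \<in> borel_measurable borel" unfolding h_def[abs_def] by measurable
  have int: "integrable M (\<lambda>\<omega>. h (Z \<omega>))" "(\<integral>\<omega>. h (Z \<omega>) \<partial>M) = (\<integral>\<omega>. Z \<omega> \<partial>M) + \<delta> * (\<integral>\<omega>. (Z \<omega>)\<^sup>2 \<partial>M) + 1 / (4 * \<delta>)" if "L2 M Z" for Z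
  proof -
    have i: "integrable M Z" "integrable M (\<lambda>\<omega>. (Z \<omega>)\<^sup>2)"
      using L2_integrable[OF that] that by (auto simp: L2_integrable_square)
    then show "integrable M (\<lambda>\<omega>. h (Z \<omega>))" unfolding h_def by simp
    show "(\<integral>\<omega>. h (Z \<omega>) \<partial>M) = (\<integral>\<omega>. Z \<omega> \<partial>M) + \<delta> * (\<integral>\<omega>. (Z \<omega>)\<^sup>2 \<partial>M) + 1 / (4 * \<delta>)"
      unfolding h_def using i by (simp add: prob_space)
  qed
  have nn: "(\<integral>\<^sup>+\<omega>. ennreal (h (Z \<omega>)) \<partial>M) = ennreal ((\<integral>\<omega>. Z \<omega> \<partial>M) + \<delta> * (\<integral>\<omega>. (Z \<omega>)\<^sup>2 \<partial>M) + 1 / (4 * \<delta>))" if "L2 M Z" for Z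
    unfolding int(2)[OF that, symmetric] by (rule nn_integral_eq_integral[OF int(1)[OF that]]) (simp add: h0)
  have meas[measurable]: "f k \<in> borel_measurable M" for k using fk(1) by (rule L2_measurable)
  have "(\<integral>\<^sup>+\<omega>. ennreal (h (g \<omega>)) \<partial>M) = (\<integral>\<^sup>+\<omega>. liminf (\<lambda>k. ennreal (h (f k \<omega>))) \<partial>M)"
  proof (rule nn_integral_cong_AE, use lim in eventually_elim)
    case (elim \<omega>)
    have "(\<lambda>k. ennreal (h (f k \<omega>))) \<longlonglongrightarrow> ennreal (h (g \<omega>))"
      unfolding h_def by (intro tendsto_ennrealI tendsto_intros elim)
    then show ?case by (simp add: lim_imp_Liminf)
  qed
  also have "\<dots> \<le> liminf (\<lambda>k. \<integral>\<^sup>+\<omega>. ennreal (h (f k \<omega>)) \<partial>M)"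
    by (rule nn_integral_liminf) measurable
  also have "\<dots> \<le> liminf (\<lambda>k::nat. ennreal (\<delta> * K + 1 / (4 * \<delta>)))"
  proof (rule Liminf_mono, rule always_eventually, rule allI)
    fix k
    have "ennreal (\<integral>\<omega>. (f k \<omega>)\<^sup>2 \<partial>M) \<le> ennreal K"
      using fk(3)[of k] L2_nn_integral_eq[OF fk(1)[of k]] by simp
    then have "(\<integral>\<omega>. (f k \<omega>)\<^sup>2 \<partial>M) \<le> K" using K by simp
    then show "(\<integral>\<^sup>+\<omega>. ennreal (h (f k \<omega>)) \<partial>M) \<le> ennreal (\<delta> * K + 1 / (4 * \<delta>))"
      unfolding nn[OF fk(1)] fk(2) using d by (intro ennreal_leI) simp
  qed
  also have "\<dots> = ennreal (\<delta> * K + 1 / (4 * \<delta>))" by (rule Liminf_const) simp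
  finally have "ennreal ((\<integral>\<omega>. g \<omega> \<partial>M) + \<delta> * (\<integral>\<omega>. (g \<omega>)\<^sup>2 \<partial>M) + 1 / (4 * \<delta>)) \<le> ennreal (\<delta> * K + 1 / (4 * \<delta>))"
    unfolding nn[OF g] .
  then have "(\<integral>\<omega>. g \<omega> \<partial>M) + \<delta> * (\<integral>\<omega>. (g \<omega>)\<^sup>2 \<partial>M) + 1 / (4 * \<delta>) \<le> \<delta> * K + 1 / (4 * \<delta>)"
    by (rule ennreal_le_iff[THEN iffD1, rotated]) (use d K in simp)
  moreover have "\<delta> * (\<integral>\<omega>. (g \<omega>)\<^sup>2 \<partial>M) \<ge> 0" using d by simp
  moreover have "\<delta> * K \<le> e" using e K by (simp add: \<delta>_def field_simps)
  ultimately show "(\<integral>\<omega>. g \<omega> \<partial>M) \<le> 0 + e" by linarith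
qed

lemma (in prob_space) mean_zero_limit:
  fixes f :: "nat \<Rightarrow> 'a \<Rightarrow> real"
  assumes fk: "\<And>k. L2 M (f k)" "\<And>k. (\<integral>\<omega>. f k \<omega> \<partial>M) = 0" "\<And>k. (\<integral>\<^sup>+\<omega>. ennreal ((f k \<omega>)\<^sup>2) \<partial>M) \<le> ennreal K"
    and g: "L2 M g" and lim: "AE \<omega> in M. (\<lambda>k. f k \<omega>) \<longlonglongrightarrow> g \<omega>" and K: "K \<ge> 0"
  shows "(\<integral>\<omega>. g \<omega> \<partial>M) = 0"
proof -
  have neg: "L2 M (\<lambda>\<omega>. - Z \<omega>)" if "L2 M Z" for Z :: "'a \<Rightarrow> real"
    using that by (simp add: L2_def)
  have "(\<integral>\<omega>. - g \<omega> \<partial>M) \<le> 0"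
  proof (rule mean_zero_limit_le[where f="\<lambda>k \<omega>. - f k \<omega>", OF neg[OF fk(1)] _ _ neg[OF g] _ K])
    show "AE \<omega> in M. (\<lambda>k. - f k \<omega>) \<longlonglongrightarrow> - g \<omega>" using lim by eventually_elim (rule tendsto_minus)
  qed (use fk in auto)
  with mean_zero_limit_le[OF fk g lim K] show ?thesis by simp
qed

lemma (in prob_space) conv_prob_zeroI_mean:
  assumes Z: "\<And>k. Z k \<in> borel_measurable M" and lim: "(\<lambda>k. \<integral>\<^sup>+\<omega>. Z k \<omega> \<partial>M) \<longlonglongrightarrow> 0"
  shows "conv_prob_zero M Z"
  unfolding conv_prob_zero_def
proof (intro allI impI)
  fix e :: real assume e: "e > 0"
  have le: "ennreal (e * measure M {\<omega> \<in> space M. Z k \<omega> > ennreal e}) \<le> (\<integral>\<^sup>+\<omega>. Z k \<omega> \<partial>M)" for k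
  proof -
    have [measurable]: "Z k \<in> borel_measurable M" by (rule Z)
    have "ennreal (e * measure M {\<omega> \<in> space M. Z k \<omega> > ennreal e}) = (\<integral>\<^sup>+\<omega>. ennreal e * indicator {\<omega> \<in> space M. Z k \<omega> > ennreal e} \<omega> \<partial>M)"
      using e by (simp add: nn_integral_cmult_indicator emeasure_eq_measure ennreal_mult)
    also have "\<dots> \<le> (\<integral>\<^sup>+\<omega>. Z k \<omega> \<partial>M)" by (intro nn_integral_mono) (auto simp: indicator_def)
    finally show ?thesis .
  qed
  show "(\<lambda>k. measure M {\<omega> \<in> space M. Z k \<omega> > ennreal e}) \<longlonglongrightarrow> 0"
  proof (rule order_tendstoI)
    fix a :: real assume a: "a > 0"
    from ennreal_tendsto_0D[OF lim, of "e * a"] e a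
    have "\<forall>\<^sub>F k in sequentially. (\<integral>\<^sup>+\<omega>. Z k \<omega> \<partial>M) < ennreal (e * a)" by simp
    then show "\<forall>\<^sub>F k in sequentially. measure M {\<omega> \<in> space M. Z k \<omega> > ennreal e} < a"
    proof eventually_elim
      case (elim k)
      from le_less_trans[OF le elim] show ?case using e a by (simp add: ennreal_less_iff)
    qed
  next
    fix a :: real assume "a < 0"
    then show "\<forall>\<^sub>F k in sequentially. a < measure M {\<omega> \<in> space M. Z k \<omega> > ennreal e}"
      by (intro always_eventually allI) (rule less_le_trans[OF _ measure_nonneg])
  qed
qed

section \<open>Measurability through completeness and continuous paths\<close>

context brownian_basis
begin

text \<open>Completeness is needed where an event agrees with a measurable one only almost surely:
  for suprema over all times of paths continuous outside a null set, and for the event of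
  convergence.\<close>

lemma complete_sets:
  assumes ae: "AE \<omega> in M. P \<omega> \<longleftrightarrow> Q \<omega>" and Q: "{\<omega> \<in> space M. Q \<omega>} \<in> sets M"
  shows "{\<omega> \<in> space M. P \<omega>} \<in> sets M"
proof -
  obtain N where N: "N \<in> null_sets M" "{\<omega> \<in> space M. \<not> (P \<omega> \<longleftrightarrow> Q \<omega>)} \<subseteq> N"
    using ae unfolding eventually_ae_filter by blast
  have "\<forall>N A. N \<in> null_sets M \<longrightarrow> A \<subseteq> N \<longrightarrow> A \<in> sets M"
    using usual unfolding usual_conditions_def by (elim conjE)
  from this[rule_format, OF N(1) Int_lower2] have "{\<omega> \<in> space M. P \<omega>} \<inter> N \<in> sets M" .
  moreover have "{\<omega> \<in> space M. Q \<omega>} - N \<in> sets M" using Q N(1) by auto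
  moreover have "{\<omega> \<in> space M. P \<omega>} = ({\<omega> \<in> space M. P \<omega>} \<inter> N) \<union> ({\<omega> \<in> space M. Q \<omega>} - N)"
    using N(2) by auto
  ultimately show ?thesis by (metis sets.Un)
qed

lemma simple_stoch_int_measurable:
  assumes "simple_pred M F ts n \<xi>" "t \<ge> 0"
  shows "(\<lambda>\<omega>. simple_stoch_int ts n \<xi> B \<omega> t) \<in> borel_measurable M"
proof -
  have ts: "ts 0 = 0" "\<And>i. i < n \<Longrightarrow> ts i < ts (Suc i)" and \<xi>: "\<And>i. i < n \<Longrightarrow> \<xi> i \<in> borel_measurable (F (ts i))"
    using assms(1) by (auto simp: simple_pred_def)
  have ts0: "0 \<le> ts i" if "i \<le> n" for i
    using grid_mono[of n ts 0 i] ts that by (auto intro: less_imp_le)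
  show ?thesis
    unfolding simple_stoch_int_def
  proof (rule borel_measurable_sum)
    fix i assume "i \<in> {..<n}"
    then have i: "i < n" "0 \<le> ts i" "0 \<le> ts (Suc i)" using ts0 by auto
    have "\<xi> i \<in> borel_measurable M" by (rule measurable_from_subalg[OF filtration_subalgebra[OF i(2)] \<xi>[OF i(1)]])
    then show "(\<lambda>\<omega>. \<xi> i \<omega> *v (B \<omega> (min t (ts (Suc i))) - B \<omega> (min t (ts i)))) \<in> borel_measurable M"
      by (intro borel_measurable_matrix_vector brownian_diff_measurable) (use i assms(2) in auto)
  qed
qed

lemma simple_stoch_int_continuous:
  assumes "simple_pred M F ts n \<xi>" "continuous_on {0..} (B \<omega>)"
  shows "continuous_on {0..} (simple_stoch_int ts n \<xi> B \<omega>)"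
proof -
  have ts: "ts 0 = 0" "\<And>i. i < n \<Longrightarrow> ts i < ts (Suc i)"
    using assms(1) by (auto simp: simple_pred_def)
  have ts0: "0 \<le> ts i" if "i \<le> n" for i
    using grid_mono[of n ts 0 i] ts that by (auto intro: less_imp_le)
  have c: "continuous_on {0..} (\<lambda>t. B \<omega> (min t r))" if "r \<ge> 0" for r
    by (rule continuous_on_compose2[OF assms(2)]) (use that in \<open>auto intro!: continuous_intros\<close>)
  show ?thesis
    unfolding simple_stoch_int_def
    by (intro continuous_on_sum bounded_linear.continuous_on[OF matrix_vector_mul_bounded_linear] continuous_on_diff c ts0) auto
qed

end

locale ito_integral = stoch_integrand M F B H
  for M :: "'a measure" and F and B :: "'a \<Rightarrow> real \<Rightarrow> real ^ 'l" and H :: "'a \<Rightarrow> real \<Rightarrow> real ^ 'l ^ 'd" +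
  fixes I :: "'a \<Rightarrow> real \<Rightarrow> real ^ 'd"
  assumes stoch_int: "is_stoch_integral M F B H I"
begin

lemma I_adapted: "t \<ge> 0 \<Longrightarrow> (\<lambda>\<omega>. I \<omega> t) \<in> borel_measurable (F t)"
  using stoch_int unfolding is_stoch_integral_def adapted_def by blast

lemma I_measurable: "t \<ge> 0 \<Longrightarrow> (\<lambda>\<omega>. I \<omega> t) \<in> borel_measurable M"
  by (rule measurable_from_subalg[OF filtration_subalgebra I_adapted])

lemma I_continuous: "AE \<omega> in M. continuous_on {0..} (I \<omega>)"
proof -
  have "AE \<omega> in M. I \<omega> 0 = 0 \<and> continuous_on {0..} (I \<omega>)"
    using stoch_int unfolding is_stoch_integral_def by (elim conjE)
  then show ?thesis by eventually_elim simp
qed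

lemma B_continuous: "AE \<omega> in M. continuous_on {0..} (B \<omega>)"
proof -
  have "AE \<omega> in M. B \<omega> 0 = 0 \<and> continuous_on {0..} (B \<omega>)"
    using BM unfolding brownian_def by (elim conjE)
  then show ?thesis by eventually_elim simp
qed

text \<open>Without this, convergence in probability would carry no information, because
  \<open>measure\<close> assigns the default value 0 to sets that are not measurable.\<close>

lemma sup_exceeds_measurable:
  assumes simple: "simple_pred M F ts n \<xi>" and T: "T \<ge> 0" and e: "e \<ge> 0"
  shows "{\<omega> \<in> space M. ennreal e < (SUP t\<in>{0..T}. ennreal (norm (simple_stoch_int ts n \<xi> B \<omega> t - I \<omega> t)))} \<in> sets M"
proof -
  define f where "f \<omega> t = norm (simple_stoch_int ts n \<xi> B \<omega> t - I \<omega> t)" for \<omega> t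
  define Q where "Q = (\<rat> \<inter> {0..T}) \<union> {T}"
  have fm[measurable]: "(\<lambda>\<omega>. f \<omega> t) \<in> borel_measurable M" if "t \<ge> 0" for t
    unfolding f_def using simple_stoch_int_measurable[OF simple that] I_measurable[OF that] by measurable
  have Qc: "countable Q" unfolding Q_def by (auto intro: countable_subset[OF _ countable_rat])
  have "{\<omega> \<in> space M. \<exists>q\<in>Q. e < f \<omega> q} = (\<Union>q\<in>Q. {\<omega> \<in> space M. e < f \<omega> q})" by auto
  also have "\<dots> \<in> sets M"
  proof (rule sets.countable_UN''[OF Qc])
    fix q assume "q \<in> Q"
    then have "q \<ge> 0" using T by (auto simp: Q_def)
    from fm[OF this] show "{\<omega> \<in> space M. e < f \<omega> q} \<in> sets M" by measurable
  qed
  finally have Qm: "{\<omega> \<in> space M. \<exists>q\<in>Q. e < f \<omega> q} \<in> sets M" .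
  show ?thesis
  proof (rule complete_sets[OF _ Qm])
    show "AE \<omega> in M. (ennreal e < (SUP t\<in>{0..T}. ennreal (norm (simple_stoch_int ts n \<xi> B \<omega> t - I \<omega> t)))) \<longleftrightarrow> (\<exists>q\<in>Q. e < f \<omega> q)"
      using I_continuous B_continuous
    proof eventually_elim
      case (elim \<omega>)
      have fc: "continuous_on {0..T} (f \<omega>)"
        unfolding f_def
        by (intro continuous_intros continuous_on_subset[OF elim(1)] continuous_on_subset[OF simple_stoch_int_continuous[OF simple elim(2)]]) auto
      have "ennreal e < (SUP t\<in>{0..T}. ennreal (f \<omega> t)) \<longleftrightarrow> (\<exists>t\<in>{0..T}. e < f \<omega> t)"
        using e by (auto simp: less_SUP_iff ennreal_less_iff)
      also have "\<dots> \<longleftrightarrow> (\<exists>q\<in>Q. e < f \<omega> q)"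
      proof
        assume "\<exists>t\<in>{0..T}. e < f \<omega> t"
        then obtain t where t: "t \<in> {0..T}" "e < f \<omega> t" by blast
        show "\<exists>q\<in>Q. e < f \<omega> q"
        proof (cases "T > 0")
          case True
          from continuous_exceeds_rational[OF fc True t] show ?thesis by (auto simp: Q_def)
        next
          case False
          then have "t = T" using t T by auto
          then show ?thesis using t by (auto simp: Q_def)
        qed
      next
        assume "\<exists>q\<in>Q. e < f \<omega> q"
        then show "\<exists>t\<in>{0..T}. e < f \<omega> t" using T by (auto simp: Q_def)
      qed
      finally show ?case by (simp add: f_def)
    qed
  qed
qed

text \<open>The defining property of the integral yields convergence in probability; a subsequence
  converges almost surely at the two times in question while keeping the convergence of the
  integrands.\<close>

lemma approximating_sequence:
  assumes uv: "0 \<le> u" "0 \<le> v"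
  shows "\<exists>ts n \<xi>. (\<forall>k. simple_pred M F (ts k) (n k) (\<xi> k)) \<and>
    (\<forall>k. (\<lambda>(\<omega>, s). simple_integrand (ts k) (n k) (\<xi> k) \<omega> s) \<in> borel_measurable (M \<Otimes>\<^sub>M borel)) \<and>
    (\<forall>T. (\<lambda>k. \<integral>\<^sup>+\<omega>. (\<integral>\<^sup>+s. ennreal ((norm (simple_integrand (ts k) (n k) (\<xi> k) \<omega> s - H_pos \<omega> s))\<^sup>2) * indicator {0<..T} s \<partial>lborel) \<partial>M) \<longlonglongrightarrow> 0) \<and>
    (AE \<omega> in M. (\<lambda>k. simple_stoch_int (ts k) (n k) (\<xi> k) B \<omega> v - simple_stoch_int (ts k) (n k) (\<xi> k) B \<omega> u) \<longlonglongrightarrow> I \<omega> v - I \<omega> u)"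
proof -
  obtain ts n \<xi> where s: "\<And>k. simple_pred M F (ts k) (n k) (\<xi> k)"
    and sm: "\<And>k. (\<lambda>(\<omega>, s). simple_integrand (ts k) (n k) (\<xi> k) \<omega> s) \<in> borel_measurable (M \<Otimes>\<^sub>M borel)"
    and sl: "\<And>T. (\<lambda>k. \<integral>\<^sup>+\<omega>. (\<integral>\<^sup>+s. ennreal ((norm (simple_integrand (ts k) (n k) (\<xi> k) \<omega> s - H_pos \<omega> s))\<^sup>2) * indicator {0<..T} s \<partial>lborel) \<partial>M) \<longlonglongrightarrow> 0"
    using simple_approximation by blast
  have prem: "conv_prob_zero M (\<lambda>k \<omega>. \<integral>\<^sup>+ s. ennreal ((norm (simple_integrand (ts k) (n k) (\<xi> k) \<omega> s - H \<omega> s))\<^sup>2) * indicator {0..T} s \<partial>lborel)" for T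
  proof -
    \<comment> \<open>Time 0 is the only place in [0, T] where \<open>H\<close> and
      \<open>H_pos\<close> can differ.\<close>
    have eq: "(\<integral>\<^sup>+ s. ennreal ((norm (simple_integrand (ts k) (n k) (\<xi> k) \<omega> s - H \<omega> s))\<^sup>2) * indicator {0..T} s \<partial>lborel)
      = (\<integral>\<^sup>+s. ennreal ((norm (simple_integrand (ts k) (n k) (\<xi> k) \<omega> s - H_pos \<omega> s))\<^sup>2) * indicator {0<..T} s \<partial>lborel)" for k \<omega>
    proof (rule nn_integral_cong_AE)
      have "AE s in lborel. s \<noteq> (0::real)" by (rule AE_lborel_singleton)
      then show "AE s in lborel. ennreal ((norm (simple_integrand (ts k) (n k) (\<xi> k) \<omega> s - H \<omega> s))\<^sup>2) * indicator {0..T} s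
         = ennreal ((norm (simple_integrand (ts k) (n k) (\<xi> k) \<omega> s - H_pos \<omega> s))\<^sup>2) * indicator {0<..T} s"
        by eventually_elim (auto simp: H_pos_def indicator_def)
    qed
    have m: "(\<lambda>\<omega>. \<integral>\<^sup>+s. ennreal ((norm (simple_integrand (ts k) (n k) (\<xi> k) \<omega> s - H_pos \<omega> s))\<^sup>2) * indicator {0<..T} s \<partial>lborel) \<in> borel_measurable M" for k
    proof -
      note [measurable] = sm[of k]
      have "(\<lambda>p. ennreal ((norm ((case p of (\<omega>, s) \<Rightarrow> simple_integrand (ts k) (n k) (\<xi> k) \<omega> s) - (case p of (\<omega>, s) \<Rightarrow> H_pos \<omega> s)))\<^sup>2) * indicator {0<..T} (snd p)) \<in> borel_measurable (M \<Otimes>\<^sub>M borel)"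
        by measurable
      then show ?thesis
        by (intro lborel.borel_measurable_nn_integral) (simp add: case_prod_beta' cong: measurable_cong_sets sets_pair_measure_cong)
    qed
    show ?thesis unfolding eq by (rule conv_prob_zeroI_mean[OF m sl])
  qed
  have "\<forall>ts n \<xi>. (\<forall>k. simple_pred M F (ts k) (n k) (\<xi> k)) \<and>
        (\<forall>T\<ge>0. conv_prob_zero M (\<lambda>k \<omega>. \<integral>\<^sup>+ s. ennreal ((norm (simple_integrand (ts k) (n k) (\<xi> k) \<omega> s - H \<omega> s))\<^sup>2)
                                             * indicator {0..T} s \<partial>lborel))
        \<longrightarrow> (\<forall>T\<ge>0. conv_prob_zero M (\<lambda>k \<omega>. SUP t\<in>{0..T}.
                ennreal (norm (simple_stoch_int (ts k) (n k) (\<xi> k) B \<omega> t - I \<omega> t))))"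
    using stoch_int unfolding is_stoch_integral_def by (elim conjE)
  then have "\<forall>T\<ge>0. conv_prob_zero M (\<lambda>k \<omega>. SUP t\<in>{0..T}. ennreal (norm (simple_stoch_int (ts k) (n k) (\<xi> k) B \<omega> t - I \<omega> t)))"
    using s prem by blast
  then have conv: "conv_prob_zero M (\<lambda>k \<omega>. SUP t\<in>{0..max u v}. ennreal (norm (simple_stoch_int (ts k) (n k) (\<xi> k) B \<omega> t - I \<omega> t)))"
    using uv by auto
  define S where "S k \<omega> t = simple_stoch_int (ts k) (n k) (\<xi> k) B \<omega> t" for k \<omega> t
  \<comment> \<open>Capping at 1 makes the error integrable, so convergence in probability becomes
    convergence in mean and an almost surely convergent subsequence can be extracted. The cap is
    inactive once \<open>W\<close> is below 1.\<close>
  define W where "W k \<omega> = min 1 (norm (S k \<omega> u - I \<omega> u) + norm (S k \<omega> v - I \<omega> v))" for k \<omega>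
  have Wm[measurable]: "W k \<in> borel_measurable M" for k
    unfolding W_def[abs_def] S_def
    using simple_stoch_int_measurable[OF s] I_measurable uv by (intro borel_measurable_min borel_measurable_add borel_measurable_norm borel_measurable_diff) auto
  have Wi: "integrable M (W k)" for k
    by (rule integrable_const_bound[of _ 1]) (auto simp: W_def)
  have "(\<lambda>k. \<integral>\<omega>. norm (W k \<omega>) \<partial>M) \<longlonglongrightarrow> 0"
  proof (rule order_tendstoI)
    fix a :: real assume a: "a > 0"
    \<comment> \<open>Two times contribute at most \<open>e\<close> each and the exceptional event
      less than a / 2, so the mean is below a / 3 + a / 2.\<close>
    define e where "e = a / 6"
    have e: "e > 0" using a by (simp add: e_def)
    define P where "P k = {\<omega> \<in> space M. (SUP t\<in>{0..max u v}. ennreal (norm (S k \<omega> t - I \<omega> t))) > ennreal e}" for k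
    have Pm[measurable]: "P k \<in> sets M" for k
      unfolding P_def S_def by (rule sup_exceeds_measurable[OF s]) (use uv e in auto)
    have "(\<lambda>k. measure M (P k)) \<longlonglongrightarrow> 0" using conv e unfolding conv_prob_zero_def P_def S_def by blast
    then have "\<forall>\<^sub>F k in sequentially. measure M (P k) < a / 2" by (rule order_tendstoD) (use a in simp)
    then show "\<forall>\<^sub>F k in sequentially. (\<integral>\<omega>. norm (W k \<omega>) \<partial>M) < a"
    proof eventually_elim
      case (elim k)
      have "(\<integral>\<omega>. norm (W k \<omega>) \<partial>M) \<le> (\<integral>\<omega>. 2 * e + indicator (P k) \<omega> \<partial>M)"
      proof (rule integral_mono)
        show "integrable M (\<lambda>\<omega>. norm (W k \<omega>))" using Wi by (rule integrable_norm)
        show "integrable M (\<lambda>\<omega>. 2 * e + indicator (P k) \<omega>)" by (intro Bochner_Integration.integrable_add) (auto simp: emeasure_eq_measure)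
        fix \<omega> assume \<omega>: "\<omega> \<in> space M"
        show "norm (W k \<omega>) \<le> 2 * e + indicator (P k) \<omega>"
        proof (cases "\<omega> \<in> P k")
          case True
          then show ?thesis using e by (simp add: W_def)
        next
          case False
          have "norm (S k \<omega> r - I \<omega> r) \<le> e" if "r \<in> {0..max u v}" for r
          proof -
            have "ennreal (norm (S k \<omega> r - I \<omega> r)) \<le> (SUP t\<in>{0..max u v}. ennreal (norm (S k \<omega> t - I \<omega> t)))"
              by (rule SUP_upper[OF that])
            also have "\<dots> \<le> ennreal e" using False \<omega> by (auto simp: P_def)
            finally show ?thesis using e by simp
          qed
          from this[of u] this[of v] show ?thesis using uv False by (auto simp: W_def)
        qed
      qed
      also have "\<dots> = 2 * e + measure M (P k)" by (simp add: prob_space emeasure_eq_measure)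
      also have "\<dots> < a" using elim a by (simp add: e_def)
      finally show ?case .
    qed
  next
    fix a :: real assume "a < 0"
    then show "\<forall>\<^sub>F k in sequentially. a < (\<integral>\<omega>. norm (W k \<omega>) \<partial>M)"
      by (intro always_eventually allI less_le_trans[OF _ integral_nonneg_AE]) auto
  qed
  from tendsto_L1_AE_subseq[OF Wi this] obtain r :: "nat \<Rightarrow> nat" where r: "strict_mono r" "AE \<omega> in M. (\<lambda>k. W (r k) \<omega>) \<longlonglongrightarrow> 0"
    by blast
  have lim: "AE \<omega> in M. (\<lambda>k. S (r k) \<omega> v - S (r k) \<omega> u) \<longlonglongrightarrow> I \<omega> v - I \<omega> u"
    using r(2)
  proof eventually_elim
    case (elim \<omega>)
    have "\<forall>\<^sub>F k in sequentially. W (r k) \<omega> < 1" using elim by (rule order_tendstoD) simp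
    then have "\<forall>\<^sub>F k in sequentially. norm ((S (r k) \<omega> v - S (r k) \<omega> u) - (I \<omega> v - I \<omega> u)) \<le> W (r k) \<omega>"
    proof eventually_elim
      case (elim k)
      have "norm ((S (r k) \<omega> v - S (r k) \<omega> u) - (I \<omega> v - I \<omega> u)) \<le> norm (S (r k) \<omega> u - I \<omega> u) + norm (S (r k) \<omega> v - I \<omega> v)"
        using norm_triangle_ineq4[of "S (r k) \<omega> v - I \<omega> v" "S (r k) \<omega> u - I \<omega> u"] by (simp add: algebra_simps)
      with elim show ?case by (auto simp: W_def)
    qed
    then have "(\<lambda>k. (S (r k) \<omega> v - S (r k) \<omega> u) - (I \<omega> v - I \<omega> u)) \<longlonglongrightarrow> 0"
      by (rule Lim_null_comparison[OF _ elim])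
    then show ?case by (simp add: LIM_zero_iff)
  qed
  have sl': "(\<lambda>k. \<integral>\<^sup>+\<omega>. (\<integral>\<^sup>+s. ennreal ((norm (simple_integrand (ts (r k)) (n (r k)) (\<xi> (r k)) \<omega> s - H_pos \<omega> s))\<^sup>2) * indicator {0<..T} s \<partial>lborel) \<partial>M) \<longlonglongrightarrow> 0" for T
    using LIMSEQ_subseq_LIMSEQ[OF sl[of T] r(1)] by (simp add: o_def)
  show ?thesis
    by (rule exI[of _ "\<lambda>k. ts (r k)"], rule exI[of _ "\<lambda>k. n (r k)"], rule exI[of _ "\<lambda>k. \<xi> (r k)"])
      (use s sm sl' lim[unfolded S_def] in blast)
qed

text \<open>Both claims are limits of those for simple integrals. The bound passes by Fatou's lemma
  and acquires the factor 2 from |x + y|^2 \<le> 2 |x|^2 + 2 |y|^2, which separates the integrand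
  from its approximation error. Conditional mean zero passes by \<open>mean_zero_limit\<close>,
  whose second moment bound is this same estimate.\<close>

theorem ito_increment:
  assumes uv: "0 \<le> u" "u \<le> v"
  shows "orth_increment M (F u) (\<lambda>\<omega>. I \<omega> v - I \<omega> u)"
    and "A \<in> sets (F u) \<Longrightarrow> (\<integral>\<^sup>+\<omega>. indicator A \<omega> * ennreal ((norm (I \<omega> v - I \<omega> u))\<^sup>2) \<partial>M)
      \<le> ennreal (2 * brownian_const) * (\<integral>\<^sup>+\<omega>. indicator A \<omega> * (\<integral>\<^sup>+s. ennreal ((norm (H_pos \<omega> s))\<^sup>2) * indicator {u<..v} s \<partial>lborel) \<partial>M)"
proof -
  have v: "0 \<le> v" using uv by simp
  obtain ts n \<xi> where s: "\<And>k. simple_pred M F (ts k) (n k) (\<xi> k)"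
    and sm: "\<And>k. (\<lambda>(\<omega>, s). simple_integrand (ts k) (n k) (\<xi> k) \<omega> s) \<in> borel_measurable (M \<Otimes>\<^sub>M borel)"
    and sl: "\<And>T. (\<lambda>k. \<integral>\<^sup>+\<omega>. (\<integral>\<^sup>+s. ennreal ((norm (simple_integrand (ts k) (n k) (\<xi> k) \<omega> s - H_pos \<omega> s))\<^sup>2) * indicator {0<..T} s \<partial>lborel) \<partial>M) \<longlonglongrightarrow> 0"
    and lim: "AE \<omega> in M. (\<lambda>k. simple_stoch_int (ts k) (n k) (\<xi> k) B \<omega> v - simple_stoch_int (ts k) (n k) (\<xi> k) B \<omega> u) \<longlonglongrightarrow> I \<omega> v - I \<omega> u"
    using approximating_sequence[OF uv(1) v] by blast
  define D where "D k \<omega> = simple_stoch_int (ts k) (n k) (\<xi> k) B \<omega> v - simple_stoch_int (ts k) (n k) (\<xi> k) B \<omega> u" for k \<omega>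
  define D' where "D' \<omega> = I \<omega> v - I \<omega> u" for \<omega>
  define J where "J k \<omega> = (\<integral>\<^sup>+s. ennreal ((norm (simple_integrand (ts k) (n k) (\<xi> k) \<omega> s))\<^sup>2) * indicator {u<..v} s \<partial>lborel)" for k \<omega>
  define J' where "J' \<omega> = (\<integral>\<^sup>+s. ennreal ((norm (H_pos \<omega> s))\<^sup>2) * indicator {u<..v} s \<partial>lborel)" for \<omega>
  define \<epsilon> where "\<epsilon> k \<omega> = (\<integral>\<^sup>+s. ennreal ((norm (simple_integrand (ts k) (n k) (\<xi> k) \<omega> s - H_pos \<omega> s))\<^sup>2) * indicator {0<..v} s \<partial>lborel)" for k \<omega>
  have Dm[measurable]: "D k \<in> borel_measurable M" for k
    unfolding D_def[abs_def] by (intro borel_measurable_diff simple_stoch_int_measurable[OF s] uv v)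
  have D'm[measurable]: "D' \<in> borel_measurable M"
    unfolding D'_def[abs_def] by (intro borel_measurable_diff I_measurable uv v)
  have limD: "AE \<omega> in M. (\<lambda>k. D k \<omega>) \<longlonglongrightarrow> D' \<omega>" using lim unfolding D_def D'_def .
  have \<epsilon>m[measurable]: "\<epsilon> k \<in> borel_measurable M" for k
  proof -
    note [measurable] = sm[of k]
    have "(\<lambda>p. ennreal ((norm ((case p of (\<omega>, s) \<Rightarrow> simple_integrand (ts k) (n k) (\<xi> k) \<omega> s) - (case p of (\<omega>, s) \<Rightarrow> H_pos \<omega> s)))\<^sup>2) * indicator {0<..v} (snd p)) \<in> borel_measurable (M \<Otimes>\<^sub>M borel)"
      by measurable
    then show ?thesis
      unfolding \<epsilon>_def[abs_def] by (intro lborel.borel_measurable_nn_integral) (simp add: case_prod_beta' cong: measurable_cong_sets sets_pair_measure_cong)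
  qed
  have J'm[measurable]: "J' \<in> borel_measurable M"
  proof -
    have "(\<lambda>p. ennreal ((norm (case p of (\<omega>, s) \<Rightarrow> H_pos \<omega> s))\<^sup>2) * indicator {u<..v} (snd p)) \<in> borel_measurable (M \<Otimes>\<^sub>M borel)"
      by measurable
    then show ?thesis
      unfolding J'_def[abs_def] by (intro lborel.borel_measurable_nn_integral) (simp add: case_prod_beta' cong: measurable_cong_sets sets_pair_measure_cong)
  qed
  have JJ: "J k \<omega> \<le> 2 * J' \<omega> + 2 * \<epsilon> k \<omega>" if \<omega>: "\<omega> \<in> space M" for k \<omega>
  proof -
    note [measurable] = section_measurable[OF H_pos_measurable \<omega>] section_measurable[OF sm \<omega>]
    have "J k \<omega> \<le> (\<integral>\<^sup>+s. 2 * (ennreal ((norm (H_pos \<omega> s))\<^sup>2) * indicator {u<..v} s) +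
        2 * (ennreal ((norm (simple_integrand (ts k) (n k) (\<xi> k) \<omega> s - H_pos \<omega> s))\<^sup>2) * indicator {0<..v} s) \<partial>lborel)"
      unfolding J_def
    proof (rule nn_integral_mono)
      fix s
      let ?a = "H_pos \<omega> s" and ?b = "simple_integrand (ts k) (n k) (\<xi> k) \<omega> s - H_pos \<omega> s"
      have "(norm (?a + ?b))\<^sup>2 \<le> (norm ?a + norm ?b)\<^sup>2" by (intro power_mono norm_triangle_ineq) simp
      also have "\<dots> \<le> 2 * (norm ?a)\<^sup>2 + 2 * (norm ?b)\<^sup>2"
        using sum_squares_bound[of "norm ?a" "norm ?b"] by (simp add: power2_sum)
      finally have "ennreal ((norm (simple_integrand (ts k) (n k) (\<xi> k) \<omega> s))\<^sup>2) \<le> ennreal (2 * (norm ?a)\<^sup>2 + 2 * (norm ?b)\<^sup>2)"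
        by (intro ennreal_leI) simp
      also have "\<dots> = 2 * ennreal ((norm ?a)\<^sup>2) + 2 * ennreal ((norm ?b)\<^sup>2)" by (simp add: ennreal_mult)
      finally show "ennreal ((norm (simple_integrand (ts k) (n k) (\<xi> k) \<omega> s))\<^sup>2) * indicator {u<..v} s
         \<le> 2 * (ennreal ((norm ?a)\<^sup>2) * indicator {u<..v} s) + 2 * (ennreal ((norm ?b)\<^sup>2) * indicator {0<..v} s)"
        using uv by (auto simp: indicator_def)
    qed
    also have "\<dots> = 2 * J' \<omega> + 2 * \<epsilon> k \<omega>"
      unfolding J'_def \<epsilon>_def by (simp add: nn_integral_add nn_integral_cmult)
    finally show ?thesis .
  qed
  let ?c = "ennreal brownian_const"
  have bk: "(\<integral>\<^sup>+\<omega>. indicator A \<omega> * ennreal ((norm (D k \<omega>))\<^sup>2) \<partial>M) \<le> ?c * (2 * (\<integral>\<^sup>+\<omega>. indicator A \<omega> * J' \<omega> \<partial>M) + 2 * (\<integral>\<^sup>+\<omega>. \<epsilon> k \<omega> \<partial>M))"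
    if A: "A \<in> sets (F u)" for A k
  proof -
    have [measurable]: "A \<in> sets M" by (rule filtration_sets[OF uv(1) A])
    have "(\<integral>\<^sup>+\<omega>. indicator A \<omega> * ennreal ((norm (D k \<omega>))\<^sup>2) \<partial>M) \<le> ?c * (\<integral>\<^sup>+\<omega>. indicator A \<omega> * J k \<omega> \<partial>M)"
      unfolding D_def J_def by (rule simple_stoch_int_increment(2)[OF s uv A])
    also have "(\<integral>\<^sup>+\<omega>. indicator A \<omega> * J k \<omega> \<partial>M) \<le> (\<integral>\<^sup>+\<omega>. 2 * (indicator A \<omega> * J' \<omega>) + 2 * \<epsilon> k \<omega> \<partial>M)"
      using JJ by (intro nn_integral_mono) (auto simp: indicator_def)
    also have "\<dots> = 2 * (\<integral>\<^sup>+\<omega>. indicator A \<omega> * J' \<omega> \<partial>M) + 2 * (\<integral>\<^sup>+\<omega>. \<epsilon> k \<omega> \<partial>M)"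
      by (simp add: nn_integral_add nn_integral_cmult)
    finally show ?thesis by (simp add: mult_left_mono)
  qed
  have main: "(\<integral>\<^sup>+\<omega>. indicator A \<omega> * ennreal ((norm (D' \<omega>))\<^sup>2) \<partial>M) \<le> ennreal (2 * brownian_const) * (\<integral>\<^sup>+\<omega>. indicator A \<omega> * J' \<omega> \<partial>M)"
    if A: "A \<in> sets (F u)" for A
  proof -
    have [measurable]: "A \<in> sets M" by (rule filtration_sets[OF uv(1) A])
    have "(\<integral>\<^sup>+\<omega>. indicator A \<omega> * ennreal ((norm (D' \<omega>))\<^sup>2) \<partial>M) = (\<integral>\<^sup>+\<omega>. liminf (\<lambda>k. indicator A \<omega> * ennreal ((norm (D k \<omega>))\<^sup>2)) \<partial>M)"
    proof (rule nn_integral_cong_AE, use limD in eventually_elim)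
      case (elim \<omega>)
      have "(\<lambda>k. indicator A \<omega> * ennreal ((norm (D k \<omega>))\<^sup>2)) \<longlonglongrightarrow> indicator A \<omega> * ennreal ((norm (D' \<omega>))\<^sup>2)"
        by (intro tendsto_mult_ennreal tendsto_const tendsto_ennrealI tendsto_intros elim) (auto simp: indicator_def)
      then show ?case by (simp add: lim_imp_Liminf)
    qed
    also have "\<dots> \<le> liminf (\<lambda>k. \<integral>\<^sup>+\<omega>. indicator A \<omega> * ennreal ((norm (D k \<omega>))\<^sup>2) \<partial>M)"
      by (rule nn_integral_liminf) measurable
    also have "\<dots> \<le> liminf (\<lambda>k. ?c * (2 * (\<integral>\<^sup>+\<omega>. indicator A \<omega> * J' \<omega> \<partial>M) + 2 * (\<integral>\<^sup>+\<omega>. \<epsilon> k \<omega> \<partial>M)))"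
      by (intro Liminf_mono always_eventually allI bk[OF A])
    also have "\<dots> = ?c * (2 * (\<integral>\<^sup>+\<omega>. indicator A \<omega> * J' \<omega> \<partial>M) + 2 * 0)"
    proof (rule lim_imp_Liminf)
      have "(\<lambda>k. \<integral>\<^sup>+\<omega>. \<epsilon> k \<omega> \<partial>M) \<longlonglongrightarrow> 0" unfolding \<epsilon>_def by (rule sl)
      then show "(\<lambda>k. ?c * (2 * (\<integral>\<^sup>+\<omega>. indicator A \<omega> * J' \<omega> \<partial>M) + 2 * (\<integral>\<^sup>+\<omega>. \<epsilon> k \<omega> \<partial>M))) \<longlonglongrightarrow> ?c * (2 * (\<integral>\<^sup>+\<omega>. indicator A \<omega> * J' \<omega> \<partial>M) + 2 * 0)"
        by (intro ennreal_tendsto_cmult tendsto_add tendsto_const) simp_all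
    qed simp
    also have "\<dots> = ennreal (2 * brownian_const) * (\<integral>\<^sup>+\<omega>. indicator A \<omega> * J' \<omega> \<partial>M)"
      by (simp add: ennreal_mult brownian_const_def mult_ac)
    finally show ?thesis .
  qed
  show "A \<in> sets (F u) \<Longrightarrow> (\<integral>\<^sup>+\<omega>. indicator A \<omega> * ennreal ((norm (I \<omega> v - I \<omega> u))\<^sup>2) \<partial>M)
      \<le> ennreal (2 * brownian_const) * (\<integral>\<^sup>+\<omega>. indicator A \<omega> * (\<integral>\<^sup>+s. ennreal ((norm (H_pos \<omega> s))\<^sup>2) * indicator {u<..v} s \<partial>lborel) \<partial>M)"
    using main[of A] by (simp only: D'_def J'_def)
  have sp: "space M \<in> sets (F u)" using filtration_space[OF uv(1)] sets.top[of "F u"] by simp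
  have ispace: "(\<integral>\<^sup>+\<omega>. indicator (space M) \<omega> * f \<omega> \<partial>M) = (\<integral>\<^sup>+\<omega>. f \<omega> \<partial>M)" for f :: "'a \<Rightarrow> ennreal"
    by (rule nn_integral_cong) simp
  have J'fin: "(\<integral>\<^sup>+\<omega>. J' \<omega> \<partial>M) < \<infinity>"
  proof -
    have "(\<integral>\<^sup>+\<omega>. J' \<omega> \<partial>M) \<le> (\<integral>\<^sup>+ \<omega>. (\<integral>\<^sup>+ t. ennreal ((norm (H \<omega> t))\<^sup>2) * indicator {0..} t \<partial>lborel) \<partial>M)"
      unfolding J'_def using uv by (intro nn_integral_mono) (auto simp: H_pos_def indicator_def)
    also note square_fin
    finally show ?thesis .
  qed
  have L2D': "L2 M D'"
  proof -
    have "(\<integral>\<^sup>+\<omega>. ennreal ((norm (D' \<omega>))\<^sup>2) \<partial>M) \<le> ennreal (2 * brownian_const) * (\<integral>\<^sup>+\<omega>. J' \<omega> \<partial>M)"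
      using main[OF sp] unfolding ispace .
    also have "\<dots> < \<infinity>" using J'fin by (simp add: ennreal_mult_less_top)
    finally show ?thesis by (simp add: L2_def)
  qed
  have "(\<lambda>k. \<integral>\<^sup>+\<omega>. \<epsilon> k \<omega> \<partial>M) \<longlonglongrightarrow> 0" unfolding \<epsilon>_def by (rule sl)
  \<comment> \<open>Beyond index \<open>N\<close> the approximation errors are at most 1, so the
    second moments are bounded by one constant \<open>K\<close>; the sequence is shifted by
    \<open>N\<close> for that reason.\<close>
  from ennreal_tendsto_0D[OF this, of 1] obtain N where "\<forall>k\<ge>N. (\<integral>\<^sup>+\<omega>. \<epsilon> k \<omega> \<partial>M) < 1"
    by (auto simp: eventually_sequentially)
  then have N: "\<And>k. k \<ge> N \<Longrightarrow> (\<integral>\<^sup>+\<omega>. \<epsilon> k \<omega> \<partial>M) \<le> 1" by (simp add: less_imp_le)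
  obtain K where K: "K \<ge> 0" "?c * (2 * (\<integral>\<^sup>+\<omega>. J' \<omega> \<partial>M) + 2 * 1) = ennreal K"
  proof (cases "?c * (2 * (\<integral>\<^sup>+\<omega>. J' \<omega> \<partial>M) + 2 * 1)")
    case top
    have "?c * (2 * (\<integral>\<^sup>+\<omega>. J' \<omega> \<partial>M) + 2 * 1) < \<infinity>" using J'fin by (simp add: ennreal_mult_less_top)
    then show ?thesis using top by simp
  qed (use that in auto)
  have Dk: "orth_increment M (F u) (D k)" for k
    unfolding D_def[abs_def] by (rule simple_stoch_int_increment(1)[OF s uv])
  show "orth_increment M (F u) (\<lambda>\<omega>. I \<omega> v - I \<omega> u)"
    unfolding D'_def[symmetric]
  proof (rule orth_incrementI[OF filtration_subalgebra[OF uv(1)] L2D'])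
    fix A and b :: "real ^ 'd" assume A: "A \<in> sets (F u)" and b: "b \<in> Basis"
    have AM[measurable]: "A \<in> sets M" by (rule filtration_sets[OF uv(1) A])
    have L2A: "L2 M (\<lambda>\<omega>. indicator A \<omega> * inner (Z \<omega>) b)" if "L2 M Z" for Z :: "'a \<Rightarrow> real ^ 'd"
    proof (rule L2_bound[OF that, of _ 1])
      show "(\<lambda>\<omega>. indicator A \<omega> * inner (Z \<omega>) b) \<in> borel_measurable M" using L2_measurable[OF that] by measurable
      show "norm (indicator A \<omega> * inner (Z \<omega>) b) \<le> 1 * norm (Z \<omega>)" for \<omega>
        using Basis_le_norm[OF b, of "Z \<omega>"] by (simp add: indicator_def)
    qed
    show "(\<integral>\<omega>. indicator A \<omega> * inner (D' \<omega>) b \<partial>M) = 0"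
    proof (rule mean_zero_limit[where f="\<lambda>k \<omega>. indicator A \<omega> * inner (D (k + N) \<omega>) b" and K=K, OF L2A _ _ L2A[OF L2D'] _ K(1)])
      fix k
      show Lk: "L2 M (D (k + N))" using Dk by (simp add: orth_increment_def)
      have wm: "(\<lambda>\<omega>. indicator A \<omega> *\<^sub>R b) \<in> borel_measurable (F u)" using A by measurable
      have "L2 M (\<lambda>\<omega>. indicator A \<omega> *\<^sub>R b)"
      proof -
        have "L2 M (\<lambda>_. b)" by (simp add: L2_def ennreal_mult_less_top emeasure_space_1)
        then show ?thesis by (rule L2_bound[of _ _ _ 1]) (auto simp: indicator_def)
      qed
      then have "(\<integral>\<omega>. inner (indicator A \<omega> *\<^sub>R b) (D (k + N) \<omega>) \<partial>M) = 0"
        using Dk[of "k + N"] wm unfolding orth_increment_def by blast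
      then show "(\<integral>\<omega>. indicator A \<omega> * inner (D (k + N) \<omega>) b \<partial>M) = 0" by (simp add: inner_commute)
      have "(\<integral>\<^sup>+\<omega>. ennreal ((indicator A \<omega> * inner (D (k + N) \<omega>) b)\<^sup>2) \<partial>M) \<le> (\<integral>\<^sup>+\<omega>. ennreal ((norm (D (k + N) \<omega>))\<^sup>2) \<partial>M)"
      proof (intro nn_integral_mono ennreal_leI)
        fix \<omega>
        have "\<bar>indicator A \<omega> * inner (D (k + N) \<omega>) b\<bar> \<le> norm (D (k + N) \<omega>)"
          using Basis_le_norm[OF b, of "D (k + N) \<omega>"] by (simp add: indicator_def)
        then have "\<bar>indicator A \<omega> * inner (D (k + N) \<omega>) b\<bar>\<^sup>2 \<le> (norm (D (k + N) \<omega>))\<^sup>2" by (intro power_mono) auto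
        then show "(indicator A \<omega> * inner (D (k + N) \<omega>) b)\<^sup>2 \<le> (norm (D (k + N) \<omega>))\<^sup>2" by simp
      qed
      also have "\<dots> \<le> ?c * (2 * (\<integral>\<^sup>+\<omega>. J' \<omega> \<partial>M) + 2 * (\<integral>\<^sup>+\<omega>. \<epsilon> (k + N) \<omega> \<partial>M))"
        using bk[OF sp] unfolding ispace .
      also have "\<dots> \<le> ?c * (2 * (\<integral>\<^sup>+\<omega>. J' \<omega> \<partial>M) + 2 * 1)"
        by (intro mult_left_mono add_left_mono N) auto
      also have "\<dots> = ennreal K" by (rule K(2))
      finally show "(\<integral>\<^sup>+\<omega>. ennreal ((indicator A \<omega> * inner (D (k + N) \<omega>) b)\<^sup>2) \<partial>M) \<le> ennreal K" .
    next
      show "AE \<omega> in M. (\<lambda>k. indicator A \<omega> * inner (D (k + N) \<omega>) b) \<longlonglongrightarrow> indicator A \<omega> * inner (D' \<omega>) b"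
        using limD
      proof eventually_elim
        case (elim \<omega>)
        then have "(\<lambda>k. D (k + N) \<omega>) \<longlonglongrightarrow> D' \<omega>" by (rule LIMSEQ_ignore_initial_segment)
        then show ?case by (intro tendsto_intros)
      qed
    qed
  qed
qed

end

subsection \<open>Riemann-Stieltjes sums and stopped sequences\<close>

lemma is_partition_concat:
  assumes p: "is_partition a b n p" and q: "is_partition b c m q"
  defines "r \<equiv> \<lambda>i. if i \<le> n then p i else q (i - n)"
  shows "is_partition a c (n + m) r"
    and "(\<Sum>i<n + m. norm (g (r (Suc i)) - g (r i))) = (\<Sum>i<n. norm (g (p (Suc i)) - g (p i))) + (\<Sum>i<m. norm (g (q (Suc i)) - g (q i)))"
proof -
  have rq: "r (n + i) = q i" for i
    using p q by (cases "i = 0") (auto simp: r_def is_partition_def)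
  show "is_partition a c (n + m) r"
    unfolding is_partition_def
  proof (intro conjI allI impI)
    show "r 0 = a" using p by (simp add: r_def is_partition_def)
    show "r (n + m) = c" using rq[of m] q by (simp add: is_partition_def)
    fix i assume i: "i < n + m"
    show "r i \<le> r (Suc i)"
    proof (cases "i < n")
      case True then show ?thesis using p by (auto simp: r_def is_partition_def)
    next
      case False
      then obtain k where k: "i = n + k" using le_Suc_ex by (metis not_less)
      then show ?thesis using rq[of k] rq[of "Suc k"] q i by (auto simp: is_partition_def)
    qed
  qed
  have "(\<Sum>i<n + m. norm (g (r (Suc i)) - g (r i))) = (\<Sum>i<n. norm (g (r (Suc i)) - g (r i))) + (\<Sum>i<m. norm (g (r (Suc (n + i))) - g (r (n + i))))"
    by (induction m) auto
  also have "(\<Sum>i<n. norm (g (r (Suc i)) - g (r i))) = (\<Sum>i<n. norm (g (p (Suc i)) - g (p i)))"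
    by (intro sum.cong) (auto simp: r_def)
  also have "(\<Sum>i<m. norm (g (r (Suc (n + i))) - g (r (n + i)))) = (\<Sum>i<m. norm (g (q (Suc i)) - g (q i)))"
    using rq by (intro sum.cong) (auto simp del: add_Suc_right simp add: add_Suc_right[symmetric])
  finally show "(\<Sum>i<n + m. norm (g (r (Suc i)) - g (r i))) = (\<Sum>i<n. norm (g (p (Suc i)) - g (p i))) + (\<Sum>i<m. norm (g (q (Suc i)) - g (q i)))" .
qed

lemma is_partition_trivial: "a \<le> b \<Longrightarrow> is_partition a b 1 (\<lambda>i. if i = 0 then a else b)"
  by (simp add: is_partition_def)

text \<open>\<open>V\<close> is the variation function, a supremum over partitions of [a, t];
  concatenating partitions makes its increments dominate the variation on subintervals. In the
  energy estimate the errors of all cells then telescope.\<close>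

lemma bounded_variation_control:
  fixes g :: "real \<Rightarrow> 'b::real_normed_vector"
  assumes bv: "bounded_variation_on a b g"
  shows "\<exists>V. \<forall>u w n p. a \<le> u \<longrightarrow> u \<le> w \<longrightarrow> w \<le> b \<longrightarrow> is_partition u w n p \<longrightarrow>
    (\<Sum>i<n. norm (g (p (Suc i)) - g (p i))) \<le> V w - V u"
proof -
  obtain C where C: "\<And>n p. is_partition a b n p \<Longrightarrow> (\<Sum>i<n. norm (g (p (Suc i)) - g (p i))) \<le> C"
    using bv unfolding bounded_variation_on_def by blast
  define S where "S t = {\<Sum>i<n. norm (g (p (Suc i)) - g (p i)) | n p. is_partition a t n p}" for t
  have bdd: "bdd_above (S t)" if "t \<le> b" for t
  proof (rule bdd_aboveI)
    fix x assume "x \<in> S t"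
    then obtain n p where x: "x = (\<Sum>i<n. norm (g (p (Suc i)) - g (p i)))" and p: "is_partition a t n p"
      by (auto simp: S_def)
    \<comment> \<open>A last cell from \<open>t\<close> to \<open>b\<close> turns the partition into
      one of [a, b], to which the constant \<open>C\<close> applies.\<close>
    have "x \<le> x + (\<Sum>i<1. norm (g (if Suc i = 0 then t else b) - g (if i = 0 then t else b)))"
      by (simp add: sum_nonneg)
    also have "\<dots> \<le> C"
      unfolding x is_partition_concat(2)[OF p is_partition_trivial[OF that], symmetric]
      by (rule C[OF is_partition_concat(1)[OF p is_partition_trivial[OF that]]])
    finally show "x \<le> C" .
  qed
  show ?thesis
  proof (intro exI[of _ "\<lambda>t. Sup (S t)"] allI impI)
    fix u w n p assume uw: "a \<le> u" "u \<le> w" "w \<le> b" and q: "is_partition u w n p"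
    let ?x = "\<Sum>i<n. norm (g (p (Suc i)) - g (p i))"
    have "Sup (S u) \<le> Sup (S w) - ?x"
    proof (rule cSup_least)
      show "S u \<noteq> {}" using is_partition_trivial[OF uw(1)] by (auto simp: S_def)
      fix y assume "y \<in> S u"
      then obtain m r where y: "y = (\<Sum>i<m. norm (g (r (Suc i)) - g (r i)))" and r: "is_partition a u m r"
        by (auto simp: S_def)
      have "y + ?x \<in> S w"
        unfolding y is_partition_concat(2)[OF r q, symmetric] S_def
        by (rule CollectI, intro exI conjI, rule refl, rule is_partition_concat(1)[OF r q])
      then have "y + ?x \<le> Sup (S w)" by (rule cSup_upper[OF _ bdd[OF uw(3)]])
      then show "y \<le> Sup (S w) - ?x" by simp
    qed
    then show "?x \<le> Sup (S w) - Sup (S u)" by simp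
  qed
qed

text \<open>On an interval where X oscillates by at most \<eta>, replacing X by its value at the
  right end costs \<eta> times the variation of Y and the length. The right end is the one that
  matches the implicit step, whose slope belongs to the new point.\<close>

lemma RS_lower_bound:
  fixes X Y :: "real \<Rightarrow> 'b::euclidean_space"
  assumes uv: "u \<le> v" and J: "RS_has_integral (\<lambda>t. X t - a) Y u v J" "integral {u..v} (\<lambda>t. inner (X t - a) b) \<le> J"
    and X: "continuous_on {u..v} X" and osc: "\<And>r. r \<in> {u..v} \<Longrightarrow> norm (X r - X v) \<le> \<eta>"
    and V: "\<And>n p. is_partition u v n p \<Longrightarrow> (\<Sum>i<n. norm (Y (p (Suc i)) - Y (p i))) \<le> D"
  shows "- inner (X v - a) ((Y v - Y u) - (v - u) *\<^sub>R b) \<le> \<eta> * (D + norm b * (v - u))"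
proof -
  have \<eta>: "\<eta> \<ge> 0" using osc[of v] uv by simp
  have int: "(v - u) * (inner (X v - a) b - \<eta> * norm b) \<le> integral {u..v} (\<lambda>t. inner (X t - a) b)"
  proof -
    have "integral {u..v} (\<lambda>t. inner (X v - a) b - \<eta> * norm b) \<le> integral {u..v} (\<lambda>t. inner (X t - a) b)"
    proof (rule integral_le)
      show "(\<lambda>t. inner (X t - a) b) integrable_on {u..v}"
        by (intro integrable_continuous_interval continuous_intros X)
      fix t assume t: "t \<in> {u..v}"
      have "inner (X v - a) b - inner (X t - a) b = - inner (X t - X v) b" by (simp add: inner_diff_left)
      also have "\<dots> \<le> norm (X t - X v) * norm b" using Cauchy_Schwarz_ineq2[of "X t - X v" b] by linarith
      also have "\<dots> \<le> \<eta> * norm b" using osc[OF t] by (intro mult_right_mono) auto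
      finally show "inner (X v - a) b - \<eta> * norm b \<le> inner (X t - a) b" by simp
    qed (rule integrable_const_ivl)
    then show ?thesis using uv by simp
  qed
  have "J \<le> inner (X v - a) (Y v - Y u) + \<eta> * D"
  proof (rule field_le_epsilon)
    fix \<epsilon> :: real assume "\<epsilon> > 0"
    with J(1) obtain \<delta> where d: "\<delta> > 0" and RS0: "\<forall>n p q. is_partition u v n p \<and> (\<forall>i<n. p (Suc i) - p i < \<delta>)
        \<and> (\<forall>i<n. p i \<le> q i \<and> q i \<le> p (Suc i))
        \<longrightarrow> \<bar>(\<Sum>i<n. inner (X (q i) - a) (Y (p (Suc i)) - Y (p i))) - J\<bar> < \<epsilon>"
      unfolding RS_has_integral_def by blast
    have RS: "\<And>n p q. is_partition u v n p \<Longrightarrow> (\<And>i. i < n \<Longrightarrow> p (Suc i) - p i < \<delta>) \<Longrightarrow>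
      (\<And>i. i < n \<Longrightarrow> p i \<le> q i \<and> q i \<le> p (Suc i)) \<Longrightarrow> \<bar>(\<Sum>i<n. inner (X (q i) - a) (Y (p (Suc i)) - Y (p i))) - J\<bar> < \<epsilon>" for n p q
      using RS0 by blast
    obtain n :: nat where n: "(v - u) / \<delta> < real n" using reals_Archimedean2 by blast
    then have n0: "n > 0" using uv d by (auto intro!: Nat.gr0I simp: divide_less_0_iff not_less[symmetric])
    define p where "p i = u + real i * ((v - u) / real n)" for i
    have pS: "p (Suc i) - p i = (v - u) / real n" for i unfolding p_def by (simp only: of_nat_Suc distrib_right)
    have "(v - u) / real n < \<delta>" using n n0 d by (simp add: field_simps)
    then have mesh: "p (Suc i) - p i < \<delta>" for i unfolding pS .
    have pm: "p i \<le> p (Suc i)" for i using pS[of i] uv by (smt (verit) divide_nonneg_nonneg of_nat_0_le_iff)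
    have p0: "p 0 = u" and pn: "p n = v" using n0 by (simp_all add: p_def)
    have part: "is_partition u v n p" using p0 pn pm by (simp add: is_partition_def)
    have pin: "p i \<in> {u..v}" if "i \<le> n" for i
      using grid_mono[of n p 0 i, OF pm] grid_mono[of n p i n, OF pm] that p0 pn by auto
    have "J \<le> (\<Sum>i<n. inner (X (p i) - a) (Y (p (Suc i)) - Y (p i))) + \<epsilon>"
      using RS[OF part mesh, of p] pm by fastforce
    also have "(\<Sum>i<n. inner (X (p i) - a) (Y (p (Suc i)) - Y (p i))) \<le> (\<Sum>i<n. inner (X v - a) (Y (p (Suc i)) - Y (p i)) + \<eta> * norm (Y (p (Suc i)) - Y (p i)))"
    proof (rule sum_mono)
      fix i assume "i \<in> {..<n}"
      then have "inner (X (p i) - X v) (Y (p (Suc i)) - Y (p i)) \<le> \<eta> * norm (Y (p (Suc i)) - Y (p i))"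
        using osc[OF pin[of i]] by (intro order_trans[OF norm_cauchy_schwarz] mult_right_mono) auto
      then show "inner (X (p i) - a) (Y (p (Suc i)) - Y (p i)) \<le> inner (X v - a) (Y (p (Suc i)) - Y (p i)) + \<eta> * norm (Y (p (Suc i)) - Y (p i))"
        by (simp add: inner_diff_left)
    qed
    also have "\<dots> = inner (X v - a) (\<Sum>i<n. Y (p (Suc i)) - Y (p i)) + \<eta> * (\<Sum>i<n. norm (Y (p (Suc i)) - Y (p i)))"
      by (simp add: sum.distrib inner_sum_right sum_distrib_left)
    also have "(\<Sum>i<n. Y (p (Suc i)) - Y (p i)) = Y v - Y u"
      by (subst sum_lessThan_telescope[of "\<lambda>i. Y (p i)"]) (simp add: p0 pn)
    also have "\<eta> * (\<Sum>i<n. norm (Y (p (Suc i)) - Y (p i))) \<le> \<eta> * D" by (intro mult_left_mono V[OF part] \<eta>)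
    finally show "J \<le> inner (X v - a) (Y v - Y u) + \<eta> * D + \<epsilon>" by simp
  qed
  then show ?thesis using int J(2) by (simp add: inner_diff_right algebra_simps)
qed

text \<open>A discrete substitute for the Ito formula: noise \<open>i\<close> is paired with the old
  vector, drift \<open>y\<close> with the new one. With D = U' - U, orthogonality of
  \<open>z\<close> gives |D|^2 = <D, i> - <D, y>, and |D - i|^2 \<ge> 0 absorbs the drift, leaving
  only |i|^2.\<close>

lemma square_increment_le:
  fixes U U' :: "'b::real_inner"
  assumes U': "U' = U + (i - y) + z" and "inner U z = 0" "inner U' z = 0"
  shows "(norm U')\<^sup>2 - (norm U)\<^sup>2 \<le> 2 * inner U i + (norm i)\<^sup>2 - 2 * inner U' y"
proof -
  define D where "D = i - y + z"
  have UD: "U' = U + D" by (simp add: U' D_def)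
  have "inner D z = 0" using assms(2,3) unfolding UD by (simp add: inner_add_left)
  moreover have "inner D D = inner D i - inner D y + inner D z"
    by (subst (2) D_def) (simp add: inner_diff_right inner_add_right)
  moreover have "inner (D - i) (D - i) \<ge> 0" by simp
  ultimately have "inner D D \<le> inner i i - 2 * inner D y"
    by (simp add: inner_diff_left inner_diff_right inner_commute)
  moreover have "inner U D = inner U i - inner U y" using assms(2) by (simp add: D_def inner_add_right inner_diff_right)
  ultimately show ?thesis
    by (simp add: UD power2_norm_eq_inner inner_add_left inner_add_right inner_commute)
qed

text \<open>The square of \<open>u\<close> stopped at its first value above \<open>C\<close>. The
  increment leading out is still counted, so the final value is at least C^2 once the level has been
  passed; yet every counted increment starts at a value of at most \<open>C\<close>, which bounds
  the weights of the noise.\<close>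

definition stopped_square :: "(nat \<Rightarrow> real) \<Rightarrow> real \<Rightarrow> nat \<Rightarrow> real" where
  "stopped_square u C n = (u 0)\<^sup>2 + (\<Sum>i<n. if \<forall>j\<le>i. u j \<le> C then (u (Suc i))\<^sup>2 - (u i)\<^sup>2 else 0)"

lemma stopped_square_cases:
  assumes "C \<ge> 0"
  shows "if \<forall>j<n. u j \<le> C then stopped_square u C n = (u n)\<^sup>2 else C\<^sup>2 \<le> stopped_square u C n"
proof (induction n)
  case (Suc n)
  have S: "stopped_square u C (Suc n) = stopped_square u C n + (if \<forall>j\<le>n. u j \<le> C then (u (Suc n))\<^sup>2 - (u n)\<^sup>2 else 0)"
    by (simp add: stopped_square_def)
  have le: "(\<forall>j<Suc n. u j \<le> C) \<longleftrightarrow> (\<forall>j\<le>n. u j \<le> C)" by (simp add: less_Suc_eq_le)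
  show ?case
  proof (cases "\<forall>j\<le>n. u j \<le> C")
    case True
    then have "\<forall>j<n. u j \<le> C" by simp
    then show ?thesis using Suc True S le by simp
  next
    case False
    show ?thesis
    proof (cases "\<forall>j<n. u j \<le> C")
      case True
      then have "u n > C" using False by (metis le_neq_implies_less not_less)
      then have "C\<^sup>2 \<le> (u n)\<^sup>2" using assms by (intro power_mono) auto
      then show ?thesis using Suc True unfolding S le if_not_P[OF False] by simp
    next
      case F2: False
      then show ?thesis using Suc unfolding S le if_not_P[OF False] by simp
    qed
  qed
qed (simp add: stopped_square_def)

lemma stopped_square_exceeds:
  assumes "C \<ge> 0" "j \<le> n" "u j > C" shows "C\<^sup>2 \<le> stopped_square u C n"
proof (cases "\<forall>j<n. u j \<le> C")
  case True
  then have "j = n" using assms by (metis le_neq_implies_less not_less)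
  then have "C\<^sup>2 \<le> (u n)\<^sup>2" using assms by (intro power_mono) auto
  then show ?thesis using stopped_square_cases[OF assms(1), of n u] True by simp
qed (use stopped_square_cases[OF assms(1), of n u] in simp)

lemma stopped_square_nonneg: "C \<ge> 0 \<Longrightarrow> stopped_square u C n \<ge> 0"
  using stopped_square_cases[of C n u] order_trans[OF zero_le_power2[of C], of "stopped_square u C n"]
  by (cases "\<forall>j<n. u j \<le> C") simp_all

lemma ennreal_le_liminfI:
  fixes g :: "nat \<Rightarrow> ennreal"
  assumes "\<And>\<epsilon>::real. \<epsilon> > 0 \<Longrightarrow> \<forall>\<^sub>F n in sequentially. x \<le> g n + ennreal \<epsilon>"
  shows "x \<le> liminf g"
proof (rule ennreal_le_epsilon)
  fix \<epsilon> :: real assume "\<epsilon> > 0"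
  from assms[OF this] have "\<forall>\<^sub>F n in sequentially. x - ennreal \<epsilon> \<le> g n"
    by eventually_elim (simp add: ennreal_minus_le_iff add.commute)
  then have "x - ennreal \<epsilon> \<le> liminf g" by (rule Liminf_bounded)
  then show "x \<le> liminf g + ennreal \<epsilon>" by (simp add: ennreal_minus_le_iff add.commute)
qed

subsection \<open>Energy estimates\<close>

text \<open>The variational inequality appears here for constant graph pairs (a, b); the Euler
  scheme inserts one such pair on every cell. \<open>N\<close> stands for the martingale part
  orthogonal to the domain.\<close>

locale monotone_sde = ito_integral M F B H I
  for M :: "'a measure" and F and B :: "'a \<Rightarrow> real \<Rightarrow> real ^ 'l" and H :: "'a \<Rightarrow> real \<Rightarrow> real ^ 'l ^ 'd" and I +
  fixes A :: "real ^ 'd \<Rightarrow> (real ^ 'd) set" and X Y N :: "'a \<Rightarrow> real \<Rightarrow> real ^ 'd" and X0 :: "'a \<Rightarrow> real ^ 'd"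
  assumes max: "maximal_monotone A"
    and X_adapted: "t \<ge> 0 \<Longrightarrow> (\<lambda>\<omega>. X \<omega> t) \<in> borel_measurable (F t)"
    and X_continuous: "\<omega> \<in> space M \<Longrightarrow> continuous_on {0..} (X \<omega>)"
    and X_domain: "AE \<omega> in M. \<forall>t\<ge>0. X \<omega> t \<in> closure (dom_op A)"
    and Y_bv: "\<omega> \<in> space M \<Longrightarrow> T \<ge> 0 \<Longrightarrow> bounded_variation_on 0 T (Y \<omega>)"
    and Y_monotone: "b \<in> A a \<Longrightarrow> AE \<omega> in M. \<forall>u v. 0 \<le> u \<longrightarrow> u \<le> v \<longrightarrow>
        (\<exists>J. RS_has_integral (\<lambda>t. X \<omega> t - a) (Y \<omega>) u v J \<and> J \<ge> integral {u..v} (\<lambda>t. inner (X \<omega> t - a) b))"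
    and N_orth: "AE \<omega> in M. \<forall>t\<ge>0. \<forall>x \<in> dom_op A. \<forall>y \<in> dom_op A. inner (N \<omega> t) (x - y) = 0"
    and equation: "AE \<omega> in M. \<forall>t\<ge>0. X \<omega> t = X0 \<omega> - Y \<omega> t + N \<omega> t + I \<omega> t"
begin

lemma X_measurable: "t \<ge> 0 \<Longrightarrow> (\<lambda>\<omega>. X \<omega> t) \<in> borel_measurable M"
  by (rule measurable_from_subalg[OF filtration_subalgebra X_adapted])

text \<open>The trace of the quadratic variation accumulated by the integral on (u, v]; half-open
  intervals make it additive over partitions.\<close>

definition quad :: "real \<Rightarrow> real \<Rightarrow> 'a \<Rightarrow> ennreal" where
  "quad u v \<omega> = (\<integral>\<^sup>+s. ennreal ((norm (H_pos \<omega> s))\<^sup>2) * indicator {u<..v} s \<partial>lborel)"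

lemma quad_measurable [measurable]: "quad u v \<in> borel_measurable M"
proof -
  have "(\<lambda>p. ennreal ((norm (case p of (\<omega>, s) \<Rightarrow> H_pos \<omega> s))\<^sup>2) * indicator {u<..v} (snd p)) \<in> borel_measurable (M \<Otimes>\<^sub>M borel)"
    by measurable
  then show ?thesis
    unfolding quad_def[abs_def] by (intro lborel.borel_measurable_nn_integral) (simp add: case_prod_beta' cong: measurable_cong_sets sets_pair_measure_cong)
qed

lemma quad_sum:
  assumes \<omega>: "\<omega> \<in> space M" and p: "\<And>i. p i \<le> p (Suc i)"
  shows "(\<Sum>i<m. quad (p i) (p (Suc i)) \<omega>) = quad (p 0) (p m) \<omega>"
proof -
  note [measurable] = section_measurable[OF H_pos_measurable \<omega>]
  have pm: "p 0 \<le> p i" for i using grid_mono[of i p 0 i] p by simp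
  have ind: "(\<Sum>i<m. indicator {p i<..p (Suc i)} s) = (indicator {p 0<..p m} s :: ennreal)" for s
  proof (induction m)
    case (Suc m)
    then show ?case using pm[of m] p[of m] by (auto simp: indicator_def)
  qed simp
  have "(\<Sum>i<m. quad (p i) (p (Suc i)) \<omega>) = (\<integral>\<^sup>+s. (\<Sum>i<m. ennreal ((norm (H_pos \<omega> s))\<^sup>2) * indicator {p i<..p (Suc i)} s) \<partial>lborel)"
    unfolding quad_def by (rule nn_integral_sum[symmetric]) measurable
  then show ?thesis by (simp only: sum_distrib_left[symmetric] ind quad_def)
qed

lemma quad_mono: "u' \<le> u \<Longrightarrow> v \<le> v' \<Longrightarrow> quad u v \<omega> \<le> quad u' v' \<omega>"
  unfolding quad_def by (intro nn_integral_mono mult_left_mono) (auto simp: indicator_def)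

lemma quad_finite: "u \<ge> 0 \<Longrightarrow> (\<integral>\<^sup>+\<omega>. quad u v \<omega> \<partial>M) < \<infinity>"
proof -
  assume u: "u \<ge> 0"
  have "(\<integral>\<^sup>+\<omega>. quad u v \<omega> \<partial>M) \<le> (\<integral>\<^sup>+ \<omega>. (\<integral>\<^sup>+ t. ennreal ((norm (H \<omega> t))\<^sup>2) * indicator {0..} t \<partial>lborel) \<partial>M)"
    unfolding quad_def using u by (intro nn_integral_mono) (auto simp: H_pos_def indicator_def)
  also note square_fin
  finally show ?thesis .
qed

text \<open>The solution lies only in the closure of the domain, but orthogonality to differences
  places the domain in a hyperplane, which is closed.\<close>

lemma orthogonal_closure:
  assumes "\<And>x y. x \<in> dom_op A \<Longrightarrow> y \<in> dom_op A \<Longrightarrow> inner z (x - y) = 0" "x \<in> closure (dom_op A)" "y \<in> dom_op A"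
  shows "inner (x - y) z = 0"
proof -
  have "closure (dom_op A) \<subseteq> {x. inner z x = inner z y}"
  proof (rule closure_minimal[OF subsetI closed_hyperplane])
    fix x assume "x \<in> dom_op A"
    from assms(1)[OF this assms(3)] show "x \<in> {x. inner z x = inner z y}" by (simp add: inner_diff_right)
  qed
  then have "inner z x = inner z y" using assms(2) by blast
  then show ?thesis by (simp add: inner_commute[of _ z] inner_diff_right)
qed

text \<open>Pathwise energy estimate along a dyadic partition, with the comparison points taken from the Euler scheme
  of the same step size; only the constants \<open>(euler, slope)\<close> enter the variational inequality for \<open>Y\<close>.\<close>

lemma pathwise_energy:
  assumes y0: "y0 \<in> A x0" and t0: "0 \<le> t0" and T: "0 \<le> T"
  shows "AE \<omega> in M. \<forall>\<epsilon>>0. \<forall>\<^sub>F n in sequentially.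
    stopped_square (\<lambda>i. norm (X \<omega> (t0 + real i / 2 ^ n) - euler A x0 n i)) C (grid_index T n) \<le>
    (norm (X \<omega> t0 - x0))\<^sup>2 + (\<Sum>i<grid_index T n. if \<forall>j\<le>i. norm (X \<omega> (t0 + real j / 2 ^ n) - euler A x0 n j) \<le> C then
       2 * inner (X \<omega> (t0 + real i / 2 ^ n) - euler A x0 n i) (I \<omega> (t0 + real (Suc i) / 2 ^ n) - I \<omega> (t0 + real i / 2 ^ n))
       + (norm (I \<omega> (t0 + real (Suc i) / 2 ^ n) - I \<omega> (t0 + real i / 2 ^ n)))\<^sup>2 else 0) + \<epsilon>"
proof -
  interpret fl: monotone_flow A x0 y0 by (unfold_locales) (use max y0 in auto)
  have e_dom: "euler A x0 n i \<in> dom_op A" for n i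
    using fl.slope_mem[of n "i - 1"] y0 by (cases i) (auto simp: dom_op_def)
  \<comment> \<open>The schemes of all levels use countably many graph pairs, so one null set serves
    them all.\<close>
  have "AE \<omega> in M. \<forall>n i. \<forall>u v. 0 \<le> u \<longrightarrow> u \<le> v \<longrightarrow>
        (\<exists>J. RS_has_integral (\<lambda>t. X \<omega> t - euler A x0 n (Suc i)) (Y \<omega>) u v J \<and> J \<ge> integral {u..v} (\<lambda>t. inner (X \<omega> t - euler A x0 n (Suc i)) (euler_slope A x0 n i)))"
    unfolding AE_all_countable by (intro allI Y_monotone fl.slope_mem)
  with X_domain N_orth equation AE_space show ?thesis
  proof eventually_elim
    case (elim \<omega>)
    note Xd = elim(1) and No = elim(2) and eq = elim(3) and \<omega> = elim(4) and mon = elim(5)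
    let ?S = "t0 + T"
    have S: "?S \<ge> 0" using t0 T by simp
    obtain V where V: "\<And>u w n p. 0 \<le> u \<Longrightarrow> u \<le> w \<Longrightarrow> w \<le> ?S \<Longrightarrow> is_partition u w n p \<Longrightarrow>
        (\<Sum>i<n. norm (Y \<omega> (p (Suc i)) - Y \<omega> (p i))) \<le> V w - V u"
      using bounded_variation_control[OF Y_bv[OF \<omega> S]] by blast
    have V0: "V u \<le> V w" if "0 \<le> u" "u \<le> w" "w \<le> ?S" for u w
    proof -
      have "norm (Y \<omega> w - Y \<omega> u) \<le> V w - V u" using V[OF that is_partition_trivial[OF that(2)]] by simp
      then have "0 \<le> V w - V u" by (rule order_trans[OF norm_ge_zero])
      then show ?thesis by simp
    qed
    \<comment> \<open>The total available for errors: the variation of \<open>Y\<close> on the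
      window plus the slope bound times its length. The later \<eta> is chosen so that 2 \<eta> D is
      at most \<epsilon>.\<close>
    define D where "D = V ?S - V t0 + norm y0 * T"
    have D: "D \<ge> 0" using V0[of t0 ?S] t0 T by (simp add: D_def)
    show ?case
    proof (intro allI impI)
      fix \<epsilon> :: real assume \<epsilon>: "\<epsilon> > 0"
      define \<eta> where "\<eta> = \<epsilon> / (2 * (D + 1))"
      have \<eta>: "\<eta> > 0" using \<epsilon> D by (simp add: \<eta>_def)
      have \<eta>D: "2 * \<eta> * D \<le> \<epsilon>" using \<epsilon> D by (simp add: \<eta>_def field_simps)
      have "uniformly_continuous_on {0..?S} (X \<omega>)"
        by (intro compact_uniformly_continuous continuous_on_subset[OF X_continuous[OF \<omega>]]) auto
      then obtain \<delta> where \<delta>: "\<delta> > 0" and uc: "\<And>r r'. r \<in> {0..?S} \<Longrightarrow> r' \<in> {0..?S} \<Longrightarrow> dist r' r < \<delta> \<Longrightarrow> dist (X \<omega> r') (X \<omega> r) < \<eta>"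
        unfolding uniformly_continuous_on_def using \<eta> by blast
      have "(\<lambda>n. 1 / 2 ^ n :: real) \<longlonglongrightarrow> 0" by (rule half_power_LIMSEQ)
      then have "\<forall>\<^sub>F n in sequentially. 1 / 2 ^ n < \<delta>" by (rule order_tendstoD) (rule \<delta>)
      then show "\<forall>\<^sub>F n in sequentially.
        stopped_square (\<lambda>i. norm (X \<omega> (t0 + real i / 2 ^ n) - euler A x0 n i)) C (grid_index T n) \<le>
        (norm (X \<omega> t0 - x0))\<^sup>2 + (\<Sum>i<grid_index T n. if \<forall>j\<le>i. norm (X \<omega> (t0 + real j / 2 ^ n) - euler A x0 n j) \<le> C then
           2 * inner (X \<omega> (t0 + real i / 2 ^ n) - euler A x0 n i) (I \<omega> (t0 + real (Suc i) / 2 ^ n) - I \<omega> (t0 + real i / 2 ^ n))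
           + (norm (I \<omega> (t0 + real (Suc i) / 2 ^ n) - I \<omega> (t0 + real i / 2 ^ n)))\<^sup>2 else 0) + \<epsilon>"
      proof eventually_elim
        case (elim n)
        define h :: real where "h = 1 / 2 ^ n"
        have h0: "h > 0" by (simp add: h_def)
        define \<tau> where "\<tau> i = t0 + real i / 2 ^ n" for i :: nat
        define U where "U i = X \<omega> (\<tau> i) - euler A x0 n i" for i
        define DI where "DI i = I \<omega> (\<tau> (Suc i)) - I \<omega> (\<tau> i)" for i
        let ?K = "grid_index T n"
        let ?P = "\<lambda>i. \<forall>j\<le>i. norm (U j) \<le> C"
        have \<tau>S: "\<tau> (Suc i) = \<tau> i + h" for i by (simp add: \<tau>_def h_def add_divide_distrib)
        have \<tau>0: "t0 \<le> \<tau> i" for i by (simp add: \<tau>_def)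
        have \<tau>K: "\<tau> i \<le> ?S" if "i \<le> ?K" for i
        proof -
          have "real i / 2 ^ n \<le> real ?K / 2 ^ n" using that by (simp add: divide_right_mono)
          also have "\<dots> \<le> T" by (rule grid_index_le[OF T])
          finally show ?thesis by (simp add: \<tau>_def)
        qed
        have step: "(norm (U (Suc i)))\<^sup>2 - (norm (U i))\<^sup>2 \<le> 2 * inner (U i) (DI i) + (norm (DI i))\<^sup>2 + 2 * \<eta> * (V (\<tau> (Suc i)) - V (\<tau> i) + norm y0 * h)"
          if i: "i < ?K" for i
        proof -
          let ?u = "\<tau> i" and ?v = "\<tau> (Suc i)" and ?a = "euler A x0 n (Suc i)" and ?b = "euler_slope A x0 n i"
          have uv: "0 \<le> ?u" "?u \<le> ?v" "?v \<le> ?S" "0 \<le> ?v" using \<tau>0[of i] \<tau>0[of "Suc i"] t0 \<tau>S[of i] h0 \<tau>K[of "Suc i"] i by auto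
          obtain J where J: "RS_has_integral (\<lambda>t. X \<omega> t - ?a) (Y \<omega>) ?u ?v J" "integral {?u..?v} (\<lambda>t. inner (X \<omega> t - ?a) ?b) \<le> J"
            using mon uv by blast
          have "- inner (X \<omega> ?v - ?a) ((Y \<omega> ?v - Y \<omega> ?u) - (?v - ?u) *\<^sub>R ?b) \<le> \<eta> * ((V ?v - V ?u) + norm ?b * (?v - ?u))"
          proof (rule RS_lower_bound[OF uv(2) J])
            show "continuous_on {?u..?v} (X \<omega>)" using uv by (intro continuous_on_subset[OF X_continuous[OF \<omega>]]) auto
            show "norm (X \<omega> r - X \<omega> ?v) \<le> \<eta>" if r: "r \<in> {?u..?v}" for r
            proof -
              have "dist (X \<omega> r) (X \<omega> ?v) < \<eta>"
                using r uv \<tau>S[of i] elim by (intro uc) (auto simp: dist_real_def h_def[symmetric])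
              then show ?thesis by (simp add: dist_norm)
            qed
            show "(\<Sum>i<m. norm (Y \<omega> (p (Suc i)) - Y \<omega> (p i))) \<le> V ?v - V ?u" if "is_partition ?u ?v m p" for m p
              by (rule V[OF uv(1-3) that])
          qed
          also have "\<dots> \<le> \<eta> * (V ?v - V ?u + norm y0 * h)"
            using fl.slope_bound[of n i] \<eta> h0 \<tau>S[of i] by (intro mult_left_mono add_left_mono mult_mono) auto
          finally have low: "- inner (U (Suc i)) ((Y \<omega> ?v - Y \<omega> ?u) - h *\<^sub>R ?b) \<le> \<eta> * (V ?v - V ?u + norm y0 * h)"
            by (simp add: U_def \<tau>S)
          \<comment> \<open>The increment of \<open>N\<close> is orthogonal to both differences,
            since solution and scheme lie in the closure of the domain and in the domain.\<close>
          have "(norm (U (Suc i)))\<^sup>2 - (norm (U i))\<^sup>2 \<le> 2 * inner (U i) (DI i) + (norm (DI i))\<^sup>2 - 2 * inner (U (Suc i)) ((Y \<omega> ?v - Y \<omega> ?u) - h *\<^sub>R ?b)"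
          proof (rule square_increment_le[where z="N \<omega> ?v - N \<omega> ?u"])
            have "X \<omega> ?v - X \<omega> ?u = - (Y \<omega> ?v - Y \<omega> ?u) + (N \<omega> ?v - N \<omega> ?u) + DI i"
              using eq uv unfolding DI_def by (simp add: algebra_simps)
            moreover have "euler A x0 n (Suc i) = euler A x0 n i - h *\<^sub>R ?b" unfolding h_def by (rule fl.euler_Suc)
            ultimately show "U (Suc i) = U i + (DI i - (Y \<omega> ?v - Y \<omega> ?u - h *\<^sub>R ?b)) + (N \<omega> ?v - N \<omega> ?u)"
              unfolding U_def by (simp add: algebra_simps)
            have o: "inner (U k) (N \<omega> t) = 0" if "t \<ge> 0" for k t
              unfolding U_def
              by (rule orthogonal_closure) (use No Xd e_dom that \<tau>0[of k] t0 in auto)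
            show "inner (U i) (N \<omega> ?v - N \<omega> ?u) = 0" "inner (U (Suc i)) (N \<omega> ?v - N \<omega> ?u) = 0"
              using o uv by (simp_all add: inner_diff_right)
          qed
          with low show ?thesis by (simp add: algebra_simps)
        qed
        \<comment> \<open>Nonnegative errors may also be added on the steps after stopping, which
          lets the sum of errors telescope over the whole grid.\<close>
        have nn: "0 \<le> 2 * \<eta> * (V (\<tau> (Suc i)) - V (\<tau> i) + norm y0 * h)" if "i < ?K" for i
          using V0[of "\<tau> i" "\<tau> (Suc i)"] \<tau>0[of i] t0 \<tau>S[of i] h0 \<tau>K[of "Suc i"] that \<eta> by simp
        have "stopped_square (\<lambda>i. norm (U i)) C ?K \<le> (norm (U 0))\<^sup>2 +
          (\<Sum>i<?K. (if ?P i then 2 * inner (U i) (DI i) + (norm (DI i))\<^sup>2 else 0) + 2 * \<eta> * (V (\<tau> (Suc i)) - V (\<tau> i) + norm y0 * h))"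
          unfolding stopped_square_def
        proof (intro add_left_mono sum_mono)
          fix i assume "i \<in> {..<?K}"
          then show "(if ?P i then (norm (U (Suc i)))\<^sup>2 - (norm (U i))\<^sup>2 else 0) \<le> (if ?P i then 2 * inner (U i) (DI i) + (norm (DI i))\<^sup>2 else 0) + 2 * \<eta> * (V (\<tau> (Suc i)) - V (\<tau> i) + norm y0 * h)"
            using step[of i] nn[of i] by auto
        qed
        also have "\<dots> = (norm (U 0))\<^sup>2 + (\<Sum>i<?K. (if ?P i then 2 * inner (U i) (DI i) + (norm (DI i))\<^sup>2 else 0)) + 2 * \<eta> * (\<Sum>i<?K. (V (\<tau> (Suc i)) - V (\<tau> i)) + norm y0 * h)"
          by (subst sum.distrib) (simp only: sum_distrib_left add.assoc)
        also have "(\<Sum>i<?K. (V (\<tau> (Suc i)) - V (\<tau> i)) + norm y0 * h) = V (\<tau> ?K) - V (\<tau> 0) + real ?K * (norm y0 * h)"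
          by (simp add: sum.distrib sum_lessThan_telescope[of "\<lambda>i. V (\<tau> i)"])
        also have "2 * \<eta> * \<dots> \<le> 2 * \<eta> * D"
        proof (rule mult_left_mono)
          have "V (\<tau> ?K) \<le> V ?S" using \<tau>0[of ?K] t0 \<tau>K[of ?K] by (intro V0) auto
          moreover have "norm y0 * (real ?K * h) \<le> norm y0 * T"
            using grid_index_le[OF T, of n] by (intro mult_left_mono) (auto simp: h_def)
          ultimately show "V (\<tau> ?K) - V (\<tau> 0) + real ?K * (norm y0 * h) \<le> D"
            by (simp add: D_def \<tau>_def mult_ac)
        qed (use \<eta> in simp)
        also note \<eta>D
        finally have "stopped_square (\<lambda>i. norm (U i)) C ?K \<le> (norm (U 0))\<^sup>2 + (\<Sum>i<?K. (if ?P i then 2 * inner (U i) (DI i) + (norm (DI i))\<^sup>2 else 0)) + \<epsilon>"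
          by simp
        then show ?case unfolding U_def DI_def \<tau>_def by simp
      qed
    qed
  qed
qed

text \<open>The function \<Phi> is any lower bound for the stopped squares in the limit. Two choices
  are used: a truncated squared distance at one time, and C^2 on the event that the distance ever
  exceeds \<open>C\<close>. The noise sums are not known to converge, so the passage to the limit
  uses only that they have mean zero and uniformly bounded second moments.\<close>

theorem stopped_energy:
  fixes \<Phi> :: "'a \<Rightarrow> real"
  assumes y0: "y0 \<in> A x0" and t0: "0 \<le> t0" and T: "0 \<le> T" and E: "E \<in> sets (F t0)" and C: "0 < C"
    and \<Phi>m[measurable]: "\<Phi> \<in> borel_measurable M" and \<Phi>0: "\<And>\<omega>. \<Phi> \<omega> \<ge> 0"
    and \<Phi>: "AE \<omega> in M. \<omega> \<in> E \<longrightarrow> (\<forall>\<epsilon>>0. \<forall>\<^sub>F n in sequentially.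
      \<Phi> \<omega> \<le> stopped_square (\<lambda>i. norm (X \<omega> (t0 + real i / 2 ^ n) - euler A x0 n i)) C (grid_index T n) + \<epsilon>)"
  shows "(\<integral>\<^sup>+\<omega>. indicator E \<omega> * ennreal (\<Phi> \<omega>) \<partial>M) \<le> (\<integral>\<^sup>+\<omega>. indicator E \<omega> * ennreal ((norm (X \<omega> t0 - x0))\<^sup>2) \<partial>M)
    + ennreal (2 * brownian_const) * (\<integral>\<^sup>+\<omega>. indicator E \<omega> * quad t0 (t0 + T) \<omega> \<partial>M)"
proof -
  define \<tau> where "\<tau> n i = t0 + real i / 2 ^ n" for n i :: nat
  define K where "K n = grid_index T n" for n
  define U where "U n i \<omega> = X \<omega> (\<tau> n i) - euler A x0 n i" for n i \<omega>
  define DI where "DI n i \<omega> = I \<omega> (\<tau> n (Suc i)) - I \<omega> (\<tau> n i)" for n i \<omega>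
  \<comment> \<open>The event that the path is in \<open>E\<close> and has not been stopped before
    step \<open>i\<close>. It depends on times up to \<open>\<tau> n i\<close> only, so it can serve
    as a weight of the next noise increment.\<close>
  define P where "P n i = {\<omega> \<in> space M. \<omega> \<in> E \<and> (\<forall>j\<in>{..i}. norm (U n j \<omega>) \<le> C)}" for n i
  define w where "w n i \<omega> = (if \<omega> \<in> P n i then 2 *\<^sub>R U n i \<omega> else 0)" for n i \<omega>
  define W where "W n \<omega> = (\<Sum>i<K n. inner (w n i \<omega>) (DI n i \<omega>))" for n \<omega>
  define Q where "Q n \<omega> = (\<Sum>i<K n. indicator (P n i) \<omega> * ennreal ((norm (DI n i \<omega>))\<^sup>2))" for n \<omega>
  let ?c = "ennreal (2 * brownian_const)"
  define Z where "Z = (\<integral>\<^sup>+\<omega>. indicator E \<omega> * quad t0 (t0 + T) \<omega> \<partial>M)"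
  have EM[measurable]: "E \<in> sets M" by (rule filtration_sets[OF t0 E])
  have \<tau>: "0 \<le> \<tau> n i" "t0 \<le> \<tau> n i" "\<tau> n i \<le> \<tau> n (Suc i)" "\<tau> n 0 = t0" for n i
    using t0 by (auto simp: \<tau>_def divide_right_mono)
  have \<tau>m: "\<tau> n i \<le> \<tau> n j" if "i \<le> j" for n i j using that by (simp add: \<tau>_def divide_right_mono)
  have \<tau>K: "\<tau> n (K n) \<le> t0 + T" for n using grid_index_le[OF T, of n] by (simp add: \<tau>_def K_def)
  have UF: "U n j \<in> borel_measurable (F (\<tau> n i))" if "j \<le> i" for n i j
  proof -
    have "(\<lambda>\<omega>. X \<omega> (\<tau> n j)) \<in> borel_measurable (F (\<tau> n i))"
      by (rule filtration_mono[OF \<tau>(1) \<tau>m[OF that] X_adapted[OF \<tau>(1)]])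
    then show ?thesis unfolding U_def[abs_def] by measurable
  qed
  have DIF: "DI n i \<in> borel_measurable (F (\<tau> n j))" if "i < j" for n i j
  proof -
    have "(\<lambda>\<omega>. I \<omega> (\<tau> n k)) \<in> borel_measurable (F (\<tau> n j))" if "k \<le> j" for k
      by (rule filtration_mono[OF \<tau>(1) \<tau>m[OF that] I_adapted[OF \<tau>(1)]])
    then show ?thesis unfolding DI_def[abs_def] using that by (intro borel_measurable_diff) auto
  qed
  have DIM[measurable]: "DI n i \<in> borel_measurable M" for n i
    by (rule measurable_from_subalg[OF filtration_subalgebra[OF \<tau>(1)] DIF[of i "Suc i"]]) simp
  have PF: "P n i \<in> sets (F (\<tau> n i))" for n i
  proof -
    have [measurable]: "E \<in> sets (F (\<tau> n i))" by (rule filtration_sets_mono[OF t0 \<tau>(2) E])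
    have "{\<omega> \<in> space (F (\<tau> n i)). \<omega> \<in> E \<and> (\<forall>j\<in>{..i}. norm (U n j \<omega>) \<le> C)} \<in> sets (F (\<tau> n i))"
    proof (intro sets.sets_Collect_conj sets.sets_Collect_finite_All')
      show "{\<omega> \<in> space (F (\<tau> n i)). \<omega> \<in> E} \<in> sets (F (\<tau> n i))" by measurable
      fix j assume "j \<in> {..i}"
      then have "U n j \<in> borel_measurable (F (\<tau> n i))" by (intro UF) simp
      then show "{\<omega> \<in> space (F (\<tau> n i)). norm (U n j \<omega>) \<le> C} \<in> sets (F (\<tau> n i))" by measurable
    qed auto
    then show ?thesis by (simp add: P_def filtration_space[OF \<tau>(1)])
  qed
  have PM[measurable]: "P n i \<in> sets M" for n i by (rule filtration_sets[OF \<tau>(1) PF])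
  have PE: "P n i \<subseteq> E" for n i by (auto simp: P_def)
  have wF: "w n i \<in> borel_measurable (F (\<tau> n i))" for n i
    unfolding w_def[abs_def] using UF[of i i n] PF[of n i] by measurable
  have wb: "norm (w n i \<omega>) \<le> 2 * C" for n i \<omega> using C by (auto simp: w_def P_def)
  have incr: "orth_increment M (F (\<tau> n i)) (DI n i)" for n i
    unfolding DI_def[abs_def] by (rule ito_increment(1)[OF \<tau>(1) \<tau>(3)])
  have incr2: "(\<integral>\<^sup>+\<omega>. indicator (P n i) \<omega> * ennreal ((norm (DI n i \<omega>))\<^sup>2) \<partial>M) \<le> ?c * (\<integral>\<^sup>+\<omega>. indicator E \<omega> * quad (\<tau> n i) (\<tau> n (Suc i)) \<omega> \<partial>M)" for n i
  proof -
    have "(\<integral>\<^sup>+\<omega>. indicator (P n i) \<omega> * ennreal ((norm (DI n i \<omega>))\<^sup>2) \<partial>M) \<le> ?c * (\<integral>\<^sup>+\<omega>. indicator (P n i) \<omega> * quad (\<tau> n i) (\<tau> n (Suc i)) \<omega> \<partial>M)"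
      unfolding DI_def quad_def by (rule ito_increment(2)[OF \<tau>(1) \<tau>(3) PF])
    also have "\<dots> \<le> ?c * (\<integral>\<^sup>+\<omega>. indicator E \<omega> * quad (\<tau> n i) (\<tau> n (Suc i)) \<omega> \<partial>M)"
      using PE[of n i] by (intro mult_left_mono nn_integral_mono mult_right_mono) (auto simp: indicator_def)
    finally show ?thesis .
  qed
  have sumZ: "(\<Sum>i<K n. \<integral>\<^sup>+\<omega>. indicator E \<omega> * quad (\<tau> n i) (\<tau> n (Suc i)) \<omega> \<partial>M) \<le> Z" for n
  proof -
    have "(\<Sum>i<K n. \<integral>\<^sup>+\<omega>. indicator E \<omega> * quad (\<tau> n i) (\<tau> n (Suc i)) \<omega> \<partial>M) = (\<integral>\<^sup>+\<omega>. indicator E \<omega> * (\<Sum>i<K n. quad (\<tau> n i) (\<tau> n (Suc i)) \<omega>) \<partial>M)"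
      by (subst nn_integral_sum[symmetric]) (auto simp: sum_distrib_left)
    also have "\<dots> = (\<integral>\<^sup>+\<omega>. indicator E \<omega> * quad t0 (\<tau> n (K n)) \<omega> \<partial>M)"
      using quad_sum[of _ "\<tau> n", OF _ \<tau>(3)] by (intro nn_integral_cong) (simp add: \<tau>(4))
    also have "\<dots> \<le> Z" unfolding Z_def using \<tau>K by (intro nn_integral_mono mult_left_mono quad_mono) auto
    finally show ?thesis .
  qed
  have ZF: "Z < \<infinity>"
  proof -
    have "Z \<le> (\<integral>\<^sup>+\<omega>. quad t0 (t0 + T) \<omega> \<partial>M)"
      unfolding Z_def by (intro nn_integral_mono) (auto simp: indicator_def)
    also note quad_finite[OF t0]
    finally show ?thesis .
  qed
  have Torth: "orth_increment M (F (\<tau> n i)) (\<lambda>\<omega>. inner (w n i \<omega>) (DI n i \<omega>))" for n i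
    by (rule orth_increment_inner[OF filtration_subalgebra[OF \<tau>(1)] incr wF wb])
  have Tmeas: "(\<lambda>\<omega>. inner (w n i \<omega>) (DI n i \<omega>)) \<in> borel_measurable (F (\<tau> n j))" if "i < j" for n i j
    using DIF[OF that, of n] filtration_mono[OF \<tau>(1) \<tau>m wF, of i j n] that by (intro borel_measurable_inner) auto
  have T2: "(\<integral>\<^sup>+\<omega>. ennreal ((norm (inner (w n i \<omega>) (DI n i \<omega>)))\<^sup>2) \<partial>M) \<le> ennreal (4 * C\<^sup>2) * (?c * (\<integral>\<^sup>+\<omega>. indicator E \<omega> * quad (\<tau> n i) (\<tau> n (Suc i)) \<omega> \<partial>M))" for n i
  proof -
    have "(\<integral>\<^sup>+\<omega>. ennreal ((norm (inner (w n i \<omega>) (DI n i \<omega>)))\<^sup>2) \<partial>M) \<le> (\<integral>\<^sup>+\<omega>. ennreal (4 * C\<^sup>2) * (indicator (P n i) \<omega> * ennreal ((norm (DI n i \<omega>))\<^sup>2)) \<partial>M)"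
    proof (rule nn_integral_mono)
      fix \<omega>
      show "ennreal ((norm (inner (w n i \<omega>) (DI n i \<omega>)))\<^sup>2) \<le> ennreal (4 * C\<^sup>2) * (indicator (P n i) \<omega> * ennreal ((norm (DI n i \<omega>))\<^sup>2))"
      proof (cases "\<omega> \<in> P n i")
        case True
        have "norm (inner (w n i \<omega>) (DI n i \<omega>)) \<le> norm (w n i \<omega>) * norm (DI n i \<omega>)"
          using Cauchy_Schwarz_ineq2 by simp
        also have "\<dots> \<le> (2 * C) * norm (DI n i \<omega>)" by (intro mult_right_mono wb) simp
        finally have "(norm (inner (w n i \<omega>) (DI n i \<omega>)))\<^sup>2 \<le> ((2 * C) * norm (DI n i \<omega>))\<^sup>2" by (intro power_mono) auto
        then have "ennreal ((norm (inner (w n i \<omega>) (DI n i \<omega>)))\<^sup>2) \<le> ennreal (4 * C\<^sup>2 * (norm (DI n i \<omega>))\<^sup>2)"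
          by (intro ennreal_leI) (simp add: power_mult_distrib)
        then show ?thesis using True by (simp add: ennreal_mult)
      qed (simp add: w_def)
    qed
    also have "\<dots> = ennreal (4 * C\<^sup>2) * (\<integral>\<^sup>+\<omega>. indicator (P n i) \<omega> * ennreal ((norm (DI n i \<omega>))\<^sup>2) \<partial>M)"
      by (rule nn_integral_cmult) measurable
    also have "\<dots> \<le> ennreal (4 * C\<^sup>2) * (?c * (\<integral>\<^sup>+\<omega>. indicator E \<omega> * quad (\<tau> n i) (\<tau> n (Suc i)) \<omega> \<partial>M))"
      by (intro mult_left_mono incr2) simp
    finally show ?thesis .
  qed
  \<comment> \<open>Stopping bounds the weights by 2 C, hence the factor 4 C^2 and a second moment
    bound that does not depend on \<open>n\<close>.\<close>
  have WL2: "L2 M (W n)" and W2: "(\<integral>\<^sup>+\<omega>. ennreal ((norm (W n \<omega>))\<^sup>2) \<partial>M) \<le> ennreal (4 * C\<^sup>2) * (?c * Z)" for n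
  proof -
    have os: "L2 M (W n) \<and> (\<integral>\<^sup>+\<omega>. ennreal ((norm (W n \<omega>))\<^sup>2) \<partial>M) = (\<Sum>i<K n. \<integral>\<^sup>+\<omega>. ennreal ((norm (inner (w n i \<omega>) (DI n i \<omega>)))\<^sup>2) \<partial>M)"
      unfolding W_def[abs_def] by (rule orth_increment_sum[where G="\<lambda>i. F (\<tau> n i)"]) (rule Torth, rule Tmeas)
    then show "L2 M (W n)" by blast
    have "(\<integral>\<^sup>+\<omega>. ennreal ((norm (W n \<omega>))\<^sup>2) \<partial>M) \<le> (\<Sum>i<K n. ennreal (4 * C\<^sup>2) * (?c * (\<integral>\<^sup>+\<omega>. indicator E \<omega> * quad (\<tau> n i) (\<tau> n (Suc i)) \<omega> \<partial>M)))"
      unfolding conjunct2[OF os] by (rule sum_mono) (rule T2)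
    also have "\<dots> = ennreal (4 * C\<^sup>2) * (?c * (\<Sum>i<K n. \<integral>\<^sup>+\<omega>. indicator E \<omega> * quad (\<tau> n i) (\<tau> n (Suc i)) \<omega> \<partial>M))"
      by (simp only: sum_distrib_left)
    also have "\<dots> \<le> ennreal (4 * C\<^sup>2) * (?c * Z)" by (intro mult_left_mono sumZ) auto
    finally show "(\<integral>\<^sup>+\<omega>. ennreal ((norm (W n \<omega>))\<^sup>2) \<partial>M) \<le> ennreal (4 * C\<^sup>2) * (?c * Z)" .
  qed
  have WM[measurable]: "W n \<in> borel_measurable M" for n by (rule L2_measurable[OF WL2])
  have W0: "(\<integral>\<omega>. W n \<omega> \<partial>M) = 0" for n
  proof -
    have one: "L2 M (\<lambda>_. 1 :: real)" by (simp add: L2_def emeasure_space_1)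
    have "(\<integral>\<omega>. W n \<omega> \<partial>M) = (\<Sum>i<K n. \<integral>\<omega>. inner (w n i \<omega>) (DI n i \<omega>) \<partial>M)"
      unfolding W_def using Torth by (intro Bochner_Integration.integral_sum L2_integrable) (auto simp: orth_increment_def)
    also have "\<dots> = 0"
    proof (rule sum.neutral, rule ballI)
      fix i
      have "(\<integral>\<omega>. inner 1 (inner (w n i \<omega>) (DI n i \<omega>)) \<partial>M) = 0"
        using Torth[of n i] one unfolding orth_increment_def by (elim conjE allE[of _ "\<lambda>_. 1"]) simp
      then show "(\<integral>\<omega>. inner (w n i \<omega>) (DI n i \<omega>) \<partial>M) = 0" by simp
    qed
    finally show ?thesis .
  qed
  have QM[measurable]: "Q n \<in> borel_measurable M" for n unfolding Q_def[abs_def] by measurable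
  have Q1: "(\<integral>\<^sup>+\<omega>. Q n \<omega> \<partial>M) \<le> ?c * Z" for n
  proof -
    have "(\<integral>\<^sup>+\<omega>. Q n \<omega> \<partial>M) = (\<Sum>i<K n. \<integral>\<^sup>+\<omega>. indicator (P n i) \<omega> * ennreal ((norm (DI n i \<omega>))\<^sup>2) \<partial>M)"
      unfolding Q_def by (rule nn_integral_sum) measurable
    also have "\<dots> \<le> (\<Sum>i<K n. ?c * (\<integral>\<^sup>+\<omega>. indicator E \<omega> * quad (\<tau> n i) (\<tau> n (Suc i)) \<omega> \<partial>M))"
      by (rule sum_mono) (rule incr2)
    also have "\<dots> = ?c * (\<Sum>i<K n. \<integral>\<^sup>+\<omega>. indicator E \<omega> * quad (\<tau> n i) (\<tau> n (Suc i)) \<omega> \<partial>M)" by (simp only: sum_distrib_left)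
    also have "\<dots> \<le> ?c * Z" by (intro mult_left_mono sumZ) auto
    finally show ?thesis .
  qed
  define R where "R = (\<integral>\<^sup>+\<omega>. indicator E \<omega> * ennreal ((norm (X \<omega> t0 - x0))\<^sup>2) \<partial>M)"
  have X0M[measurable]: "(\<lambda>\<omega>. X \<omega> t0) \<in> borel_measurable M" by (rule X_measurable[OF t0])
  have path: "AE \<omega> in M. \<omega> \<in> E \<longrightarrow> (\<forall>\<epsilon>>0. \<forall>\<^sub>F n in sequentially.
      \<Phi> \<omega> \<le> (norm (X \<omega> t0 - x0))\<^sup>2 + W n \<omega> + enn2real (Q n \<omega>) + \<epsilon>)"
    using \<Phi> pathwise_energy[OF y0 t0 T, of C] AE_space
  proof eventually_elim
    case (elim \<omega>)
    show ?case
    proof (intro impI allI)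
      fix \<epsilon> :: real assume E': "\<omega> \<in> E" and "\<epsilon> > 0"
      then have "\<epsilon> / 2 > 0" by simp
      from elim(1)[rule_format, OF E' this] elim(2)[rule_format, OF this]
      show "\<forall>\<^sub>F n in sequentially. \<Phi> \<omega> \<le> (norm (X \<omega> t0 - x0))\<^sup>2 + W n \<omega> + enn2real (Q n \<omega>) + \<epsilon>"
      proof eventually_elim
        case (elim n)
        have PP: "\<omega> \<in> P n i \<longleftrightarrow> (\<forall>j\<le>i. norm (U n j \<omega>) \<le> C)" for i
          using E' \<open>\<omega> \<in> space M\<close> by (auto simp: P_def)
        have "Q n \<omega> = ennreal (\<Sum>i<K n. if \<omega> \<in> P n i then (norm (DI n i \<omega>))\<^sup>2 else 0)"
        proof -
          have "Q n \<omega> = (\<Sum>i<K n. ennreal (if \<omega> \<in> P n i then (norm (DI n i \<omega>))\<^sup>2 else 0))"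
            unfolding Q_def by (rule sum.cong) (simp_all add: indicator_def)
          also have "\<dots> = ennreal (\<Sum>i<K n. if \<omega> \<in> P n i then (norm (DI n i \<omega>))\<^sup>2 else 0)"
            by (rule sum_ennreal) simp
          finally show ?thesis .
        qed
        then have Qr: "enn2real (Q n \<omega>) = (\<Sum>i<K n. if \<omega> \<in> P n i then (norm (DI n i \<omega>))\<^sup>2 else 0)"
          by (simp add: sum_nonneg)
        have "(\<Sum>i<K n. if \<forall>j\<le>i. norm (U n j \<omega>) \<le> C then 2 * inner (U n i \<omega>) (DI n i \<omega>) + (norm (DI n i \<omega>))\<^sup>2 else 0) = W n \<omega> + enn2real (Q n \<omega>)"
          unfolding Qr W_def sum.distrib[symmetric] PP[symmetric] by (intro sum.cong) (auto simp: w_def)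
        then show ?case using elim unfolding U_def DI_def \<tau>_def K_def by linarith
      qed
    qed
  qed
  have Qfin: "Q n \<omega> = ennreal (enn2real (Q n \<omega>))" for n \<omega>
    unfolding Q_def by (simp add: ennreal_mult_less_top indicator_def less_top[symmetric])
  \<comment> \<open>The sum \<open>W n\<close> may be negative. Replacing it by the nonnegative
    \<open>h (W n)\<close> permits Fatou's lemma; the price is a term proportional to \<delta>, and
    the constant 1 / (4 \<delta>) appears on both sides and cancels.\<close>
  have main: "(\<integral>\<^sup>+\<omega>. indicator E \<omega> * ennreal (\<Phi> \<omega>) \<partial>M) \<le> R + ?c * Z + ennreal \<delta> * (ennreal (4 * C\<^sup>2) * (?c * Z))" if d: "\<delta> > 0" for \<delta> :: real
  proof -
    define h where "h x = x + \<delta> * x\<^sup>2 + 1 / (4 * \<delta>)" for x :: real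
    have h0: "h x \<ge> 0" for x unfolding h_def by (rule square_completion_nonneg[OF d])
    have hm[measurable]: "h \<in> borel_measurable borel" unfolding h_def[abs_def] by measurable
    have hW: "(\<integral>\<^sup>+\<omega>. ennreal (h (W n \<omega>)) \<partial>M) \<le> ennreal \<delta> * (ennreal (4 * C\<^sup>2) * (?c * Z)) + ennreal (1 / (4 * \<delta>))" for n
    proof -
      have i: "integrable M (W n)" "integrable M (\<lambda>\<omega>. (W n \<omega>)\<^sup>2)"
        using L2_integrable[OF WL2] WL2[of n] by (auto simp: L2_integrable_square)
      have ih: "integrable M (\<lambda>\<omega>. h (W n \<omega>))" unfolding h_def using i by simp
      have "(\<integral>\<^sup>+\<omega>. ennreal (h (W n \<omega>)) \<partial>M) = ennreal (\<integral>\<omega>. h (W n \<omega>) \<partial>M)"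
        by (rule nn_integral_eq_integral[OF ih]) (simp add: h0)
      also have "(\<integral>\<omega>. h (W n \<omega>) \<partial>M) = \<delta> * (\<integral>\<omega>. (W n \<omega>)\<^sup>2 \<partial>M) + 1 / (4 * \<delta>)"
        unfolding h_def using i W0[of n] by (simp add: prob_space)
      also have "ennreal \<dots> = ennreal \<delta> * ennreal (\<integral>\<omega>. (W n \<omega>)\<^sup>2 \<partial>M) + ennreal (1 / (4 * \<delta>))"
        using d by (simp add: ennreal_mult)
      also have "ennreal (\<integral>\<omega>. (W n \<omega>)\<^sup>2 \<partial>M) = (\<integral>\<^sup>+\<omega>. ennreal ((norm (W n \<omega>))\<^sup>2) \<partial>M)"
        using L2_nn_integral_eq[OF WL2[of n]] by simp
      finally show ?thesis using W2[of n] by (simp add: mult_left_mono add_right_mono)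
    qed
    define g where "g n \<omega> = indicator E \<omega> * ennreal ((norm (X \<omega> t0 - x0))\<^sup>2) + Q n \<omega> + ennreal (h (W n \<omega>))" for n \<omega>
    have "AE \<omega> in M. indicator E \<omega> * ennreal (\<Phi> \<omega>) + ennreal (1 / (4 * \<delta>)) \<le> liminf (\<lambda>n. g n \<omega>)"
      using path
    proof eventually_elim
      case (elim \<omega>)
      show ?case
      proof (rule ennreal_le_liminfI)
        fix \<epsilon> :: real assume \<epsilon>: "\<epsilon> > 0"
        show "\<forall>\<^sub>F n in sequentially. indicator E \<omega> * ennreal (\<Phi> \<omega>) + ennreal (1 / (4 * \<delta>)) \<le> g n \<omega> + ennreal \<epsilon>"
        proof (cases "\<omega> \<in> E")
          case True
          from elim[rule_format, OF True \<epsilon>] show ?thesis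
          proof eventually_elim
            case (elim n)
            have "0 \<le> \<delta> * (W n \<omega>)\<^sup>2" using d by simp
            then have "\<Phi> \<omega> + 1 / (4 * \<delta>) \<le> ((norm (X \<omega> t0 - x0))\<^sup>2 + enn2real (Q n \<omega>) + h (W n \<omega>)) + \<epsilon>"
              using elim unfolding h_def by linarith
            then have "ennreal (\<Phi> \<omega> + 1 / (4 * \<delta>)) \<le> ennreal (((norm (X \<omega> t0 - x0))\<^sup>2 + enn2real (Q n \<omega>) + h (W n \<omega>)) + \<epsilon>)"
              by (rule ennreal_leI)
            then have "ennreal (\<Phi> \<omega>) + ennreal (1 / (4 * \<delta>)) \<le> ennreal ((norm (X \<omega> t0 - x0))\<^sup>2) + ennreal (enn2real (Q n \<omega>)) + ennreal (h (W n \<omega>)) + ennreal \<epsilon>"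
              using \<Phi>0 d h0 \<epsilon> by (simp add: ennreal_plus)
            then show ?case using True by (simp add: g_def Qfin[symmetric])
          qed
        next
          \<comment> \<open>Outside \<open>E\<close> all weights vanish, so \<open>h (W n)\<close>
            is exactly the constant that was added.\<close>
          case False
          then have "W n \<omega> = 0" for n unfolding W_def w_def using PE by (intro sum.neutral) auto
          then have "g n \<omega> \<ge> ennreal (1 / (4 * \<delta>))" for n
            by (simp add: g_def h_def)
          then show ?thesis using False by (simp add: add_increasing2)
        qed
      qed
    qed
    then have "(\<integral>\<^sup>+\<omega>. indicator E \<omega> * ennreal (\<Phi> \<omega>) + ennreal (1 / (4 * \<delta>)) \<partial>M) \<le> (\<integral>\<^sup>+\<omega>. liminf (\<lambda>n. g n \<omega>) \<partial>M)"
      by (rule nn_integral_mono_AE)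
    also have "\<dots> \<le> liminf (\<lambda>n. \<integral>\<^sup>+\<omega>. g n \<omega> \<partial>M)"
      unfolding g_def by (rule nn_integral_liminf) measurable
    also have "\<dots> \<le> liminf (\<lambda>n::nat. R + ?c * Z + (ennreal \<delta> * (ennreal (4 * C\<^sup>2) * (?c * Z)) + ennreal (1 / (4 * \<delta>))))"
    proof (intro Liminf_mono always_eventually allI)
      fix n
      have "(\<integral>\<^sup>+\<omega>. g n \<omega> \<partial>M) = R + (\<integral>\<^sup>+\<omega>. Q n \<omega> \<partial>M) + (\<integral>\<^sup>+\<omega>. ennreal (h (W n \<omega>)) \<partial>M)"
        unfolding g_def R_def by (simp add: nn_integral_add)
      also have "\<dots> \<le> R + ?c * Z + (ennreal \<delta> * (ennreal (4 * C\<^sup>2) * (?c * Z)) + ennreal (1 / (4 * \<delta>)))"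
        by (intro add_mono order_refl Q1 hW)
      finally show "(\<integral>\<^sup>+\<omega>. g n \<omega> \<partial>M) \<le> \<dots>" .
    qed
    also have "\<dots> = R + ?c * Z + (ennreal \<delta> * (ennreal (4 * C\<^sup>2) * (?c * Z)) + ennreal (1 / (4 * \<delta>)))"
      by (rule Liminf_const) simp
    also have "(\<integral>\<^sup>+\<omega>. indicator E \<omega> * ennreal (\<Phi> \<omega>) + ennreal (1 / (4 * \<delta>)) \<partial>M) = (\<integral>\<^sup>+\<omega>. indicator E \<omega> * ennreal (\<Phi> \<omega>) \<partial>M) + ennreal (1 / (4 * \<delta>))"
      by (simp add: nn_integral_add emeasure_space_1)
    finally have "ennreal (1 / (4 * \<delta>)) + (\<integral>\<^sup>+\<omega>. indicator E \<omega> * ennreal (\<Phi> \<omega>) \<partial>M) \<le> ennreal (1 / (4 * \<delta>)) + (R + ?c * Z + ennreal \<delta> * (ennreal (4 * C\<^sup>2) * (?c * Z)))"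
      by (simp only: add_ac)
    then show ?thesis by (subst (asm) ennreal_add_left_cancel_le) auto
  qed
  obtain k where k: "k \<ge> 0" "ennreal (4 * C\<^sup>2) * (?c * Z) = ennreal k"
  proof (cases "ennreal (4 * C\<^sup>2) * (?c * Z)")
    case top
    have "ennreal (4 * C\<^sup>2) * (?c * Z) < \<infinity>" using ZF by (simp add: ennreal_mult_less_top)
    then show ?thesis using top by simp
  qed (use that in auto)
  have "(\<integral>\<^sup>+\<omega>. indicator E \<omega> * ennreal (\<Phi> \<omega>) \<partial>M) \<le> R + ?c * Z"
  proof (rule ennreal_le_epsilon)
    fix \<epsilon> :: real assume \<epsilon>: "\<epsilon> > 0"
    \<comment> \<open>The level \<open>C\<close> is fixed by now, so the surplus \<delta> k,
      although \<open>k\<close> contains C^2, can be made at most \<epsilon>.\<close>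
    define \<delta> where "\<delta> = \<epsilon> / (k + 1)"
    have d: "\<delta> > 0" using \<epsilon> k by (simp add: \<delta>_def)
    have "\<delta> * k \<le> \<epsilon>" using \<epsilon> k by (simp add: \<delta>_def field_simps)
    then have "ennreal \<delta> * ennreal k \<le> ennreal \<epsilon>" using d k by (simp add: ennreal_mult[symmetric] ennreal_leI)
    then show "(\<integral>\<^sup>+\<omega>. indicator E \<omega> * ennreal (\<Phi> \<omega>) \<partial>M) \<le> R + ?c * Z + ennreal \<epsilon>"
      using main[OF d] unfolding k(2) by (rule order_trans[OF _ add_left_mono, rotated])
  qed
  then show ?thesis by (simp only: R_def Z_def)
qed

end

subsection \<open>Convergence\<close>

lemma (in prob_space) AE_from_small_exceptions:
  assumes "\<And>\<eta>::real. \<eta> > 0 \<Longrightarrow> \<exists>N\<in>sets M. emeasure M N \<le> ennreal \<eta> \<and> (AE \<omega> in M. \<omega> \<notin> N \<longrightarrow> P \<omega>)"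
  shows "AE \<omega> in M. P \<omega>"
proof -
  have "\<forall>k::nat. \<exists>N\<in>sets M. emeasure M N \<le> ennreal (1 / real (Suc k)) \<and> (AE \<omega> in M. \<omega> \<notin> N \<longrightarrow> P \<omega>)"
    using assms by simp
  then obtain N where N: "\<And>k. N k \<in> sets M" "\<And>k. emeasure M (N k) \<le> ennreal (1 / real (Suc k))" "\<And>k. AE \<omega> in M. \<omega> \<notin> N k \<longrightarrow> P \<omega>"
    by metis
  have "emeasure M (\<Inter>k. N k) = 0"
  proof -
    have "(\<lambda>k. ennreal (1 / real (Suc k))) \<longlonglongrightarrow> ennreal 0"
      using LIMSEQ_inverse_real_of_nat by (intro tendsto_ennrealI) (simp add: inverse_eq_divide)
    moreover have "emeasure M (\<Inter>k. N k) \<le> ennreal (1 / real (Suc k))" for k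
      using emeasure_mono[of "\<Inter>k. N k" "N k" M] N(1,2) by (auto intro: order_trans)
    ultimately have "emeasure M (\<Inter>k. N k) \<le> ennreal 0" by (intro LIMSEQ_le_const) auto
    then show ?thesis by simp
  qed
  then have "AE \<omega> in M. \<omega> \<notin> (\<Inter>k. N k)"
    using N(1) by (intro AE_not_in) (auto simp: null_sets_def)
  moreover have "AE \<omega> in M. \<forall>k. \<omega> \<notin> N k \<longrightarrow> P \<omega>" unfolding AE_all_countable using N(3) by blast
  ultimately show ?thesis by eventually_elim auto
qed

text \<open>Two centres are close to each other because some late time is near both, so the centres
  form a Cauchy sequence; closedness keeps its limit in S.\<close>

lemma eventually_near_closed_imp_convergent:
  fixes x :: "real \<Rightarrow> 'b::euclidean_space"
  assumes S: "closed S" and near: "\<And>m::nat. \<exists>z\<in>S. \<forall>\<^sub>F t in at_top. norm (x t - z) \<le> 1 / real (Suc m)"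
  shows "\<exists>z\<in>S. (x \<longlongrightarrow> z) at_top"
proof -
  obtain z where z: "\<And>m. z m \<in> S" "\<And>m. \<forall>\<^sub>F t in at_top. norm (x t - z m) \<le> 1 / real (Suc m)"
    using near by metis
  have dz: "norm (z m - z l) \<le> 1 / real (Suc m) + 1 / real (Suc l)" for m l
  proof -
    have "\<forall>\<^sub>F t in at_top. norm (x t - z m) \<le> 1 / real (Suc m) \<and> norm (x t - z l) \<le> 1 / real (Suc l)"
      using z(2) by (simp add: eventually_conj)
    then obtain t where "norm (x t - z m) \<le> 1 / real (Suc m)" "norm (x t - z l) \<le> 1 / real (Suc l)"
      by (auto simp: eventually_at_top_linorder)
    then show ?thesis using norm_triangle_ineq4[of "x t - z l" "x t - z m"] by simp
  qed
  have inv: "(\<lambda>m. 1 / real (Suc m)) \<longlonglongrightarrow> 0" using LIMSEQ_inverse_real_of_nat by (simp add: inverse_eq_divide)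
  have small: "\<exists>m0. \<forall>m\<ge>m0. 1 / real (Suc m) < e" if "e > 0" for e
    using order_tendstoD(2)[OF inv that] by (auto simp: eventually_sequentially)
  have "Cauchy z"
  proof (rule CauchyI)
    fix e :: real assume "e > 0"
    then obtain m0 where m0: "\<And>m. m \<ge> m0 \<Longrightarrow> 1 / real (Suc m) < e / 2" using small[of "e / 2"] by auto
    show "\<exists>M. \<forall>m\<ge>M. \<forall>n\<ge>M. norm (z m - z n) < e"
    proof (intro exI[of _ m0] allI impI)
      fix m n assume "m0 \<le> m" "m0 \<le> n"
      then show "norm (z m - z n) < e" using dz[of m n] m0[of m] m0[of n] by linarith
    qed
  qed
  then obtain zz where zz: "z \<longlonglongrightarrow> zz" using Cauchy_convergent convergent_def by blast
  have "zz \<in> S" using S z(1) zz by (rule closed_sequentially)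
  moreover have "(x \<longlongrightarrow> zz) at_top"
  proof (rule tendstoI)
    fix e :: real assume "e > 0"
    then obtain m0 where m0: "\<And>m. m \<ge> m0 \<Longrightarrow> 1 / real (Suc m) < e / 2" using small[of "e / 2"] by auto
    have "\<forall>\<^sub>F m in sequentially. dist (z m) zz < e / 2" using zz \<open>e > 0\<close> by (intro tendstoD) auto
    then obtain m where m: "m \<ge> m0" "dist (z m) zz < e / 2"
      by (auto simp: eventually_sequentially) (metis le_cases)
    from z(2)[of m] show "\<forall>\<^sub>F t in at_top. dist (x t) zz < e"
    proof eventually_elim
      case (elim t)
      then show ?case using m m0[OF m(1)] dist_triangle[of "x t" zz "z m"] by (simp add: dist_norm)
    qed
  qed
  ultimately show ?thesis by blast
qed

lemma stopped_square_ge_min: "C \<ge> 0 \<Longrightarrow> min (C\<^sup>2) ((u n)\<^sup>2) \<le> stopped_square u C n"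
  using stopped_square_cases[of C n u] by (cases "\<forall>j<n. u j \<le> C") simp_all

lemma norm_add3_square_le: "(norm (a + b + c))\<^sup>2 \<le> 2 * (norm a)\<^sup>2 + 4 * (norm b)\<^sup>2 + 4 * (norm (c :: 'b::real_normed_vector))\<^sup>2"
proof -
  have "norm (a + b + c) \<le> norm a + (norm b + norm c)"
    using norm_triangle_ineq[of "a + b" c] norm_triangle_ineq[of a b] by linarith
  then have "(norm (a + b + c))\<^sup>2 \<le> (norm a + (norm b + norm c))\<^sup>2" by (intro power_mono) auto
  also have "\<dots> \<le> 2 * (norm a)\<^sup>2 + 2 * (norm b + norm c)\<^sup>2"
    using sum_squares_bound[of "norm a" "norm b + norm c"] by (simp add: power2_sum[of "norm a" "norm b + norm c"])
  also have "(norm b + norm c)\<^sup>2 \<le> 2 * (norm b)\<^sup>2 + 2 * (norm c)\<^sup>2"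
    using sum_squares_bound[of "norm b" "norm c"] by (simp add: power2_sum)
  finally show ?thesis by simp
qed

section \<open>Energy estimates on an unbounded time horizon\<close>

context monotone_sde
begin

abbreviation flow where "flow x0 \<equiv> monotone_flow.flow A x0"

definition tail :: "real \<Rightarrow> 'a \<Rightarrow> ennreal" where
  "tail u \<omega> = (\<integral>\<^sup>+s. ennreal ((norm (H_pos \<omega> s))\<^sup>2) * indicator {u<..} s \<partial>lborel)"

lemma tail_measurable [measurable]: "tail u \<in> borel_measurable M"
proof -
  have "(\<lambda>p. ennreal ((norm (case p of (\<omega>, s) \<Rightarrow> H_pos \<omega> s))\<^sup>2) * indicator {u<..} (snd p)) \<in> borel_measurable (M \<Otimes>\<^sub>M borel)"
    by measurable
  then show ?thesis
    unfolding tail_def[abs_def] by (intro lborel.borel_measurable_nn_integral) (simp add: case_prod_beta' cong: measurable_cong_sets sets_pair_measure_cong)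
qed

lemma quad_le_tail: "quad u v \<omega> \<le> tail u \<omega>"
  unfolding quad_def tail_def by (intro nn_integral_mono mult_left_mono) (auto simp: indicator_def)

lemma tail_LIMSEQ: "(\<lambda>n. \<integral>\<^sup>+\<omega>. tail (real n) \<omega> \<partial>M) \<longlonglongrightarrow> 0"
proof -
  have m1[measurable]: "(\<lambda>(\<omega>, s). H_pos \<omega> s) \<in> borel_measurable (M \<Otimes>\<^sub>M lborel)"
    using H_pos_measurable by (simp cong: measurable_cong_sets sets_pair_measure_cong)
  define d where "d n p = ennreal ((norm (case p of (\<omega>, s) \<Rightarrow> H_pos \<omega> s))\<^sup>2) * indicator {real n<..} (snd p)" for n :: nat and p :: "'a \<times> real"
  have [measurable]: "d n \<in> borel_measurable (M \<Otimes>\<^sub>M lborel)" for n unfolding d_def[abs_def] by measurable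
  have "(\<lambda>n. \<integral>\<^sup>+p. d n p \<partial>(M \<Otimes>\<^sub>M lborel)) \<longlonglongrightarrow> (\<integral>\<^sup>+p. 0 \<partial>(M \<Otimes>\<^sub>M (lborel :: real measure)))"
  proof (rule nn_integral_dominated_convergence[where w="\<lambda>p. ennreal ((norm (case p of (\<omega>, s) \<Rightarrow> H_pos \<omega> s))\<^sup>2)"])
    show "AE p in M \<Otimes>\<^sub>M lborel. d n p \<le> ennreal ((norm (case p of (\<omega>, s) \<Rightarrow> H_pos \<omega> s))\<^sup>2)" for n
      by (rule AE_I2) (auto simp: d_def indicator_def)
    show "AE p in M \<Otimes>\<^sub>M lborel. (\<lambda>n. d n p) \<longlonglongrightarrow> 0"
    proof (rule AE_I2)
      fix p :: "'a \<times> real"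
      have "\<forall>\<^sub>F n in sequentially. snd p \<le> real n"
        using filterlim_real_sequentially filterlim_at_top by blast
      then have "\<forall>\<^sub>F n in sequentially. d n p = 0"
        by eventually_elim (auto simp: d_def indicator_def)
      then show "(\<lambda>n. d n p) \<longlonglongrightarrow> 0" by (rule tendsto_eventually)
    qed
  qed (use H_pos_square_fin in auto)
  moreover have "(\<integral>\<^sup>+p. d n p \<partial>(M \<Otimes>\<^sub>M lborel)) = (\<integral>\<^sup>+\<omega>. tail (real n) \<omega> \<partial>M)" for n
    unfolding tail_def by (subst lborel.nn_integral_fst[symmetric]) (auto simp: d_def)
  ultimately show ?thesis by simp
qed

lemma flow_interp: "y0 \<in> A x0 \<Longrightarrow> monotone_flow A x0 y0"
  using max by (simp add: monotone_flow_def)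

lemma euler_path_LIMSEQ:
  assumes y0: "y0 \<in> A x0" and t0: "0 \<le> t0" and r: "0 \<le> r" and \<omega>: "\<omega> \<in> space M"
  shows "(\<lambda>n. norm (X \<omega> (t0 + real (grid_index r n) / 2 ^ n) - euler A x0 n (grid_index r n))) \<longlonglongrightarrow> norm (X \<omega> (t0 + r) - flow x0 r)"
proof (intro tendsto_norm tendsto_diff)
  interpret fl: monotone_flow A x0 y0 by (rule flow_interp[OF y0])
  show "(\<lambda>n. euler A x0 n (grid_index r n)) \<longlonglongrightarrow> flow x0 r" by (rule fl.euler_grid_LIMSEQ[OF r])
  have "(\<lambda>n. t0 + real (grid_index r n) / 2 ^ n) \<longlonglongrightarrow> t0 + r" by (intro tendsto_intros grid_index_LIMSEQ r)
  moreover have "continuous (at (t0 + r) within {0..}) (X \<omega>)"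
    using X_continuous[OF \<omega>] t0 r by (simp add: continuous_on_eq_continuous_within)
  ultimately show "(\<lambda>n. X \<omega> (t0 + real (grid_index r n) / 2 ^ n)) \<longlonglongrightarrow> X \<omega> (t0 + r)"
    unfolding continuous_within_sequentially using t0 by (auto simp: o_def)
qed

text \<open>The stopped square at the final index dominates the true square capped at C^2. The bound
  does not depend on \<open>C\<close>, so the cap is removed by letting \<open>C\<close>
  grow.\<close>

lemma energy_at:
  assumes y0: "y0 \<in> A x0" and t0: "0 \<le> t0" and r: "0 \<le> r" and E: "E \<in> sets (F t0)"
  shows "(\<integral>\<^sup>+\<omega>. indicator E \<omega> * ennreal ((norm (X \<omega> (t0 + r) - flow x0 r))\<^sup>2) \<partial>M) \<le> (\<integral>\<^sup>+\<omega>. indicator E \<omega> * ennreal ((norm (X \<omega> t0 - x0))\<^sup>2) \<partial>M)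
    + ennreal (2 * brownian_const) * (\<integral>\<^sup>+\<omega>. indicator E \<omega> * tail t0 \<omega> \<partial>M)" (is "_ \<le> ?R")
proof -
  have EM[measurable]: "E \<in> sets M" by (rule filtration_sets[OF t0 E])
  have Xm[measurable]: "(\<lambda>\<omega>. X \<omega> (t0 + r)) \<in> borel_measurable M" by (rule X_measurable) (use t0 r in simp)
  define v where "v \<omega> = (norm (X \<omega> (t0 + r) - flow x0 r))\<^sup>2" for \<omega>
  have vm[measurable]: "v \<in> borel_measurable M" unfolding v_def[abs_def] by measurable
  have k: "(\<integral>\<^sup>+\<omega>. indicator E \<omega> * ennreal (min ((real (Suc k))\<^sup>2) (v \<omega>)) \<partial>M) \<le> ?R" for k
  proof -
    define C where "C = real (Suc k)"
    have C: "C > 0" by (simp add: C_def)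
    have "(\<integral>\<^sup>+\<omega>. indicator E \<omega> * ennreal (min (C\<^sup>2) (v \<omega>)) \<partial>M) \<le> (\<integral>\<^sup>+\<omega>. indicator E \<omega> * ennreal ((norm (X \<omega> t0 - x0))\<^sup>2) \<partial>M)
      + ennreal (2 * brownian_const) * (\<integral>\<^sup>+\<omega>. indicator E \<omega> * quad t0 (t0 + r) \<omega> \<partial>M)"
    proof (rule stopped_energy[OF y0 t0 r E C])
      show "AE \<omega> in M. \<omega> \<in> E \<longrightarrow> (\<forall>\<epsilon>>0. \<forall>\<^sub>F n in sequentially. min (C\<^sup>2) (v \<omega>)
        \<le> stopped_square (\<lambda>i. norm (X \<omega> (t0 + real i / 2 ^ n) - euler A x0 n i)) C (grid_index r n) + \<epsilon>)"
      proof (rule AE_I2, intro impI allI)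
        fix \<omega> and \<epsilon> :: real assume \<omega>: "\<omega> \<in> space M" and \<epsilon>: "\<epsilon> > 0"
        have "(\<lambda>n. min (C\<^sup>2) ((norm (X \<omega> (t0 + real (grid_index r n) / 2 ^ n) - euler A x0 n (grid_index r n)))\<^sup>2)) \<longlonglongrightarrow> min (C\<^sup>2) (v \<omega>)"
          unfolding v_def by (intro tendsto_min tendsto_const tendsto_power euler_path_LIMSEQ[OF y0 t0 r \<omega>])
        then have "\<forall>\<^sub>F n in sequentially. min (C\<^sup>2) (v \<omega>) - \<epsilon> < min (C\<^sup>2) ((norm (X \<omega> (t0 + real (grid_index r n) / 2 ^ n) - euler A x0 n (grid_index r n)))\<^sup>2)"
          by (rule order_tendstoD) (use \<epsilon> in linarith)
        then show "\<forall>\<^sub>F n in sequentially. min (C\<^sup>2) (v \<omega>)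
          \<le> stopped_square (\<lambda>i. norm (X \<omega> (t0 + real i / 2 ^ n) - euler A x0 n i)) C (grid_index r n) + \<epsilon>"
        proof eventually_elim
          case (elim n)
          show ?case
            using elim stopped_square_ge_min[of C "\<lambda>i. norm (X \<omega> (t0 + real i / 2 ^ n) - euler A x0 n i)" "grid_index r n"] C by linarith
        qed
      qed
    qed (auto simp: v_def)
    also have "\<dots> \<le> ?R" by (intro add_left_mono mult_left_mono nn_integral_mono quad_le_tail) auto
    finally show ?thesis by (simp add: C_def)
  qed
  have "(\<integral>\<^sup>+\<omega>. indicator E \<omega> * ennreal (v \<omega>) \<partial>M) \<le> (\<integral>\<^sup>+\<omega>. liminf (\<lambda>k. indicator E \<omega> * ennreal (min ((real (Suc k))\<^sup>2) (v \<omega>))) \<partial>M)"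
  proof (rule nn_integral_mono)
    fix \<omega>
    have "\<forall>\<^sub>F k in sequentially. v \<omega> \<le> real k" using filterlim_real_sequentially filterlim_at_top by blast
    then have "\<forall>\<^sub>F k in sequentially. indicator E \<omega> * ennreal (v \<omega>) \<le> indicator E \<omega> * ennreal (min ((real (Suc k))\<^sup>2) (v \<omega>))"
    proof eventually_elim
      case (elim k)
      have "real k \<le> (real (Suc k))\<^sup>2" by (simp add: power2_eq_square algebra_simps)
      then show ?case using elim by (simp add: min_absorb2)
    qed
    then show "indicator E \<omega> * ennreal (v \<omega>) \<le> liminf (\<lambda>k. indicator E \<omega> * ennreal (min ((real (Suc k))\<^sup>2) (v \<omega>)))"
      by (rule Liminf_bounded)
  qed
  also have "\<dots> \<le> liminf (\<lambda>k. \<integral>\<^sup>+\<omega>. indicator E \<omega> * ennreal (min ((real (Suc k))\<^sup>2) (v \<omega>)) \<partial>M)"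
    by (rule nn_integral_liminf) measurable
  also have "\<dots> \<le> liminf (\<lambda>k::nat. ?R)" by (intro Liminf_mono always_eventually allI k)
  also have "\<dots> = ?R" by (rule Liminf_const) simp
  finally show ?thesis by (simp only: v_def)
qed

text \<open>Rational times make this a countable union of events; by continuity of both paths its
  complement controls all times, as \<open>X_near_flow\<close> shows.\<close>

definition exceeds :: "real \<Rightarrow> real \<Rightarrow> real ^ 'd \<Rightarrow> 'a set" where
  "exceeds t0 C x0 = {\<omega> \<in> space M. \<exists>r\<in>\<rat> \<inter> {0..}. C < norm (X \<omega> (t0 + r) - flow x0 r)}"

lemma exceeds_measurable [measurable]: "t0 \<ge> 0 \<Longrightarrow> exceeds t0 C x0 \<in> sets M"
proof -
  assume t0: "t0 \<ge> 0"
  have "exceeds t0 C x0 = (\<Union>r\<in>\<rat> \<inter> {0..}. {\<omega> \<in> space M. C < norm (X \<omega> (t0 + r) - flow x0 r)})"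
    by (auto simp: exceeds_def)
  also have "\<dots> \<in> sets M"
  proof (rule sets.countable_UN'')
    show "countable (\<rat> \<inter> {0..} :: real set)" by (rule countable_subset[OF _ countable_rat]) auto
    fix r :: real assume "r \<in> \<rat> \<inter> {0..}"
    then have [measurable]: "(\<lambda>\<omega>. X \<omega> (t0 + r)) \<in> borel_measurable M" using t0 by (intro X_measurable) auto
    show "{\<omega> \<in> space M. C < norm (X \<omega> (t0 + r) - flow x0 r)} \<in> sets M" by measurable
  qed
  finally show ?thesis .
qed

text \<open>A maximal inequality of Doob type obtained from the stopped squares: once the distance
  exceeds \<open>C\<close> on the horizon \<open>k\<close>, nearby grid points do so too and the
  stopped square is at least C^2. The right-hand side does not depend on the horizon.\<close>

lemma energy_exceeds:
  assumes y0: "y0 \<in> A x0" and t0: "0 \<le> t0" and C: "C > 0" and E: "E \<in> sets (F t0)"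
  shows "(\<integral>\<^sup>+\<omega>. indicator E \<omega> * ennreal (C\<^sup>2 * indicator (exceeds t0 C x0) \<omega>) \<partial>M) \<le> (\<integral>\<^sup>+\<omega>. indicator E \<omega> * ennreal ((norm (X \<omega> t0 - x0))\<^sup>2) \<partial>M)
    + ennreal (2 * brownian_const) * (\<integral>\<^sup>+\<omega>. indicator E \<omega> * tail t0 \<omega> \<partial>M)" (is "_ \<le> ?R")
proof -
  have EM[measurable]: "E \<in> sets M" by (rule filtration_sets[OF t0 E])
  define B where "B k = {\<omega> \<in> space M. \<exists>r\<in>\<rat> \<inter> {0..real k}. C < norm (X \<omega> (t0 + r) - flow x0 r)}" for k
  have BM[measurable]: "B k \<in> sets M" for k
  proof -
    have "B k = (\<Union>r\<in>\<rat> \<inter> {0..real k}. {\<omega> \<in> space M. C < norm (X \<omega> (t0 + r) - flow x0 r)})"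
      by (auto simp: B_def)
    also have "\<dots> \<in> sets M"
    proof (rule sets.countable_UN'')
      show "countable (\<rat> \<inter> {0..real k})" by (rule countable_subset[OF _ countable_rat]) auto
      fix r :: real assume "r \<in> \<rat> \<inter> {0..real k}"
      then have [measurable]: "(\<lambda>\<omega>. X \<omega> (t0 + r)) \<in> borel_measurable M" using t0 by (intro X_measurable) auto
      show "{\<omega> \<in> space M. C < norm (X \<omega> (t0 + r) - flow x0 r)} \<in> sets M" by measurable
    qed
    finally show ?thesis .
  qed
  have k: "(\<integral>\<^sup>+\<omega>. indicator E \<omega> * ennreal (C\<^sup>2 * indicator (B k) \<omega>) \<partial>M) \<le> ?R" for k
  proof -
    have "(\<integral>\<^sup>+\<omega>. indicator E \<omega> * ennreal (C\<^sup>2 * indicator (B k) \<omega>) \<partial>M) \<le> (\<integral>\<^sup>+\<omega>. indicator E \<omega> * ennreal ((norm (X \<omega> t0 - x0))\<^sup>2) \<partial>M)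
      + ennreal (2 * brownian_const) * (\<integral>\<^sup>+\<omega>. indicator E \<omega> * quad t0 (t0 + real k) \<omega> \<partial>M)"
    proof (rule stopped_energy[OF y0 t0 _ E C])
      show "AE \<omega> in M. \<omega> \<in> E \<longrightarrow> (\<forall>\<epsilon>>0. \<forall>\<^sub>F n in sequentially. C\<^sup>2 * indicator (B k) \<omega>
        \<le> stopped_square (\<lambda>i. norm (X \<omega> (t0 + real i / 2 ^ n) - euler A x0 n i)) C (grid_index (real k) n) + \<epsilon>)"
      proof (rule AE_I2, intro impI allI)
        fix \<omega> and \<epsilon> :: real assume \<omega>: "\<omega> \<in> space M" and \<epsilon>: "\<epsilon> > 0"
        show "\<forall>\<^sub>F n in sequentially. C\<^sup>2 * indicator (B k) \<omega>
          \<le> stopped_square (\<lambda>i. norm (X \<omega> (t0 + real i / 2 ^ n) - euler A x0 n i)) C (grid_index (real k) n) + \<epsilon>"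
        proof (cases "\<omega> \<in> B k")
          case True
          then obtain r where r: "0 \<le> r" "r \<le> real k" "C < norm (X \<omega> (t0 + r) - flow x0 r)" by (auto simp: B_def)
          have "\<forall>\<^sub>F n in sequentially. C < norm (X \<omega> (t0 + real (grid_index r n) / 2 ^ n) - euler A x0 n (grid_index r n))"
            by (rule order_tendstoD(1)[OF euler_path_LIMSEQ[OF y0 t0 r(1) \<omega>] r(3)])
          then show ?thesis
          proof eventually_elim
            case (elim n)
            have "C\<^sup>2 \<le> stopped_square (\<lambda>i. norm (X \<omega> (t0 + real i / 2 ^ n) - euler A x0 n i)) C (grid_index (real k) n)"
              by (rule stopped_square_exceeds[of _ "grid_index r n"]) (use C elim grid_index_mono[OF r(2)] in auto)
            then show ?case using True \<epsilon> by simp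
          qed
        next
          case False
          then show ?thesis using stopped_square_nonneg[of C] C \<epsilon> by (intro always_eventually allI) (simp add: add_nonneg_nonneg)
        qed
      qed
    qed (use C in auto)
    also have "\<dots> \<le> ?R" by (intro add_left_mono mult_left_mono nn_integral_mono quad_le_tail) auto
    finally show ?thesis .
  qed
  have "(\<integral>\<^sup>+\<omega>. indicator E \<omega> * ennreal (C\<^sup>2 * indicator (exceeds t0 C x0) \<omega>) \<partial>M) \<le> (\<integral>\<^sup>+\<omega>. liminf (\<lambda>k. indicator E \<omega> * ennreal (C\<^sup>2 * indicator (B k) \<omega>)) \<partial>M)"
  proof (rule nn_integral_mono)
    fix \<omega>
    have "\<forall>\<^sub>F k in sequentially. indicator (exceeds t0 C x0) \<omega> \<le> (indicator (B k) \<omega> :: real)"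
    proof (cases "\<omega> \<in> exceeds t0 C x0")
      case True
      then obtain r where r: "\<omega> \<in> space M" "r \<in> \<rat>" "0 \<le> r" "C < norm (X \<omega> (t0 + r) - flow x0 r)" by (auto simp: exceeds_def)
      have "\<forall>\<^sub>F k in sequentially. r \<le> real k" using filterlim_real_sequentially filterlim_at_top by blast
      then show ?thesis by eventually_elim (use r in \<open>auto simp: B_def indicator_def\<close>)
    qed simp
    then have "\<forall>\<^sub>F k in sequentially. indicator E \<omega> * ennreal (C\<^sup>2 * indicator (exceeds t0 C x0) \<omega>) \<le> indicator E \<omega> * ennreal (C\<^sup>2 * indicator (B k) \<omega>)"
      by eventually_elim (intro mult_left_mono ennreal_leI; simp)
    then show "indicator E \<omega> * ennreal (C\<^sup>2 * indicator (exceeds t0 C x0) \<omega>) \<le> liminf (\<lambda>k. indicator E \<omega> * ennreal (C\<^sup>2 * indicator (B k) \<omega>))"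
      by (rule Liminf_bounded)
  qed
  also have "\<dots> \<le> liminf (\<lambda>k. \<integral>\<^sup>+\<omega>. indicator E \<omega> * ennreal (C\<^sup>2 * indicator (B k) \<omega>) \<partial>M)"
    by (rule nn_integral_liminf) measurable
  also have "\<dots> \<le> liminf (\<lambda>k::nat. ?R)" by (intro Liminf_mono always_eventually allI k)
  also have "\<dots> = ?R" by (rule Liminf_const) simp
  finally show ?thesis .
qed

text \<open>The centres are a countable dense subset of the domain and \<open>idx\<close> is the
  first centre within \<rho>, hence known at time \<open>t0\<close>. Where no centre is near, which
  happens only on a null set, \<open>LEAST\<close> has an arbitrary value.\<close>

lemma cells:
  assumes t0: "t0 \<ge> 0" and \<rho>: "\<rho> > 0" and ne: "A z \<noteq> {}"
  shows "\<exists>idx D. (\<forall>i::nat. A (D i) \<noteq> {}) \<and> idx \<in> measurable (F t0) (count_space UNIV) \<and> (AE \<omega> in M. norm (X \<omega> t0 - D (idx \<omega>)) < \<rho>)"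
proof -
  obtain S where S: "countable S" "S \<subseteq> dom_op A" "dom_op A \<subseteq> closure S" using separable[of "dom_op A"] by metis
  have "S \<noteq> {}" using S(3) ne by (auto simp: dom_op_def)
  define D where "D = from_nat_into S"
  have DS: "range D = S" unfolding D_def by (rule range_from_nat_into[OF \<open>S \<noteq> {}\<close> S(1)])
  define idx where "idx \<omega> = (LEAST i. norm (X \<omega> t0 - D i) < \<rho>)" for \<omega>
  note [measurable] = X_adapted[OF t0]
  have "idx \<in> measurable (F t0) (count_space UNIV)" unfolding idx_def[abs_def] by measurable
  moreover have "AE \<omega> in M. norm (X \<omega> t0 - D (idx \<omega>)) < \<rho>"
    using X_domain
  proof eventually_elim
    case (elim \<omega>)
    then have "X \<omega> t0 \<in> closure S" using t0 closure_minimal[OF S(3)] by auto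
    then obtain y where "y \<in> S" "dist y (X \<omega> t0) < \<rho>" using \<rho> unfolding closure_approachable by blast
    then obtain i where "norm (X \<omega> t0 - D i) < \<rho>" unfolding DS[symmetric] by (auto simp: dist_norm norm_minus_commute)
    then show ?case unfolding idx_def by (rule LeastI)
  qed
  moreover have "A (D i) \<noteq> {}" for i using DS S(2) by (auto simp: dom_op_def)
  ultimately show ?thesis by blast
qed

text \<open>The energy estimates compare with one fixed starting point on an event known at
  \<open>t0\<close>. Summation over the disjoint events where \<open>idx\<close> is constant gives
  an estimate for a random starting point, and on each of them the initial error is at most
  \<rho>^2.\<close>

lemma cell_energy:
  fixes idx :: "'a \<Rightarrow> nat" and f :: "nat \<Rightarrow> 'a \<Rightarrow> ennreal"
  assumes t0: "t0 \<ge> 0" and idx: "idx \<in> measurable (F t0) (count_space UNIV)" and close: "AE \<omega> in M. norm (X \<omega> t0 - D (idx \<omega>)) < \<rho>"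
    and f[measurable]: "\<And>i. f i \<in> borel_measurable M"
    and le: "\<And>i E. E \<in> sets (F t0) \<Longrightarrow> (\<integral>\<^sup>+\<omega>. indicator E \<omega> * f i \<omega> \<partial>M) \<le> (\<integral>\<^sup>+\<omega>. indicator E \<omega> * ennreal ((norm (X \<omega> t0 - D i))\<^sup>2) \<partial>M)
      + ennreal (2 * brownian_const) * (\<integral>\<^sup>+\<omega>. indicator E \<omega> * tail t0 \<omega> \<partial>M)"
  shows "(\<integral>\<^sup>+\<omega>. f (idx \<omega>) \<omega> \<partial>M) \<le> ennreal (\<rho>\<^sup>2) + ennreal (2 * brownian_const) * (\<integral>\<^sup>+\<omega>. tail t0 \<omega> \<partial>M)"
proof -
  define E where "E i = {\<omega> \<in> space M. idx \<omega> = i}" for i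
  have EF: "E i \<in> sets (F t0)" for i
    using measurable_sets[OF idx, of "{i}"] by (simp add: E_def vimage_def Int_def filtration_space[OF t0] conj_commute)
  have [measurable]: "E i \<in> sets M" for i by (rule filtration_sets[OF t0 EF])
  have single: "(\<Sum>i. indicator (E i) \<omega> * g i) = g (idx \<omega>)" if "\<omega> \<in> space M" for \<omega> and g :: "nat \<Rightarrow> ennreal"
    by (subst suminf_finite[of "{idx \<omega>}"]) (use that in \<open>auto simp: E_def\<close>)
  let ?g = "\<lambda>\<omega>. ennreal (\<rho>\<^sup>2) + ennreal (2 * brownian_const) * tail t0 \<omega>"
  have "(\<integral>\<^sup>+\<omega>. f (idx \<omega>) \<omega> \<partial>M) = (\<integral>\<^sup>+\<omega>. (\<Sum>i. indicator (E i) \<omega> * f i \<omega>) \<partial>M)"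
    by (rule nn_integral_cong) (simp add: single)
  also have "\<dots> = (\<Sum>i. \<integral>\<^sup>+\<omega>. indicator (E i) \<omega> * f i \<omega> \<partial>M)" by (rule nn_integral_suminf) measurable
  also have "\<dots> \<le> (\<Sum>i. \<integral>\<^sup>+\<omega>. indicator (E i) \<omega> * ?g \<omega> \<partial>M)"
  proof (rule suminf_le)
    fix i
    have "(\<integral>\<^sup>+\<omega>. indicator (E i) \<omega> * f i \<omega> \<partial>M) \<le> (\<integral>\<^sup>+\<omega>. indicator (E i) \<omega> * ennreal ((norm (X \<omega> t0 - D i))\<^sup>2) \<partial>M)
      + ennreal (2 * brownian_const) * (\<integral>\<^sup>+\<omega>. indicator (E i) \<omega> * tail t0 \<omega> \<partial>M)" by (rule le[OF EF])
    also have "(\<integral>\<^sup>+\<omega>. indicator (E i) \<omega> * ennreal ((norm (X \<omega> t0 - D i))\<^sup>2) \<partial>M) \<le> (\<integral>\<^sup>+\<omega>. indicator (E i) \<omega> * ennreal (\<rho>\<^sup>2) \<partial>M)"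
    proof (rule nn_integral_mono_AE, use close in eventually_elim)
      case (elim \<omega>)
      show ?case
      proof (cases "\<omega> \<in> E i")
        case True
        then have "norm (X \<omega> t0 - D i) \<le> \<rho>" using elim by (auto simp: E_def)
        then show ?thesis using True by (simp add: ennreal_leI power_mono)
      qed simp
    qed
    also have "(\<integral>\<^sup>+\<omega>. indicator (E i) \<omega> * ennreal (\<rho>\<^sup>2) \<partial>M) + ennreal (2 * brownian_const) * (\<integral>\<^sup>+\<omega>. indicator (E i) \<omega> * tail t0 \<omega> \<partial>M) = (\<integral>\<^sup>+\<omega>. indicator (E i) \<omega> * ?g \<omega> \<partial>M)"
    proof -
      have "ennreal (2 * brownian_const) * (\<integral>\<^sup>+\<omega>. indicator (E i) \<omega> * tail t0 \<omega> \<partial>M) = (\<integral>\<^sup>+\<omega>. indicator (E i) \<omega> * (ennreal (2 * brownian_const) * tail t0 \<omega>) \<partial>M)"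
        by (subst nn_integral_cmult[symmetric]) (auto simp: mult.left_commute)
      then show ?thesis by (simp only: distrib_left) (subst nn_integral_add; simp)
    qed
    finally show "(\<integral>\<^sup>+\<omega>. indicator (E i) \<omega> * f i \<omega> \<partial>M) \<le> (\<integral>\<^sup>+\<omega>. indicator (E i) \<omega> * ?g \<omega> \<partial>M)" by (simp add: add_right_mono)
  qed auto
  also have "\<dots> = (\<integral>\<^sup>+\<omega>. (\<Sum>i. indicator (E i) \<omega> * ?g \<omega>) \<partial>M)" by (rule nn_integral_suminf[symmetric]) measurable
  also have "\<dots> = (\<integral>\<^sup>+\<omega>. ?g \<omega> \<partial>M)"
  proof (rule nn_integral_cong)
    fix \<omega> assume "\<omega> \<in> space M"
    then show "(\<Sum>i. indicator (E i) \<omega> * ?g \<omega>) = ?g \<omega>" by (rule single)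
  qed
  also have "\<dots> = ennreal (\<rho>\<^sup>2) + ennreal (2 * brownian_const) * (\<integral>\<^sup>+\<omega>. tail t0 \<omega> \<partial>M)"
    by (simp add: nn_integral_add nn_integral_cmult emeasure_space_1)
  finally show ?thesis .
qed

lemma small_cells:
  assumes ne: "A z \<noteq> {}" and e: "e > 0"
  shows "\<exists>t0 D idx. t0 \<ge> 0 \<and> (\<forall>i::nat. A (D i) \<noteq> {}) \<and> idx \<in> measurable (F t0) (count_space UNIV) \<and>
    (\<forall>r\<ge>0. (\<integral>\<^sup>+\<omega>. ennreal ((norm (X \<omega> (t0 + r) - flow (D (idx \<omega>)) r))\<^sup>2) \<partial>M) \<le> ennreal e) \<and>
    (\<forall>C>0. (\<integral>\<^sup>+\<omega>. ennreal (C\<^sup>2 * indicator (exceeds t0 C (D (idx \<omega>))) \<omega>) \<partial>M) \<le> ennreal e)"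
proof -
  let ?c = "ennreal (2 * brownian_const)"
  \<comment> \<open>Half of the budget \<open>e\<close> goes to the initial error \<rho>^2, the
    other half to the tail of the noise.\<close>
  define \<rho> where "\<rho> = sqrt (e / 2)"
  have \<rho>: "\<rho> > 0" "\<rho>\<^sup>2 = e / 2" using e by (simp_all add: \<rho>_def)
  have "(\<lambda>n. ?c * (\<integral>\<^sup>+\<omega>. tail (real n) \<omega> \<partial>M)) \<longlonglongrightarrow> ?c * 0"
    by (intro ennreal_tendsto_cmult tail_LIMSEQ) simp
  then have "(\<lambda>n. ?c * (\<integral>\<^sup>+\<omega>. tail (real n) \<omega> \<partial>M)) \<longlonglongrightarrow> 0" by simp
  from ennreal_tendsto_0D[OF this, of "e / 2"] e obtain n where n: "?c * (\<integral>\<^sup>+\<omega>. tail (real n) \<omega> \<partial>M) < ennreal (e / 2)"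
    by (auto simp: eventually_sequentially)
  define t0 where "t0 = real n"
  have t0: "t0 \<ge> 0" by (simp add: t0_def)
  have sum: "ennreal (\<rho>\<^sup>2) + ?c * (\<integral>\<^sup>+\<omega>. tail t0 \<omega> \<partial>M) \<le> ennreal e"
  proof -
    have "ennreal (\<rho>\<^sup>2) + ?c * (\<integral>\<^sup>+\<omega>. tail t0 \<omega> \<partial>M) \<le> ennreal (e / 2) + ennreal (e / 2)"
      using n by (intro add_mono) (auto simp: \<rho>(2) t0_def)
    also have "\<dots> = ennreal e" using e by (simp add: ennreal_plus[symmetric] del: ennreal_plus)
    finally show ?thesis .
  qed
  obtain idx D where D: "\<And>i::nat. A (D i) \<noteq> {}" and idx: "idx \<in> measurable (F t0) (count_space UNIV)" and close: "AE \<omega> in M. norm (X \<omega> t0 - D (idx \<omega>)) < \<rho>"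
    using cells[OF t0 \<rho>(1) ne] by blast
  have "\<forall>i. \<exists>y. y \<in> A (D i)" using D by blast
  then obtain y where y: "\<And>i. y i \<in> A (D i)" by metis
  show ?thesis
  proof (intro exI[of _ t0] exI[of _ D] exI[of _ idx] conjI allI impI t0 D idx)
    fix r :: real assume r: "r \<ge> 0"
    have [measurable]: "(\<lambda>\<omega>. X \<omega> (t0 + r)) \<in> borel_measurable M" by (rule X_measurable) (use t0 r in simp)
    have "(\<integral>\<^sup>+\<omega>. ennreal ((norm (X \<omega> (t0 + r) - flow (D (idx \<omega>)) r))\<^sup>2) \<partial>M) \<le> ennreal (\<rho>\<^sup>2) + ?c * (\<integral>\<^sup>+\<omega>. tail t0 \<omega> \<partial>M)"
      by (rule cell_energy[OF t0 idx close, where f="\<lambda>i \<omega>. ennreal ((norm (X \<omega> (t0 + r) - flow (D i) r))\<^sup>2)"])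
        (measurable, rule energy_at[OF y t0 r])
    then show "(\<integral>\<^sup>+\<omega>. ennreal ((norm (X \<omega> (t0 + r) - flow (D (idx \<omega>)) r))\<^sup>2) \<partial>M) \<le> ennreal e" using sum by (rule order_trans)
  next
    fix C :: real assume C: "C > 0"
    have [measurable]: "exceeds t0 C x0 \<in> sets M" for x0 by (rule exceeds_measurable[OF t0])
    have "(\<integral>\<^sup>+\<omega>. ennreal (C\<^sup>2 * indicator (exceeds t0 C (D (idx \<omega>))) \<omega>) \<partial>M) \<le> ennreal (\<rho>\<^sup>2) + ?c * (\<integral>\<^sup>+\<omega>. tail t0 \<omega> \<partial>M)"
      by (rule cell_energy[OF t0 idx close, where f="\<lambda>i \<omega>. ennreal (C\<^sup>2 * indicator (exceeds t0 C (D i)) \<omega>)"])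
        (measurable, rule energy_exceeds[OF y t0 C])
    then show "(\<integral>\<^sup>+\<omega>. ennreal (C\<^sup>2 * indicator (exceeds t0 C (D (idx \<omega>))) \<omega>) \<partial>M) \<le> ennreal e" using sum by (rule order_trans)
  qed
qed

end

lemma progressive_adapted:
  assumes "progressive F Z" shows "adapted F Z"
  unfolding adapted_def
proof (intro allI impI)
  fix t :: real assume t: "t \<ge> 0"
  have "(\<lambda>(\<omega>, s). Z \<omega> s) \<in> borel_measurable (F t \<Otimes>\<^sub>M restrict_space borel {0..t})"
    using assms t unfolding progressive_def by blast
  moreover have "(\<lambda>\<omega>. (\<omega>, t)) \<in> measurable (F t) (F t \<Otimes>\<^sub>M restrict_space borel {0..t})"
    by (intro measurable_Pair measurable_ident measurable_const) (use t in \<open>auto simp: space_restrict_space\<close>)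
  ultimately have "(\<lambda>\<omega>. (\<lambda>(\<omega>, s). Z \<omega> s) (\<omega>, t)) \<in> borel_measurable (F t)"
    by (rule measurable_compose[rotated])
  then show "(\<lambda>\<omega>. Z \<omega> t) \<in> borel_measurable (F t)" by simp
qed

lemma (in monotone_flow) flow_continuous: "continuous_on {0..} flow"
proof (rule lipschitz_on_continuous_on)
  show "lipschitz_on (norm y0) {0..} flow"
    by (rule lipschitz_onI) (use flow_Lipschitz in \<open>auto simp: dist_norm dist_real_def\<close>)
qed

lemma (in monotone_flow) flow_zero_dist:
  assumes "0 \<in> A z" shows "norm (flow r - z) \<le> norm (x0 - z)"
proof (cases "r \<ge> 0")
  case True
  then show ?thesis using flow_speed[OF assms, of 0 r] by simp
next
  case False then show ?thesis by (simp add: flow_neg)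
qed

section \<open>Almost sure and mean-square convergence\<close>

context monotone_sde
begin

lemma X_near_flow:
  assumes y0: "y0 \<in> A x0" and t0: "t0 \<ge> 0" and \<omega>: "\<omega> \<in> space M" "\<omega> \<notin> exceeds t0 C x0" and r: "r \<ge> 0"
  shows "norm (X \<omega> (t0 + r) - flow x0 r) \<le> C"
proof (rule ccontr)
  interpret fl: monotone_flow A x0 y0 by (rule flow_interp[OF y0])
  assume "\<not> ?thesis"
  then have gt: "C < norm (X \<omega> (t0 + r) - flow x0 r)" by simp
  \<comment> \<open>The interval is enlarged to length r + 1 because the search for a rational time
    needs a nondegenerate interval, also when r = 0.\<close>
  have "continuous_on {0..r + 1} (\<lambda>r. norm (X \<omega> (t0 + r) - flow x0 r))"
    by (intro continuous_intros continuous_on_subset[OF fl.flow_continuous] continuous_on_compose2[OF X_continuous[OF \<omega>(1)]]) (use t0 in auto)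
  from continuous_exceeds_rational[OF this _ _ gt] r
  obtain q where "q \<in> \<rat>" "q \<in> {0..r + 1}" "C < norm (X \<omega> (t0 + q) - flow x0 q)" by auto
  then show False using \<omega> by (auto simp: exceeds_def)
qed

text \<open>Up to an event of arbitrarily small probability, a path stays close to one trajectory,
  which settles at a zero; thus the path is eventually close to some zero, for every tolerance. In
  mean square the same comparison is made with the random trajectory selected at time
  \<open>t0\<close>.\<close>

theorem convergence:
  assumes z0: "0 \<in> A z0"
    and traj: "\<And>x0 x. x0 \<in> closure (dom_op A) \<Longrightarrow> ode_traj A x0 x \<Longrightarrow> \<exists>z. 0 \<in> A z \<and> (x \<longlongrightarrow> z) at_top"
    and L2_0: "(\<integral>\<^sup>+\<omega>. ennreal ((norm (X \<omega> 0))\<^sup>2) \<partial>M) < \<infinity>"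
  shows "\<exists>Xs. Xs \<in> borel_measurable M \<and> (\<forall>\<omega> \<in> space M. 0 \<in> A (Xs \<omega>)) \<and>
           (AE \<omega> in M. ((\<lambda>t. X \<omega> t) \<longlongrightarrow> Xs \<omega>) at_top) \<and>
           ((\<lambda>t. \<integral>\<^sup>+ \<omega>. ennreal ((norm (X \<omega> t - Xs \<omega>))\<^sup>2) \<partial>M) \<longlongrightarrow> 0) at_top"
proof -
  let ?S = "{z. 0 \<in> A z}"
  have Scl: "closed ?S" by (rule maximal_monotone_zeros_closed[OF max])
  have ne: "A z0 \<noteq> {}" using z0 by blast
  have flow_conv: "\<exists>z. 0 \<in> A z \<and> (flow x0 \<longlongrightarrow> z) at_top" if nonempty: "A x0 \<noteq> {}" for x0
  proof -
    obtain y0 where y0: "y0 \<in> A x0" using nonempty by blast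
    interpret fl: monotone_flow A x0 y0 by (rule flow_interp[OF y0])
    have "x0 \<in> closure (dom_op A)" using nonempty closure_subset[of "dom_op A"] by (auto simp: dom_op_def)
    then show ?thesis by (rule traj[OF _ fl.flow_ode_traj])
  qed
  have near: "AE \<omega> in M. \<exists>z\<in>?S. \<forall>\<^sub>F t in at_top. norm (X \<omega> t - z) \<le> 1 / real (Suc m)" for m :: nat
  proof (rule AE_from_small_exceptions)
    fix \<eta> :: real assume \<eta>: "\<eta> > 0"
    \<comment> \<open>Half of the tolerance is for the distance to the trajectory, half for the
      distance of the trajectory to its limit.\<close>
    define C where "C = 1 / (2 * real (Suc m))"
    have C: "C > 0" "2 * C = 1 / real (Suc m)" by (simp_all add: C_def field_simps)
    \<comment> \<open>By Markov's inequality a mean of at most \<eta> C^2 leaves probability at most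
      \<eta> for exceeding \<open>C\<close>.\<close>
    have "\<eta> * C\<^sup>2 > 0" using \<eta> C(1) by simp
    from small_cells[OF ne this] obtain t0 D idx where t0: "t0 \<ge> 0" and D: "\<And>i::nat. A (D i) \<noteq> {}"
      and idx: "idx \<in> measurable (F t0) (count_space UNIV)"
      and ex: "\<And>C'. C' > 0 \<Longrightarrow> (\<integral>\<^sup>+\<omega>. ennreal (C'\<^sup>2 * indicator (exceeds t0 C' (D (idx \<omega>))) \<omega>) \<partial>M) \<le> ennreal (\<eta> * C\<^sup>2)"
      by blast
    have idxM: "idx \<in> measurable M (count_space UNIV)" by (rule measurable_from_subalg[OF filtration_subalgebra[OF t0] idx])
    define N where "N = (\<Union>i. {\<omega> \<in> space M. idx \<omega> = i} \<inter> exceeds t0 C (D i))"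
    have NM[measurable]: "N \<in> sets M"
      unfolding N_def
    proof (intro sets.countable_UN image_subsetI sets.Int exceeds_measurable t0)
      show "{\<omega> \<in> space M. idx \<omega> = i} \<in> sets M" for i using idxM by measurable
    qed
    have Nin: "\<omega> \<in> N \<longleftrightarrow> \<omega> \<in> exceeds t0 C (D (idx \<omega>))" for \<omega> by (auto simp: N_def exceeds_def)
    have "ennreal (C\<^sup>2) * emeasure M N = (\<integral>\<^sup>+\<omega>. ennreal (C\<^sup>2 * indicator (exceeds t0 C (D (idx \<omega>))) \<omega>) \<partial>M)"
      by (subst nn_integral_cmult_indicator[symmetric]) (auto intro!: nn_integral_cong simp: indicator_def Nin)
    also have "\<dots> \<le> ennreal (\<eta> * C\<^sup>2)" by (rule ex[OF C(1)])
    finally have "ennreal (C\<^sup>2 * measure M N) \<le> ennreal (C\<^sup>2 * \<eta>)" by (simp add: emeasure_eq_measure ennreal_mult mult.commute)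
    then have "measure M N \<le> \<eta>" using C(1) \<eta> by (subst (asm) ennreal_le_iff) auto
    then have "emeasure M N \<le> ennreal \<eta>" by (simp add: emeasure_eq_measure ennreal_leI)
    moreover have "AE \<omega> in M. \<omega> \<notin> N \<longrightarrow> (\<exists>z\<in>?S. \<forall>\<^sub>F t in at_top. norm (X \<omega> t - z) \<le> 1 / real (Suc m))"
    proof (rule AE_I2, rule impI)
      fix \<omega> assume \<omega>: "\<omega> \<in> space M" "\<omega> \<notin> N"
      let ?x = "D (idx \<omega>)"
      obtain y0 where y0: "y0 \<in> A ?x" using D by blast
      obtain z where z: "0 \<in> A z" "(flow ?x \<longlongrightarrow> z) at_top" using flow_conv[OF D] by blast
      from tendstoD[OF z(2) C(1)] obtain R where R: "\<And>r. r \<ge> R \<Longrightarrow> dist (flow ?x r) z < C"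
        by (auto simp: eventually_at_top_linorder)
      have "norm (X \<omega> t - z) \<le> 1 / real (Suc m)" if t: "t \<ge> t0 + max 0 R" for t
      proof -
        have "norm (X \<omega> (t0 + (t - t0)) - flow ?x (t - t0)) \<le> C"
          by (rule X_near_flow[OF y0 t0]) (use \<omega> t Nin in auto)
        moreover have "norm (flow ?x (t - t0) - z) \<le> C" using R[of "t - t0"] t max.cobounded2[of R 0] by (simp add: dist_norm max_def split: if_splits)
        ultimately show ?thesis
          using norm_triangle_ineq[of "X \<omega> t - flow ?x (t - t0)" "flow ?x (t - t0) - z"] C(2) by simp
      qed
      then show "\<exists>z\<in>?S. \<forall>\<^sub>F t in at_top. norm (X \<omega> t - z) \<le> 1 / real (Suc m)"
        using z(1) by (auto simp: eventually_at_top_linorder)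
    qed
    ultimately show "\<exists>N\<in>sets M. emeasure M N \<le> ennreal \<eta> \<and> (AE \<omega> in M. \<omega> \<notin> N \<longrightarrow> (\<exists>z\<in>?S. \<forall>\<^sub>F t in at_top. norm (X \<omega> t - z) \<le> 1 / real (Suc m)))"
      using NM by blast
  qed
  have "AE \<omega> in M. \<forall>m::nat. \<exists>z\<in>?S. \<forall>\<^sub>F t in at_top. norm (X \<omega> t - z) \<le> 1 / real (Suc m)"
    unfolding AE_all_countable using near by blast
  then have conv: "AE \<omega> in M. \<exists>z\<in>?S. (X \<omega> \<longlongrightarrow> z) at_top"
    by eventually_elim (rule eventually_near_closed_imp_convergent[OF Scl], blast)
  define G where "G = {\<omega> \<in> space M. \<exists>z\<in>?S. (X \<omega> \<longlongrightarrow> z) at_top}"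
  have GM[measurable]: "G \<in> sets M" unfolding G_def
    by (rule complete_sets[where Q="\<lambda>_. True"]) (use conv in auto)
  \<comment> \<open>The limit is taken along the integers so that it is measurable, and the default
    \<open>z0\<close> off the event of convergence makes every value a zero of
    \<open>A\<close>.\<close>
  define Xs where "Xs \<omega> = (if \<omega> \<in> G then lim (\<lambda>n. X \<omega> (real n)) else z0)" for \<omega>
  have Xm: "(\<lambda>\<omega>. X \<omega> t) \<in> borel_measurable M" if "t \<ge> 0" for t by (rule X_measurable[OF that])
  have XsM[measurable]: "Xs \<in> borel_measurable M"
  proof -
    have "(\<lambda>\<omega>. lim (\<lambda>n. X \<omega> (real n))) \<in> borel_measurable M"
      by (rule borel_measurable_lim_metric) (rule Xm, simp)
    then show ?thesis unfolding Xs_def[abs_def] by measurable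
  qed
  have XsG: "0 \<in> A (Xs \<omega>) \<and> (X \<omega> \<longlongrightarrow> Xs \<omega>) at_top" if G: "\<omega> \<in> G" for \<omega>
  proof -
    obtain z where z: "0 \<in> A z" "(X \<omega> \<longlongrightarrow> z) at_top" using G by (auto simp: G_def)
    have "(\<lambda>n. X \<omega> (real n)) \<longlonglongrightarrow> z" by (rule filterlim_compose[OF z(2) filterlim_real_sequentially])
    then have "Xs \<omega> = z" using G by (simp add: Xs_def limI)
    then show ?thesis using z by simp
  qed
  have XsA: "AE \<omega> in M. (X \<omega> \<longlongrightarrow> Xs \<omega>) at_top"
    using conv AE_space by eventually_elim (use XsG in \<open>auto simp: G_def\<close>)
  have XsS: "\<forall>\<omega>\<in>space M. 0 \<in> A (Xs \<omega>)" using XsG z0 by (auto simp: Xs_def)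
  \<comment> \<open>The flow started at a zero is constant, so the energy estimate from time 0 with
    this comparison path bounds the second moment at all times.\<close>
  have XtL2: "(\<integral>\<^sup>+\<omega>. ennreal ((norm (X \<omega> t - z0))\<^sup>2) \<partial>M) < \<infinity>" if t: "t \<ge> 0" for t
  proof -
    interpret fl: monotone_flow A z0 0 by (rule flow_interp[OF z0])
    have sp: "space M \<in> sets (F 0)" using filtration_space[of 0] sets.top[of "F 0"] by simp
    have drop: "(\<integral>\<^sup>+\<omega>. indicator (space M) \<omega> * f \<omega> \<partial>M) = (\<integral>\<^sup>+\<omega>. f \<omega> \<partial>M)" for f :: "'a \<Rightarrow> ennreal"
      by (rule nn_integral_cong) simp
    have "flow z0 t = z0" using fl.flow_zero_dist[OF z0, of t] by simp
    then have "(\<integral>\<^sup>+\<omega>. ennreal ((norm (X \<omega> t - z0))\<^sup>2) \<partial>M) \<le> (\<integral>\<^sup>+\<omega>. ennreal ((norm (X \<omega> 0 - z0))\<^sup>2) \<partial>M) + ennreal (2 * brownian_const) * (\<integral>\<^sup>+\<omega>. tail 0 \<omega> \<partial>M)"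
      using energy_at[OF z0 order_refl t sp] unfolding drop by simp
    also have "\<dots> < \<infinity>"
    proof -
      have [measurable]: "(\<lambda>\<omega>. X \<omega> 0) \<in> borel_measurable M" by (rule Xm) simp
      have "(\<integral>\<^sup>+\<omega>. ennreal ((norm (X \<omega> 0 - z0))\<^sup>2) \<partial>M) \<le> (\<integral>\<^sup>+\<omega>. 2 * ennreal ((norm (X \<omega> 0))\<^sup>2) + ennreal (2 * (norm z0)\<^sup>2) \<partial>M)"
      proof (rule nn_integral_mono)
        fix \<omega>
        have "(norm (X \<omega> 0 - z0))\<^sup>2 \<le> (norm (X \<omega> 0) + norm z0)\<^sup>2" by (intro power_mono norm_triangle_ineq4) simp
        also have "\<dots> \<le> 2 * (norm (X \<omega> 0))\<^sup>2 + 2 * (norm z0)\<^sup>2"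
          using sum_squares_bound[of "norm (X \<omega> 0)" "norm z0"] by (simp add: power2_sum)
        finally have "ennreal ((norm (X \<omega> 0 - z0))\<^sup>2) \<le> ennreal (2 * (norm (X \<omega> 0))\<^sup>2 + 2 * (norm z0)\<^sup>2)" by (rule ennreal_leI)
        then show "ennreal ((norm (X \<omega> 0 - z0))\<^sup>2) \<le> 2 * ennreal ((norm (X \<omega> 0))\<^sup>2) + ennreal (2 * (norm z0)\<^sup>2)"
          by (simp add: ennreal_mult)
      qed
      also have "\<dots> = 2 * (\<integral>\<^sup>+\<omega>. ennreal ((norm (X \<omega> 0))\<^sup>2) \<partial>M) + ennreal (2 * (norm z0)\<^sup>2)"
        by (simp add: nn_integral_add nn_integral_cmult emeasure_space_1)
      also have "\<dots> < \<infinity>" using L2_0 by (simp add: ennreal_mult_less_top)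
      finally have 1: "(\<integral>\<^sup>+\<omega>. ennreal ((norm (X \<omega> 0 - z0))\<^sup>2) \<partial>M) < \<infinity>" .
      have "(\<integral>\<^sup>+\<omega>. tail 0 \<omega> \<partial>M) \<le> (\<integral>\<^sup>+ \<omega>. (\<integral>\<^sup>+ t. ennreal ((norm (H \<omega> t))\<^sup>2) * indicator {0..} t \<partial>lborel) \<partial>M)"
        unfolding tail_def by (intro nn_integral_mono) (auto simp: H_pos_def indicator_def)
      also note square_fin
      finally show ?thesis using 1 by (simp add: ennreal_mult_less_top)
    qed
    finally show ?thesis .
  qed
  have L2: "((\<lambda>t. \<integral>\<^sup>+ \<omega>. ennreal ((norm (X \<omega> t - Xs \<omega>))\<^sup>2) \<partial>M) \<longlongrightarrow> 0) at_top"
  proof (rule ennreal_tendsto_0I)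
    fix e :: real assume e: "e > 0"
    \<comment> \<open>Three errors enter with the weights 2, 4 and 4 of
      \<open>norm_add3_square_le\<close>, which add up to 10.\<close>
    then have e': "e / 10 > 0" by simp
    from small_cells[OF ne this] obtain t0 D idx where t0: "t0 \<ge> 0" and D: "\<And>i::nat. A (D i) \<noteq> {}"
      and idx: "idx \<in> measurable (F t0) (count_space UNIV)"
      and en: "\<And>r. r \<ge> 0 \<Longrightarrow> (\<integral>\<^sup>+\<omega>. ennreal ((norm (X \<omega> (t0 + r) - flow (D (idx \<omega>)) r))\<^sup>2) \<partial>M) \<le> ennreal (e / 10)"
      by blast
    have idxM[measurable]: "idx \<in> measurable M (count_space UNIV)" by (rule measurable_from_subalg[OF filtration_subalgebra[OF t0] idx])
    have "\<forall>i. \<exists>z. 0 \<in> A z \<and> (flow (D i) \<longlongrightarrow> z) at_top" using flow_conv[OF D] by blast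
    then obtain l where l: "\<And>i. 0 \<in> A (l i)" "\<And>i. (flow (D i) \<longlongrightarrow> l i) at_top" by metis
    \<comment> \<open>The trajectory selected by the cell of the path at time \<open>t0\<close>;
      \<open>V'\<close> is its random limit, a zero of \<open>A\<close>.\<close>
    define V where "V r \<omega> = flow (D (idx \<omega>)) r" for r \<omega>
    define V' where "V' \<omega> = l (idx \<omega>)" for \<omega>
    have VM[measurable]: "V r \<in> borel_measurable M" for r unfolding V_def[abs_def] by measurable
    have V'M[measurable]: "V' \<in> borel_measurable M" unfolding V'_def[abs_def] by measurable
    have Vl: "((\<lambda>r. V r \<omega>) \<longlongrightarrow> V' \<omega>) at_top" for \<omega> using l(2) by (simp add: V_def V'_def)
    have Vb: "norm (V r \<omega> - z0) \<le> norm (D (idx \<omega>) - z0)" for r \<omega>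
    proof -
      obtain y0 where y0: "y0 \<in> A (D (idx \<omega>))" using D by blast
      interpret fl: monotone_flow A "D (idx \<omega>)" y0 by (rule flow_interp[OF y0])
      show ?thesis unfolding V_def by (rule fl.flow_zero_dist[OF z0])
    qed
    have V0: "V 0 \<omega> = D (idx \<omega>)" for \<omega>
    proof -
      obtain y0 where y0: "y0 \<in> A (D (idx \<omega>))" using D by blast
      interpret fl: monotone_flow A "D (idx \<omega>)" y0 by (rule flow_interp[OF y0])
      show ?thesis unfolding V_def by simp
    qed
    have V'b: "norm (V' \<omega> - z0) \<le> norm (D (idx \<omega>) - z0)" for \<omega>
    proof (rule tendsto_upperbound)
      show "((\<lambda>r. norm (V r \<omega> - z0)) \<longlongrightarrow> norm (V' \<omega> - z0)) at_top" by (intro tendsto_intros Vl)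
    qed (use Vb in auto)
    \<comment> \<open>Square integrability of the selected starting points; it follows from that of
      the solution at \<open>t0\<close> together with the energy estimate at r = 0.\<close>
    have en0: "(\<integral>\<^sup>+\<omega>. ennreal ((norm (D (idx \<omega>) - z0))\<^sup>2) \<partial>M) < \<infinity>"
    proof -
      have [measurable]: "(\<lambda>\<omega>. X \<omega> t0) \<in> borel_measurable M" by (rule Xm[OF t0])
      have [measurable]: "(\<lambda>\<omega>. D (idx \<omega>)) \<in> borel_measurable M" by measurable
      have "(\<integral>\<^sup>+\<omega>. ennreal ((norm (D (idx \<omega>) - z0))\<^sup>2) \<partial>M) \<le> (\<integral>\<^sup>+\<omega>. 2 * ennreal ((norm (X \<omega> t0 - D (idx \<omega>)))\<^sup>2) + 2 * ennreal ((norm (X \<omega> t0 - z0))\<^sup>2) \<partial>M)"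
      proof (rule nn_integral_mono)
        fix \<omega>
        let ?a = "X \<omega> t0 - D (idx \<omega>)" and ?b = "X \<omega> t0 - z0"
        have "(norm (?b - ?a))\<^sup>2 \<le> (norm ?b + norm ?a)\<^sup>2" by (intro power_mono norm_triangle_ineq4) simp
        also have "\<dots> \<le> 2 * (norm ?a)\<^sup>2 + 2 * (norm ?b)\<^sup>2"
          using sum_squares_bound[of "norm ?b" "norm ?a"] by (simp add: power2_sum)
        finally have "ennreal ((norm (D (idx \<omega>) - z0))\<^sup>2) \<le> ennreal (2 * (norm ?a)\<^sup>2 + 2 * (norm ?b)\<^sup>2)" by (intro ennreal_leI) simp
        then show "ennreal ((norm (D (idx \<omega>) - z0))\<^sup>2) \<le> 2 * ennreal ((norm ?a)\<^sup>2) + 2 * ennreal ((norm ?b)\<^sup>2)" by (simp add: ennreal_mult)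
      qed
      also have "\<dots> = 2 * (\<integral>\<^sup>+\<omega>. ennreal ((norm (X \<omega> t0 - D (idx \<omega>)))\<^sup>2) \<partial>M) + 2 * (\<integral>\<^sup>+\<omega>. ennreal ((norm (X \<omega> t0 - z0))\<^sup>2) \<partial>M)"
        by (simp add: nn_integral_add nn_integral_cmult)
      also have "\<dots> < \<infinity>"
      proof -
        have "(\<integral>\<^sup>+\<omega>. ennreal ((norm (X \<omega> t0 - D (idx \<omega>)))\<^sup>2) \<partial>M) \<le> ennreal (e / 10)"
          using en[of 0] V0 by (simp add: V_def)
        then have "(\<integral>\<^sup>+\<omega>. ennreal ((norm (X \<omega> t0 - D (idx \<omega>)))\<^sup>2) \<partial>M) < \<infinity>" by (rule le_less_trans) simp
        then show ?thesis using XtL2[OF t0] by (simp add: ennreal_mult_less_top)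
      qed
      finally show ?thesis .
    qed
    \<comment> \<open>Trajectories never move away from the zero \<open>z0\<close>, so the distance
      of the starting point to \<open>z0\<close> dominates all later distances and the limit may be
      taken under the expectation.\<close>
    have lim1: "((\<lambda>r. \<integral>\<^sup>+\<omega>. ennreal ((norm (V r \<omega> - V' \<omega>))\<^sup>2) \<partial>M) \<longlongrightarrow> 0) at_top"
    proof (rule tendsto_at_topI_sequentially)
      fix r :: "nat \<Rightarrow> real" assume r: "filterlim r at_top sequentially"
      have "(\<lambda>n. \<integral>\<^sup>+\<omega>. ennreal ((norm (V (r n) \<omega> - V' \<omega>))\<^sup>2) \<partial>M) \<longlonglongrightarrow> (\<integral>\<^sup>+\<omega>. 0 \<partial>M)"
      proof (rule nn_integral_dominated_convergence[where w="\<lambda>\<omega>. 4 * ennreal ((norm (D (idx \<omega>) - z0))\<^sup>2)"])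
        show "(\<integral>\<^sup>+\<omega>. 4 * ennreal ((norm (D (idx \<omega>) - z0))\<^sup>2) \<partial>M) < \<infinity>"
          using en0 by (subst nn_integral_cmult) (auto simp: ennreal_mult_less_top)
        show "AE \<omega> in M. ennreal ((norm (V (r n) \<omega> - V' \<omega>))\<^sup>2) \<le> 4 * ennreal ((norm (D (idx \<omega>) - z0))\<^sup>2)" for n
        proof (rule AE_I2)
          fix \<omega>
          have "norm (V (r n) \<omega> - V' \<omega>) \<le> 2 * norm (D (idx \<omega>) - z0)"
            using norm_triangle_ineq4[of "V (r n) \<omega> - z0" "V' \<omega> - z0"] Vb[of "r n" \<omega>] V'b[of \<omega>] by simp
          then have "(norm (V (r n) \<omega> - V' \<omega>))\<^sup>2 \<le> (2 * norm (D (idx \<omega>) - z0))\<^sup>2" by (intro power_mono) auto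
          then have "ennreal ((norm (V (r n) \<omega> - V' \<omega>))\<^sup>2) \<le> ennreal (4 * (norm (D (idx \<omega>) - z0))\<^sup>2)"
            by (intro ennreal_leI) (simp add: power_mult_distrib)
          then show "ennreal ((norm (V (r n) \<omega> - V' \<omega>))\<^sup>2) \<le> 4 * ennreal ((norm (D (idx \<omega>) - z0))\<^sup>2)" by (simp add: ennreal_mult)
        qed
        show "AE \<omega> in M. (\<lambda>n. ennreal ((norm (V (r n) \<omega> - V' \<omega>))\<^sup>2)) \<longlonglongrightarrow> 0"
        proof (rule AE_I2)
          fix \<omega>
          have "(\<lambda>n. V (r n) \<omega>) \<longlonglongrightarrow> V' \<omega>" by (rule filterlim_compose[OF Vl r])
          then have "(\<lambda>n. ennreal ((norm (V (r n) \<omega> - V' \<omega>))\<^sup>2)) \<longlonglongrightarrow> ennreal ((norm (V' \<omega> - V' \<omega>))\<^sup>2)"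
            by (intro tendsto_ennrealI tendsto_intros)
          then show "(\<lambda>n. ennreal ((norm (V (r n) \<omega> - V' \<omega>))\<^sup>2)) \<longlonglongrightarrow> 0" by simp
        qed
      qed auto
      then show "(\<lambda>n. \<integral>\<^sup>+\<omega>. ennreal ((norm (V (r n) \<omega> - V' \<omega>))\<^sup>2) \<partial>M) \<longlonglongrightarrow> 0" by simp
    qed
    \<comment> \<open>The estimate between path and trajectory is uniform in time, so Fatou's lemma
      along the integers carries it over to the two limits.\<close>
    have lim2: "(\<integral>\<^sup>+\<omega>. ennreal ((norm (V' \<omega> - Xs \<omega>))\<^sup>2) \<partial>M) \<le> ennreal (e / 10)"
    proof -
      have Xtm[measurable]: "(\<lambda>\<omega>. X \<omega> (t0 + real n)) \<in> borel_measurable M" for n by (rule Xm) (use t0 in simp)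
      have "(\<integral>\<^sup>+\<omega>. ennreal ((norm (V' \<omega> - Xs \<omega>))\<^sup>2) \<partial>M) = (\<integral>\<^sup>+\<omega>. liminf (\<lambda>n. ennreal ((norm (X \<omega> (t0 + real n) - V (real n) \<omega>))\<^sup>2)) \<partial>M)"
      proof (rule nn_integral_cong_AE, use XsA in eventually_elim)
        case (elim \<omega>)
        have "filterlim (\<lambda>n. t0 + real n) at_top sequentially"
          by (rule filterlim_tendsto_add_at_top[OF tendsto_const filterlim_real_sequentially])
        then have "(\<lambda>n. X \<omega> (t0 + real n)) \<longlonglongrightarrow> Xs \<omega>" by (rule filterlim_compose[OF elim])
        moreover have "(\<lambda>n. V (real n) \<omega>) \<longlonglongrightarrow> V' \<omega>" by (rule filterlim_compose[OF Vl filterlim_real_sequentially])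
        ultimately have "(\<lambda>n. ennreal ((norm (X \<omega> (t0 + real n) - V (real n) \<omega>))\<^sup>2)) \<longlonglongrightarrow> ennreal ((norm (Xs \<omega> - V' \<omega>))\<^sup>2)"
          by (intro tendsto_ennrealI tendsto_intros)
        then have "liminf (\<lambda>n. ennreal ((norm (X \<omega> (t0 + real n) - V (real n) \<omega>))\<^sup>2)) = ennreal ((norm (Xs \<omega> - V' \<omega>))\<^sup>2)"
          by (rule lim_imp_Liminf[OF sequentially_bot])
        then show ?case by (simp add: norm_minus_commute)
      qed
      also have "\<dots> \<le> liminf (\<lambda>n. \<integral>\<^sup>+\<omega>. ennreal ((norm (X \<omega> (t0 + real n) - V (real n) \<omega>))\<^sup>2) \<partial>M)"
        by (rule nn_integral_liminf) measurable
      also have "\<dots> \<le> liminf (\<lambda>n::nat. ennreal (e / 10))"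
        by (intro Liminf_mono always_eventually allI) (use en in \<open>simp add: V_def\<close>)
      also have "\<dots> = ennreal (e / 10)" by (rule Liminf_const) simp
      finally show ?thesis .
    qed
    from ennreal_tendsto_0D[OF lim1 e'] obtain R where R: "\<And>r. r \<ge> R \<Longrightarrow> (\<integral>\<^sup>+\<omega>. ennreal ((norm (V r \<omega> - V' \<omega>))\<^sup>2) \<partial>M) < ennreal (e / 10)"
      by (auto simp: eventually_at_top_linorder)
    have "(\<integral>\<^sup>+ \<omega>. ennreal ((norm (X \<omega> t - Xs \<omega>))\<^sup>2) \<partial>M) \<le> ennreal e" if t: "t \<ge> t0 + max 0 R" for t
    proof -
      define r where "r = t - t0"
      have r: "r \<ge> 0" "r \<ge> R" "t = t0 + r" using t by (auto simp: r_def)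
      have [measurable]: "(\<lambda>\<omega>. X \<omega> t) \<in> borel_measurable M" by (rule Xm) (use r t0 in simp)
      have "(\<integral>\<^sup>+ \<omega>. ennreal ((norm (X \<omega> t - Xs \<omega>))\<^sup>2) \<partial>M) \<le> (\<integral>\<^sup>+ \<omega>. 2 * ennreal ((norm (X \<omega> t - V r \<omega>))\<^sup>2) + 4 * ennreal ((norm (V r \<omega> - V' \<omega>))\<^sup>2) + 4 * ennreal ((norm (V' \<omega> - Xs \<omega>))\<^sup>2) \<partial>M)"
      proof (rule nn_integral_mono)
        fix \<omega>
        have "ennreal ((norm (X \<omega> t - Xs \<omega>))\<^sup>2) \<le> ennreal (2 * (norm (X \<omega> t - V r \<omega>))\<^sup>2 + 4 * (norm (V r \<omega> - V' \<omega>))\<^sup>2 + 4 * (norm (V' \<omega> - Xs \<omega>))\<^sup>2)"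
          using norm_add3_square_le[of "X \<omega> t - V r \<omega>" "V r \<omega> - V' \<omega>" "V' \<omega> - Xs \<omega>"] by (intro ennreal_leI) simp
        then show "ennreal ((norm (X \<omega> t - Xs \<omega>))\<^sup>2) \<le> 2 * ennreal ((norm (X \<omega> t - V r \<omega>))\<^sup>2) + 4 * ennreal ((norm (V r \<omega> - V' \<omega>))\<^sup>2) + 4 * ennreal ((norm (V' \<omega> - Xs \<omega>))\<^sup>2)"
          by (simp add: ennreal_mult)
      qed
      also have "\<dots> = 2 * (\<integral>\<^sup>+ \<omega>. ennreal ((norm (X \<omega> t - V r \<omega>))\<^sup>2) \<partial>M) + 4 * (\<integral>\<^sup>+ \<omega>. ennreal ((norm (V r \<omega> - V' \<omega>))\<^sup>2) \<partial>M) + 4 * (\<integral>\<^sup>+ \<omega>. ennreal ((norm (V' \<omega> - Xs \<omega>))\<^sup>2) \<partial>M)"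
        by (simp add: nn_integral_add nn_integral_cmult)
      also have "\<dots> \<le> 2 * ennreal (e / 10) + 4 * ennreal (e / 10) + 4 * ennreal (e / 10)"
        using en[OF r(1)] R[OF r(2)] lim2 r(3) by (intro add_mono mult_left_mono) (auto simp: V_def)
      also have "\<dots> = ennreal (2 * (e / 10) + 4 * (e / 10) + 4 * (e / 10))"
        using e by (simp flip: ennreal_numeral ennreal_mult ennreal_plus)
      also have "2 * (e / 10) + 4 * (e / 10) + 4 * (e / 10) = e" by simp
      finally show ?thesis .
    qed
    then show "\<forall>\<^sub>F t in at_top. (\<integral>\<^sup>+ \<omega>. ennreal ((norm (X \<omega> t - Xs \<omega>))\<^sup>2) \<partial>M) \<le> ennreal e"
      unfolding eventually_at_top_linorder by blast
  qed
  show ?thesis using XsM XsS XsA L2 by blast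
qed

end

section \<open>Application to solutions of the stochastic inclusion\<close>

theorem theorem4p4:
  fixes M :: "'a measure" and F :: "real \<Rightarrow> 'a measure"
    and B :: "'a \<Rightarrow> real \<Rightarrow> real ^ 'l"
    and A :: "real ^ 'd \<Rightarrow> (real ^ 'd) set"
    and \<sigma> :: "'a \<Rightarrow> real \<Rightarrow> real ^ 'd \<Rightarrow> real ^ 'l ^ 'd"
    and \<kappa> :: "real \<Rightarrow> real"
    and X0 :: "'a \<Rightarrow> real ^ 'd"
    and X Y Mt :: "'a \<Rightarrow> real \<Rightarrow> real ^ 'd"
  assumes usual: "usual_conditions M F"
    and BM: "brownian M F B"
    and maxmon: "maximal_monotone A"
    and S_ne: "{x. 0 \<in> A x} \<noteq> {}"
    and sigma_prog: "\<forall>x. progressive F (\<lambda>\<omega> t. \<sigma> \<omega> t x)"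
    and kappa_meas: "\<kappa> \<in> borel_measurable (restrict_space lborel {0..})"
    and kappa_L2loc: "\<forall>T\<ge>0. (\<integral>\<^sup>+ t. ennreal ((\<kappa> t)\<^sup>2) * indicator {0..T} t \<partial>lborel) < \<infinity>"
    and sigma_lip: "\<forall>\<omega> \<in> space M. \<forall>t\<ge>0. \<forall>x y. norm (\<sigma> \<omega> t x - \<sigma> \<omega> t y) \<le> \<kappa> t * norm (x - y)"
    and sigma_inf: "(\<integral>\<^sup>+ \<omega>. (\<integral>\<^sup>+ t. (SUP x. ennreal (norm (\<sigma> \<omega> t x)))\<^sup>2 * indicator {0..} t \<partial>lborel) \<partial>M) < \<infinity>"
    and X0_meas: "X0 \<in> borel_measurable (F 0)"
    and X0_L2: "(\<integral>\<^sup>+ \<omega>. ennreal ((norm (X0 \<omega>))\<^sup>2) \<partial>M) < \<infinity>"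
    and X0_dom: "\<forall>\<omega> \<in> space M. X0 \<omega> \<in> closure (dom_op A)"
    and sol: "sde_solution M F B A \<sigma> X0 X Y Mt"
    and traj: "\<forall>x0 \<in> closure (dom_op A). \<forall>x. ode_traj A x0 x \<longrightarrow> (\<exists>z. 0 \<in> A z \<and> (x \<longlongrightarrow> z) at_top)"
  shows "\<exists>Xs. Xs \<in> borel_measurable M \<and> (\<forall>\<omega> \<in> space M. 0 \<in> A (Xs \<omega>)) \<and>
           (AE \<omega> in M. ((\<lambda>t. X \<omega> t) \<longlongrightarrow> Xs \<omega>) at_top) \<and>
           ((\<lambda>t. \<integral>\<^sup>+ \<omega>. ennreal ((norm (X \<omega> t - Xs \<omega>))\<^sup>2) \<partial>M) \<longlongrightarrow> 0) at_top"
proof -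
  note sol' = sol[unfolded sde_solution_def]
  have Xp: "progressive F X" using sol' by (elim conjE)
  have cont: "\<forall>\<omega> \<in> space M. continuous_on {0..} (X \<omega>) \<and> continuous_on {0..} (Y \<omega>)
        \<and> continuous_on {0..} (Mt \<omega>) \<and> Y \<omega> 0 = 0 \<and> Mt \<omega> 0 = 0" using sol' by (elim conjE)
  have dom: "AE \<omega> in M. \<forall>t\<ge>0. X \<omega> t \<in> closure (dom_op A)" using sol' by (elim conjE)
  have Hp: "progressive F (\<lambda>\<omega> t. \<sigma> \<omega> t (X \<omega> t))" using sol' by (elim conjE)
  have bv: "\<forall>\<omega> \<in> space M. \<forall>T\<ge>0. bounded_variation_on 0 T (Y \<omega>)" using sol' by (elim conjE)
  have mono: "\<forall>\<alpha> \<beta>. adapted F \<alpha> \<and> adapted F \<beta> \<and>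
        (\<forall>\<omega> \<in> space M. continuous_on {0..} (\<alpha> \<omega>) \<and> continuous_on {0..} (\<beta> \<omega>)) \<and>
        (\<forall>\<omega> \<in> space M. \<forall>t\<ge>0. (\<alpha> \<omega> t, \<beta> \<omega> t) \<in> gph A)
        \<longrightarrow> (AE \<omega> in M. \<forall>a b. 0 \<le> a \<longrightarrow> a \<le> b \<longrightarrow>
              (\<exists>J. RS_has_integral (\<lambda>t. X \<omega> t - \<alpha> \<omega> t) (Y \<omega>) a b J \<and>
                   J \<ge> integral {a..b} (\<lambda>t. inner (X \<omega> t - \<alpha> \<omega> t) (\<beta> \<omega> t))))" using sol' by (elim conjE)
  have orth: "AE \<omega> in M. \<forall>t\<ge>0. \<forall>x \<in> dom_op A. \<forall>y \<in> dom_op A. inner (Mt \<omega> t) (x - y) = 0" using sol' by (elim conjE)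
  obtain I where I: "is_stoch_integral M F B (\<lambda>\<omega> t. \<sigma> \<omega> t (X \<omega> t)) I"
    and eqn: "AE \<omega> in M. \<forall>t\<ge>0. X \<omega> t = X0 \<omega> - Y \<omega> t + Mt \<omega> t + I \<omega> t" using sol' by (elim conjE exE)
  \<comment> \<open>The integrand is the coefficient along the solution; bounding it by the supremum
    over all states gives its global square integrability. Constant processes are continuous and
    adapted, so the variational inequality applies to every fixed graph pair.\<close>
  interpret monotone_sde M F B "\<lambda>\<omega> t. \<sigma> \<omega> t (X \<omega> t)" I A X Y Mt X0
  proof (unfold_locales)
    show "(\<integral>\<^sup>+ \<omega>. (\<integral>\<^sup>+ t. ennreal ((norm (\<sigma> \<omega> t (X \<omega> t)))\<^sup>2) * indicator {0..} t \<partial>lborel) \<partial>M) < \<infinity>"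
    proof (rule le_less_trans[OF _ sigma_inf], intro nn_integral_mono mult_right_mono)
      fix \<omega> t
      have "ennreal ((norm (\<sigma> \<omega> t (X \<omega> t)))\<^sup>2) = (ennreal (norm (\<sigma> \<omega> t (X \<omega> t))))\<^sup>2" by (simp add: ennreal_power)
      also have "\<dots> \<le> (SUP x. ennreal (norm (\<sigma> \<omega> t x)))\<^sup>2" by (intro power_mono SUP_upper) auto
      finally show "ennreal ((norm (\<sigma> \<omega> t (X \<omega> t)))\<^sup>2) \<le> (SUP x. ennreal (norm (\<sigma> \<omega> t x)))\<^sup>2" .
    qed simp
    show "(\<lambda>\<omega>. X \<omega> t) \<in> borel_measurable (F t)" if "t \<ge> 0" for t
      using progressive_adapted[OF Xp] that by (simp add: adapted_def)
    show "AE \<omega> in M. \<forall>u v. 0 \<le> u \<longrightarrow> u \<le> v \<longrightarrow>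
        (\<exists>J. RS_has_integral (\<lambda>t. X \<omega> t - a) (Y \<omega>) u v J \<and> J \<ge> integral {u..v} (\<lambda>t. inner (X \<omega> t - a) b))" if "b \<in> A a" for a b
      by (rule mono[rule_format, of "\<lambda>_ _. a" "\<lambda>_ _. b"]) (use that in \<open>simp add: adapted_def gph_def\<close>)
  qed (use usual BM Hp I maxmon cont dom bv orth eqn in auto)
  obtain z0 where z0: "0 \<in> A z0" using S_ne by blast
  have I0: "AE \<omega> in M. I \<omega> 0 = 0 \<and> continuous_on {0..} (I \<omega>)" using I unfolding is_stoch_integral_def by (elim conjE)
  \<comment> \<open>At time 0 the three remaining terms of the equation vanish, so the second moment
    of the initial datum is that of the path at 0.\<close>
  have "AE \<omega> in M. X \<omega> 0 = X0 \<omega>"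
    using eqn I0 AE_space by eventually_elim (use cont in auto)
  then have "(\<integral>\<^sup>+\<omega>. ennreal ((norm (X \<omega> 0))\<^sup>2) \<partial>M) = (\<integral>\<^sup>+\<omega>. ennreal ((norm (X0 \<omega>))\<^sup>2) \<partial>M)"
    by (intro nn_integral_cong_AE) (auto elim!: AE_mp)
  then have "(\<integral>\<^sup>+\<omega>. ennreal ((norm (X \<omega> 0))\<^sup>2) \<partial>M) < \<infinity>" using X0_L2 by simp
  from convergence[OF z0 _ this] traj show ?thesis by blast
qed

end
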